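(* Assume the standing assumption (A), Assumption (F1) and Assumption (F2). Then the process $(X,\Lambda)$ has the Feller property: for every $t>0$ and every bounded continuous $f:\mathbb R^d\times\mathbb S\to\mathbb R$, the map $(x,k)\mapsto\mathbb E_{x,k}[f(X(t),\Lambda(t))]$ is continuous on $\mathbb R^d\times\mathbb S$.
   Context: Let $d,n_0\ge1$ be integers, $\mathbb S=\{1,\dots,n_0\}$ (discrete topology), $\mathbb R^d_0=\mathbb R^d\setminus\{0\}$, $B(0,r)=\{x\in\mathbb R^d:|x|<r\}$, and fix $\varepsilon_0>0$. For each $(x,k)\in\mathbb R^d\times\mathbb S$ let $a(x,k)$ be a symmetric nonnegative definite real $d\times d$ matrix, $b(x,k)\in\mathbb R^d$, and $\nu(x,k,\cdot)$ a $\sigma$-finite measure on $\mathbb R^d_0$ with $\int|u|^2\mathbf 1_{B(0,\varepsilon_0)}(u)\nu(x,k,du)<\infty$ and $\nu(x,k,\mathbb R^d\setminus B(0,\varepsilon_0))<\infty$, all measurable in $(x,k)$. For $k\in\mathbb S$ and $g\in C^2(\mathbb R^d)$ let $\mathcal L_kg(x)=\frac12\mathrm{tr}(a(x,k)\nabla^2g(x))+\langle b(x,k),\nabla g(x)\rangle+\int_{\mathbb R^d_0}\big(g(x+u)-g(x)-\langle\nabla g(x),u\rangle\mathbf 1_{B(0,\varepsilon_0)}(u)\big)\nu(x,k,du)$. Let $Q(x)=(q_{kl}(x))_{k,l\in\mathbb S}$ be measurable in $x$, with $q_{kl}(x)\ge0$ for $k\ne l$ and $\sum_{l}q_{kl}(x)=0$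 for each $k$. For $f:\mathbb R^d\times\mathbb S\to\mathbb R$ with each $f(\cdot,k)\in C^2(\mathbb R^d)$, put $\mathcal Af(x,k)=\mathcal L_kf(\cdot,k)(x)+\sum_{l\in\mathbb S}q_{kl}(x)(f(x,l)-f(x,k))$. Let $\Omega=D([0,\infty),\mathbb R^d\times\mathbb S)$ (càdlàg paths, Skorohod topology), $(X(t),\Lambda(t))=\omega(t)$ the coordinate process, $\mathcal F_t$ the $\sigma$-field generated by the coordinates up to time $t$, $\mathcal F=\bigvee_t\mathcal F_t$. A probability $P$ on $(\Omega,\mathcal F)$ is a martingale solution for $\mathcal A$ starting from $(x,k)$ if $P((X(0),\Lambda(0))=(x,k))=1$ and, for every $f$ with $f(\cdot,k)\in C_c^\infty(\mathbb R^d)$ for all $k$, $f(X(t),\Lambda(t))-f(X(0),\Lambda(0))-\int_0^t\mathcal Af(X(s),\Lambda(s))ds$ is an $\{\mathcal F_t\}$-martingale under $P$. Martingale solutions for $\mathcal L_k$ starting from $x$ are defined analogously on $D([0,\infty),\mathbb R^d)$ with coordinate process $X$ and test functions $g\in C_c^\infty(\mathbb R^d)$. Standing assumption (A): (i) for each $k\in\mathbb S$ and $x\in\mathbb R^d$ the martingale problem for $\mathcal L_k$ starting from $x$ has a unique solution; (ii) each $q_{kk}$ is bounded from below; (iii) $\sup_{(x,k)}\int_{\mathbb R^d_0}(1\wedge|y|^2)\nu(x,k,dy)<\infty$. Under (A) the martingale problem for $\mathcal A$ has a unique solution $P^{(x,k)}$ from each $(x,k)$; $\mathbb E_{x,k}$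 denotes expectation under $P^{(x,k)}$. Assumption (F1): there exist a constant $H>0$ and a nondecreasing concave $\rho:[0,\infty)\to[0,\infty)$ with $\rho(r)>0$ for $r>0$ and $\int_{0+}dr/\rho(r)=\infty$, such that for all $k\in\mathbb S$ and $x,z\in\mathbb R^d$: $\|\sigma(x,k)-\sigma(z,k)\|^2+2\langle x-z,b(x,k)-b(z,k)\rangle\le H|x-z|\rho(|x-z|)$ and $\int_{\mathbb R^d_0}|u|\,\|\nu(x,k,\cdot)-\nu(z,k,\cdot)\|(du)\le H\rho(|x-z|)$, where $\sigma(x,k)$ is a $d\times d$ matrix with $\sigma\sigma^T=a$, $\|\cdot\|$ is the Hilbert–Schmidt norm for matrices and $\|\mu\|$ denotes the total variation measure of a signed measure $\mu$. Assumption (F2): $|q_{kl}(x)-q_{kl}(z)|\le H|x-z|$ for all $x,z\in\mathbb R^d$ and $k\ne l$, with the same $H$. *)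

theory Defs
  imports "HOL-Probability.Probability"
begin

definition partial_dir :: "'d::finite \<Rightarrow> (real^'d \<Rightarrow> real) \<Rightarrow> real^'d \<Rightarrow> real" where
  "partial_dir i g = (\<lambda>x. deriv (\<lambda>t. g (x + t *\<^sub>R axis i 1)) 0)"

fun iter_partial :: "'d::finite list \<Rightarrow> (real^'d \<Rightarrow> real) \<Rightarrow> real^'d \<Rightarrow> real" where
  "iter_partial [] g = g"
| "iter_partial (i # is) g = partial_dir i (iter_partial is g)"

definition smooth_fun :: "(real^'d::finite \<Rightarrow> real) \<Rightarrow> bool" where
  "smooth_fun g \<longleftrightarrow> (\<forall>is. continuous_on UNIV (iter_partial is g) \<and>
      (\<forall>i x. (\<lambda>t. iter_partial is g (x + t *\<^sub>R axis i 1)) differentiable (at 0)))"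

definition C_c_inf :: "(real^'d::finite \<Rightarrow> real) set" where
  "C_c_inf = {g. smooth_fun g \<and> compact (closure {x. g x \<noteq> 0})}"

definition grad :: "(real^'d::finite \<Rightarrow> real) \<Rightarrow> real^'d \<Rightarrow> real^'d" where
  "grad g x = (\<chi> i. partial_dir i g x)"

definition hess :: "(real^'d::finite \<Rightarrow> real) \<Rightarrow> real^'d \<Rightarrow> real^'d^'d" where
  "hess g x = (\<chi> i j. partial_dir i (partial_dir j g) x)"

definition gen_L ::
  "(real^'d::finite \<Rightarrow> nat \<Rightarrow> real^'d^'d) \<Rightarrow> (real^'d \<Rightarrow> nat \<Rightarrow> real^'d) \<Rightarrow>
   (real^'d \<Rightarrow> nat \<Rightarrow> (real^'d) measure) \<Rightarrow> real \<Rightarrow> nat \<Rightarrow> (real^'d \<Rightarrow> real) \<Rightarrow> real^'d \<Rightarrow> real" where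
  "gen_L a b \<nu> \<epsilon>0 k g x =
     (1/2) * trace (a x k ** hess g x) + b x k \<bullet> grad g x
     + (\<integral>u. (g (x + u) - g x - (grad g x \<bullet> u) * indicator (ball 0 \<epsilon>0) u) \<partial>(\<nu> x k))"

definition gen_A ::
  "nat \<Rightarrow> (real^'d::finite \<Rightarrow> nat \<Rightarrow> real^'d^'d) \<Rightarrow> (real^'d \<Rightarrow> nat \<Rightarrow> real^'d) \<Rightarrow>
   (real^'d \<Rightarrow> nat \<Rightarrow> (real^'d) measure) \<Rightarrow> real \<Rightarrow> (real^'d \<Rightarrow> nat \<Rightarrow> nat \<Rightarrow> real) \<Rightarrow>
   ((real^'d) \<times> nat \<Rightarrow> real) \<Rightarrow> (real^'d) \<times> nat \<Rightarrow> real" where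
  "gen_A n0 a b \<nu> \<epsilon>0 q f = (\<lambda>(x, k).
     gen_L a b \<nu> \<epsilon>0 k (\<lambda>y. f (y, k)) x + (\<Sum>l\<in>{1..n0}. q x k l * (f (x, l) - f (x, k))))"

definition test_A :: "nat \<Rightarrow> ((real^'d::finite) \<times> nat \<Rightarrow> real) set" where
  "test_A n0 = {f. \<forall>k\<in>{1..n0}. (\<lambda>y. f (y, k)) \<in> C_c_inf}"

text \<open>Cadlag paths on [0,infinity) with values in E; a path is extended to t<0 by its
  value at 0, so that these functions correspond bijectively to D([0,infinity),E).\<close>
definition cadlag_paths :: "'e::topological_space set \<Rightarrow> (real \<Rightarrow> 'e) set" where
  "cadlag_paths E = {\<omega>. (\<forall>t. \<omega> t \<in> E) \<and> (\<forall>t<0. \<omega> t = \<omega> 0) \<and>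
      (\<forall>t\<ge>0. continuous (at_right t) \<omega>) \<and> (\<forall>t>0. \<exists>l\<in>E. (\<omega> \<longlongrightarrow> l) (at_left t))}"

definition path_filt :: "'e::topological_space set \<Rightarrow> real \<Rightarrow> (real \<Rightarrow> 'e) measure" where
  "path_filt E t = sigma (cadlag_paths E)
     {{\<omega> \<in> cadlag_paths E. \<omega> s \<in> A} | s A. 0 \<le> s \<and> s \<le> t \<and> A \<in> sets borel}"

definition path_space :: "'e::topological_space set \<Rightarrow> (real \<Rightarrow> 'e) measure" where
  "path_space E = sigma (cadlag_paths E)
     {{\<omega> \<in> cadlag_paths E. \<omega> s \<in> A} | s A. 0 \<le> s \<and> A \<in> sets borel}"

definition is_martingale :: "'a measure \<Rightarrow> (real \<Rightarrow> 'a measure) \<Rightarrow> (real \<Rightarrow> 'a \<Rightarrow> real) \<Rightarrow> bool" where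
  "is_martingale P F M \<longleftrightarrow>
     (\<forall>t\<ge>0. M t \<in> borel_measurable (F t) \<and> integrable P (M t)) \<and>
     (\<forall>s t A. 0 \<le> s \<longrightarrow> s \<le> t \<longrightarrow> A \<in> sets (F s) \<longrightarrow>
        (\<integral>\<omega>. indicator A \<omega> * M t \<omega> \<partial>P) = (\<integral>\<omega>. indicator A \<omega> * M s \<omega> \<partial>P))"

definition mp_solution ::
  "'e::topological_space set \<Rightarrow> ('e \<Rightarrow> real) set \<Rightarrow> (('e \<Rightarrow> real) \<Rightarrow> 'e \<Rightarrow> real) \<Rightarrow> 'e \<Rightarrow>
   (real \<Rightarrow> 'e) measure \<Rightarrow> bool" where
  "mp_solution E T G e0 P \<longleftrightarrow>
     sets P = sets (path_space E) \<and> prob_space P \<and>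
     emeasure P {\<omega> \<in> space P. \<omega> 0 = e0} = 1 \<and>
     (\<forall>f\<in>T. is_martingale P (path_filt E)
        (\<lambda>t \<omega>. f (\<omega> t) - f (\<omega> 0) - (LINT s:{0..t}|lborel. G f (\<omega> s))))"

text \<open>integral of g against the total variation measure of mu1 - mu2 (sigma-finite measures),
  computed via densities with respect to the dominating measure mu1 + mu2.\<close>
definition tv_nn_integral :: "('a \<Rightarrow> ennreal) \<Rightarrow> 'a measure \<Rightarrow> 'a measure \<Rightarrow> ennreal" where
  "tv_nn_integral g \<mu>1 \<mu>2 =
    (let m = measure_of (space \<mu>1) (sets \<mu>1) (\<lambda>A. emeasure \<mu>1 A + emeasure \<mu>2 A);
         f1 = RN_deriv m \<mu>1; f2 = RN_deriv m \<mu>2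
     in \<integral>\<^sup>+u. g u * ((f1 u - f2 u) + (f2 u - f1 u)) \<partial>m)"

end

theory Submission
  imports Defs "HOL-Computational_Algebra.Polynomial"
begin

text \<open>
  Only the identity \<open>E f(X t, \<Lambda> t) = f(x, k) + E (integral of A f(X s, \<Lambda> s) over s \<le> t)\<close> for test functions \<open>f\<close>
  is used, so no coupled process has to be constructed; the coupling is carried out at the level of a monotone
  finite-difference scheme.

  The generator is replaced by the generator \<open>G\<close> of a bounded-rate random walk: difference quotients along the drift
  and along the columns of \<open>\<sigma>\<close>, jumps of size at least \<open>r\<close>, and switching, with the local coefficients cut off outside a
  ball. Following Krylov, one time step of the scheme takes a supremum over coefficients frozen at nearby points
  (shaking of the coefficients), so that mollifying an iterate started in a Lipschitz \<open>g\<close> gives a smooth supersolution up to a small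
  error; testing the martingale problem with it bounds \<open>E g(X t, \<Lambda> t)\<close> from above by the iterate. Bounding \<open>E g\<close> from
  \<open>x\<close> and \<open>E (1 - g)\<close> from \<open>z\<close> in this way, it remains to show that the sum of the two iterates exceeds 1 by little
  when \<open>x\<close> and \<open>z\<close> are close.

  This follows by induction over the time steps: the excess is dominated by an affine function of
  \<open>sqrt (|x - z|^2 + \<delta>^2)\<close> plus a logarithmic Lyapunov function that controls the cut-off. One step of the coupled scheme
  changes the distance by at most \<open>h C \<rho>\<close> of it, and the concave \<open>\<rho>\<close> is replaced by its tangent at the current
  term of the Euler sequence of \<open>s' = C \<rho>(s)\<close>; by Osgood's condition this sequence stays small when it starts small.
  Bounded continuous functions are then reached through inf-convolutions.
\<close>

section \<open>Mollifiers\<close>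

text \<open>The coefficients are only measurable in \<open>x\<close> and F1 controls
  \<open>b\<close> one-sidedly, so a value function of the martingale problem need not be
  differentiable, and mollifying it does not commute with a variable-coefficient generator. A
  generator with frozen coefficients is translation invariant and does commute; the supremum over
  nearby frozen points pays for the freedom of choosing the point. A supremum yields upper bounds
  only, hence the detour through \<open>1 - g\<close>. Derivative bounds of a mollified iterate come
  from the mollifier alone and are the same after every time step. This fixes the order of the
  parameters: first the radius of the cut-off and the mollification scale \<open>\<epsilon>\<close>,
  then the jump truncation \<open>r\<close>, then the space step \<open>\<tau>\<close>, and the
  number of time steps last. The excess is dominated by an affine function of the smoothed distance
  because such a function feels a step only through the mean increment of the distance, which is the
  quantity bounded by F1. This is why \<rho> enters through tangents.\<close>

definition expinv :: "real poly \<Rightarrow> real \<Rightarrow> real" where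
  "expinv p t = (if t > 0 then poly p (1 / t) * exp (- (1 / t)) else 0)"

lemma poly_times_exp_neg_tendsto_0:
  "((\<lambda>s. poly p s * exp (- s)) \<longlongrightarrow> (0::real)) at_top"
proof -
  have "((\<lambda>s. \<Sum>i\<le>degree p. coeff p i * (s ^ i / exp s)) \<longlongrightarrow> (\<Sum>i\<le>degree p. coeff p i * 0)) at_top"
    by (intro tendsto_intros tendsto_power_div_exp_0)
  then show ?thesis
    by (simp add: poly_altdef sum_distrib_right exp_minus divide_inverse mult.assoc)
qed

text \<open>In the variable \<open>s = 1 / t\<close> the derivative of \<open>p(s) exp(-s)\<close>
  is \<open>s^2 (p(s) - p'(s)) exp(-s)\<close>, so carrying the polynomial along closes the family
  under differentiation. At 0 both one-sided difference quotients tend to 0.\<close>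

lemma expinv_deriv:
  "(expinv p has_real_derivative expinv ([:0,0,1:] * (p - pderiv p)) t) (at t)"
proof (cases t "0::real" rule: linorder_cases)
  case less
  have "((\<lambda>_. 0) has_real_derivative 0) (at t)" by simp
  then have "(expinv p has_real_derivative 0) (at t)"
    by (rule has_field_derivative_transform_within_open[where S="{..<0}"])
      (use less in \<open>auto simp: expinv_def\<close>)
  then show ?thesis using less by (simp add: expinv_def)
next
  case equal
  have "((\<lambda>s. expinv p s / s) \<longlongrightarrow> 0) (at_right 0)"
  proof -
    \<comment> \<open>Dividing by \<open>s\<close> only multiplies the polynomial in
      \<open>1 / s\<close> by its variable.\<close>
    have "((\<lambda>s. poly ([:0,1:] * p) (inverse s) * exp (- inverse s)) \<longlongrightarrow> (0::real)) (at_right 0)"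
      by (rule filterlim_compose[OF poly_times_exp_neg_tendsto_0 filterlim_inverse_at_top_right])
    then show ?thesis
      by (rule Lim_transform_eventually)
        (auto simp: eventually_at_filter expinv_def field_simps intro!: always_eventually)
  qed
  moreover have "((\<lambda>s. expinv p s / s) \<longlongrightarrow> 0) (at_left 0)"
    by (rule Lim_transform_eventually[OF tendsto_const])
      (auto simp: eventually_at_filter expinv_def intro!: always_eventually)
  ultimately have "((\<lambda>s. expinv p s / s) \<longlongrightarrow> 0) (at 0)"
    by (simp add: filterlim_split_at)
  then show ?thesis using equal by (simp add: DERIV_def expinv_def)
next
  case greater
  have d1: "((\<lambda>t. 1 / t) has_real_derivative - (1 / t\<^sup>2)) (at t)"
    using greater by (auto intro!: derivative_eq_intros simp: power2_eq_square)
  note d2 = DERIV_chain2[OF poly_DERIV d1, of p]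
  note d3 = DERIV_chain2[OF DERIV_exp DERIV_minus[OF d1]]
  have "((\<lambda>t. poly p (1 / t) * exp (- (1 / t))) has_real_derivative
      expinv ([:0,0,1:] * (p - pderiv p)) t) (at t)"
    by (rule DERIV_cong[OF DERIV_mult[OF d2 d3]])
      (use greater in \<open>simp add: expinv_def field_simps power2_eq_square\<close>)
  then show ?thesis
    by (rule has_field_derivative_transform_within_open[where S="{0<..}"])
      (use greater in \<open>auto simp: expinv_def\<close>)
qed

section \<open>Functions with control of all iterated partial derivatives\<close>

lemma has_real_derivative_along_line:
  fixes g :: "real^'d::finite \<Rightarrow> real"
  assumes "(g has_derivative (\<lambda>v. \<Sum>i\<in>UNIV. v $ i * g' i)) (at (x + t *\<^sub>R v))"
  shows "((\<lambda>t. g (x + t *\<^sub>R v)) has_real_derivative (\<Sum>i\<in>UNIV. v $ i * g' i)) (at t)"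
proof -
  have "((\<lambda>t. x + t *\<^sub>R v) has_derivative (\<lambda>s. s *\<^sub>R v)) (at t)"
    by (auto intro!: derivative_eq_intros)
  from has_derivative_compose[OF this assms] show ?thesis
    unfolding has_field_derivative_def
    by (rule has_derivative_eq_rhs) (simp add: fun_eq_iff sum_distrib_left sum_distrib_right mult_ac)
qed

lemma partial_dir_eqI:
  fixes g :: "real^'d::finite \<Rightarrow> real"
  assumes "(g has_derivative (\<lambda>v. \<Sum>i\<in>UNIV. v $ i * g' i)) (at x)"
  shows "partial_dir i g x = g' i"
    and "(\<lambda>t. g (x + t *\<^sub>R axis i 1)) differentiable (at 0)"
proof -
  have "((\<lambda>t. g (x + t *\<^sub>R axis i 1)) has_real_derivative (\<Sum>j\<in>UNIV. axis i 1 $ j * g' j)) (at 0)"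
    using has_real_derivative_along_line[of g g' x 0 "axis i 1"] assms by simp
  moreover have "(\<Sum>j\<in>UNIV. axis i 1 $ j * g' j) = g' i"
    by (simp add: axis_def if_distrib[of "\<lambda>c. c * _"] cong: if_cong)
  ultimately have *: "((\<lambda>t. g (x + t *\<^sub>R axis i 1)) has_real_derivative g' i) (at 0)" by simp
  then show "partial_dir i g x = g' i" unfolding partial_dir_def by (rule DERIV_imp_deriv)
  show "(\<lambda>t. g (x + t *\<^sub>R axis i 1)) differentiable (at 0)"
    using * real_differentiable_def by blast
qed

text \<open>Only closure under partial derivatives matters: existence and continuity of all iterated
  partials then follow by induction on the list of directions, without any formula for them.\<close>

inductive_set expinv_algebra :: "(real^'d::finite \<Rightarrow> real) set" where
  base: "(\<lambda>x. expinv p (c + s * x $ i)) \<in> expinv_algebra"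
| add: "f \<in> expinv_algebra \<Longrightarrow> g \<in> expinv_algebra \<Longrightarrow> (\<lambda>x. f x + g x) \<in> expinv_algebra"
| mult: "f \<in> expinv_algebra \<Longrightarrow> g \<in> expinv_algebra \<Longrightarrow> (\<lambda>x. f x * g x) \<in> expinv_algebra"
| scale: "f \<in> expinv_algebra \<Longrightarrow> (\<lambda>x. c * f x) \<in> expinv_algebra"

lemma expinv_smult: "expinv (smult c p) t = c * expinv p t"
  by (simp add: expinv_def)

lemma expinv_algebra_derivatives:
  fixes g :: "real^'d::finite \<Rightarrow> real"
  assumes "g \<in> expinv_algebra"
  shows "\<exists>g'. (\<forall>i. g' i \<in> expinv_algebra) \<and>
    (\<forall>x. (g has_derivative (\<lambda>v. \<Sum>i\<in>UNIV. v $ i * g' i x)) (at x))"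
  using assms
proof induction
  case (base p c s i)
  obtain p' where p': "\<And>t. (expinv p has_real_derivative expinv p' t) (at t)"
    using expinv_deriv by blast
  \<comment> \<open>The vanishing partials are written with the zero polynomial, so that they too
    are generators of the algebra.\<close>
  let ?g' = "\<lambda>j x :: real^'d. expinv (smult (if j = i then s else 0) p') (c + s * x $ i)"
  have "((\<lambda>x. expinv p (c + s * x $ i)) has_derivative (\<lambda>v. \<Sum>j\<in>UNIV. v $ j * ?g' j x)) (at x)" for x :: "real^'d"
  proof -
    have 1: "((\<lambda>x::real^'d. c + s * x $ i) has_derivative (\<lambda>v. s * v $ i)) (at x)"
      by (auto intro!: derivative_eq_intros bounded_linear.has_derivative[OF bounded_linear_vec_nth])
    have 2: "v $ j * ?g' j x = (if j = i then v $ i * (s * expinv p' (c + s * x $ i)) else 0)" for v j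
      by (simp add: expinv_smult)
    show ?thesis
      by (rule has_derivative_eq_rhs[OF has_derivative_compose[OF 1
              p'[unfolded has_field_derivative_def]]])
        (simp add: 2 fun_eq_iff del: smult_0_left)
  qed
  moreover have "?g' j \<in> expinv_algebra" for j by (rule expinv_algebra.base)
  ultimately show ?case by (intro exI[of _ ?g']) auto
next
  case (add f g)
  obtain f' where f': "\<And>i. f' i \<in> expinv_algebra"
    "\<And>x. (f has_derivative (\<lambda>v. \<Sum>i\<in>UNIV. v $ i * f' i x)) (at x)" using add.IH(1) by blast
  obtain g' where g': "\<And>i. g' i \<in> expinv_algebra"
    "\<And>x. (g has_derivative (\<lambda>v. \<Sum>i\<in>UNIV. v $ i * g' i x)) (at x)" using add.IH(2) by blast
  note D = f'(2) g'(2)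
  have "((\<lambda>x. f x + g x) has_derivative (\<lambda>v. \<Sum>i\<in>UNIV. v $ i * (f' i x + g' i x))) (at x)" for x
    by (rule has_derivative_eq_rhs[OF has_derivative_add[OF D]])
      (simp add: sum.distrib algebra_simps)
  then show ?case using f'(1) g'(1) by (intro exI[of _ "\<lambda>i x. f' i x + g' i x"]) (auto intro: expinv_algebra.add)
next
  case (mult f g)
  obtain f' where f': "\<And>i. f' i \<in> expinv_algebra"
    "\<And>x. (f has_derivative (\<lambda>v. \<Sum>i\<in>UNIV. v $ i * f' i x)) (at x)" using mult.IH(1) by blast
  obtain g' where g': "\<And>i. g' i \<in> expinv_algebra"
    "\<And>x. (g has_derivative (\<lambda>v. \<Sum>i\<in>UNIV. v $ i * g' i x)) (at x)" using mult.IH(2) by blast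
  note D = f'(2) g'(2)
  have "((\<lambda>x. f x * g x) has_derivative (\<lambda>v. \<Sum>i\<in>UNIV. v $ i * (f x * g' i x + f' i x * g x))) (at x)" for x
    by (rule has_derivative_eq_rhs[OF has_derivative_mult[OF D]])
      (simp add: sum.distrib algebra_simps sum_distrib_left sum_distrib_right)
  then show ?case using f'(1) g'(1) mult.hyps
    by (intro exI[of _ "\<lambda>i x. f x * g' i x + f' i x * g x"]) (auto intro!: expinv_algebra.add expinv_algebra.mult)
next
  case (scale f c)
  obtain f' where f': "\<And>i. f' i \<in> expinv_algebra"
    "\<And>x. (f has_derivative (\<lambda>v. \<Sum>i\<in>UNIV. v $ i * f' i x)) (at x)" using scale.IH by blast
  note D = f'(2)
  have "((\<lambda>x. c * f x) has_derivative (\<lambda>v. \<Sum>i\<in>UNIV. v $ i * (c * f' i x))) (at x)" for x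
    by (rule has_derivative_eq_rhs[OF has_derivative_mult_right[OF D]])
      (simp add: algebra_simps sum_distrib_left)
  then show ?case using f'(1) by (intro exI[of _ "\<lambda>i x. c * f' i x"]) (auto intro: expinv_algebra.scale)
qed

text \<open>Stronger than \<open>smooth_fun\<close>: every iterated partial has a total derivative,
  which gives the chain rule along lines, and is bounded, which gives Taylor remainders uniform in
  the base point.\<close>

definition smooth_bounded :: "(real^'d::finite \<Rightarrow> real) \<Rightarrow> bool" where
  "smooth_bounded g \<longleftrightarrow> (\<forall>is. bounded (range (iter_partial is g)) \<and>
    (\<forall>x. (iter_partial is g has_derivative (\<lambda>v. \<Sum>i\<in>UNIV. v $ i * iter_partial (i # is) g x)) (at x)))"

lemma smooth_bounded_has_derivative:
  "smooth_bounded g \<Longrightarrow>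
    (iter_partial is g has_derivative (\<lambda>v. \<Sum>i\<in>UNIV. v $ i * iter_partial (i # is) g x)) (at x)"
  unfolding smooth_bounded_def by blast

lemma smooth_bounded_continuous: "smooth_bounded g \<Longrightarrow> continuous_on UNIV (iter_partial is g)"
  by (intro continuous_at_imp_continuous_on ballI
      has_derivative_continuous[OF smooth_bounded_has_derivative])

lemma smooth_bounded_iter_partial:
  assumes "smooth_bounded g" shows "smooth_bounded (iter_partial js g)"
proof -
  have eq: "iter_partial is (iter_partial js g) = iter_partial (is @ js) g" for "is"
    by (induction "is") auto
  show ?thesis
    unfolding smooth_bounded_def eq append_Cons
    using assms unfolding smooth_bounded_def by blast
qed

lemma smooth_bounded_imp_C_c_inf:
  assumes "smooth_bounded g" "\<And>x. x \<notin> cball 0 R \<Longrightarrow> g x = 0"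
  shows "g \<in> C_c_inf"
proof -
  have "smooth_fun g"
    unfolding smooth_fun_def
    using smooth_bounded_continuous[OF assms(1)]
      partial_dir_eqI(2)[OF smooth_bounded_has_derivative[OF assms(1)]] by blast
  moreover have "closure {x. g x \<noteq> 0} \<subseteq> cball 0 R"
    by (rule closure_minimal) (use assms(2) in blast, simp)
  then have "compact (closure {x. g x \<noteq> 0})"
    using compact_cball closed_closure compact_eq_bounded_closed bounded_subset by blast
  ultimately show ?thesis by (simp add: C_c_inf_def)
qed

text \<open>All partials vanish on the open complement of the ball that carries the function, so
  boundedness reduces to continuity on a compact ball.\<close>

lemma expinv_algebra_smooth_bounded:
  fixes g :: "real^'d::finite \<Rightarrow> real"
  assumes g: "g \<in> expinv_algebra" and supp: "\<And>x. x \<notin> cball 0 R \<Longrightarrow> g x = 0"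
  shows "smooth_bounded g"
proof -
  have *: "iter_partial is g \<in> expinv_algebra \<and> (\<forall>x. x \<notin> cball 0 R \<longrightarrow> iter_partial is g x = 0)" for "is"
  proof (induction "is")
    case Nil show ?case using g supp by (metis iter_partial.simps(1))
  next
    case (Cons i "is")
    obtain g' where g': "\<And>i. g' i \<in> expinv_algebra"
      "\<And>x. (iter_partial is g has_derivative (\<lambda>v. \<Sum>i\<in>UNIV. v $ i * g' i x)) (at x)"
      using expinv_algebra_derivatives[of "iter_partial is g"] Cons by blast
    have "iter_partial (i # is) g = g' i"
      using partial_dir_eqI(1)[OF g'(2)] by auto
    moreover have "partial_dir i (iter_partial is g) x = 0" if "x \<notin> cball 0 R" for x
    proof -
      have "(iter_partial is g has_derivative (\<lambda>v. 0)) (at x)"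
        by (rule has_derivative_transform_within_open[OF has_derivative_const, where s="- cball 0 R"])
          (use that Cons in auto)
      then show ?thesis using partial_dir_eqI(1)[of "iter_partial is g" "\<lambda>_. 0" x i] by simp
    qed
    ultimately show ?case using g'(1) by auto
  qed
  have D: "(iter_partial is g has_derivative (\<lambda>v. \<Sum>i\<in>UNIV. v $ i * iter_partial (i # is) g x)) (at x)" for "is" x
  proof -
    obtain g' where g': "\<And>x. (iter_partial is g has_derivative (\<lambda>v. \<Sum>i\<in>UNIV. v $ i * g' i x)) (at x)"
      using expinv_algebra_derivatives[of "iter_partial is g"] * by blast
    then show ?thesis using partial_dir_eqI(1)[OF g'] by simp
  qed
  have "bounded (range (iter_partial is g))" for "is"
  proof -
    have "continuous_on (cball 0 R) (iter_partial is g)"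
      by (intro continuous_at_imp_continuous_on ballI has_derivative_continuous[OF D])
    then have "bounded (iter_partial is g ` cball 0 R)"
      by (intro compact_imp_bounded compact_continuous_image compact_cball)
    then have "bounded (insert 0 (iter_partial is g ` cball 0 R))" by simp
    then show ?thesis by (rule bounded_subset) (use * in blast)
  qed
  then show ?thesis using D by (simp add: smooth_bounded_def)
qed

lemma prod_expinv_algebra:
  assumes "finite I" "I \<noteq> {}" "\<And>i. i \<in> I \<Longrightarrow> f i \<in> expinv_algebra"
  shows "(\<lambda>x. \<Prod>i\<in>I. f i x) \<in> expinv_algebra"
  using assms by (induction I rule: finite_ne_induct) (auto intro: expinv_algebra.mult)

lemma expinv_1_pos: "t > 0 \<Longrightarrow> expinv 1 t > 0" and expinv_1_nonneg: "expinv 1 t \<ge> 0"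
  and expinv_nonpos: "t \<le> 0 \<Longrightarrow> expinv p t = 0"
  by (auto simp: expinv_def)

text \<open>A product of one-dimensional bumps on \<open>(-c, c)\<close>, divided by its integral.
  The integral is positive because the product is continuous, nonnegative and positive at 0, and
  nonempty open sets are not negligible.\<close>

lemma exists_mollifier:
  assumes "\<epsilon> > 0"
  obtains \<eta> :: "real^'d::finite \<Rightarrow> real" where "smooth_bounded \<eta>" "\<And>x. \<eta> x \<ge> 0"
    "\<And>x. \<epsilon> \<le> norm x \<Longrightarrow> \<eta> x = 0" "(\<integral>x. \<eta> x \<partial>lborel) = 1" "integrable lborel \<eta>"
proof -
  \<comment> \<open>A point of norm at least \<open>\<epsilon>\<close> has l1 norm at least
    \<open>\<epsilon>\<close>, hence a coordinate of modulus at least this \<open>c\<close>, and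
    there one factor of the bump vanishes.\<close>
  define c where "c = \<epsilon> / real CARD('d)"
  have c: "c > 0" using assms by (simp add: c_def)
  define \<phi> :: "real^'d \<Rightarrow> real"
    where "\<phi> = (\<lambda>x. \<Prod>i\<in>UNIV. expinv 1 (c + 1 * x $ i) * expinv 1 (c + (-1) * x $ i))"
  have alg: "\<phi> \<in> expinv_algebra"
    unfolding \<phi>_def by (intro prod_expinv_algebra expinv_algebra.mult expinv_algebra.base) auto
  have nonneg: "\<phi> x \<ge> 0" for x unfolding \<phi>_def by (intro prod_nonneg) (simp add: expinv_1_nonneg)
  have supp: "\<phi> x = 0" if "\<epsilon> \<le> norm x" for x
  proof -
    have 1: "\<epsilon> \<le> (\<Sum>i\<in>UNIV. \<bar>x $ i\<bar>)" using that norm_le_l1_cart[of x] by linarith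
    have "\<exists>i. c \<le> \<bar>x $ i\<bar>"
    proof (rule ccontr)
      assume "\<nexists>i. c \<le> \<bar>x $ i\<bar>"
      then have "(\<Sum>i\<in>UNIV. \<bar>x $ i\<bar>) < (\<Sum>i\<in>(UNIV::'d set). c)"
        by (intro sum_strict_mono) (auto simp: not_le)
      then show False using 1 by (simp add: c_def)
    qed
    then obtain i where "c \<le> \<bar>x $ i\<bar>" by auto
    then have "expinv 1 (c + 1 * x $ i) * expinv 1 (c + (-1) * x $ i) = 0"
      by (cases "x $ i \<ge> 0") (auto simp: expinv_nonpos)
    then show ?thesis unfolding \<phi>_def by (intro prod_zero) auto
  qed
  have sb: "smooth_bounded \<phi>"
    by (rule expinv_algebra_smooth_bounded[OF alg, of \<epsilon>]) (auto intro: supp)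
  have cont: "continuous_on UNIV \<phi>" using smooth_bounded_continuous[OF sb, of "[]"] by simp
  have int: "integrable lborel \<phi>"
  proof -
    have "set_integrable lborel (cball 0 \<epsilon>) \<phi>"
      using borel_integrable_compact[of "cball 0 \<epsilon>" \<phi>] cont continuous_on_subset
      by (auto simp: set_integrable_def)
    moreover have "(\<lambda>x. indicator (cball 0 \<epsilon>) x *\<^sub>R \<phi> x) = \<phi>"
      using supp by (auto simp: indicator_def fun_eq_iff)
    ultimately show ?thesis by (simp add: set_integrable_def)
  qed
  define m where "m = (\<integral>x. \<phi> x \<partial>lborel)"
  have "m > 0"
  proof -
    have "\<phi> 0 > 0" unfolding \<phi>_def using c by (intro prod_pos) (simp add: expinv_1_pos)
    have "m \<noteq> 0"
    proof
      assume "m = 0"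
      then have "AE x in lborel. \<phi> x = 0"
        using integral_nonneg_eq_0_iff_AE[OF int] nonneg by (simp add: m_def)
      then have "AE x in lborel. x \<notin> {x. \<phi> x > 0}" by auto
      moreover have op: "open {x. \<phi> x > 0}" by (intro open_Collect_less continuous_on_const cont)
      ultimately have "{x. \<phi> x > 0} \<in> null_sets lborel"
        by (subst AE_iff_null_sets) auto
      then have "negligible {x. \<phi> x > 0}"
        by (simp add: negligible_iff_null_sets null_sets_completionI)
      then show False using open_not_negligible[OF op] \<open>\<phi> 0 > 0\<close> by auto
    qed
    moreover have "m \<ge> 0" unfolding m_def by (simp add: nonneg)
    ultimately show ?thesis by simp
  qed
  let ?\<eta> = "\<lambda>x. (1 / m) * \<phi> x"
  have "smooth_bounded ?\<eta>"
    by (rule expinv_algebra_smooth_bounded[of _ \<epsilon>]) (intro expinv_algebra.scale alg, auto intro: supp)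
  moreover have "(\<integral>x. ?\<eta> x \<partial>lborel) = 1" using \<open>m > 0\<close> by (simp add: m_def)
  moreover have "integrable lborel ?\<eta>" by (intro integrable_mult_right int)
  ultimately show ?thesis using that[of ?\<eta>] nonneg supp \<open>m > 0\<close> by auto
qed

section \<open>Taylor bounds and convolution\<close>

lemma abs_sum_cart_le:
  fixes v :: "real^'d::finite"
  assumes "\<And>i. \<bar>c i\<bar> \<le> M"
  shows "\<bar>\<Sum>i\<in>UNIV. v $ i * c i\<bar> \<le> real CARD('d) * norm v * M"
proof -
  have "\<bar>\<Sum>i\<in>UNIV. v $ i * c i\<bar> \<le> (\<Sum>i\<in>(UNIV::'d set). norm v * M)"
    using assms by (intro order.trans[OF sum_abs] sum_mono)
      (auto simp: abs_mult intro!: mult_mono component_le_norm_cart)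
  then show ?thesis by simp
qed

lemma smooth_bounded_line_derivative:
  assumes "smooth_bounded g"
  shows "((\<lambda>t. iter_partial is g (x + t *\<^sub>R v)) has_real_derivative
      (\<Sum>i\<in>UNIV. v $ i * iter_partial (i # is) g (x + t *\<^sub>R v))) (at t)"
  by (rule has_real_derivative_along_line[OF smooth_bounded_has_derivative[OF assms]])

context
  fixes g :: "real^'d::finite \<Rightarrow> real" and x v :: "real^'d"
  assumes g: "smooth_bounded g"
begin

text \<open>The derivatives of order 0 to 3 of \<open>g (x + t v)\<close> in \<open>t\<close>,
  indexed by their order as the Maclaurin formula expects.\<close>

private definition line_diff :: "nat \<Rightarrow> real \<Rightarrow> real" where
  "line_diff m t = (if m = 0 then g (x + t *\<^sub>R v)
    else if m = 1 then \<Sum>i\<in>UNIV. v $ i * iter_partial [i] g (x + t *\<^sub>R v)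
    else if m = 2 then \<Sum>i\<in>UNIV. v $ i * (\<Sum>j\<in>UNIV. v $ j * iter_partial [j, i] g (x + t *\<^sub>R v))
    else \<Sum>i\<in>UNIV. v $ i * (\<Sum>j\<in>UNIV. v $ j *
      (\<Sum>l\<in>UNIV. v $ l * iter_partial [l, j, i] g (x + t *\<^sub>R v))))"

private lemma line_diff_deriv:
  assumes "m < 3" shows "(line_diff m has_real_derivative line_diff (Suc m) t) (at t)"
proof -
  note D = smooth_bounded_line_derivative[OF g]
  consider "m = 0" | "m = 1" | "m = 2" using assms by linarith
  then show ?thesis
  proof cases
    case 1
    then show ?thesis using D[of "[]" x v t] by (simp add: line_diff_def[abs_def])
  next
    case 2
    have "((\<lambda>t. \<Sum>i\<in>UNIV. v $ i * iter_partial [i] g (x + t *\<^sub>R v)) has_real_derivative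
      (\<Sum>i\<in>UNIV. v $ i * (\<Sum>j\<in>UNIV. v $ j * iter_partial [j, i] g (x + t *\<^sub>R v)))) (at t)"
      by (intro DERIV_sum DERIV_cmult D)
    then show ?thesis using 2 by (simp add: line_diff_def[abs_def])
  next
    case 3
    have "((\<lambda>t. \<Sum>i\<in>UNIV. v $ i * (\<Sum>j\<in>UNIV. v $ j * iter_partial [j, i] g (x + t *\<^sub>R v)))
      has_real_derivative (\<Sum>i\<in>UNIV. v $ i * (\<Sum>j\<in>UNIV. v $ j *
      (\<Sum>l\<in>UNIV. v $ l * iter_partial [l, j, i] g (x + t *\<^sub>R v))))) (at t)"
      by (intro DERIV_sum DERIV_cmult D)
    then show ?thesis using 3 by (simp add: line_diff_def[abs_def])
  qed
qed

lemma smooth_bounded_taylor2: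
  assumes M: "\<And>i j x. \<bar>iter_partial [i, j] g x\<bar> \<le> M"
  shows "\<bar>g (x + v) - g x - (\<Sum>i\<in>UNIV. v $ i * iter_partial [i] g x)\<bar> \<le> real CARD('d)^2 * (norm v)^2 * M"
proof -
  have "M \<ge> 0" using M[of undefined undefined undefined] by linarith
  obtain t where "line_diff 0 1 = (\<Sum>m<2. line_diff m 0 / fact m * 1 ^ m) + line_diff 2 t / fact 2 * 1 ^ 2"
    using Maclaurin_bi_le[of line_diff "line_diff 0" 2 1] line_diff_deriv by auto
  then have "g (x + v) - g x - (\<Sum>i\<in>UNIV. v $ i * iter_partial [i] g x) = line_diff 2 t / 2"
    by (simp add: line_diff_def lessThan_nat_numeral)
  moreover have "\<bar>line_diff 2 t\<bar> \<le> real CARD('d) * norm v * (real CARD('d) * norm v * M)"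
    unfolding line_diff_def using M by (auto intro!: abs_sum_cart_le)
  moreover have "0 \<le> real CARD('d) * norm v * (real CARD('d) * norm v * M)" using \<open>M \<ge> 0\<close> by simp
  ultimately show ?thesis by (simp add: power2_eq_square mult_ac)
qed

text \<open>Expanding at \<open>t = 1\<close> and \<open>t = -1\<close> cancels the first-order
  terms, so only the two third-order remainders are left; their factors 1/6 are given away.\<close>

lemma smooth_bounded_taylor3:
  assumes M: "\<And>i j l x. \<bar>iter_partial [i, j, l] g x\<bar> \<le> M"
  shows "\<bar>g (x + v) + g (x - v) - 2 * g x - (\<Sum>i\<in>UNIV. v $ i * (\<Sum>j\<in>UNIV. v $ j * iter_partial [j, i] g x))\<bar>
    \<le> real CARD('d)^3 * (norm v)^3 * M"
proof -
  have T: "\<exists>t. line_diff 0 s = (\<Sum>m<3. line_diff m 0 / fact m * s ^ m) + line_diff 3 t / fact 3 * s ^ 3" for s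
    using Maclaurin_bi_le[of line_diff "line_diff 0" 3 s] line_diff_deriv by auto
  have "(\<Sum>m<3. line_diff m 0 / fact m * s ^ m) = line_diff 0 0 + line_diff 1 0 * s + line_diff 2 0 / 2 * s^2" for s
  proof -
    have "{..<3} = {0, 1, 2::nat}" by auto
    then show ?thesis by (simp add: fact_numeral)
  qed
  then have "\<exists>t. line_diff 0 s = line_diff 0 0 + line_diff 1 0 * s + line_diff 2 0 / 2 * s^2 + line_diff 3 t / 6 * s^3" for s
    using T[of s] by (simp add: fact_numeral)
  then obtain t1 t2 where t: "line_diff 0 1 = line_diff 0 0 + line_diff 1 0 * 1 + line_diff 2 0 / 2 * 1^2 + line_diff 3 t1 / 6 * 1^3"
    "line_diff 0 (-1) = line_diff 0 0 + line_diff 1 0 * (-1) + line_diff 2 0 / 2 * (-1)^2 + line_diff 3 t2 / 6 * (-1)^3"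
    by metis
  have "g (x + v) + g (x - v) - 2 * g x - line_diff 2 0 = line_diff 3 t1 / 6 - line_diff 3 t2 / 6"
    using t by (simp add: line_diff_def[of 0])
  moreover have "\<bar>line_diff 3 t\<bar> \<le> real CARD('d) * norm v * (real CARD('d) * norm v * (real CARD('d) * norm v * M))" for t
    unfolding line_diff_def using M by (auto intro!: abs_sum_cart_le)
  note this[of t1] this[of t2]
  ultimately show ?thesis by (simp add: line_diff_def power3_eq_cube mult_ac)
qed

end

text \<open>\<open>\<zeta>\<close> carries the irregular function and \<open>\<phi>\<close> the
  smooth kernel, so that derivatives fall on \<open>\<phi>\<close>.\<close>

definition conv :: "('a::euclidean_space \<Rightarrow> real) \<Rightarrow> ('a \<Rightarrow> real) \<Rightarrow> 'a \<Rightarrow> real" where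
  "conv \<zeta> \<phi> x = (\<integral>y. \<zeta> y * \<phi> (x - y) \<partial>lborel)"

locale convolvable =
  fixes \<zeta> :: "'a::euclidean_space \<Rightarrow> real" and R s :: real
  assumes meas: "\<zeta> \<in> borel_measurable borel" and bd: "\<And>y. \<bar>\<zeta> y\<bar> \<le> s"
    and supp: "\<And>y. y \<notin> cball 0 R \<Longrightarrow> \<zeta> y = 0"
begin

lemma integrable_conv:
  assumes "\<phi> \<in> borel_measurable borel" "\<And>y. \<bar>\<phi> y\<bar> \<le> M"
  shows "integrable lborel (\<lambda>y. \<zeta> y * \<phi> (x - y))"
proof (rule Bochner_Integration.integrable_bound)
  show "integrable lborel (\<lambda>y::'a. (s * M) * indicator (cball 0 R) y)"
    by (intro integrable_mult_right integrable_real_indicator) (auto simp: emeasure_bounded_finite[unfolded infinity_ennreal_def])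
  show "(\<lambda>y. \<zeta> y * \<phi> (x - y)) \<in> borel_measurable lborel"
    using meas assms(1) by measurable
  show "AE y in lborel. norm (\<zeta> y * \<phi> (x - y)) \<le> norm (s * M * indicator (cball 0 R) y)"
  proof (rule AE_I2)
    fix y
    have "s \<ge> 0" "M \<ge> 0" using bd[of y] assms(2)[of y] by linarith+
    then show "norm (\<zeta> y * \<phi> (x - y)) \<le> norm (s * M * indicator (cball 0 R) y)"
      using bd[of y] assms(2)[of "x - y"] supp[of y]
      by (cases "y \<in> cball 0 R") (auto simp: abs_mult intro!: mult_mono)
  qed
qed

lemma abs_conv_le:
  assumes "\<And>y. \<bar>\<phi> y\<bar> \<le> M" "\<phi> \<in> borel_measurable borel"
  shows "\<bar>conv \<zeta> \<phi> x\<bar> \<le> s * M * measure lborel (cball 0 R :: 'a set)"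
proof -
  have sM: "s \<ge> 0" "M \<ge> 0" using bd[of undefined] assms(1)[of undefined] by linarith+
  have "\<bar>conv \<zeta> \<phi> x\<bar> \<le> (\<integral>y. \<bar>\<zeta> y * \<phi> (x - y)\<bar> \<partial>lborel)"
    unfolding conv_def by (rule integral_abs_bound)
  also have "\<dots> \<le> (\<integral>y. (s * M) * indicator (cball 0 R) (y::'a) \<partial>lborel)"
  proof (rule integral_mono)
    show "integrable lborel (\<lambda>y. \<bar>\<zeta> y * \<phi> (x - y)\<bar>)"
      by (intro integrable_abs integrable_conv[OF assms(2,1)])
    show "integrable lborel (\<lambda>y::'a. (s * M) * indicator (cball 0 R) y)"
      by (intro integrable_mult_right integrable_real_indicator) (auto simp: emeasure_bounded_finite[unfolded infinity_ennreal_def])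
    show "\<bar>\<zeta> y * \<phi> (x - y)\<bar> \<le> s * M * indicator (cball 0 R) y" for y
      using bd[of y] assms(1)[of "x - y"] supp[of y] sM
      by (cases "y \<in> cball 0 R") (auto simp: abs_mult intro!: mult_mono)
  qed
  also have "\<dots> = s * M * measure lborel (cball 0 R :: 'a set)"
    by simp
  finally show ?thesis .
qed

end

lemma smooth_bounded_bound:
  assumes "smooth_bounded g" obtains M where "\<And>x. \<bar>iter_partial is g x\<bar> \<le> M" "M \<ge> 0"
proof -
  have "bounded (range (iter_partial is g))" using assms by (simp add: smooth_bounded_def)
  then obtain M where "\<And>x. \<bar>iter_partial is g x\<bar> \<le> M" unfolding bounded_iff by auto
  with this[of undefined] show ?thesis using that by force
qed

lemma finite_bounds:
  fixes F :: "'i::finite \<Rightarrow> 'x \<Rightarrow> real"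
  assumes "\<And>i. \<exists>M. \<forall>x. \<bar>F i x\<bar> \<le> M" shows "\<exists>M\<ge>0. \<forall>i x. \<bar>F i x\<bar> \<le> M"
proof -
  obtain M where M: "\<And>i x. \<bar>F i x\<bar> \<le> M i" using assms by metis
  have "\<bar>F i x\<bar> \<le> (\<Sum>i\<in>UNIV. \<bar>M i\<bar>)" for i x
    using M[of i x] member_le_sum[of i UNIV "\<lambda>i. \<bar>M i\<bar>"] by simp
  then show ?thesis by (intro exI[of _ "\<Sum>i\<in>UNIV. \<bar>M i\<bar>"]) (auto simp: sum_nonneg)
qed

lemma smooth_bounded_bounds3:
  fixes g :: "real^'d::finite \<Rightarrow> real"
  assumes "smooth_bounded g"
  obtains M where "M \<ge> 0" "\<And>x. \<bar>g x\<bar> \<le> M" "\<And>i x. \<bar>iter_partial [i] g x\<bar> \<le> M"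
    "\<And>i j x. \<bar>iter_partial [i,j] g x\<bar> \<le> M" "\<And>i j l x. \<bar>iter_partial [i,j,l] g x\<bar> \<le> M"
proof -
  note B = smooth_bounded_bound[OF assms]
  obtain M0 where M0: "\<And>x. \<bar>g x\<bar> \<le> M0" "M0 \<ge> 0" using B[of "[]"] by auto
  obtain M1 where M1: "\<And>i x. \<bar>iter_partial [i] g x\<bar> \<le> M1" "M1 \<ge> 0"
    using finite_bounds[of "\<lambda>i. iter_partial [i] g"] B by metis
  obtain M2 where M2: "\<And>i x. \<bar>iter_partial [fst i, snd i] g x\<bar> \<le> M2" "M2 \<ge> 0"
    using finite_bounds[of "\<lambda>i :: 'd \<times> 'd. iter_partial [fst i, snd i] g"] B by metis
  obtain M3 where M3: "\<And>i x. \<bar>iter_partial [fst i, fst (snd i), snd (snd i)] g x\<bar> \<le> M3" "M3 \<ge> 0"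
    using finite_bounds[of "\<lambda>i :: 'd \<times> 'd \<times> 'd. iter_partial [fst i, fst (snd i), snd (snd i)] g"] B by metis
  show ?thesis
  proof (rule that[of "M0 + M1 + M2 + M3"])
    show "\<bar>iter_partial [i,j] g x\<bar> \<le> M0 + M1 + M2 + M3" for i j x
      using M2(1)[of "(i,j)" x] M0 M1 M2 M3 by simp
    show "\<bar>iter_partial [i,j,l] g x\<bar> \<le> M0 + M1 + M2 + M3" for i j l x
      using M3(1)[of "(i,j,l)" x] M0 M1 M2 M3 by simp
    show "\<bar>g x\<bar> \<le> M0 + M1 + M2 + M3" for x using M0(1)[of x] M1 M2 M3 by simp
    show "\<bar>iter_partial [i] g x\<bar> \<le> M0 + M1 + M2 + M3" for i x using M1(1)[of i x] M0 M2 M3 by simp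
  qed (use M0 M1 M2 M3 in auto)
qed

lemma smooth_bounded_measurable:
  "smooth_bounded g \<Longrightarrow> iter_partial is g \<in> borel_measurable borel"
  by (intro borel_measurable_continuous_onI smooth_bounded_continuous)

lemma has_derivativeI_quadratic:
  fixes f :: "'a::real_normed_vector \<Rightarrow> real"
  assumes "bounded_linear f'" "\<And>v. \<bar>f (x + v) - f x - f' v\<bar> \<le> C * (norm v)^2"
  shows "(f has_derivative f') (at x)"
proof (rule has_derivative_at[THEN iffD2], intro conjI assms(1))
  have "((\<lambda>v::'a. C * norm v) \<longlongrightarrow> C * norm (0::'a)) (at 0)"
    by (intro tendsto_mult tendsto_const tendsto_norm tendsto_ident_at)
  then have *: "((\<lambda>v::'a. C * norm v) \<longlongrightarrow> 0) (at 0)" by simp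
  have "norm (norm (f (x + v) - f x - f' v) / norm v) \<le> C * norm v" for v
  proof (cases "v = 0")
    case False
    then show ?thesis using assms(2)[of v] by (simp add: divide_le_eq power2_eq_square mult.assoc)
  qed simp
  then show "((\<lambda>v. norm (f (x + v) - f x - f' v) / norm v) \<longlongrightarrow> 0) (at 0)"
    by (intro Lim_null_comparison[OF _ *] always_eventually allI)
qed

text \<open>The Taylor remainder of \<open>g\<close> is quadratic in \<open>v\<close> uniformly in
  the base point, so integrating it against \<open>\<zeta>\<close> keeps it quadratic; no limit is
  exchanged with the integral.\<close>

lemma conv_has_derivative:
  fixes g :: "real^'d::finite \<Rightarrow> real"
  assumes "convolvable \<zeta> R s" and g: "smooth_bounded g"
  shows "(conv \<zeta> g has_derivative (\<lambda>v. \<Sum>i\<in>UNIV. v $ i * conv \<zeta> (partial_dir i g) x)) (at x)"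
proof -
  interpret convolvable \<zeta> R s by fact
  obtain M where M: "M \<ge> 0" "\<And>x. \<bar>g x\<bar> \<le> M" "\<And>i x. \<bar>iter_partial [i] g x\<bar> \<le> M"
    "\<And>i j x. \<bar>iter_partial [i,j] g x\<bar> \<le> M" using smooth_bounded_bounds3[OF g] by metis
  have [measurable]: "g \<in> borel_measurable borel" "\<And>i. partial_dir i g \<in> borel_measurable borel"
    using smooth_bounded_measurable[OF g, of "[]"] smooth_bounded_measurable[OF g, of "[_]"] by simp_all
  note [measurable] = meas
  have i1: "integrable lborel (\<lambda>y. \<zeta> y * g (x - y))" for x
    by (rule integrable_conv[of _ M]) (use M in auto)
  have i2: "integrable lborel (\<lambda>y. \<zeta> y * partial_dir i g (x - y))" for x i
    by (rule integrable_conv[of _ M]) (use M(3) in auto)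
  show ?thesis
  proof (rule has_derivativeI_quadratic)
    show "bounded_linear (\<lambda>v. \<Sum>i\<in>UNIV. v $ i * conv \<zeta> (partial_dir i g) x)"
      by (intro bounded_linear_sum bounded_linear_mult_left[THEN bounded_linear_compose] bounded_linear_vec_nth)
    fix v :: "real^'d"
    let ?r = "\<lambda>p. g (p + v) - g p - (\<Sum>i\<in>UNIV. v $ i * partial_dir i g p)"
    have "conv \<zeta> g (x + v) - conv \<zeta> g x - (\<Sum>i\<in>UNIV. v $ i * conv \<zeta> (partial_dir i g) x)
      = (\<integral>y. \<zeta> y * g (x + v - y) - \<zeta> y * g (x - y) - (\<Sum>i\<in>UNIV. v $ i * (\<zeta> y * partial_dir i g (x - y))) \<partial>lborel)"
      unfolding conv_def using i1 i2 by (simp add: Bochner_Integration.integral_sum)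
    also have "\<dots> = conv \<zeta> ?r x"
      unfolding conv_def
      by (intro Bochner_Integration.integral_cong)
        (simp_all add: algebra_simps sum_distrib_left)
    finally show "\<bar>conv \<zeta> g (x + v) - conv \<zeta> g x - (\<Sum>i\<in>UNIV. v $ i * conv \<zeta> (partial_dir i g) x)\<bar>
      \<le> s * (real CARD('d)^2 * M) * measure lborel (cball 0 R :: (real^'d) set) * (norm v)^2"
      using abs_conv_le[of ?r "real CARD('d)^2 * (norm v)^2 * M" x] smooth_bounded_taylor2[OF g M(4), of _ v]
      by (simp add: mult_ac)
  qed
qed

lemma iter_partial_conv:
  fixes g :: "real^'d::finite \<Rightarrow> real"
  assumes "convolvable \<zeta> R s" and g: "smooth_bounded g"
  shows "iter_partial is (conv \<zeta> g) = conv \<zeta> (iter_partial is g)"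
proof (induction "is")
  case (Cons i "is")
  have "partial_dir i (conv \<zeta> (iter_partial is g)) x = conv \<zeta> (partial_dir i (iter_partial is g)) x" for x
    by (rule partial_dir_eqI(1)[OF conv_has_derivative[OF assms(1) smooth_bounded_iter_partial[OF g]]])
  then show ?case using Cons by auto
qed simp

lemma smooth_bounded_conv:
  fixes g :: "real^'d::finite \<Rightarrow> real"
  assumes "convolvable \<zeta> R s" and g: "smooth_bounded g"
  shows "smooth_bounded (conv \<zeta> g)"
  unfolding smooth_bounded_def iter_partial_conv[OF assms]
proof (intro allI conjI)
  fix "is" and x :: "real^'d"
  show "(conv \<zeta> (iter_partial is g) has_derivative (\<lambda>v. \<Sum>i\<in>UNIV. v $ i * conv \<zeta> (iter_partial (i # is) g) x)) (at x)"
    using conv_has_derivative[OF assms(1) smooth_bounded_iter_partial[OF g, of "is"]] by simp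
  obtain M where M: "\<And>x. \<bar>iter_partial is g x\<bar> \<le> M" using smooth_bounded_bound[OF g] by metis
  show "bounded (range (conv \<zeta> (iter_partial is g)))"
    using convolvable.abs_conv_le[OF assms(1) M smooth_bounded_measurable[OF g]]
    unfolding bounded_iff by auto
qed

text \<open>The reflection about \<open>x / 2\<close> preserves Lebesgue measure. One form puts
  derivatives on the mollifier; the other averages translates of the irregular function, and that is
  where a frozen generator can be applied.\<close>

lemma conv_swap:
  fixes \<zeta> \<phi> :: "'a::euclidean_space \<Rightarrow> real"
  assumes [measurable]: "\<zeta> \<in> borel_measurable borel" "\<phi> \<in> borel_measurable borel"
  shows "conv \<zeta> \<phi> x = (\<integral>w. \<phi> w * \<zeta> (x - w) \<partial>lborel)"
proof -
  have "distr lborel borel (\<lambda>w. x + (-1) *\<^sub>R w) = (lborel :: 'a measure)"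
    using lborel_affine[of "-1" x] by (simp add: density_1)
  then have "conv \<zeta> \<phi> x = (\<integral>y. \<zeta> y * \<phi> (x - y) \<partial>distr lborel borel (\<lambda>w. x + (-1) *\<^sub>R w))"
    by (simp add: conv_def)
  also have "\<dots> = (\<integral>w. \<zeta> (x - w) * \<phi> w \<partial>lborel)"
    by (subst integral_distr) simp_all
  finally show ?thesis by (simp add: mult_ac)
qed

section \<open>Martingale solutions\<close>

lemma space_path_space [simp]: "space (path_space E) = cadlag_paths E"
  unfolding path_space_def by (rule space_measure_of) auto

lemma measurable_coordinate:
  assumes "0 \<le> s" shows "(\<lambda>\<omega>. \<omega> s) \<in> path_space E \<rightarrow>\<^sub>M borel"
proof (rule measurableI)
  fix A :: "'a set" assume A: "A \<in> sets borel"
  have "{\<omega> \<in> cadlag_paths E. \<omega> s \<in> A} \<in> sets (path_space E)"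
    unfolding path_space_def using A assms by (subst sets_measure_of) auto
  moreover have "(\<lambda>\<omega>. \<omega> s) -` A \<inter> space (path_space E) = {\<omega> \<in> cadlag_paths E. \<omega> s \<in> A}" by auto
  ultimately show "(\<lambda>\<omega>. \<omega> s) -` A \<inter> space (path_space E) \<in> sets (path_space E)" by simp
qed simp

text \<open>A right-continuous path is the limit of its values at the next grid point strictly to
  the right, and the grid point depends on the time only through an integer. The continuous map
  \<open>\<phi>\<close> moves the limit into a metric space, where pointwise limits of measurable
  maps are measurable.\<close>

lemma measurable_evaluation:
  fixes E :: "'e::t2_space set" and \<phi> :: "'e \<Rightarrow> 'f::metric_space"
  assumes \<phi>: "continuous_on UNIV \<phi>"
  shows "(\<lambda>(s, \<omega>). \<phi> (\<omega> (max 0 s))) \<in> borel \<Otimes>\<^sub>M path_space E \<rightarrow>\<^sub>M borel"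
proof (rule borel_measurable_LIMSEQ_metric)
  let ?r = "\<lambda>n (s::real). (real_of_int \<lfloor>real (Suc n) * max 0 s\<rfloor> + 1) / real (Suc n)"
  fix n :: nat
  have pos: "0 \<le> (real_of_int \<bar>i\<bar> + 1) / real (Suc n)" for i :: int by simp
  \<comment> \<open>The absolute value keeps the sampled time nonnegative for every integer index,
    including those the floor never takes; coordinates are known to be measurable at nonnegative
    times.\<close>
  have "(\<lambda>p. \<phi> (snd p ((real_of_int \<bar>\<lfloor>real (Suc n) * max 0 (fst p)\<rfloor>\<bar> + 1) / real (Suc n))))
      \<in> borel \<Otimes>\<^sub>M path_space E \<rightarrow>\<^sub>M borel"
    by (rule measurable_compose_countable[where f="\<lambda>i p. \<phi> (snd p ((real_of_int \<bar>i\<bar> + 1) / real (Suc n)))"])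
      (auto intro!: measurable_compose[OF measurable_snd measurable_compose[OF measurable_coordinate
          borel_measurable_continuous_onI[OF \<phi>]]] pos)
  moreover have "\<bar>\<lfloor>real (Suc n) * max 0 s\<rfloor>\<bar> = \<lfloor>real (Suc n) * max 0 s\<rfloor>" for s :: real by simp
  ultimately show "(\<lambda>p. \<phi> (snd p (?r n (fst p)))) \<in> borel \<Otimes>\<^sub>M path_space E \<rightarrow>\<^sub>M borel" by simp
next
  let ?r = "\<lambda>n (s::real). (real_of_int \<lfloor>real (Suc n) * max 0 s\<rfloor> + 1) / real (Suc n)"
  fix p :: "real \<times> (real \<Rightarrow> 'e)" assume "p \<in> space (borel \<Otimes>\<^sub>M path_space E)"
  then obtain s \<omega> where p: "p = (s, \<omega>)" and \<omega>: "\<omega> \<in> cadlag_paths E" by (auto simp: space_pair_measure)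
  have gt: "?r n s > max 0 s" for n
  proof -
    define u where "u = max 0 s"
    have "real (Suc n) * u < real_of_int \<lfloor>real (Suc n) * u\<rfloor> + 1" by linarith
    then show ?thesis unfolding u_def[symmetric] by (simp add: pos_less_divide_eq mult.commute del: of_nat_Suc)
  qed
  have le: "?r n s \<le> max 0 s + 1 / real (Suc n)" for n
  proof -
    define u c where "u = max 0 s" and "c = real (Suc n)"
    have "c > 0" by (simp add: c_def)
    have "real_of_int \<lfloor>c * u\<rfloor> + 1 \<le> c * u + 1" by linarith
    from divide_right_mono[OF this, of c] \<open>c > 0\<close>
    have "(real_of_int \<lfloor>c * u\<rfloor> + 1) / c \<le> u + 1 / c" by (simp add: add_divide_distrib)
    then show ?thesis unfolding u_def c_def .
  qed
  have "(\<lambda>n. ?r n s) \<longlonglongrightarrow> max 0 s"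
  proof (rule tendsto_sandwich[OF _ _ tendsto_const])
    have "(\<lambda>n. max 0 s + 1 / real (Suc n)) \<longlonglongrightarrow> max 0 s + 0"
      by (intro tendsto_intros LIMSEQ_Suc[OF lim_1_over_n])
    then show "(\<lambda>n. max 0 s + 1 / real (Suc n)) \<longlonglongrightarrow> max 0 s" by simp
    show "\<forall>\<^sub>F n in sequentially. max 0 s \<le> ?r n s" using gt by (intro always_eventually allI less_imp_le)
    show "\<forall>\<^sub>F n in sequentially. ?r n s \<le> max 0 s + 1 / real (Suc n)" using le by (intro always_eventually allI)
  qed
  then have "filterlim (\<lambda>n. ?r n s) (at_right (max 0 s)) sequentially"
    using gt by (auto simp: filterlim_at intro!: always_eventually simp: less_imp_neq[symmetric])
  moreover have "(\<omega> \<longlongrightarrow> \<omega> (max 0 s)) (at_right (max 0 s))"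
    using \<omega> by (simp add: cadlag_paths_def continuous_within)
  ultimately have "(\<lambda>n. \<omega> (?r n s)) \<longlonglongrightarrow> \<omega> (max 0 s)" by (rule filterlim_compose[rotated])
  moreover have "isCont \<phi> (\<omega> (max 0 s))" using \<phi> by (simp add: continuous_on_eq_continuous_at)
  ultimately have "(\<lambda>n. \<phi> (\<omega> (?r n s))) \<longlonglongrightarrow> \<phi> (\<omega> (max 0 s))" by (rule isCont_tendsto_compose[rotated])
  then show "(\<lambda>n. \<phi> (snd p (?r n (fst p)))) \<longlonglongrightarrow> (case p of (s, \<omega>) \<Rightarrow> \<phi> (\<omega> (max 0 s)))"
    using p by simp
qed

text \<open>The regime is embedded into the reals, the limit is taken in
  \<open>real^'d \<times> real\<close>, and the regime is recovered by the measurable floor.\<close>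

lemma measurable_evaluation_pair_nat:
  fixes E :: "((real^'d::finite) \<times> nat) set"
  shows "(\<lambda>(s, \<omega>). \<omega> (max 0 s)) \<in> borel \<Otimes>\<^sub>M path_space E \<rightarrow>\<^sub>M borel"
proof -
  let ?\<phi> = "\<lambda>p :: (real^'d) \<times> nat. (fst p, real (snd p))"
  let ?\<psi> = "\<lambda>p :: (real^'d) \<times> real. (fst p, nat \<lfloor>snd p\<rfloor>)"
  have "continuous_on UNIV (real :: nat \<Rightarrow> real)" by (simp add: Topological_Spaces.continuous_on_discrete)
  then have "continuous_on UNIV ?\<phi>"
    by (intro continuous_on_Pair continuous_on_fst continuous_on_id
        continuous_on_compose2[of UNIV real _ snd] continuous_on_snd) auto
  note m = measurable_evaluation[OF this, of E]
  have "(\<lambda>p :: (real^'d) \<times> real. nat \<lfloor>snd p\<rfloor>) \<in> borel \<rightarrow>\<^sub>M borel"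
    by (rule measurable_compose[OF measurable_compose[OF borel_measurable_continuous_onI[of snd] measurable_real_floor]])
      (auto intro: continuous_intros)
  then have "?\<psi> \<in> borel \<rightarrow>\<^sub>M borel"
    by (intro borel_measurable_Pair borel_measurable_continuous_onI[of fst]) (auto intro: continuous_intros)
  from measurable_compose[OF m this] show ?thesis by (simp add: case_prod_beta)
qed

section \<open>Expectations of test functions under a martingale solution\<close>

locale mp_sol =
  fixes E :: "'e::topological_space set" and T G e0 P
  assumes sol: "mp_solution E T G e0 P"
    and evaluation: "(\<lambda>(s, \<omega>). \<omega> (max 0 s)) \<in> borel \<Otimes>\<^sub>M path_space E \<rightarrow>\<^sub>M borel"
begin

lemma sets_P: "sets P = sets (path_space E)" and prob_P: "prob_space P"
  using sol by (auto simp: mp_solution_def)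

lemma space_P: "space P = cadlag_paths E"
  using sets_eq_imp_space_eq[OF sets_P] by simp

sublocale prob_space P by (rule prob_P)

lemma in_E: "\<omega> \<in> space P \<Longrightarrow> \<omega> s \<in> E"
  by (simp add: space_P cadlag_paths_def)

lemma coordinate_measurable [measurable]: "0 \<le> s \<Longrightarrow> (\<lambda>\<omega>. \<omega> s) \<in> P \<rightarrow>\<^sub>M borel"
  using measurable_coordinate[of s E] measurable_cong_sets[OF sets_P refl] by blast

lemma start:
  assumes [measurable]: "f \<in> borel_measurable borel"
  shows "expectation (\<lambda>\<omega>. f (\<omega> 0)) = (f e0 :: real)"
proof -
  have "prob {\<omega> \<in> space P. \<omega> 0 = e0} = 1"
    using sol by (simp add: mp_solution_def emeasure_eq_measure)
  moreover have "{\<omega> \<in> space P. \<omega> 0 = e0} \<in> sets P"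
    using \<open>prob _ = 1\<close> measure_notin_sets by fastforce
  ultimately have "AE \<omega> in P. \<omega> 0 = e0" using prob_Collect_eq_1[of "\<lambda>\<omega>. \<omega> 0 = e0"] by simp
  then have "expectation (\<lambda>\<omega>. f (\<omega> 0)) = expectation (\<lambda>\<omega>. f e0)"
    by (intro integral_cong_AE) auto
  then show ?thesis by (simp add: prob_space)
qed

context
  fixes f g :: "'e \<Rightarrow> real" and B C :: real
  assumes f: "f \<in> T" "f \<in> borel_measurable borel" "\<And>e. e \<in> E \<Longrightarrow> \<bar>f e\<bar> \<le> B"
    and g: "g \<in> borel_measurable borel" "\<And>e. e \<in> E \<Longrightarrow> G f e = g e" "\<And>e. e \<in> E \<Longrightarrow> \<bar>g e\<bar> \<le> C"
begin

lemma integrable_test: "0 \<le> t \<Longrightarrow> integrable P (\<lambda>\<omega>. f (\<omega> t))"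
  using f by (intro integrable_const_bound[of _ B]) (auto intro!: AE_I2 in_E)

lemma integrable_gen: "0 \<le> t \<Longrightarrow> integrable P (\<lambda>\<omega>. g (\<omega> t))"
  using g by (intro integrable_const_bound[of _ C]) (auto intro!: AE_I2 in_E)

lemma expectation_gen_bound: "0 \<le> t \<Longrightarrow> \<bar>expectation (\<lambda>\<omega>. g (\<omega> t))\<bar> \<le> C"
proof -
  assume "0 \<le> t"
  have "\<bar>expectation (\<lambda>\<omega>. g (\<omega> t))\<bar> \<le> expectation (\<lambda>\<omega>. \<bar>g (\<omega> t)\<bar>)" by (rule integral_abs_bound)
  also have "\<dots> \<le> expectation (\<lambda>_. C)"
    by (intro integral_mono integrable_abs integrable_gen \<open>0 \<le> t\<close>) (auto intro: g(3) in_E)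
  finally show ?thesis by (simp add: prob_space)
qed

text \<open>The martingale identity between the times 0 and \<open>t\<close> on the whole path
  space, with Fubini for the time integral. \<open>g\<close> agrees with \<open>G f\<close> on the
  state space, where all paths live, and is measurable everywhere, as Fubini requires. Reading paths
  at \<open>max 0 s\<close> makes the integrand jointly measurable on the whole time axis.\<close>

lemma evolution:
  assumes t: "0 \<le> t"
  shows "expectation (\<lambda>\<omega>. f (\<omega> t)) = f e0 + (LINT s:{0..t}|lborel. expectation (\<lambda>\<omega>. g (\<omega> (max 0 s))))"
    and "set_integrable lborel {0..t} (\<lambda>s. expectation (\<lambda>\<omega>. g (\<omega> (max 0 s))))"
proof -
  interpret pair: pair_sigma_finite lborel P ..
  let ?h = "\<lambda>s \<omega>. indicator {0..t} s * g (\<omega> (max 0 s))"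
  have "(\<lambda>(s, \<omega>). \<omega> (max 0 s)) \<in> lborel \<Otimes>\<^sub>M P \<rightarrow>\<^sub>M borel"
    using evaluation measurable_cong_sets[OF sets_pair_measure_cong[OF sets_lborel sets_P] refl]
    by blast
  from measurable_compose[OF this g(1)]
  have m: "(\<lambda>(s, \<omega>). g (\<omega> (max 0 s))) \<in> borel_measurable (lborel \<Otimes>\<^sub>M P)" by (simp add: case_prod_beta)
  then have m': "(\<lambda>(s, \<omega>). ?h s \<omega>) \<in> borel_measurable (lborel \<Otimes>\<^sub>M P)"
    unfolding case_prod_beta by measurable
  have int: "integrable (lborel \<Otimes>\<^sub>M P) (\<lambda>(s, \<omega>). ?h s \<omega>)"
  proof (rule Bochner_Integration.integrable_bound[OF _ m'])
    have "emeasure (lborel \<Otimes>\<^sub>M P) ({0..t} \<times> space P) = emeasure lborel {0..t} * emeasure P (space P)"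
      by (rule emeasure_pair_measure_Times) auto
    then show "integrable (lborel \<Otimes>\<^sub>M P) (\<lambda>p. C * indicator ({0..t} \<times> space P) p)"
      by (intro integrable_mult_right integrable_real_indicator) (auto simp: emeasure_space_1 t)
    have "\<bar>C\<bar> = C" using expectation_gen_bound[OF t] by linarith
    then show "AE p in lborel \<Otimes>\<^sub>M P. norm (case p of (s, \<omega>) \<Rightarrow> ?h s \<omega>) \<le> norm (C * indicator ({0..t} \<times> space P) p)"
      by (intro AE_I2) (auto simp: space_pair_measure abs_mult indicator_def split: prod.splits intro!: g(3) in_E)
  qed
  have "space (path_filt E 0) = space P"
    unfolding path_filt_def space_P by (rule space_measure_of) auto
  then have top: "space P \<in> sets (path_filt E 0)" using sets.top[of "path_filt E 0"] by simp
  have "is_martingale P (path_filt E) (\<lambda>t \<omega>. f (\<omega> t) - f (\<omega> 0) - (LINT s:{0..t}|lborel. G f (\<omega> s)))" (is "is_martingale _ _ ?M")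
    using sol f(1) by (simp add: mp_solution_def)
  then have "(\<integral>\<omega>. indicator (space P) \<omega> * ?M t \<omega> \<partial>P) = (\<integral>\<omega>. indicator (space P) \<omega> * ?M 0 \<omega> \<partial>P)"
    unfolding is_martingale_def using t top by blast
  moreover have "(LINT s:{0..0}|lborel. G f (\<omega> s)) = 0" for \<omega> :: "real \<Rightarrow> 'e"
  proof -
    have "AE s in lborel. indicator {0..0} s *\<^sub>R G f (\<omega> s) = 0"
      using AE_lborel_singleton[of 0] by eventually_elim (auto simp: indicator_def)
    then show ?thesis unfolding set_lebesgue_integral_def by (rule integral_eq_zero_AE)
  qed
  moreover have "(\<integral>\<omega>. indicator (space P) \<omega> * ?M t \<omega> \<partial>P) = (\<integral>\<omega>. ?M t \<omega> \<partial>P)"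
    by (intro Bochner_Integration.integral_cong) auto
  moreover have "(\<integral>\<omega>. indicator (space P) \<omega> * ?M 0 \<omega> \<partial>P) = 0"
    using calculation(2) by simp
  ultimately have 0: "(\<integral>\<omega>. ?M t \<omega> \<partial>P) = 0" by simp
  have M: "?M t \<omega> = f (\<omega> t) - f (\<omega> 0) - (\<integral>s. ?h s \<omega> \<partial>lborel)" if "\<omega> \<in> space P" for \<omega>
    unfolding set_lebesgue_integral_def using that
    by (auto intro!: Bochner_Integration.integral_cong simp: indicator_def g(2) in_E max_def)
  have int2: "integrable P (\<lambda>\<omega>. \<integral>s. ?h s \<omega> \<partial>lborel)"
    using pair.integrable_snd[OF int] by (simp add: case_prod_beta)
  have "(\<integral>\<omega>. ?M t \<omega> \<partial>P) = (\<integral>\<omega>. f (\<omega> t) - f (\<omega> 0) - (\<integral>s. ?h s \<omega> \<partial>lborel) \<partial>P)"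
    by (intro Bochner_Integration.integral_cong M) auto
  also have "\<dots> = expectation (\<lambda>\<omega>. f (\<omega> t)) - f e0 - (\<integral>\<omega>. (\<integral>s. ?h s \<omega> \<partial>lborel) \<partial>P)"
    using integrable_test[OF t] integrable_test[of 0] int2 start[OF f(2)] by simp
  also have "(\<integral>\<omega>. (\<integral>s. ?h s \<omega> \<partial>lborel) \<partial>P) = (\<integral>s. (\<integral>\<omega>. ?h s \<omega> \<partial>P) \<partial>lborel)"
    using pair.Fubini_integral[of ?h] int by simp
  finally show "expectation (\<lambda>\<omega>. f (\<omega> t)) = f e0 + (LINT s:{0..t}|lborel. expectation (\<lambda>\<omega>. g (\<omega> (max 0 s))))"
    using 0 by (simp add: set_lebesgue_integral_def)
  show "set_integrable lborel {0..t} (\<lambda>s. expectation (\<lambda>\<omega>. g (\<omega> (max 0 s))))"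
    using pair.integrable_fst[OF int] by (simp add: case_prod_beta set_integrable_def)
qed

lemma increment:
  assumes "0 \<le> t" "0 \<le> h"
  shows "expectation (\<lambda>\<omega>. f (\<omega> (t + h))) - expectation (\<lambda>\<omega>. f (\<omega> t))
    = (LINT s:{t..t+h}|lborel. expectation (\<lambda>\<omega>. g (\<omega> (max 0 s))))"
    and "set_integrable lborel {t..t+h} (\<lambda>s. expectation (\<lambda>\<omega>. g (\<omega> (max 0 s))))"
proof -
  let ?e = "\<lambda>s. expectation (\<lambda>\<omega>. g (\<omega> (max 0 s)))"
  have i: "set_integrable lborel {0..t+h} ?e" using evolution(2)[of "t+h"] assms by simp
  show i2: "set_integrable lborel {t..t+h} ?e" by (rule set_integrable_subset[OF i]) (use assms in auto)
  have "(LINT s:{0..t} \<union> {t..t+h}|lborel. ?e s) = (LINT s:{0..t}|lborel. ?e s) + (LINT s:{t..t+h}|lborel. ?e s)"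
  proof (rule set_integral_Un_AE)
    show "AE x in lborel. \<not> (x \<in> {0..t} \<and> x \<in> {t..t+h})"
      using AE_lborel_singleton[of t] by eventually_elim auto
  qed (use evolution(2)[OF assms(1)] i2 in auto)
  moreover have "{0..t} \<union> {t..t+h} = {0..t+h}" using assms by auto
  ultimately show "expectation (\<lambda>\<omega>. f (\<omega> (t + h))) - expectation (\<lambda>\<omega>. f (\<omega> t)) = (LINT s:{t..t+h}|lborel. ?e s)"
    using evolution(1)[of "t+h"] evolution(1)[of t] assms by simp
qed

lemma increment_ge:
  assumes "0 \<le> t" "0 \<le> h" and c: "\<And>s. t \<le> s \<Longrightarrow> s \<le> t + h \<Longrightarrow> c \<le> expectation (\<lambda>\<omega>. g (\<omega> s))"
  shows "c * h \<le> expectation (\<lambda>\<omega>. f (\<omega> (t + h))) - expectation (\<lambda>\<omega>. f (\<omega> t))"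
proof -
  have "(LINT s:{t..t+h}|lborel. c) \<le> (LINT s:{t..t+h}|lborel. expectation (\<lambda>\<omega>. g (\<omega> (max 0 s))))"
    by (rule set_integral_mono)
      (use increment(2)[OF assms(1,2)] c assms in \<open>auto simp: max_def set_integrable_def\<close>)
  moreover have "(LINT s:{t..t+h}|lborel. c) = c * h" using assms by (simp add: set_lebesgue_integral_def)
  ultimately show ?thesis using increment(1)[OF assms(1,2)] by simp
qed

lemma increment_abs_le:
  assumes "0 \<le> t" "0 \<le> h"
  shows "\<bar>expectation (\<lambda>\<omega>. f (\<omega> (t + h))) - expectation (\<lambda>\<omega>. f (\<omega> t))\<bar> \<le> C * h"
proof -
  have "(LINT s:{t..t+h}|lborel. expectation (\<lambda>\<omega>. g (\<omega> (max 0 s)))) \<le> (LINT s:{t..t+h}|lborel. C)"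
    by (rule set_integral_mono)
      (use increment(2)[OF assms(1,2)] expectation_gen_bound assms in \<open>auto simp: abs_le_iff set_integrable_def\<close>)
  moreover have "(LINT s:{t..t+h}|lborel. C) = C * h" using assms by (simp add: set_lebesgue_integral_def)
  moreover have "- C * h \<le> expectation (\<lambda>\<omega>. f (\<omega> (t + h))) - expectation (\<lambda>\<omega>. f (\<omega> t))"
    by (rule increment_ge) (use expectation_gen_bound assms in \<open>auto simp: abs_le_iff minus_le_iff\<close>)
  ultimately show ?thesis using increment(1)[OF assms(1,2)] by simp
qed

end
end

section \<open>Regime-switching generators\<close>

text \<open>Both measures have densities with respect to their sum, and sigma-finiteness makes these
  finite almost everywhere, so they may be taken real valued. The two truncated differences in
  \<open>tv_nn_integral\<close> then add up to \<open>\<bar>f1 u - f2 u\<bar>\<close>.\<close>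

lemma tv_nn_integral_densities:
  assumes sf1: "sigma_finite_measure \<mu>1" and sf2: "sigma_finite_measure \<mu>2" and sets_eq: "sets \<mu>2 = sets \<mu>1"
  obtains m f1 f2 where "sets m = sets \<mu>1" "f1 \<in> borel_measurable m" "f2 \<in> borel_measurable m"
    "\<And>u. 0 \<le> f1 u" "\<And>u. 0 \<le> f2 u"
    "\<mu>1 = density m (\<lambda>u. ennreal (f1 u))" "\<mu>2 = density m (\<lambda>u. ennreal (f2 u))"
    "\<And>g. tv_nn_integral g \<mu>1 \<mu>2 = (\<integral>\<^sup>+u. g u * ennreal \<bar>f1 u - f2 u\<bar> \<partial>m)"
proof -
  define m where "m = measure_of (space \<mu>1) (sets \<mu>1) (\<lambda>A. emeasure \<mu>1 A + emeasure \<mu>2 A)"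
  have sets_m[simp]: "sets m = sets \<mu>1" by (simp add: m_def)
  have space_m[simp]: "space m = space \<mu>1" by (simp add: m_def space_measure_of_conv)
  have em: "emeasure m A = emeasure \<mu>1 A + emeasure \<mu>2 A" if "A \<in> sets \<mu>1" for A
    unfolding m_def
  proof (rule emeasure_measure_of_sigma[OF _ _ _ that])
    show "sigma_algebra (space \<mu>1) (sets \<mu>1)" by (rule sets.sigma_algebra_axioms)
    show "positive (sets \<mu>1) (\<lambda>A. emeasure \<mu>1 A + emeasure \<mu>2 A)" by (simp add: positive_def)
    show "countably_additive (sets \<mu>1) (\<lambda>A. emeasure \<mu>1 A + emeasure \<mu>2 A)"
    proof (rule countably_additiveI)
      fix A :: "nat \<Rightarrow> 'a set" assume A: "range A \<subseteq> sets \<mu>1" "disjoint_family A"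
      then show "(\<Sum>i. emeasure \<mu>1 (A i) + emeasure \<mu>2 (A i)) = emeasure \<mu>1 (\<Union> (range A)) + emeasure \<mu>2 (\<Union> (range A))"
        by (subst suminf_add[symmetric]) (auto simp: suminf_emeasure sets_eq)
    qed
  qed
  interpret m: sigma_finite_measure m
  proof
    obtain A where A: "range A \<subseteq> sets \<mu>1" "(\<Union>i. A i) = space \<mu>1" "\<And>i. emeasure \<mu>1 (A i) \<noteq> \<infinity>" "incseq A"
      using sigma_finite_measure.sigma_finite_incseq[OF sf1] by metis
    obtain B where B: "range B \<subseteq> sets \<mu>2" "(\<Union>i. B i) = space \<mu>2" "\<And>i. emeasure \<mu>2 (B i) \<noteq> \<infinity>" "incseq B"
      using sigma_finite_measure.sigma_finite_incseq[OF sf2] by metis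
    have sp: "space \<mu>2 = space \<mu>1" by (rule sets_eq_imp_space_eq[OF sets_eq])
    \<comment> \<open>The exhaustions are increasing, so a point of \<open>A i\<close> and
      \<open>B j\<close> lies in both sets of index \<open>max i j\<close>; hence the intersections
      with equal indices already cover the space.\<close>
    show "\<exists>F. countable F \<and> F \<subseteq> sets m \<and> \<Union> F = space m \<and> (\<forall>a\<in>F. emeasure m a \<noteq> \<infinity>)"
    proof (intro exI[of _ "range (\<lambda>i. A i \<inter> B i)"] conjI ballI)
      show "range (\<lambda>i. A i \<inter> B i) \<subseteq> sets m" using A(1) B(1) sets_eq by auto
      show "\<Union> (range (\<lambda>i. A i \<inter> B i)) = space m"
      proof (intro equalityI subsetI)
        fix x assume "x \<in> space m"
        then obtain i j where "x \<in> A i" "x \<in> B j" using A(2) B(2) sp by (metis UN_E space_m)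
        then have "x \<in> A (max i j) \<inter> B (max i j)"
          using A(4) B(4) by (meson IntI incseqD max.cobounded1 max.cobounded2 subsetD)
        then show "x \<in> \<Union> (range (\<lambda>i. A i \<inter> B i))" by blast
      qed (use A(2) in auto)
      fix a assume "a \<in> range (\<lambda>i. A i \<inter> B i)"
      then obtain i where i: "a = A i \<inter> B i" by auto
      have "a \<in> sets \<mu>1" using A(1) B(1) sets_eq i by auto
      moreover have "emeasure \<mu>1 a \<noteq> \<infinity>"
        using A(3)[of i] emeasure_mono[of a "A i" \<mu>1] A(1) i by (auto simp: top_unique)
      moreover have "emeasure \<mu>2 a \<noteq> \<infinity>"
        using B(3)[of i] emeasure_mono[of a "B i" \<mu>2] B(1) i by (auto simp: top_unique)
      ultimately show "emeasure m a \<noteq> \<infinity>" by (simp add: em)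
    qed simp
  qed
  have ac: "absolutely_continuous m \<mu>1" "absolutely_continuous m \<mu>2"
    using sets_eq by (auto simp: absolutely_continuous_def null_sets_def em)
  define g1 g2 where "g1 = RN_deriv m \<mu>1" and "g2 = RN_deriv m \<mu>2"
  have [measurable]: "g1 \<in> borel_measurable m" "g2 \<in> borel_measurable m" by (simp_all add: g1_def g2_def)
  have d: "density m g1 = \<mu>1" "density m g2 = \<mu>2"
    using m.density_RN_deriv[OF ac(1)] m.density_RN_deriv[OF ac(2)] sets_eq by (simp_all add: g1_def g2_def)
  have fin: "AE u in m. g1 u \<noteq> \<infinity>" "AE u in m. g2 u \<noteq> \<infinity>"
    using m.sigma_finite_iff_density_finite[of g1] m.sigma_finite_iff_density_finite[of g2] sf1 sf2
    by (simp_all add: d)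
  define f1 f2 where "f1 = (\<lambda>u. enn2real (g1 u))" and "f2 = (\<lambda>u. enn2real (g2 u))"
  have [measurable]: "f1 \<in> borel_measurable m" "f2 \<in> borel_measurable m" by (simp_all add: f1_def f2_def)
  have "density m g1 = density m (\<lambda>u. ennreal (f1 u))" "density m g2 = density m (\<lambda>u. ennreal (f2 u))"
    unfolding f1_def f2_def using fin
    by (auto intro!: density_cong elim: AE_mp simp: less_top)
  then have d': "\<mu>1 = density m (\<lambda>u. ennreal (f1 u))" "\<mu>2 = density m (\<lambda>u. ennreal (f2 u))"
    using d by simp_all
  have "tv_nn_integral g \<mu>1 \<mu>2 = (\<integral>\<^sup>+u. g u * ennreal \<bar>f1 u - f2 u\<bar> \<partial>m)" for g
  proof -
    have "tv_nn_integral g \<mu>1 \<mu>2 = (\<integral>\<^sup>+u. g u * ((g1 u - g2 u) + (g2 u - g1 u)) \<partial>m)"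
      by (simp add: tv_nn_integral_def Let_def m_def g1_def g2_def)
    also have "\<dots> = (\<integral>\<^sup>+u. g u * ennreal \<bar>f1 u - f2 u\<bar> \<partial>m)"
    proof (rule nn_integral_cong_AE)
      show "AE u in m. g u * ((g1 u - g2 u) + (g2 u - g1 u)) = g u * ennreal \<bar>f1 u - f2 u\<bar>"
        using fin
      proof eventually_elim
        case (elim u)
        then have "g1 u = ennreal (f1 u)" "g2 u = ennreal (f2 u)" by (simp_all add: f1_def f2_def less_top)
        moreover have "0 \<le> f1 u" "0 \<le> f2 u" by (simp_all add: f1_def f2_def)
        ultimately show ?case
          by (cases "f1 u \<le> f2 u") (auto simp: ennreal_minus ennreal_neg)
      qed
    qed
    finally show ?thesis .
  qed
  note tv = this
  show ?thesis
    by (rule that[OF sets_m _ _ _ _ d' tv]) (measurable, simp_all add: f1_def f2_def)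
qed

locale switching =
  fixes n0 :: nat and \<epsilon>0 H C\<nu> Qb :: real
    and a \<sigma> :: "real^'d::finite \<Rightarrow> nat \<Rightarrow> real^'d^'d"
    and b :: "real^'d \<Rightarrow> nat \<Rightarrow> real^'d"
    and \<nu> :: "real^'d \<Rightarrow> nat \<Rightarrow> (real^'d) measure"
    and q :: "real^'d \<Rightarrow> nat \<Rightarrow> nat \<Rightarrow> real"
    and \<rho> :: "real \<Rightarrow> real"
  assumes eps0: "\<epsilon>0 > 0"
    and a_meas: "k \<in> {1..n0} \<Longrightarrow> (\<lambda>x. a x k) \<in> borel_measurable borel"
    and b_meas: "k \<in> {1..n0} \<Longrightarrow> (\<lambda>x. b x k) \<in> borel_measurable borel"
    and sets_nu: "k \<in> {1..n0} \<Longrightarrow> sets (\<nu> x k) = sets borel"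
    and nu_sfin: "k \<in> {1..n0} \<Longrightarrow> sigma_finite_measure (\<nu> x k)"
    and nu_meas: "k \<in> {1..n0} \<Longrightarrow> A \<in> sets borel \<Longrightarrow> (\<lambda>x. emeasure (\<nu> x k) A) \<in> borel_measurable borel"
    and q_meas: "k \<in> {1..n0} \<Longrightarrow> l \<in> {1..n0} \<Longrightarrow> (\<lambda>x. q x k l) \<in> borel_measurable borel"
    and q_nonneg: "k \<in> {1..n0} \<Longrightarrow> l \<in> {1..n0} \<Longrightarrow> k \<noteq> l \<Longrightarrow> q x k l \<ge> 0"
    and q_bound: "k \<in> {1..n0} \<Longrightarrow> l \<in> {1..n0} \<Longrightarrow> \<bar>q x k l\<bar> \<le> Qb"
    and Cnu_nonneg: "0 \<le> C\<nu>"
    and nu_bound: "k \<in> {1..n0} \<Longrightarrow> (\<integral>\<^sup>+y. ennreal (min 1 ((norm y)\<^sup>2)) \<partial>(\<nu> x k)) \<le> ennreal C\<nu>"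
    and H_pos: "H > 0"
    and rho_mono: "mono_on {0..} \<rho>" and rho_concave: "concave_on {0..} \<rho>"
    and rho_nonneg: "r \<ge> 0 \<Longrightarrow> \<rho> r \<ge> 0" and rho_pos: "r > 0 \<Longrightarrow> \<rho> r > 0"
    and sigma: "k \<in> {1..n0} \<Longrightarrow> \<sigma> x k ** transpose (\<sigma> x k) = a x k"
    and F1: "k \<in> {1..n0} \<Longrightarrow> (norm (\<sigma> x k - \<sigma> z k))\<^sup>2 + 2 * ((x - z) \<bullet> (b x k - b z k))
            \<le> H * norm (x - z) * \<rho> (norm (x - z))"
    and F1_jump: "k \<in> {1..n0} \<Longrightarrow>
        tv_nn_integral (\<lambda>u. ennreal (norm u)) (\<nu> x k) (\<nu> z k) \<le> ennreal (H * \<rho> (norm (x - z)))"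
    and F2: "k \<in> {1..n0} \<Longrightarrow> l \<in> {1..n0} \<Longrightarrow> k \<noteq> l \<Longrightarrow> \<bar>q x k l - q z k l\<bar> \<le> H * norm (x - z)"
begin

abbreviation (input) trunc_sq :: "real^'d \<Rightarrow> real" where "trunc_sq u \<equiv> min 1 ((norm u)\<^sup>2)"

lemma trunc_sq_ge: "0 < r \<Longrightarrow> r \<le> norm u \<Longrightarrow> min 1 (r\<^sup>2) \<le> trunc_sq u"
  by (intro min.mono power_mono) auto

lemma nu_space: "k \<in> {1..n0} \<Longrightarrow> space (\<nu> x k) = UNIV"
  using sets_eq_imp_space_eq[OF sets_nu] by simp

lemma nu_measurable: "k \<in> {1..n0} \<Longrightarrow> f \<in> borel_measurable borel \<Longrightarrow> f \<in> borel_measurable (\<nu> x k)"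
  using measurable_cong_sets[OF sets_nu refl] by blast

lemma nu_integrable_trunc_sq:
  assumes k: "k \<in> {1..n0}" shows "integrable (\<nu> x k) trunc_sq" "(\<integral>u. trunc_sq u \<partial>\<nu> x k) \<le> C\<nu>"
proof -
  have m: "(\<lambda>u::real^'d. trunc_sq u) \<in> borel_measurable (\<nu> x k)" by (rule nu_measurable[OF k]) measurable
  show i: "integrable (\<nu> x k) (\<lambda>u. trunc_sq u)"
  proof (rule integrableI_nonneg[OF m])
    show "(\<integral>\<^sup>+u. ennreal (trunc_sq u) \<partial>\<nu> x k) < \<infinity>"
      using nu_bound[OF k, of x] by (rule order.strict_trans1) simp
  qed auto
  have "ennreal (\<integral>u. trunc_sq u \<partial>\<nu> x k) \<le> ennreal C\<nu>"
    using nu_bound[OF k, of x] by (subst nn_integral_eq_integral[symmetric, OF i]) auto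
  then show "(\<integral>u. trunc_sq u \<partial>\<nu> x k) \<le> C\<nu>" using Cnu_nonneg by (simp add: ennreal_le_iff)
qed

lemma nu_integrable:
  fixes f :: "real^'d \<Rightarrow> 'b::{banach, second_countable_topology}"
  assumes k: "k \<in> {1..n0}" and f: "f \<in> borel_measurable borel" and K: "\<And>u. norm (f u) \<le> K * trunc_sq u"
  shows "integrable (\<nu> x k) f" "norm (\<integral>u. f u \<partial>\<nu> x k) \<le> K * C\<nu>"
proof -
  have "0 \<le> K" using K[of "axis undefined 1"] order.trans[OF norm_ge_zero] by simp
  show i: "integrable (\<nu> x k) f"
    by (rule Bochner_Integration.integrable_bound[OF integrable_mult_right[where c=K, OF nu_integrable_trunc_sq(1)[OF k]]])
      (use K \<open>0 \<le> K\<close> f nu_measurable[OF k] in \<open>auto intro!: AE_I2 simp: abs_mult\<close>)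
  have "norm (\<integral>u. f u \<partial>\<nu> x k) \<le> (\<integral>u. norm (f u) \<partial>\<nu> x k)" by (rule integral_norm_bound)
  also have "\<dots> \<le> (\<integral>u. K * trunc_sq u \<partial>\<nu> x k)"
    by (intro integral_mono integrable_norm i integrable_mult_right nu_integrable_trunc_sq(1)[OF k] K)
  also have "\<dots> = K * (\<integral>u. trunc_sq u \<partial>\<nu> x k)" by simp
  also have "\<dots> \<le> K * C\<nu>" by (intro mult_left_mono nu_integrable_trunc_sq(2)[OF k] \<open>0 \<le> K\<close>)
  finally show "norm (\<integral>u. f u \<partial>\<nu> x k) \<le> K * C\<nu>" .
qed

lemma nu_densities:
  assumes k: "k \<in> {1..n0}"
  obtains m f1 f2 where "sets m = sets borel" "f1 \<in> borel_measurable borel" "f2 \<in> borel_measurable borel"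
    "\<And>u. 0 \<le> f1 u" "\<And>u. 0 \<le> f2 u"
    "\<nu> x k = density m (\<lambda>u. ennreal (f1 u))" "\<nu> z k = density m (\<lambda>u. ennreal (f2 u))"
    "integrable m (\<lambda>u. norm u * \<bar>f1 u - f2 u\<bar>)"
    "(\<integral>u. norm u * \<bar>f1 u - f2 u\<bar> \<partial>m) \<le> H * \<rho> (norm (x - z))"
proof -
  obtain m f1 f2 where m: "sets m = sets (\<nu> x k)" "f1 \<in> borel_measurable m" "f2 \<in> borel_measurable m"
    "\<And>u. 0 \<le> f1 u" "\<And>u. 0 \<le> f2 u"
    "\<nu> x k = density m (\<lambda>u. ennreal (f1 u))" "\<nu> z k = density m (\<lambda>u. ennreal (f2 u))"
    "\<And>g. tv_nn_integral g (\<nu> x k) (\<nu> z k) = (\<integral>\<^sup>+u. g u * ennreal \<bar>f1 u - f2 u\<bar> \<partial>m)"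
    by (rule tv_nn_integral_densities[OF nu_sfin[OF k, of x] nu_sfin[OF k, of z]])
      (simp only: sets_nu[OF k], blast)
  have sm: "sets m = sets borel" using m(1) sets_nu[OF k] by simp
  have [measurable]: "f1 \<in> borel_measurable borel" "f2 \<in> borel_measurable borel"
    using m(2,3) measurable_cong_sets[OF sm refl] by blast+
  have le: "(\<integral>\<^sup>+u. ennreal (norm u * \<bar>f1 u - f2 u\<bar>) \<partial>m) \<le> ennreal (H * \<rho> (norm (x - z)))"
    using F1_jump[OF k, of x z] m(8)[of "\<lambda>u. ennreal (norm u)"] by (simp add: ennreal_mult)
  have mm: "(\<lambda>u. norm u * \<bar>f1 u - f2 u\<bar>) \<in> borel_measurable m"
    by (subst measurable_cong_sets[OF sm refl]) measurable
  have i: "integrable m (\<lambda>u. norm u * \<bar>f1 u - f2 u\<bar>)"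
    by (rule integrableI_nonneg[OF mm]) (use order.strict_trans1[OF le] in auto)
  have "0 \<le> H * \<rho> (norm (x - z))" using H_pos rho_nonneg by simp
  then have le': "(\<integral>u. norm u * \<bar>f1 u - f2 u\<bar> \<partial>m) \<le> H * \<rho> (norm (x - z))"
    using le nn_integral_eq_integral[OF i] by (simp add: ennreal_le_iff)
  show ?thesis by (rule that[OF sm _ _ m(4-7) i le']) measurable
qed

text \<open>The jump condition of F1 in usable form: with common densities the difference of the
  integrals is an integral of \<open>(f1 - f2) g\<close>, and the growth bound on \<open>g\<close>
  matches the weight \<open>norm u\<close> in the assumed total variation bound.\<close>

lemma nu_integral_diff:
  fixes g :: "real^'d \<Rightarrow> 'b::{banach, second_countable_topology}"
  assumes k: "k \<in> {1..n0}" and g: "g \<in> borel_measurable borel"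
    and i: "integrable (\<nu> x k) g" "integrable (\<nu> z k) g"
    and K: "\<And>u. norm (g u) \<le> K * norm u" "0 \<le> K"
  shows "norm ((\<integral>u. g u \<partial>\<nu> x k) - (\<integral>u. g u \<partial>\<nu> z k)) \<le> K * (H * \<rho> (norm (x - z)))"
proof -
  obtain m f1 f2 where m: "sets m = sets borel" "f1 \<in> borel_measurable borel" "f2 \<in> borel_measurable borel"
    "\<And>u. 0 \<le> f1 u" "\<And>u. 0 \<le> f2 u"
    "\<nu> x k = density m (\<lambda>u. ennreal (f1 u))" "\<nu> z k = density m (\<lambda>u. ennreal (f2 u))"
    "integrable m (\<lambda>u. norm u * \<bar>f1 u - f2 u\<bar>)"
    "(\<integral>u. norm u * \<bar>f1 u - f2 u\<bar> \<partial>m) \<le> H * \<rho> (norm (x - z))"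
    by (rule nu_densities[OF k, of x z]) (rule that)
  have M: "g \<in> borel_measurable m" "f1 \<in> borel_measurable m" "f2 \<in> borel_measurable m"
    using g m(2,3) by (simp_all add: measurable_cong_sets[OF m(1) refl])
  have nn: "AE u in m. 0 \<le> f1 u" "AE u in m. 0 \<le> f2 u" using m(4,5) by auto
  have i': "integrable m (\<lambda>u. f1 u *\<^sub>R g u)" "integrable m (\<lambda>u. f2 u *\<^sub>R g u)"
    using i unfolding m(6,7) integrable_density[OF M(1,2) nn(1)] integrable_density[OF M(1,3) nn(2)] .
  have "(\<integral>u. g u \<partial>\<nu> x k) - (\<integral>u. g u \<partial>\<nu> z k) = (\<integral>u. f1 u *\<^sub>R g u \<partial>m) - (\<integral>u. f2 u *\<^sub>R g u \<partial>m)"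
    unfolding m(6,7) integral_density[OF M(1,2) nn(1)] integral_density[OF M(1,3) nn(2)] ..
  also have "\<dots> = (\<integral>u. (f1 u - f2 u) *\<^sub>R g u \<partial>m)"
    using i' by (simp add: scaleR_diff_left)
  also have "norm \<dots> \<le> (\<integral>u. norm ((f1 u - f2 u) *\<^sub>R g u) \<partial>m)" by (rule integral_norm_bound)
  also have "\<dots> \<le> (\<integral>u. K * (norm u * \<bar>f1 u - f2 u\<bar>) \<partial>m)"
  proof (rule integral_mono)
    show "integrable m (\<lambda>u. norm ((f1 u - f2 u) *\<^sub>R g u))"
      using i' by (intro integrable_norm) (simp add: scaleR_diff_left)
    show "norm ((f1 u - f2 u) *\<^sub>R g u) \<le> K * (norm u * \<bar>f1 u - f2 u\<bar>)" for u
      using mult_right_mono[OF K(1)[of u], of "\<bar>f1 u - f2 u\<bar>"] by (simp add: mult_ac)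
  qed (use m in simp)
  also have "\<dots> \<le> K * (H * \<rho> (norm (x - z)))" using m(9) K(2) by (simp add: mult_left_mono)
  finally show ?thesis .
qed

lemma borel_measurable_nu_nn_integral:
  assumes k: "k \<in> {1..n0}" and g: "g \<in> borel_measurable borel"
  shows "(\<lambda>x. \<integral>\<^sup>+u. g u \<partial>\<nu> x k) \<in> borel_measurable borel"
  using g
proof (induction rule: borel_measurable_induct)
  case (cong f g)
  then show ?case by (simp add: fun_eq_iff)
next
  case (set A)
  then show ?case using nu_meas[OF k] sets_nu[OF k] by simp
next
  case (mult u c)
  then have "(\<integral>\<^sup>+v. c * u v \<partial>\<nu> x k) = c * (\<integral>\<^sup>+v. u v \<partial>\<nu> x k)" for x
    using nu_measurable[OF k mult(2)] by (intro nn_integral_cmult) auto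
  then show ?case using mult by simp
next
  case (add u v)
  then have "(\<integral>\<^sup>+w. v w + u w \<partial>\<nu> x k) = (\<integral>\<^sup>+w. v w \<partial>\<nu> x k) + (\<integral>\<^sup>+w. u w \<partial>\<nu> x k)" for x
    using nu_measurable[OF k add(1)] nu_measurable[OF k add(3)] by (intro nn_integral_add) auto
  then show ?case using add by simp
next
  case (seq U)
  have "(\<integral>\<^sup>+u. (SUP i. U i) u \<partial>\<nu> x k) = (SUP i. \<integral>\<^sup>+u. U i u \<partial>\<nu> x k)" for x
    unfolding SUP_apply using seq nu_measurable[OF k seq(1)] by (intro nn_integral_monotone_convergence_SUP) auto
  then show ?case using seq by simp
qed

text \<open>The measures \<open>\<nu> x k\<close> may be infinite near 0. Weighting them by
  \<open>trunc_sq / (C\<nu> + 1)\<close> yields a measurable subprobability kernel, and the weight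
  is divided out of \<open>F\<close> again.\<close>

lemma borel_measurable_nu_integral:
  fixes F :: "real^'d \<Rightarrow> real^'d \<Rightarrow> real"
  assumes k: "k \<in> {1..n0}" and F: "(\<lambda>(x, u). F x u) \<in> borel_measurable (borel \<Otimes>\<^sub>M borel)"
    and K: "\<And>x u. \<bar>F x u\<bar> \<le> K * trunc_sq u"
  shows "(\<lambda>x. \<integral>u. F x u \<partial>\<nu> x k) \<in> borel_measurable borel"
proof -
  define w where "w = (\<lambda>u::real^'d. trunc_sq u / (C\<nu> + 1))"
  define \<kappa> where "\<kappa> = (\<lambda>x. density (\<nu> x k) (\<lambda>u. ennreal (w u)))"
  have w: "w \<in> borel_measurable borel" "\<And>u. 0 \<le> w u" using Cnu_nonneg by (auto simp: w_def)
  have [measurable]: "w \<in> borel_measurable (\<nu> x k)" for x using nu_measurable[OF k w(1)] .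
  have kernel: "\<kappa> \<in> borel \<rightarrow>\<^sub>M subprob_algebra borel"
  proof (rule measurable_subprob_algebra)
    fix x
    show s: "sets (\<kappa> x) = sets borel" by (simp add: \<kappa>_def sets_nu[OF k])
    have "emeasure (\<kappa> x) (space (\<kappa> x)) = (\<integral>\<^sup>+u. ennreal (w u) \<partial>\<nu> x k)"
      unfolding \<kappa>_def by (subst emeasure_density) (auto intro!: nn_integral_cong simp: nu_space[OF k] sets_nu[OF k])
    also have "\<dots> = (\<integral>\<^sup>+u. ennreal (trunc_sq u) * ennreal (1 / (C\<nu> + 1)) \<partial>\<nu> x k)"
      using Cnu_nonneg by (intro nn_integral_cong) (simp add: w_def ennreal_mult'[symmetric])
    also have "\<dots> = (\<integral>\<^sup>+u. ennreal (trunc_sq u) \<partial>\<nu> x k) * ennreal (1 / (C\<nu> + 1))"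
      by (rule nn_integral_multc) (rule nu_measurable[OF k], measurable)
    also have "\<dots> \<le> ennreal C\<nu> * ennreal (1 / (C\<nu> + 1))" by (intro mult_right_mono nu_bound[OF k]) auto
    also have "\<dots> \<le> 1" using Cnu_nonneg by (simp add: ennreal_mult'[symmetric] ennreal_le_1)
    finally show "subprob_space (\<kappa> x)"
      by (intro subprob_spaceI) (auto simp: \<kappa>_def nu_space[OF k])
  next
    fix A :: "(real^'d) set" assume A[measurable]: "A \<in> sets borel"
    have "emeasure (\<kappa> x) A = (\<integral>\<^sup>+u. ennreal (w u) * indicator A u \<partial>\<nu> x k)" for x
      unfolding \<kappa>_def by (rule emeasure_density) (auto simp: sets_nu[OF k])
    then show "(\<lambda>x. emeasure (\<kappa> x) A) \<in> borel_measurable borel"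
      using w by (simp add: borel_measurable_nu_nn_integral[OF k])
  qed
  define F' where "F' = (\<lambda>x u. F x u / w u)"
  note [measurable] = F w(1)
  have F'm: "(\<lambda>(x, u). F' x u) \<in> borel_measurable (borel \<Otimes>\<^sub>M borel)"
    unfolding F'_def case_prod_beta by measurable
  have F'm2: "F' x \<in> borel_measurable borel" for x
    using measurable_compose_Pair1[OF _ F'm, of x] by simp
  \<comment> \<open>At \<open>u = 0\<close> the weight vanishes and the quotient is 0 by convention,
    but there the bound by \<open>trunc_sq\<close> forces \<open>F x 0 = 0\<close>.\<close>
  have eq: "w u * F' x u = F x u" for x u
    using K[of x u] Cnu_nonneg by (cases "u = 0") (auto simp: F'_def w_def min_def add_nonneg_eq_0_iff)
  have int: "integrable (\<nu> x k) (F x)" for x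
    by (rule nu_integrable(1)[OF k, of _ K]) (use K measurable_compose_Pair1[OF _ F, of x] in auto)
  have "(\<integral>u. F x u \<partial>\<nu> x k) = (\<integral>u. F' x u \<partial>\<kappa> x)" for x
    unfolding \<kappa>_def by (subst integral_density) (use nu_measurable[OF k F'm2] w(2) eq in auto)
  moreover have "(\<integral>u. F' x u \<partial>\<kappa> x) = enn2real (\<integral>\<^sup>+u. ennreal (F' x u) \<partial>\<kappa> x) - enn2real (\<integral>\<^sup>+u. ennreal (- F' x u) \<partial>\<kappa> x)" for x
  proof (rule real_lebesgue_integral_def)
    show "integrable (\<kappa> x) (F' x)"
      unfolding \<kappa>_def by (subst integrable_density) (use nu_measurable[OF k F'm2] w(2) eq int in auto)
  qed
  moreover have "(\<lambda>x. \<integral>\<^sup>+u. ennreal (F' x u) \<partial>\<kappa> x) \<in> borel_measurable borel"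
    "(\<lambda>x. \<integral>\<^sup>+u. ennreal (- F' x u) \<partial>\<kappa> x) \<in> borel_measurable borel"
    by (rule nn_integral_measurable_subprob_algebra2[OF _ kernel]; use F'm in \<open>simp add: case_prod_beta\<close>)+
  ultimately show ?thesis by simp
qed

end

section \<open>Derivatives off the support; the second-order term as a sum over columns\<close>

lemma iter_partial_eq_0:
  assumes "\<And>x. x \<notin> cball 0 R \<Longrightarrow> g x = 0" "x \<notin> cball 0 R"
  shows "iter_partial is g x = 0"
  using assms(2)
proof (induction "is" arbitrary: x)
  case (Cons i "is")
  have "open (- cball 0 R :: (real^'a) set)" by (intro open_Compl closed_cball)
  moreover have "((\<lambda>t. x + t *\<^sub>R axis i 1) \<longlongrightarrow> x + 0 *\<^sub>R axis i 1) (nhds (0::real))"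
    by (intro tendsto_intros filterlim_ident)
  ultimately have "\<forall>\<^sub>F t in nhds (0::real). x + t *\<^sub>R axis i 1 \<in> - cball 0 R"
    using Cons.prems by (auto dest!: topological_tendstoD)
  then have "\<forall>\<^sub>F t in nhds (0::real). iter_partial is g (x + t *\<^sub>R axis i 1) = 0"
    by (rule eventually_mono) (use Cons.IH in auto)
  then have "deriv (\<lambda>t. iter_partial is g (x + t *\<^sub>R axis i 1)) 0 = deriv (\<lambda>t. 0) 0"
    by (rule deriv_cong_ev) simp
  then show ?case by (simp add: partial_dir_def)
qed (use assms(1) in simp)

lemma grad_inner: "grad g x \<bullet> u = (\<Sum>i\<in>UNIV. u $ i * iter_partial [i] g x)"
  by (simp add: inner_vec_def grad_def mult.commute)

text \<open>A sum of second derivatives in the directions of the columns of the root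
  \<open>s\<close>. The central differences of the scheme along these columns approximate it term by
  term.\<close>

lemma trace_mult_hess:
  "trace ((s ** transpose s) ** hess g x) =
    (\<Sum>j\<in>UNIV. \<Sum>i\<in>UNIV. column j s $ i * (\<Sum>l\<in>UNIV. column j s $ l * iter_partial [l, i] g x))"
proof -
  have "trace ((s ** transpose s) ** hess g x)
    = (\<Sum>i\<in>UNIV. \<Sum>l\<in>UNIV. \<Sum>j\<in>UNIV. s $ i $ j * s $ l $ j * iter_partial [l, i] g x)"
    by (simp add: trace_def matrix_matrix_mult_def transpose_def hess_def sum_distrib_right)
  also have "\<dots> = (\<Sum>i\<in>UNIV. \<Sum>j\<in>UNIV. \<Sum>l\<in>UNIV. s $ i $ j * s $ l $ j * iter_partial [l, i] g x)"
    by (intro sum.cong refl sum.swap)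
  also have "\<dots> = (\<Sum>j\<in>UNIV. \<Sum>i\<in>UNIV. \<Sum>l\<in>UNIV. s $ i $ j * s $ l $ j * iter_partial [l, i] g x)"
    by (rule sum.swap)
  finally show ?thesis by (simp add: column_def sum_distrib_left mult.assoc)
qed

lemma norm_column_le: "norm (column j (s :: real^'n::finite^'m::finite)) \<le> norm s"
proof -
  have "(norm (column j s))\<^sup>2 \<le> (norm s)\<^sup>2"
    unfolding norm_vec_def L2_set_def column_def
    by (simp add: sum_nonneg) (intro sum_mono member_le_sum, auto)
  then show ?thesis by (simp add: power2_le_iff_abs_le)
qed

lemma sum_norm_column: "(\<Sum>j\<in>UNIV. (norm (column j (s :: real^'n::finite^'m::finite)))\<^sup>2) = (norm s)\<^sup>2"
  unfolding norm_vec_def L2_set_def column_def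
  by (simp add: sum_nonneg) (rule sum.swap)

section \<open>Concavity of \<rho> and growth of the coefficients\<close>

context switching begin

text \<open>Concavity together with \<open>\<rho> 0 \<ge> 0\<close> makes the quotient
  \<open>\<rho> r / r\<close> nonincreasing.\<close>

lemma rho_slope: "0 < r \<Longrightarrow> r \<le> s \<Longrightarrow> \<rho> s \<le> (s / r) * \<rho> r"
proof -
  assume r: "0 < r" "r \<le> s"
  have "convex_on {0..} (\<lambda>x. - \<rho> x)" using rho_concave by (simp add: concave_on_def)
  from convex_onD[OF this, of "r / s" 0 s] r
  have "- \<rho> r \<le> (1 - r / s) * - \<rho> 0 + (r / s) * - \<rho> s" by simp
  moreover have "(1 - r / s) * - \<rho> 0 \<le> 0" using r rho_nonneg[of 0] by (simp add: mult_le_0_iff divide_le_eq)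
  ultimately have "(r / s) * \<rho> s \<le> \<rho> r" by linarith
  then show ?thesis using r by (simp add: field_simps)
qed

lemma rho_le: "0 \<le> r \<Longrightarrow> r \<le> s \<Longrightarrow> \<rho> r \<le> \<rho> s"
  using rho_mono by (auto simp: mono_on_def)

lemma rho_linear: "0 \<le> r \<Longrightarrow> \<rho> r \<le> \<rho> 1 * (1 + r)"
proof (cases "r \<le> 1")
  case True
  assume "0 \<le> r"
  then have "\<rho> r \<le> \<rho> 1" using rho_le True by simp
  also have "\<dots> \<le> \<rho> 1 * (1 + r)" using rho_nonneg[of 1] \<open>0 \<le> r\<close> by (simp add: mult_le_cancel_left1)
  finally show ?thesis .
next
  case False
  then have "\<rho> r \<le> (r / 1) * \<rho> 1" by (intro rho_slope) auto
  then show ?thesis using rho_nonneg[of 1] by (simp add: algebra_simps)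
qed

text \<open>The slope is the right derivative. Monotonicity gives its sign, and the tangent line
  evaluated at 0 lies above \<open>\<rho> 0 \<ge> 0\<close>, which gives the bound by
  \<open>\<rho> s / s\<close>. This bound later keeps the slopes accumulated over all time steps
  finite.\<close>

lemma rho_supergradient:
  assumes s: "0 < s"
  obtains p where "0 \<le> p" "p \<le> \<rho> s / s" "\<And>r. 0 \<le> r \<Longrightarrow> \<rho> r \<le> \<rho> s + p * (r - s)"
proof -
  have conv: "convex_on {0..} (\<lambda>x. - \<rho> x)" using rho_concave by (simp add: concave_on_def)
  define p where "p = - Inf ((\<lambda>t. (- \<rho> s - - \<rho> t) / (s - t)) ` ({s<..} \<inter> {0..}))"
  have le: "\<rho> r \<le> \<rho> s + p * (r - s)" if "0 \<le> r" for r
    using convex_le_Inf_differential[OF conv, of s r] s that by (simp add: p_def)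
  have "0 \<le> p" using le[of "s + 1"] rho_le[of s "s + 1"] s by simp
  moreover have "p \<le> \<rho> s / s" using le[of 0] rho_nonneg[of 0] s by (simp add: field_simps)
  ultimately show ?thesis using that le by blast
qed

text \<open>F1 bounds \<open>(x - e) \<bullet> (b x k - b e k)\<close> from above for any reference
  point \<open>e\<close>. The \<open>2 d\<close> reference points \<open>c e_i\<close> and
  \<open>- c e_i\<close> turn this into a bound for the modulus of each coordinate of
  \<open>b x k\<close>, up to a term \<open>R * norm (b x k)\<close>.\<close>

lemma b_bounded_one:
  assumes k: "k \<in> {1..n0}" and R: "0 < R"
  shows "\<exists>B. \<forall>x. norm x \<le> R \<longrightarrow> norm (b x k) \<le> B"
proof -
  define d where "d = real CARD('d)"
  have d: "d \<ge> 1" by (simp add: d_def Suc_le_eq)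
  \<comment> \<open>Summing the coordinate bounds produces \<open>d R * norm (b x k)\<close>; for
    this \<open>c\<close> that is half of the left-hand side and can be absorbed.\<close>
  define c where "c = 2 * d * R"
  have c: "c > 0" using d R by (simp add: c_def)
  define e where "e = (\<lambda>(i::'d, s::bool). (if s then c else - c) *\<^sub>R axis i (1::real))"
  have "\<exists>B0\<ge>0. \<forall>p (x::unit). \<bar>norm (b (e p) k)\<bar> \<le> B0" by (rule finite_bounds) auto
  then obtain B0 where B0: "0 \<le> B0" "\<And>p. norm (b (e p) k) \<le> B0" by auto
  define K where "K = (R + c) * B0 + H / 2 * (R + c) * \<rho> (R + c)"
  have "norm (b x k) \<le> 2 * d * K / c" if x: "norm x \<le> R" for x
  proof -
    have 1: "(x - e p) \<bullet> b x k \<le> K" for p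
    proof -
      have n: "norm (x - e p) \<le> R + c"
        using norm_triangle_ineq4[of x "e p"] x c by (auto simp: e_def split: prod.splits)
      have "2 * ((x - e p) \<bullet> (b x k - b (e p) k)) \<le> H * norm (x - e p) * \<rho> (norm (x - e p))"
        using F1[OF k, of x "e p"] zero_le_power2[of "norm (\<sigma> x k - \<sigma> (e p) k)"] by linarith
      also have "\<dots> \<le> H * (R + c) * \<rho> (R + c)"
        using n H_pos rho_nonneg R c by (intro mult_mono rho_le) auto
      finally have "(x - e p) \<bullet> b x k \<le> (x - e p) \<bullet> b (e p) k + H / 2 * (R + c) * \<rho> (R + c)"
        by (simp add: inner_diff_right)
      moreover have "(x - e p) \<bullet> b (e p) k \<le> norm (x - e p) * norm (b (e p) k)" by (rule norm_cauchy_schwarz)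
      moreover have "norm (x - e p) * norm (b (e p) k) \<le> (R + c) * B0"
        using n B0 by (intro mult_mono) (auto intro: order.trans[OF norm_ge_zero])
      ultimately show ?thesis by (simp add: K_def)
    qed
    have xb: "- (x \<bullet> b x k) \<le> R * norm (b x k)"
      using norm_cauchy_schwarz[of "- x" "b x k"] mult_right_mono[OF x norm_ge_zero[of "b x k"]] by simp
    have "c * \<bar>b x k $ i\<bar> \<le> K + R * norm (b x k)" for i
      using 1[of "(i, True)"] 1[of "(i, False)"] xb c
      by (auto simp: e_def inner_diff_left inner_add_left inner_axis' abs_if)
    then have "(\<Sum>i\<in>UNIV. c * \<bar>b x k $ i\<bar>) \<le> (\<Sum>i\<in>(UNIV::'d set). K + R * norm (b x k))"
      by (intro sum_mono)
    then have "c * (\<Sum>i\<in>UNIV. \<bar>b x k $ i\<bar>) \<le> d * (K + R * norm (b x k))"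
      by (simp add: sum_distrib_left d_def)
    moreover have "c * norm (b x k) \<le> c * (\<Sum>i\<in>UNIV. \<bar>b x k $ i\<bar>)"
      using c by (intro mult_left_mono norm_le_l1_cart) auto
    ultimately have "c * norm (b x k) \<le> d * K + (c / 2) * norm (b x k)"
      by (simp add: c_def algebra_simps)
    then show ?thesis using c by (simp add: field_simps)
  qed
  then show ?thesis by blast
qed

text \<open>Once \<open>b\<close> is bounded on a ball, F1 against the origin bounds
  \<open>\<sigma>\<close> there. The radius is raised to at least 1 to make it positive.\<close>

lemma coeffs_locally_bounded:
  obtains B where "B \<ge> 0" "\<And>k x. k \<in> {1..n0} \<Longrightarrow> norm x \<le> R \<Longrightarrow> norm (b x k) \<le> B \<and> norm (\<sigma> x k) \<le> B"
proof -
  define R' where "R' = max 1 R"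
  have R': "0 < R'" "R \<le> R'" "1 \<le> R'" by (auto simp: R'_def)
  obtain B where B: "\<And>k x. k \<in> {1..n0} \<Longrightarrow> norm x \<le> R' \<Longrightarrow> norm (b x k) \<le> B k"
    using b_bounded_one[OF _ R'(1)] by metis
  define Bs where "Bs = (\<lambda>k. norm (\<sigma> 0 k) + (1 + H * R' * \<rho> R' + 4 * R' * B k))"
  have s: "norm (\<sigma> x k) \<le> Bs k" if k: "k \<in> {1..n0}" and x: "norm x \<le> R'" for x k
  proof -
    have "(norm (\<sigma> x k - \<sigma> 0 k))\<^sup>2 \<le> H * norm x * \<rho> (norm x) - 2 * (x \<bullet> (b x k - b 0 k))"
      using F1[OF k, of x 0] by simp
    moreover have "H * norm x * \<rho> (norm x) \<le> H * R' * \<rho> R'"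
      using x H_pos rho_nonneg R' by (intro mult_mono rho_le) auto
    moreover have "- (x \<bullet> (b x k - b 0 k)) \<le> R' * (2 * B k)"
    proof -
      have "- (x \<bullet> (b x k - b 0 k)) \<le> norm x * norm (b x k - b 0 k)"
        using norm_cauchy_schwarz[of "- x" "b x k - b 0 k"] by simp
      also have "norm (b x k - b 0 k) \<le> 2 * B k"
        using norm_triangle_ineq4[of "b x k" "b 0 k"] B[OF k x] B[OF k, of 0] R' by simp
      then have "norm x * norm (b x k - b 0 k) \<le> R' * (2 * B k)"
        using x R' by (intro mult_mono) auto
      finally show ?thesis .
    qed
    ultimately have sq: "(norm (\<sigma> x k - \<sigma> 0 k))\<^sup>2 \<le> H * R' * \<rho> R' + 4 * R' * B k" by linarith
    have "norm (\<sigma> x k - \<sigma> 0 k) \<le> 1 + (norm (\<sigma> x k - \<sigma> 0 k))\<^sup>2"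
      using zero_le_power2[of "norm (\<sigma> x k - \<sigma> 0 k) - 1/2"] by (simp add: power2_eq_square algebra_simps)
    then show ?thesis
      using sq norm_triangle_ineq2[of "\<sigma> x k" "\<sigma> 0 k"] by (simp add: Bs_def)
  qed
  define T where "T = (\<Sum>k\<in>{1..n0}. \<bar>B k\<bar> + \<bar>Bs k\<bar>)"
  have "B k \<le> T \<and> Bs k \<le> T" if "k \<in> {1..n0}" for k
    using member_le_sum[OF that, of "\<lambda>k. \<bar>B k\<bar> + \<bar>Bs k\<bar>"] by (auto simp: T_def)
  moreover have "0 \<le> T" unfolding T_def by (intro sum_nonneg) auto
  ultimately show ?thesis
    using that[of T] B s R' by (meson order.trans)
qed

text \<open>F1 is applied to \<open>y\<close> and the unit vector \<open>e\<close> in its direction.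
  As \<open>y - e\<close> is the multiple \<open>1 - 1 / s\<close> of \<open>y\<close>, normalising
  the drift term leaves the squared increment of \<open>\<sigma>\<close> with the factor
  \<open>\<theta> > 1\<close>, and this surplus absorbs the cross term in the square of
  \<open>norm (\<sigma> y k)\<close>.\<close>

lemma coercive_growth:
  obtains Cg where "Cg \<ge> 0"
    "\<And>k y. k \<in> {1..n0} \<Longrightarrow> 2 * (y \<bullet> b y k) + (norm (\<sigma> y k))\<^sup>2 \<le> Cg * (1 + (norm y)\<^sup>2)"
proof -
  obtain B where B: "B \<ge> 0" "\<And>k x. k \<in> {1..n0} \<Longrightarrow> norm x \<le> 2 \<Longrightarrow> norm (b x k) \<le> B \<and> norm (\<sigma> x k) \<le> B"
    using coeffs_locally_bounded[of 2] by blast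
  define Cg where "Cg = 4 * B + B\<^sup>2 + 4 * H * \<rho> 1"
  have nonneg: "Cg \<ge> 0" using B H_pos rho_nonneg[of 1] by (simp add: Cg_def)
  have "2 * (y \<bullet> b y k) + (norm (\<sigma> y k))\<^sup>2 \<le> Cg * (1 + (norm y)\<^sup>2)" if k: "k \<in> {1..n0}" for k y
  proof (cases "norm y \<le> 2")
    case True
    have "y \<bullet> b y k \<le> norm y * norm (b y k)" by (rule norm_cauchy_schwarz)
    also have "\<dots> \<le> 2 * B" using True B(2)[OF k True] by (intro mult_mono) auto
    finally have "2 * (y \<bullet> b y k) \<le> 4 * B" by simp
    moreover have "(norm (\<sigma> y k))\<^sup>2 \<le> B\<^sup>2" using B(2)[OF k True] by (intro power_mono) auto
    moreover have "4 * B + B\<^sup>2 \<le> Cg" using H_pos rho_nonneg[of 1] by (simp add: Cg_def)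
    moreover have "Cg * 1 \<le> Cg * (1 + (norm y)\<^sup>2)" using nonneg by (intro mult_left_mono) auto
    ultimately show ?thesis by linarith
  next
    case False
    define s where "s = norm y"
    define e where "e = (1 / s) *\<^sub>R y"
    have s: "s > 2" using False by (simp add: s_def)
    have ne: "norm e = 1" using s by (simp add: e_def s_def[symmetric])
    note Be = B(2)[OF k, of e, unfolded ne]
    have ye: "y - e = (1 - 1 / s) *\<^sub>R y" by (simp add: e_def algebra_simps)
    have nye: "norm (y - e) = s - 1"
      unfolding ye norm_scaleR using s by (simp add: s_def[symmetric] field_simps)
    define m where "m = norm (\<sigma> y k - \<sigma> e k)"
    define \<theta> where "\<theta> = s / (s - 1)"
    have \<theta>: "\<theta> \<ge> 0" "\<theta> \<le> 2" "\<theta> * (1 - 1 / s) = 1" using s by (auto simp: \<theta>_def field_simps)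
    have "m\<^sup>2 + 2 * ((1 - 1 / s) * (y \<bullet> (b y k - b e k))) \<le> H * (s - 1) * \<rho> (s - 1)"
      using F1[OF k, of y e] unfolding nye unfolding m_def ye by simp
    also have "\<dots> \<le> H * s * (\<rho> 1 * (1 + s))"
      using s H_pos rho_nonneg[of "s - 1"] rho_nonneg[of 1] rho_linear[of "s - 1"]
      by (intro mult_mono order.trans[OF rho_linear[of "s - 1"]]) auto
    finally have X: "m\<^sup>2 + 2 * ((1 - 1 / s) * (y \<bullet> (b y k - b e k))) \<le> H * s * (\<rho> 1 * (1 + s))" (is "?L \<le> ?Y") .
    have "?Y \<ge> 0" using s H_pos rho_nonneg[of 1] by simp
    have "\<theta> * ?L = \<theta> * m\<^sup>2 + 2 * (\<theta> * (1 - 1 / s)) * (y \<bullet> (b y k - b e k))" by (simp add: algebra_simps)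
    then have "\<theta> * m\<^sup>2 + 2 * (y \<bullet> (b y k - b e k)) = \<theta> * ?L" using \<theta>(3) by simp
    also have "\<dots> \<le> \<theta> * ?Y" using X \<theta>(1) by (rule mult_left_mono)
    also have "\<dots> \<le> 2 * ?Y" using \<theta>(2) \<open>?Y \<ge> 0\<close> by (rule mult_right_mono)
    finally have 1: "\<theta> * m\<^sup>2 + 2 * (y \<bullet> b y k) \<le> 2 * ?Y + 2 * (y \<bullet> b e k)" by (simp add: inner_diff_right)
    have "y \<bullet> b e k \<le> norm y * norm (b e k)" by (rule norm_cauchy_schwarz)
    also have "\<dots> \<le> s * B" using Be s by (intro mult_mono) (auto simp: s_def)
    finally have 2: "y \<bullet> b e k \<le> s * B" .
    have "norm (\<sigma> y k) \<le> m + B"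
      using norm_triangle_ineq2[of "\<sigma> y k" "\<sigma> e k"] Be by (simp add: m_def)
    then have "(norm (\<sigma> y k))\<^sup>2 \<le> (m + B)\<^sup>2" by (intro power_mono) auto
    \<comment> \<open>Young's inequality: \<open>\<theta> = s / (s - 1)\<close> and \<open>s\<close>
      are conjugate exponents.\<close>
    also have "\<dots> \<le> \<theta> * m\<^sup>2 + s * B\<^sup>2"
    proof -
      have "0 \<le> (m - (s - 1) * B)\<^sup>2 / (s - 1)" using s by simp
      also have "\<dots> = \<theta> * m\<^sup>2 + s * B\<^sup>2 - (m + B)\<^sup>2"
        using s by (simp add: \<theta>_def field_simps power2_eq_square)
      finally show ?thesis by simp
    qed
    finally have 3: "2 * (y \<bullet> b y k) + (norm (\<sigma> y k))\<^sup>2 \<le> 2 * ?Y + 2 * (s * B) + s * B\<^sup>2"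
      using 1 2 by linarith
    have s1: "s \<le> 1 + s\<^sup>2" "s * (1 + s) \<le> 2 * (1 + s\<^sup>2)"
      using s zero_le_power2[of "s - 1"] by (simp_all add: power2_eq_square algebra_simps)
    have "2 * ?Y = 2 * (H * \<rho> 1) * (s * (1 + s))" by (simp add: mult_ac)
    also have "\<dots> \<le> 2 * (H * \<rho> 1) * (2 * (1 + s\<^sup>2))"
      using s1 H_pos rho_nonneg[of 1] by (intro mult_left_mono) auto
    finally have "2 * ?Y \<le> 4 * H * \<rho> 1 * (1 + s\<^sup>2)" by (simp add: algebra_simps)
    moreover have "2 * (s * B) \<le> 4 * ((1 + s\<^sup>2) * B)"
    proof -
      have "0 \<le> (1 + s\<^sup>2) * B" using B(1) by simp
      with mult_right_mono[OF s1(1) B(1)] show ?thesis by linarith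
    qed
    then have "2 * (s * B) \<le> 4 * B * (1 + s\<^sup>2)" by (simp add: mult_ac)
    moreover have "s * B\<^sup>2 \<le> B\<^sup>2 * (1 + s\<^sup>2)" using mult_right_mono[OF s1(1), of "B\<^sup>2"] by (simp add: algebra_simps)
    ultimately show ?thesis using 3 by (simp add: Cg_def s_def algebra_simps)
  qed
  then show ?thesis using that nonneg by blast
qed

end

section \<open>Boundedness and measurability of the generator\<close>

lemma borel_measurable_pair_countable:
  fixes h :: "'c::{countable, t2_space, second_countable_topology} \<Rightarrow> 'a::second_countable_topology \<Rightarrow> 'b::topological_space"
  assumes "\<And>k. h k \<in> borel_measurable borel"
  shows "(\<lambda>(x, k). h k x) \<in> borel_measurable borel"
proof -
  have fst: "fst \<in> borel_measurable (borel :: ('a \<times> 'c) measure)"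
    by (intro borel_measurable_continuous_onI continuous_on_fst continuous_on_id)
  have snd: "snd \<in> borel_measurable (borel :: ('a \<times> 'c) measure)"
    by (intro borel_measurable_continuous_onI continuous_on_snd continuous_on_id)
  have "sets (borel :: 'c measure) = sets (count_space UNIV)" by (simp add: sets_borel_eq_count_space)
  from measurable_cong_sets[OF refl this] snd have "snd \<in> (borel :: ('a \<times> 'c) measure) \<rightarrow>\<^sub>M count_space UNIV"
    by blast
  then have "(\<lambda>p. h (snd p) (fst p)) \<in> borel_measurable borel"
    by (rule measurable_compose_countable[where f="\<lambda>k p. h k (fst p)", rotated])
      (rule measurable_compose[OF fst assms])
  then show ?thesis by (simp add: case_prod_beta)
qed

lemma vec_nth_measurable: "(\<lambda>x :: real^'n. x $ i) \<in> borel_measurable borel"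
  by (intro borel_measurable_continuous_onI continuous_on_component continuous_on_id)

section \<open>Compensator, small jumps and bounds for the generator\<close>

context switching begin

text \<open>If only jumps of size at least \<open>r\<close> are kept, the compensating gradient term
  over the jumps between \<open>r\<close> and \<open>\<epsilon>0\<close> turns into this correction
  of the drift.\<close>

definition compensator :: "real \<Rightarrow> real^'d \<Rightarrow> nat \<Rightarrow> real^'d" where
  "compensator r y k = (\<integral>u. indicator {u. r \<le> norm u \<and> norm u < \<epsilon>0} u *\<^sub>R u \<partial>\<nu> y k)"

lemma compensator_integrable:
  assumes k: "k \<in> {1..n0}" and r: "0 < r"
  shows "integrable (\<nu> y k) (\<lambda>u. indicator {u. r \<le> norm u \<and> norm u < \<epsilon>0} u *\<^sub>R u)"
    and "norm (compensator r y k) \<le> \<epsilon>0 / min 1 (r\<^sup>2) * C\<nu>"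
proof -
  have m: "(\<lambda>u::real^'d. indicator {u. r \<le> norm u \<and> norm u < \<epsilon>0} u *\<^sub>R u) \<in> borel_measurable borel"
    by measurable
  have "norm (indicator {u. r \<le> norm u \<and> norm u < \<epsilon>0} u *\<^sub>R u) \<le> \<epsilon>0 / min 1 (r\<^sup>2) * trunc_sq u" for u :: "real^'d"
  proof (cases "r \<le> norm u \<and> norm u < \<epsilon>0")
    case True
    have "min 1 (r\<^sup>2) > 0" using r by simp
    then have "\<epsilon>0 = \<epsilon>0 / min 1 (r\<^sup>2) * min 1 (r\<^sup>2)" by (metis less_irrefl nonzero_eq_divide_eq)
    also have "\<dots> \<le> \<epsilon>0 / min 1 (r\<^sup>2) * trunc_sq u"
      using trunc_sq_ge[OF r] True eps0 r by (intro mult_left_mono) auto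
    finally show ?thesis using True by simp
  qed (use eps0 in simp)
  from nu_integrable[OF k m this]
  show "integrable (\<nu> y k) (\<lambda>u. indicator {u. r \<le> norm u \<and> norm u < \<epsilon>0} u *\<^sub>R u)"
    "norm (compensator r y k) \<le> \<epsilon>0 / min 1 (r\<^sup>2) * C\<nu>" unfolding compensator_def .
qed

lemma compensator_diff:
  assumes k: "k \<in> {1..n0}" and r: "0 < r"
  shows "norm (compensator r y k - compensator r z k) \<le> H * \<rho> (norm (y - z))"
  unfolding compensator_def
  using nu_integral_diff[OF k _ compensator_integrable(1)[OF k r, of y] compensator_integrable(1)[OF k r, of z], of 1]
  by (simp add: indicator_def)

definition small_jumps :: "real \<Rightarrow> real^'d \<Rightarrow> nat \<Rightarrow> real" where
  "small_jumps r x k = (\<integral>u. indicator {u. norm u < r} u * (norm u)\<^sup>2 \<partial>\<nu> x k)"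

lemma small_jumps_integrable:
  assumes k: "k \<in> {1..n0}" and r: "0 < r"
  shows "integrable (\<nu> x k) (\<lambda>u. indicator {u. norm u < r} u * (norm u)\<^sup>2)"
    and "\<bar>small_jumps r x k\<bar> \<le> max 1 (r\<^sup>2) * C\<nu>"
proof -
  have "norm (indicator {u. norm u < r} u * (norm u)\<^sup>2) \<le> max 1 (r\<^sup>2) * trunc_sq u" for u :: "real^'d"
  proof -
    have "(norm u)\<^sup>2 \<le> r\<^sup>2" if "norm u < r" using that by (intro power_mono) auto
    moreover have "1 * (norm u)\<^sup>2 \<le> max 1 (r\<^sup>2) * (norm u)\<^sup>2" by (intro mult_right_mono) auto
    ultimately show ?thesis by (auto simp: indicator_def min_def)
  qed
  from nu_integrable[OF k _ this]
  show "integrable (\<nu> x k) (\<lambda>u. indicator {u. norm u < r} u * (norm u)\<^sup>2)"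
    "\<bar>small_jumps r x k\<bar> \<le> max 1 (r\<^sup>2) * C\<nu>" unfolding small_jumps_def by auto
qed

text \<open>On \<open>norm u < r\<close> the integrand is at most \<open>r * norm u\<close>, so the
  jump condition of F1 compares with the measure at the origin at a cost of order \<open>r\<close>.
  Smallness uniform on balls thus reduces to dominated convergence for finitely many
  measures.\<close>

lemma small_jumps_le:
  assumes k: "k \<in> {1..n0}" and r: "0 < r"
  shows "small_jumps r x k \<le> small_jumps r 0 k + r * (H * \<rho> (norm x))"
proof -
  have "norm (indicator {u. norm u < r} u * (norm u)\<^sup>2) \<le> r * norm u" for u :: "real^'d"
    using mult_right_mono[of "norm u" r "norm u"] by (auto simp: indicator_def power2_eq_square r less_imp_le)
  from nu_integral_diff[OF k _ small_jumps_integrable(1)[OF k r, of x] small_jumps_integrable(1)[OF k r, of 0] this] r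
  show ?thesis by (auto simp: small_jumps_def)
qed

lemma small_jumps_mono:
  assumes k: "k \<in> {1..n0}" and r: "0 < r" "r \<le> r'"
  shows "small_jumps r x k \<le> small_jumps r' x k"
  unfolding small_jumps_def
  by (intro integral_mono small_jumps_integrable k) (use r in \<open>auto simp: indicator_def\<close>)

lemma small_jumps_tendsto_0:
  assumes k: "k \<in> {1..n0}"
  shows "(\<lambda>n. small_jumps (1 / real (Suc n)) x k) \<longlonglongrightarrow> 0"
proof -
  have "(\<lambda>n. \<integral>u. indicator {u. norm u < 1 / real (Suc n)} u * (norm u)\<^sup>2 \<partial>\<nu> x k) \<longlonglongrightarrow> (\<integral>u. 0 \<partial>\<nu> x k)"
  proof (rule integral_dominated_convergence[where w="\<lambda>u. trunc_sq u"])
    show "AE u in \<nu> x k. (\<lambda>n. indicator {u. norm u < 1 / real (Suc n)} u * (norm u)\<^sup>2) \<longlonglongrightarrow> 0"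
    proof (rule AE_I2)
      fix u :: "real^'d"
      show "(\<lambda>n. indicator {u. norm u < 1 / real (Suc n)} u * (norm u)\<^sup>2) \<longlonglongrightarrow> 0"
      proof (cases "u = 0")
        case False
        then obtain N where N: "inverse (real (Suc N)) < norm u" using reals_Archimedean[of "norm u"] by auto
        have "1 / real (Suc n) \<le> norm u" if "n \<ge> N" for n
        proof -
          have "1 / real (Suc n) \<le> 1 / real (Suc N)" using that by (intro divide_left_mono) auto
          then show ?thesis using N by (simp add: inverse_eq_divide)
        qed
        then have "\<forall>\<^sub>F n in sequentially. indicator {u. norm u < 1 / real (Suc n)} u * (norm u)\<^sup>2 = 0"
          unfolding eventually_sequentially by (intro exI[of _ N]) (force simp: indicator_def)
        then show ?thesis by (rule tendsto_eventually)
      qed simp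
    qed
    show "AE u in \<nu> x k. norm (indicator {u. norm u < 1 / real (Suc n)} u * (norm u)\<^sup>2) \<le> trunc_sq u" for n
    proof (rule AE_I2)
      fix u :: "real^'d"
      have "(norm u)\<^sup>2 \<le> 1" if "norm u < 1 / real (Suc n)"
      proof -
        have "1 / real (Suc n) \<le> 1" by (simp add: divide_le_eq)
        then have "norm u \<le> 1" using that by linarith
        then show ?thesis by (simp add: power_le_one)
      qed
      then show "norm (indicator {u. norm u < 1 / real (Suc n)} u * (norm u)\<^sup>2) \<le> trunc_sq u"
        by (simp add: indicator_def)
    qed
  qed (use nu_integrable_trunc_sq(1)[OF k] borel_measurable_integrable[OF small_jumps_integrable(1)[OF k]] in auto)
  then show ?thesis by (simp add: small_jumps_def)
qed

lemma small_jumps_uniform: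
  assumes "0 < \<kappa>"
  obtains r1 where "0 < r1" "r1 \<le> 1"
    "\<And>k x r. k \<in> {1..n0} \<Longrightarrow> norm x \<le> R \<Longrightarrow> 0 < r \<Longrightarrow> r \<le> r1 \<Longrightarrow> small_jumps r x k \<le> \<kappa>"
proof -
  have "\<forall>\<^sub>F n in sequentially. \<forall>k\<in>{1..n0}. small_jumps (1 / real (Suc n)) 0 k < \<kappa> / 2"
    using order_tendstoD(2)[OF small_jumps_tendsto_0[of _ 0], of _ "\<kappa> / 2"] assms
    by (intro eventually_ball_finite) auto
  moreover have "(\<lambda>n. 1 / real (Suc n) * (H * \<rho> \<bar>R\<bar>)) \<longlonglongrightarrow> 0 * (H * \<rho> \<bar>R\<bar>)"
    by (intro tendsto_intros LIMSEQ_Suc[OF lim_1_over_n])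
  then have "\<forall>\<^sub>F n in sequentially. 1 / real (Suc n) * (H * \<rho> \<bar>R\<bar>) < \<kappa> / 2"
    by (rule order_tendstoD(2)) (use assms in simp)
  ultimately have "\<forall>\<^sub>F n in sequentially. (\<forall>k\<in>{1..n0}. small_jumps (1 / real (Suc n)) 0 k < \<kappa> / 2) \<and>
      1 / real (Suc n) * (H * \<rho> \<bar>R\<bar>) < \<kappa> / 2" by (rule eventually_conj)
  then obtain n where n: "\<And>k. k \<in> {1..n0} \<Longrightarrow> small_jumps (1 / real (Suc n)) 0 k < \<kappa> / 2"
    "1 / real (Suc n) * (H * \<rho> \<bar>R\<bar>) < \<kappa> / 2"
    using eventually_happens by fastforce
  show ?thesis
  proof (rule that[of "1 / real (Suc n)"])
    fix k x r assume k: "k \<in> {1..n0}" and x: "norm (x::real^'d) \<le> R" and r: "0 < r" "r \<le> 1 / real (Suc n)"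
    have "small_jumps r x k \<le> small_jumps (1 / real (Suc n)) x k" by (rule small_jumps_mono[OF k r])
    also have "\<dots> \<le> small_jumps (1 / real (Suc n)) 0 k + 1 / real (Suc n) * (H * \<rho> (norm x))"
      by (rule small_jumps_le[OF k]) simp
    also have "1 / real (Suc n) * (H * \<rho> (norm x)) \<le> 1 / real (Suc n) * (H * \<rho> \<bar>R\<bar>)"
      using x H_pos by (intro mult_left_mono rho_le) auto
    finally show "small_jumps r x k \<le> \<kappa>" using n(1)[OF k] n(2) by linarith
  qed (auto simp: divide_le_eq)
qed

text \<open>One constant for the values and all derivatives up to order three, the third order being
  needed for central differences. Errors of the scheme can then be stated in terms of
  \<open>M\<close> and \<open>R\<close> alone.\<close>

definition bounded_test :: "real \<Rightarrow> real \<Rightarrow> (nat \<Rightarrow> real^'d \<Rightarrow> real) \<Rightarrow> bool" where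
  "bounded_test M R Z \<longleftrightarrow> (\<forall>k\<in>{1..n0}. smooth_bounded (Z k) \<and> (\<forall>x. \<bar>Z k x\<bar> \<le> M) \<and>
    (\<forall>i x. \<bar>iter_partial [i] (Z k) x\<bar> \<le> M) \<and> (\<forall>i j x. \<bar>iter_partial [i, j] (Z k) x\<bar> \<le> M) \<and>
    (\<forall>i j l x. \<bar>iter_partial [i, j, l] (Z k) x\<bar> \<le> M) \<and> (\<forall>x. x \<notin> cball 0 R \<longrightarrow> Z k x = 0))"

abbreviation (input) gen :: "(nat \<Rightarrow> real^'d \<Rightarrow> real) \<Rightarrow> real^'d \<Rightarrow> nat \<Rightarrow> real" where
  "gen Z x k \<equiv> gen_A n0 a b \<nu> \<epsilon>0 q (\<lambda>(x, k). Z k x) (x, k)"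

definition jump_part :: "(real^'d \<Rightarrow> real) \<Rightarrow> real^'d \<Rightarrow> real^'d \<Rightarrow> real" where
  "jump_part g x u = g (x + u) - g x - (grad g x \<bullet> u) * indicator (ball 0 \<epsilon>0) u"

definition diffusion_part :: "(real^'d \<Rightarrow> real) \<Rightarrow> real^'d \<Rightarrow> nat \<Rightarrow> real" where
  "diffusion_part g x k = (\<Sum>j\<in>UNIV. \<Sum>i\<in>UNIV. column j (\<sigma> x k) $ i *
      (\<Sum>l\<in>UNIV. column j (\<sigma> x k) $ l * iter_partial [l, i] g x))"

text \<open>The rates are read at \<open>y\<close> and the function at \<open>x\<close>, since the
  scheme freezes coefficients at a point other than the one where it evaluates.\<close>

definition switch_part :: "(nat \<Rightarrow> real^'d \<Rightarrow> real) \<Rightarrow> real^'d \<Rightarrow> real^'d \<Rightarrow> nat \<Rightarrow> real" where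
  "switch_part Z y x k = (\<Sum>l\<in>{1..n0}. q y k l * (Z l x - Z k x))"

lemma gen_eq:
  assumes k: "k \<in> {1..n0}"
  shows "gen Z x k = 1/2 * diffusion_part (Z k) x k + b x k \<bullet> grad (Z k) x
    + (\<integral>u. jump_part (Z k) x u \<partial>\<nu> x k) + switch_part Z x x k"
  unfolding diffusion_part_def trace_mult_hess[symmetric] sigma[OF k]
  by (simp add: gen_A_def gen_L_def jump_part_def switch_part_def)

definition jump_const :: real where
  "jump_const = (real CARD('d))\<^sup>2 * max 1 (\<epsilon>0\<^sup>2) + 2 / min 1 (\<epsilon>0\<^sup>2)"

lemma jump_const_nonneg: "0 \<le> jump_const"
  using eps0 by (auto simp: jump_const_def intro!: add_nonneg_nonneg divide_nonneg_nonneg)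

lemma jump_part_bound:
  assumes g: "smooth_bounded g" and M0: "\<And>x. \<bar>g x\<bar> \<le> M" and M2: "\<And>i j x. \<bar>iter_partial [i,j] g x\<bar> \<le> M"
  shows "\<bar>jump_part g x u\<bar> \<le> jump_const * M * trunc_sq u"
proof -
  have M: "0 \<le> M" using M0[of 0] by linarith
  show ?thesis
  proof (cases "norm u < \<epsilon>0")
    case True
    then have "\<bar>jump_part g x u\<bar> \<le> (real CARD('d))\<^sup>2 * (norm u)\<^sup>2 * M"
      using smooth_bounded_taylor2[OF g M2, of x u] by (simp add: jump_part_def grad_inner)
    also have "(norm u)\<^sup>2 \<le> max 1 (\<epsilon>0\<^sup>2) * trunc_sq u"
    proof -
      have "(norm u)\<^sup>2 \<le> \<epsilon>0\<^sup>2" using True by (intro power_mono) auto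
      moreover have "1 * (norm u)\<^sup>2 \<le> max 1 (\<epsilon>0\<^sup>2) * (norm u)\<^sup>2" by (intro mult_right_mono) auto
      ultimately show ?thesis by (auto simp: min_def)
    qed
    also have "(real CARD('d))\<^sup>2 * (max 1 (\<epsilon>0\<^sup>2) * trunc_sq u) * M \<le> jump_const * M * trunc_sq u"
      using M eps0 by (simp add: jump_const_def algebra_simps)
    finally show ?thesis using M by (simp add: mult_left_mono mult_right_mono)
  next
    case False
    then have "\<bar>jump_part g x u\<bar> \<le> 2 * M" using M0[of "x + u"] M0[of x] by (simp add: jump_part_def)
    also have "\<dots> = 2 / min 1 (\<epsilon>0\<^sup>2) * M * min 1 (\<epsilon>0\<^sup>2)" using eps0 by (simp add: min_def)
    also have "\<dots> \<le> 2 / min 1 (\<epsilon>0\<^sup>2) * M * trunc_sq u"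
      using trunc_sq_ge[OF eps0, of u] False M eps0 by (intro mult_left_mono) auto
    also have "\<dots> \<le> jump_const * M * trunc_sq u"
      using M by (intro mult_right_mono) (auto simp: jump_const_def)
    finally show ?thesis .
  qed
qed

lemma jump_part_measurable:
  assumes g: "smooth_bounded g"
  shows "(\<lambda>(x, u). jump_part g x u) \<in> borel_measurable (borel \<Otimes>\<^sub>M borel)" "jump_part g x \<in> borel_measurable borel"
proof -
  have [measurable]: "g \<in> borel_measurable borel"
    using smooth_bounded_measurable[OF g, of "[]"] by simp
  note gi = smooth_bounded_measurable[OF g]
  show m: "(\<lambda>(x, u). jump_part g x u) \<in> borel_measurable (borel \<Otimes>\<^sub>M borel)"
    unfolding jump_part_def case_prod_beta grad_inner
    by (intro borel_measurable_diff borel_measurable_times borel_measurable_sum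
        measurable_compose[OF measurable_fst gi] measurable_compose[OF measurable_snd vec_nth_measurable]
        measurable_compose[OF measurable_snd borel_measurable_indicator[OF borel_open[OF open_ball]]]) measurable
  show "jump_part g x \<in> borel_measurable borel" using measurable_compose_Pair1[OF _ m, of x] by simp
qed

lemma switch_part_bound:
  assumes k: "k \<in> {1..n0}" and M: "\<And>l x. l \<in> {1..n0} \<Longrightarrow> \<bar>Z l x\<bar> \<le> M"
  shows "\<bar>switch_part Z y x k\<bar> \<le> real n0 * (Qb * (2 * M))"
proof -
  have "\<bar>switch_part Z y x k\<bar> \<le> (\<Sum>l\<in>{1..n0}. Qb * (2 * M))"
    unfolding switch_part_def
  proof (intro order.trans[OF sum_abs] sum_mono)
    fix l assume l: "l \<in> {1..n0}"
    have "\<bar>q y k l\<bar> * \<bar>Z l x - Z k x\<bar> \<le> Qb * (2 * M)"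
      using q_bound[OF k l, of y] M[OF l, of x] M[OF k, of x] by (intro mult_mono) auto
    then show "\<bar>q y k l * (Z l x - Z k x)\<bar> \<le> Qb * (2 * M)" by (simp add: abs_mult)
  qed
  then show ?thesis by simp
qed

lemma local_parts_outside:
  assumes "\<And>x. x \<notin> cball 0 R \<Longrightarrow> g x = 0" "x \<notin> cball 0 R"
  shows "diffusion_part g x k = 0" "grad g x = 0"
proof -
  have 0: "iter_partial is g x = 0" for "is" by (rule iter_partial_eq_0[OF assms])
  show "diffusion_part g x k = 0" by (simp add: diffusion_part_def 0 del: iter_partial.simps)
  show "grad g x = 0" using 0[of "[_]"] by (simp add: grad_def vec_eq_iff)
qed

text \<open>Drift and diffusion vanish off the ball that carries the test function, so local bounds
  suffice for them; jumps and switching act from everywhere and use the global bounds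
  \<open>C\<nu>\<close> and \<open>Qb\<close>. The constant depends on \<open>R\<close> but not on
  the test function.\<close>

lemma gen_bounded:
  obtains CA where "0 \<le> CA" "\<And>M Z x k. bounded_test M R Z \<Longrightarrow> k \<in> {1..n0} \<Longrightarrow> \<bar>gen Z x k\<bar> \<le> CA * M"
proof -
  obtain B where B: "B \<ge> 0" "\<And>k x. k \<in> {1..n0} \<Longrightarrow> norm x \<le> R \<Longrightarrow> norm (b x k) \<le> B \<and> norm (\<sigma> x k) \<le> B"
    using coeffs_locally_bounded[of R] by blast
  let ?d = "real CARD('d)"
  define CA where "CA = ?d * (?d * B * (?d * B)) + ?d * B + jump_const * C\<nu> + real n0 * (\<bar>Qb\<bar> * 2)"
  have "\<bar>gen Z x k\<bar> \<le> CA * M" if Z: "bounded_test M R Z" and k: "k \<in> {1..n0}" for M Z x k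
  proof -
    have g: "smooth_bounded (Z k)" and M0: "\<And>k x. k \<in> {1..n0} \<Longrightarrow> \<bar>Z k x\<bar> \<le> M"
      and M1: "\<And>i x. \<bar>iter_partial [i] (Z k) x\<bar> \<le> M"
      and M2: "\<And>i j x. \<bar>iter_partial [i,j] (Z k) x\<bar> \<le> M"
      and supp: "\<And>x. x \<notin> cball 0 R \<Longrightarrow> Z k x = 0"
      using Z k unfolding bounded_test_def by blast+
    have M: "0 \<le> M" using M0[OF k, of 0] by linarith
    have J: "\<bar>\<integral>u. jump_part (Z k) x u \<partial>\<nu> x k\<bar> \<le> jump_const * M * C\<nu>"
      using nu_integrable(2)[OF k jump_part_measurable(2)[OF g, of x], where K="jump_const * M"]
        jump_part_bound[OF g M0[OF k] M2] by simp
    have S: "\<bar>switch_part Z x x k\<bar> \<le> real n0 * (\<bar>Qb\<bar> * 2) * M"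
    proof -
      have "Qb * (2 * M) \<le> \<bar>Qb\<bar> * (2 * M)" using M by (intro mult_right_mono) auto
      then show ?thesis using switch_part_bound[OF k, of Z M x x] M0
          mult_left_mono[of "Qb * (2 * M)" "\<bar>Qb\<bar> * (2 * M)" "real n0"] by (simp add: mult_ac)
    qed
    have L: "\<bar>1/2 * diffusion_part (Z k) x k + b x k \<bullet> grad (Z k) x\<bar> \<le> (?d * (?d * B * (?d * B)) + ?d * B) * M"
    proof (cases "x \<in> cball 0 R")
      case True
      then have b: "norm (b x k) \<le> B" "norm (\<sigma> x k) \<le> B" using B(2)[OF k, of x] by auto
      have v: "norm (column j (\<sigma> x k)) \<le> B" for j using norm_column_le[of j "\<sigma> x k"] b by linarith
      have "\<bar>diffusion_part (Z k) x k\<bar> \<le> (\<Sum>j\<in>(UNIV::'d set). ?d * B * (?d * B * M))"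
        unfolding diffusion_part_def
      proof (rule order.trans[OF sum_abs], rule sum_mono)
        fix j
        let ?v = "norm (column j (\<sigma> x k))"
        have "\<bar>\<Sum>i\<in>UNIV. column j (\<sigma> x k) $ i * (\<Sum>l\<in>UNIV. column j (\<sigma> x k) $ l * iter_partial [l, i] (Z k) x)\<bar>
          \<le> ?d * ?v * (?d * ?v * M)" by (intro abs_sum_cart_le M2)
        also have "\<dots> \<le> ?d * B * (?d * B * M)" using v M B by (intro mult_mono) auto
        finally show "\<bar>\<Sum>i\<in>UNIV. column j (\<sigma> x k) $ i * (\<Sum>l\<in>UNIV. column j (\<sigma> x k) $ l * iter_partial [l, i] (Z k) x)\<bar> \<le> ?d * B * (?d * B * M)" .
      qed
      then have 1: "\<bar>diffusion_part (Z k) x k\<bar> \<le> ?d * (?d * B * (?d * B)) * M" by (simp add: mult_ac)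
      have "b x k \<bullet> grad (Z k) x = (\<Sum>i\<in>UNIV. b x k $ i * iter_partial [i] (Z k) x)"
        by (subst inner_commute) (rule grad_inner)
      also have "\<bar>\<dots>\<bar> \<le> ?d * norm (b x k) * M" by (intro abs_sum_cart_le M1)
      also have "\<dots> \<le> ?d * B * M" using b M B by (intro mult_mono) auto
      finally have 2: "\<bar>b x k \<bullet> grad (Z k) x\<bar> \<le> ?d * B * M" .
      show ?thesis using 1 2 by (simp add: algebra_simps)
    next
      case False
      then show ?thesis using local_parts_outside[OF supp] M B by simp
    qed
    show ?thesis unfolding gen_eq[OF k] CA_def using J S L by (simp add: algebra_simps)
  qed
  moreover have "0 \<le> CA" using B jump_const_nonneg Cnu_nonneg by (simp add: CA_def)
  ultimately show ?thesis using that by blast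
qed

lemma gen_measurable:
  assumes Z: "bounded_test M R Z"
  shows "(\<lambda>(x, k). if k \<in> {1..n0} then gen Z x k else 0) \<in> borel_measurable borel"
proof (rule borel_measurable_pair_countable)
  fix k
  show "(\<lambda>x. if k \<in> {1..n0} then gen Z x k else 0) \<in> borel_measurable borel"
  proof (cases "k \<in> {1..n0}")
    case k: True
    have sm: "\<And>l. l \<in> {1..n0} \<Longrightarrow> smooth_bounded (Z l)" and M0: "\<And>x. \<bar>Z k x\<bar> \<le> M"
      and M2: "\<And>i j x. \<bar>iter_partial [i,j] (Z k) x\<bar> \<le> M"
      using Z k unfolding bounded_test_def by blast+
    note g = sm[OF k]
    have [measurable]: "\<And>is. iter_partial is (Z k) \<in> borel_measurable borel"
      by (rule smooth_bounded_measurable[OF g])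
    have [measurable]: "Z l \<in> borel_measurable borel" if "l \<in> {1..n0}" for l
      using smooth_bounded_measurable[OF sm[OF that], of "[]"] by simp
    have mq: "(\<lambda>x. switch_part Z x x k) \<in> borel_measurable borel"
      unfolding switch_part_def
      by (intro borel_measurable_sum borel_measurable_times q_meas borel_measurable_diff k) (use k in measurable)
    have ma: "(\<lambda>x. a x k $ i $ j) \<in> borel_measurable borel" for i j
      by (rule measurable_compose[OF a_meas[OF k], of "\<lambda>m. m $ i $ j"])
        (intro borel_measurable_continuous_onI continuous_on_component continuous_on_id)
    \<comment> \<open>Measurability is assumed for \<open>a\<close>, whereas \<open>\<sigma>\<close>
      is an arbitrary root, so the trace form is used here.\<close>
    have mt: "(\<lambda>x. trace (a x k ** hess (Z k) x)) \<in> borel_measurable borel"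
    proof -
      have "trace (a x k ** hess (Z k) x) = (\<Sum>i\<in>UNIV. \<Sum>l\<in>UNIV. a x k $ i $ l * iter_partial [l, i] (Z k) x)" for x
        by (simp add: trace_def matrix_matrix_mult_def hess_def)
      then show ?thesis
        by (simp only:) (intro borel_measurable_sum borel_measurable_times ma smooth_bounded_measurable[OF g])
    qed
    have mb: "(\<lambda>x. b x k \<bullet> grad (Z k) x) \<in> borel_measurable borel"
    proof -
      have "b x k \<bullet> grad (Z k) x = (\<Sum>i\<in>UNIV. b x k $ i * iter_partial [i] (Z k) x)" for x
        by (subst inner_commute) (rule grad_inner)
      moreover have "(\<lambda>x. b x k $ i) \<in> borel_measurable borel" for i
        by (intro measurable_compose[OF b_meas[OF k]] borel_measurable_continuous_onI continuous_on_component continuous_on_id)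
      ultimately show ?thesis
        by (simp only:) (intro borel_measurable_sum borel_measurable_times smooth_bounded_measurable[OF g])
    qed
    have mj: "(\<lambda>x. \<integral>u. jump_part (Z k) x u \<partial>\<nu> x k) \<in> borel_measurable borel"
      by (rule borel_measurable_nu_integral[OF k jump_part_measurable(1)[OF g] jump_part_bound[OF g M0 M2]])
    have "gen Z x k = 1/2 * trace (a x k ** hess (Z k) x) + b x k \<bullet> grad (Z k) x
      + (\<integral>u. jump_part (Z k) x u \<partial>\<nu> x k) + switch_part Z x x k" for x
      unfolding gen_eq[OF k] diffusion_part_def sigma[OF k, symmetric] trace_mult_hess ..
    then show ?thesis using k mt mb mj mq by simp
  qed (simp del: atLeastAtMost_iff)
qed

end

section \<open>Approximation by bounded-rate generators\<close>

context switching begin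

lemma large_jump_integrable:
  assumes k: "k \<in> {1..n0}" and r: "0 < r" and U: "U \<in> borel_measurable borel" and M: "\<And>x. \<bar>U x\<bar> \<le> M"
  shows "integrable (\<nu> y k) (\<lambda>u. indicator {u. r \<le> norm u} u * (U (x + u) - U x))"
    and "\<bar>\<integral>u. indicator {u. r \<le> norm u} u * (U (x + u) - U x) \<partial>\<nu> y k\<bar> \<le> 2 * M / min 1 (r\<^sup>2) * C\<nu>"
proof -
  have M0: "0 \<le> M" using M[of 0] by linarith
  have m: "(\<lambda>u. indicator {u. r \<le> norm u} u * (U (x + u) - U x)) \<in> borel_measurable borel"
    using U by measurable
  have "norm (indicator {u. r \<le> norm u} u * (U (x + u) - U x)) \<le> 2 * M / min 1 (r\<^sup>2) * trunc_sq u" for u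
  proof (cases "r \<le> norm u")
    case True
    have "min 1 (r\<^sup>2) > 0" using r by simp
    then have "2 * M = 2 * M / min 1 (r\<^sup>2) * min 1 (r\<^sup>2)" by (metis less_irrefl nonzero_eq_divide_eq)
    also have "\<dots> \<le> 2 * M / min 1 (r\<^sup>2) * trunc_sq u"
      using trunc_sq_ge[OF r True] M0 r by (intro mult_left_mono) auto
    finally show ?thesis using True M[of "x + u"] M[of x] by simp
  qed (use M0 in simp)
  from nu_integrable[OF k m this]
  show "integrable (\<nu> y k) (\<lambda>u. indicator {u. r \<le> norm u} u * (U (x + u) - U x))"
    "\<bar>\<integral>u. indicator {u. r \<le> norm u} u * (U (x + u) - U x) \<partial>\<nu> y k\<bar> \<le> 2 * M / min 1 (r\<^sup>2) * C\<nu>"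
    by auto
qed

text \<open>Without the cut-off, a large drift at a distant point could carry
  \<open>x + \<tau> b\<close> into the support of a test function for every fixed
  \<open>\<tau>\<close>, and consistency would not be uniform in space.\<close>

definition drift :: "real \<Rightarrow> real \<Rightarrow> real^'d \<Rightarrow> nat \<Rightarrow> real^'d" where
  "drift r R y k = (if norm y \<le> R then b y k - compensator r y k else 0)"

definition diff_col :: "real \<Rightarrow> real^'d \<Rightarrow> nat \<Rightarrow> 'd \<Rightarrow> real^'d" where
  "diff_col R y k j = (if norm y \<le> R then column j (\<sigma> y k) else 0)"

definition jump_op :: "real \<Rightarrow> (nat \<Rightarrow> real^'d \<Rightarrow> real) \<Rightarrow> real^'d \<Rightarrow> real^'d \<Rightarrow> nat \<Rightarrow> real" where
  "jump_op r U y x k = (\<integral>u. indicator {u. r \<le> norm u} u * (U k (x + u) - U k x) \<partial>\<nu> y k)"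

text \<open>All off-diagonal weights are nonnegative with bounded total mass, so an explicit Euler
  step is monotone for small time steps. For fixed \<open>y\<close> every term is a difference in
  \<open>x\<close> with constant coefficients.\<close>

definition approx_gen ::
  "real \<Rightarrow> real \<Rightarrow> real \<Rightarrow> (nat \<Rightarrow> real^'d \<Rightarrow> real) \<Rightarrow> real^'d \<Rightarrow> real^'d \<Rightarrow> nat \<Rightarrow> real" where
  "approx_gen \<tau> r R U y x k =
    1 / \<tau> * (U k (x + \<tau> *\<^sub>R drift r R y k) - U k x)
    + (\<Sum>j\<in>UNIV. 1 / (2 * \<tau>) * (U k (x + sqrt \<tau> *\<^sub>R diff_col R y k j)
        + U k (x - sqrt \<tau> *\<^sub>R diff_col R y k j) - 2 * U k x))
    + jump_op r U y x k + switch_part U y x k"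

lemma jump_integral_split:
  assumes k: "k \<in> {1..n0}" and r: "0 < r" "r \<le> \<epsilon>0" and g: "smooth_bounded g"
    and M0: "\<And>x. \<bar>g x\<bar> \<le> M" and M2: "\<And>i j x. \<bar>iter_partial [i,j] g x\<bar> \<le> M"
  shows "(\<integral>u. jump_part g x u \<partial>\<nu> x k) = (\<integral>u. indicator {u. norm u < r} u * jump_part g x u \<partial>\<nu> x k)
      + (\<integral>u. indicator {u. r \<le> norm u} u * (g (x + u) - g x) \<partial>\<nu> x k) - grad g x \<bullet> compensator r x k"
    and "integrable (\<nu> x k) (\<lambda>u. indicator {u. norm u < r} u * jump_part g x u)"
proof -
  have gm: "g \<in> borel_measurable borel" using smooth_bounded_measurable[OF g, of "[]"] by simp
  note [measurable] = jump_part_measurable(2)[OF g]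
  have M: "0 \<le> M" using M0[of 0] by linarith
  show i1: "integrable (\<nu> x k) (\<lambda>u. indicator {u. norm u < r} u * jump_part g x u)"
  proof (rule nu_integrable(1)[OF k])
    show "norm (indicator {u. norm u < r} u * jump_part g x u) \<le> jump_const * M * trunc_sq u" for u
      using jump_part_bound[OF g M0 M2, of x u] jump_const_nonneg M by (auto simp: indicator_def)
  qed measurable
  note i2 = large_jump_integrable(1)[OF k r(1) gm M0, of x x]
  note i3 = compensator_integrable(1)[OF k r(1), of x]
  have "(\<integral>u. jump_part g x u \<partial>\<nu> x k) = (\<integral>u. indicator {u. norm u < r} u * jump_part g x u
      + indicator {u. r \<le> norm u} u * (g (x + u) - g x)
      - grad g x \<bullet> (indicator {u. r \<le> norm u \<and> norm u < \<epsilon>0} u *\<^sub>R u) \<partial>\<nu> x k)"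
    by (intro Bochner_Integration.integral_cong refl) (use r in \<open>auto simp: jump_part_def indicator_def\<close>)
  also have "\<dots> = (\<integral>u. indicator {u. norm u < r} u * jump_part g x u \<partial>\<nu> x k)
      + (\<integral>u. indicator {u. r \<le> norm u} u * (g (x + u) - g x) \<partial>\<nu> x k)
      - (\<integral>u. grad g x \<bullet> (indicator {u. r \<le> norm u \<and> norm u < \<epsilon>0} u *\<^sub>R u) \<partial>\<nu> x k)"
    using i1 i2 integrable_inner_right[OF i3, of "grad g x"]
    by (simp del: inner_scaleR_right)
  also have "(\<integral>u. grad g x \<bullet> (indicator {u. r \<le> norm u \<and> norm u < \<epsilon>0} u *\<^sub>R u) \<partial>\<nu> x k) = grad g x \<bullet> compensator r x k"
    unfolding compensator_def using i3 by (rule integral_inner_right)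
  finally show "(\<integral>u. jump_part g x u \<partial>\<nu> x k) = (\<integral>u. indicator {u. norm u < r} u * jump_part g x u \<partial>\<nu> x k)
      + (\<integral>u. indicator {u. r \<le> norm u} u * (g (x + u) - g x) \<partial>\<nu> x k) - grad g x \<bullet> compensator r x k" .
qed

lemma small_jump_remainder:
  assumes k: "k \<in> {1..n0}" and r: "0 < r" "r \<le> \<epsilon>0" and g: "smooth_bounded g"
    and M0: "\<And>x. \<bar>g x\<bar> \<le> M" and M2: "\<And>i j x. \<bar>iter_partial [i,j] g x\<bar> \<le> M"
  shows "\<bar>\<integral>u. indicator {u. norm u < r} u * jump_part g x u \<partial>\<nu> x k\<bar> \<le> (real CARD('d))\<^sup>2 * M * small_jumps r x k"
proof -
  have "\<bar>\<integral>u. indicator {u. norm u < r} u * jump_part g x u \<partial>\<nu> x k\<bar>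
      \<le> (\<integral>u. \<bar>indicator {u. norm u < r} u * jump_part g x u\<bar> \<partial>\<nu> x k)" by (rule integral_abs_bound)
  also have "\<dots> \<le> (\<integral>u. (real CARD('d))\<^sup>2 * M * (indicator {u. norm u < r} u * (norm u)\<^sup>2) \<partial>\<nu> x k)"
  proof (rule integral_mono)
    show "integrable (\<nu> x k) (\<lambda>u. \<bar>indicator {u. norm u < r} u * jump_part g x u\<bar>)"
      by (intro integrable_abs jump_integral_split(2)[OF k r g M0 M2])
    show "\<bar>indicator {u. norm u < r} u * jump_part g x u\<bar>
        \<le> (real CARD('d))\<^sup>2 * M * (indicator {u. norm u < r} u * (norm u)\<^sup>2)" for u
      using smooth_bounded_taylor2[OF g M2, of x u] r
      by (auto simp: indicator_def jump_part_def grad_inner mult_ac)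
  qed (intro integrable_mult_right small_jumps_integrable(1) k r)
  finally show ?thesis by (simp add: small_jumps_def)
qed

text \<open>\<open>r\<close> controls the discarded small jumps, and the admissible
  \<open>\<tau>\<close> depends on \<open>r\<close> because the bound on the compensated drift grows
  as \<open>r\<close> shrinks. The coefficients are cut off at \<open>R + 1\<close> and
  \<open>r \<le> 1\<close>, so beyond the cut-off a discarded jump cannot reach the support.\<close>

lemma approx_gen_consistent:
  assumes "0 < \<kappa>" "0 \<le> M"
  obtains r1 where "0 < r1" "\<And>r. 0 < r \<Longrightarrow> r \<le> r1 \<Longrightarrow> \<exists>\<tau>1>0. \<forall>\<tau>. 0 < \<tau> \<and> \<tau> \<le> \<tau>1 \<longrightarrow>
    (\<forall>Z x k. bounded_test M R Z \<and> k \<in> {1..n0} \<longrightarrow> \<bar>gen Z x k - approx_gen \<tau> r (R + 1) Z x x k\<bar> \<le> \<kappa>)"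
proof -
  let ?d = "real CARD('d)"
  obtain B where B: "B \<ge> 0" "\<And>k x. k \<in> {1..n0} \<Longrightarrow> norm x \<le> R + 1 \<Longrightarrow> norm (b x k) \<le> B \<and> norm (\<sigma> x k) \<le> B"
    using coeffs_locally_bounded[of "R + 1"] by blast
  \<comment> \<open>Half of the tolerance goes to the small jumps, the other half to the difference
    quotients; the \<open>+ 1\<close> guards against \<open>M = 0\<close>.\<close>
  define \<kappa>' where "\<kappa>' = \<kappa> / (2 * (?d\<^sup>2 * M + 1))"
  have den: "?d\<^sup>2 * M + 1 > 0" using assms by (simp add: add_nonneg_pos)
  then have \<kappa>': "\<kappa>' > 0" "?d\<^sup>2 * M * \<kappa>' \<le> \<kappa> / 2"
    using assms by (auto simp: \<kappa>'_def field_simps)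
  obtain r0 where r0: "0 < r0" "r0 \<le> 1"
    "\<And>k x r. k \<in> {1..n0} \<Longrightarrow> norm x \<le> R + 1 \<Longrightarrow> 0 < r \<Longrightarrow> r \<le> r0 \<Longrightarrow> small_jumps r x k \<le> \<kappa>'"
    using small_jumps_uniform[OF \<kappa>'(1), of "R + 1"] by blast
  show ?thesis
  proof (rule that[of "min r0 \<epsilon>0"])
    show "0 < min r0 \<epsilon>0" using r0 eps0 by simp
    fix r assume r: "0 < r" "r \<le> min r0 \<epsilon>0"
    define B\<beta> where "B\<beta> = B + \<epsilon>0 / min 1 (r\<^sup>2) * C\<nu>"
    have "((\<lambda>\<tau>. ?d\<^sup>2 * B\<beta>\<^sup>2 * M * \<tau> + ?d^4 * B^3 * M * sqrt \<tau>) \<longlongrightarrow> ?d\<^sup>2 * B\<beta>\<^sup>2 * M * 0 + ?d^4 * B^3 * M * sqrt 0) (at_right 0)"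
      by (intro tendsto_intros tendsto_ident_at)
    then have "\<forall>\<^sub>F \<tau> in at_right 0. ?d\<^sup>2 * B\<beta>\<^sup>2 * M * \<tau> + ?d^4 * B^3 * M * sqrt \<tau> < \<kappa> / 2"
      by (rule order_tendstoD(2)) (use assms in simp)
    then obtain t0 where t0: "t0 > 0" "\<And>\<tau>. 0 < \<tau> \<Longrightarrow> \<tau> < t0 \<Longrightarrow> ?d\<^sup>2 * B\<beta>\<^sup>2 * M * \<tau> + ?d^4 * B^3 * M * sqrt \<tau> < \<kappa> / 2"
      unfolding eventually_at_right_field by auto
    have "\<bar>gen Z x k - approx_gen \<tau> r (R + 1) Z x x k\<bar> \<le> \<kappa>"
      if \<tau>: "0 < \<tau>" "\<tau> \<le> t0 / 2" and Z: "bounded_test M R Z" and k: "k \<in> {1..n0}" for \<tau> Z x k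
    proof -
      have g: "smooth_bounded (Z k)" and M0: "\<And>x. \<bar>Z k x\<bar> \<le> M"
        and M2: "\<And>i j x. \<bar>iter_partial [i,j] (Z k) x\<bar> \<le> M"
        and M3: "\<And>i j l x. \<bar>iter_partial [i,j,l] (Z k) x\<bar> \<le> M"
        and supp: "\<And>x. x \<notin> cball 0 R \<Longrightarrow> Z k x = 0"
        using Z k unfolding bounded_test_def by blast+
      have re: "r \<le> \<epsilon>0" "r \<le> r0" "r \<le> 1" using r r0 by auto
      let ?I = "\<integral>u. indicator {u. norm u < r} u * jump_part (Z k) x u \<partial>\<nu> x k"
      have gen: "gen Z x k = 1/2 * diffusion_part (Z k) x k + (b x k - compensator r x k) \<bullet> grad (Z k) x
        + ?I + jump_op r Z x x k + switch_part Z x x k"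
        unfolding gen_eq[OF k] jump_integral_split(1)[OF k r(1) re(1) g M0 M2] jump_op_def
        by (simp add: inner_diff_left inner_commute[of "grad (Z k) x"])
      show ?thesis
      proof (cases "norm x \<le> R + 1")
        case True
        then have bs: "norm (b x k) \<le> B" "norm (\<sigma> x k) \<le> B" using B(2)[OF k] by auto
        let ?\<beta> = "b x k - compensator r x k" and ?v = "\<lambda>j. column j (\<sigma> x k)"
        have b: "norm ?\<beta> \<le> B\<beta>"
          using norm_triangle_ineq4[of "b x k" "compensator r x k"] bs compensator_integrable(2)[OF k r(1), of x]
          by (simp add: B\<beta>_def)
        have e1: "\<bar>1 / \<tau> * (Z k (x + \<tau> *\<^sub>R ?\<beta>) - Z k x) - ?\<beta> \<bullet> grad (Z k) x\<bar> \<le> ?d\<^sup>2 * B\<beta>\<^sup>2 * M * \<tau>"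
        proof -
          have "(\<Sum>i\<in>UNIV. (\<tau> *\<^sub>R ?\<beta>) $ i * iter_partial [i] (Z k) x) = \<tau> * (?\<beta> \<bullet> grad (Z k) x)"
            by (simp only: grad_inner[symmetric]) (simp add: inner_commute)
          then have "\<bar>Z k (x + \<tau> *\<^sub>R ?\<beta>) - Z k x - \<tau> * (?\<beta> \<bullet> grad (Z k) x)\<bar> \<le> ?d\<^sup>2 * (norm (\<tau> *\<^sub>R ?\<beta>))\<^sup>2 * M"
            using smooth_bounded_taylor2[OF g M2, of x "\<tau> *\<^sub>R ?\<beta>"] by simp
          also have "\<dots> \<le> ?d\<^sup>2 * (\<tau> * B\<beta>)\<^sup>2 * M"
            using b \<tau> assms by (intro mult_left_mono mult_right_mono power_mono) auto
          also have "\<dots> = \<tau> * (?d\<^sup>2 * B\<beta>\<^sup>2 * M * \<tau>)" by (simp add: power2_eq_square)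
          finally have *: "\<bar>Z k (x + \<tau> *\<^sub>R ?\<beta>) - Z k x - \<tau> * (?\<beta> \<bullet> grad (Z k) x)\<bar> / \<tau> \<le> ?d\<^sup>2 * B\<beta>\<^sup>2 * M * \<tau>"
            using \<tau> by (simp add: divide_le_eq mult_ac)
          have "1 / \<tau> * (Z k (x + \<tau> *\<^sub>R ?\<beta>) - Z k x) - ?\<beta> \<bullet> grad (Z k) x
            = (Z k (x + \<tau> *\<^sub>R ?\<beta>) - Z k x - \<tau> * (?\<beta> \<bullet> grad (Z k) x)) / \<tau>"
            using \<tau> by (simp add: diff_divide_distrib)
          then show ?thesis using * \<tau> by (simp add: abs_divide)
        qed
        have e2: "\<bar>(\<Sum>j\<in>UNIV. 1 / (2 * \<tau>) * (Z k (x + sqrt \<tau> *\<^sub>R ?v j) + Z k (x - sqrt \<tau> *\<^sub>R ?v j) - 2 * Z k x))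
            - 1/2 * diffusion_part (Z k) x k\<bar> \<le> ?d^4 * B^3 * M * sqrt \<tau>"
        proof -
          let ?Q = "\<lambda>v. \<Sum>i\<in>UNIV. v $ i * (\<Sum>l\<in>UNIV. v $ l * iter_partial [l, i] (Z k) x)"
          have "\<bar>1 / (2 * \<tau>) * (Z k (x + sqrt \<tau> *\<^sub>R ?v j) + Z k (x - sqrt \<tau> *\<^sub>R ?v j) - 2 * Z k x)
              - 1/2 * ?Q (?v j)\<bar> \<le> ?d^3 * B^3 * M * sqrt \<tau>" for j
          proof -
            have "?Q (sqrt \<tau> *\<^sub>R ?v j) = sqrt \<tau> * sqrt \<tau> * ?Q (?v j)"
              by (simp add: sum_distrib_left mult_ac del: iter_partial.simps real_sqrt_mult_self)
            then have Q: "?Q (sqrt \<tau> *\<^sub>R ?v j) = \<tau> * ?Q (?v j)" using \<tau> by simp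
            have "norm (?v j) \<le> B" using norm_column_le[of j "\<sigma> x k"] bs by linarith
            then have n: "norm (sqrt \<tau> *\<^sub>R ?v j) \<le> sqrt \<tau> * B" using \<tau> by (simp add: mult_left_mono)
            have "\<bar>Z k (x + sqrt \<tau> *\<^sub>R ?v j) + Z k (x - sqrt \<tau> *\<^sub>R ?v j) - 2 * Z k x - \<tau> * ?Q (?v j)\<bar>
              \<le> ?d^3 * (norm (sqrt \<tau> *\<^sub>R ?v j))^3 * M"
              using smooth_bounded_taylor3[OF g M3, of x "sqrt \<tau> *\<^sub>R ?v j"] unfolding Q .
            also have "\<dots> \<le> ?d^3 * (sqrt \<tau> * B)^3 * M"
              using n assms by (intro mult_left_mono mult_right_mono power_mono) auto
            also have "\<dots> = \<tau> * (?d^3 * B^3 * M * sqrt \<tau>)"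
              using \<tau> by (simp add: power_mult_distrib power3_eq_cube)
            finally have *: "\<bar>Z k (x + sqrt \<tau> *\<^sub>R ?v j) + Z k (x - sqrt \<tau> *\<^sub>R ?v j) - 2 * Z k x - \<tau> * ?Q (?v j)\<bar> / \<tau>
              \<le> ?d^3 * B^3 * M * sqrt \<tau>" using \<tau> by (simp add: divide_le_eq mult_ac)
            have e: "1 / (2 * \<tau>) * (Z k (x + sqrt \<tau> *\<^sub>R ?v j) + Z k (x - sqrt \<tau> *\<^sub>R ?v j) - 2 * Z k x) - 1/2 * ?Q (?v j)
              = (Z k (x + sqrt \<tau> *\<^sub>R ?v j) + Z k (x - sqrt \<tau> *\<^sub>R ?v j) - 2 * Z k x - \<tau> * ?Q (?v j)) / \<tau> / 2"
              using \<tau> by (simp add: diff_divide_distrib add_divide_distrib del: iter_partial.simps)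
            have half: "c / 2 \<le> c" if "0 \<le> c" for c :: real using that by simp
            have "\<bar>w / \<tau> / 2\<bar> \<le> \<bar>w\<bar> / \<tau>" for w
            proof -
              have "\<bar>w / \<tau> / 2\<bar> = (\<bar>w\<bar> / \<tau>) / 2" using \<tau> by (simp add: abs_divide)
              also have "\<dots> \<le> \<bar>w\<bar> / \<tau>" by (rule half) (use \<tau> in simp)
              finally show ?thesis .
            qed
            from order.trans[OF this *] show ?thesis unfolding e .
          qed
          then have "(\<Sum>j\<in>UNIV. \<bar>1 / (2 * \<tau>) * (Z k (x + sqrt \<tau> *\<^sub>R ?v j) + Z k (x - sqrt \<tau> *\<^sub>R ?v j) - 2 * Z k x)
              - 1/2 * ?Q (?v j)\<bar>) \<le> (\<Sum>j\<in>(UNIV::'d set). ?d^3 * B^3 * M * sqrt \<tau>)"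
            by (intro sum_mono)
          then have "\<bar>\<Sum>j\<in>UNIV. 1 / (2 * \<tau>) * (Z k (x + sqrt \<tau> *\<^sub>R ?v j) + Z k (x - sqrt \<tau> *\<^sub>R ?v j) - 2 * Z k x)
              - 1/2 * ?Q (?v j)\<bar> \<le> (\<Sum>j\<in>(UNIV::'d set). ?d^3 * B^3 * M * sqrt \<tau>)"
            by (rule order.trans[OF sum_abs])
          moreover have "(\<Sum>j\<in>(UNIV::'d set). ?d^3 * B^3 * M * sqrt \<tau>) = ?d^4 * B^3 * M * sqrt \<tau>"
            by (simp add: power4_eq_xxxx power3_eq_cube)
          ultimately show ?thesis
            unfolding sum_subtractf diffusion_part_def sum_distrib_left[symmetric] by (simp only:)
        qed
        have e3: "\<bar>?I\<bar> \<le> \<kappa> / 2"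
        proof -
          have "\<bar>?I\<bar> \<le> ?d\<^sup>2 * M * small_jumps r x k" by (rule small_jump_remainder[OF k r(1) re(1) g M0 M2])
          also have "\<dots> \<le> ?d\<^sup>2 * M * \<kappa>'" using r0(3)[OF k True r(1) re(2)] assms by (intro mult_left_mono) auto
          finally show ?thesis using \<kappa>' by linarith
        qed
        have "?d\<^sup>2 * B\<beta>\<^sup>2 * M * \<tau> + ?d^4 * B^3 * M * sqrt \<tau> < \<kappa> / 2" using t0 \<tau> by auto
        moreover have "approx_gen \<tau> r (R + 1) Z x x k = 1 / \<tau> * (Z k (x + \<tau> *\<^sub>R ?\<beta>) - Z k x)
          + (\<Sum>j\<in>UNIV. 1 / (2 * \<tau>) * (Z k (x + sqrt \<tau> *\<^sub>R ?v j) + Z k (x - sqrt \<tau> *\<^sub>R ?v j) - 2 * Z k x))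
          + jump_op r Z x x k + switch_part Z x x k"
          using True by (simp add: approx_gen_def drift_def diff_col_def)
        ultimately show ?thesis unfolding gen using e1 e2 e3 by linarith
      next
        case False
        then have x: "x \<notin> cball 0 R" by simp
        have "?I = (\<integral>u. 0 \<partial>\<nu> x k)"
        proof (intro Bochner_Integration.integral_cong refl)
          fix u
          show "indicator {u. norm u < r} u * jump_part (Z k) x u = 0"
          proof (cases "norm u < r")
            case True
            then have "x + u \<notin> cball 0 R"
              using False re(3) norm_triangle_ineq4[of "x + u" u] by auto
            then show ?thesis using supp x local_parts_outside(2)[OF supp x] by (simp add: jump_part_def)
          qed simp
        qed
        then have "?I = 0" by simp
        then show ?thesis
          unfolding gen using local_parts_outside[OF supp x] False assms
          by (simp add: approx_gen_def drift_def diff_col_def)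
      qed
    qed
    then show "\<exists>\<tau>1>0. \<forall>\<tau>. 0 < \<tau> \<and> \<tau> \<le> \<tau>1 \<longrightarrow>
      (\<forall>Z x k. bounded_test M R Z \<and> k \<in> {1..n0} \<longrightarrow> \<bar>gen Z x k - approx_gen \<tau> r (R + 1) Z x x k\<bar> \<le> \<kappa>)"
      using t0(1) by (intro exI[of _ "t0 / 2"]) auto
  qed
qed

end

section \<open>The shaken scheme\<close>

locale scheme = switching n0 \<epsilon>0 H C\<nu> Qb a \<sigma> b \<nu> q \<rho>
  for n0 :: nat and \<epsilon>0 H C\<nu> Qb :: real
    and a \<sigma> :: "real^'d::finite \<Rightarrow> nat \<Rightarrow> real^'d^'d"
    and b :: "real^'d \<Rightarrow> nat \<Rightarrow> real^'d"
    and \<nu> :: "real^'d \<Rightarrow> nat \<Rightarrow> (real^'d) measure"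
    and q :: "real^'d \<Rightarrow> nat \<Rightarrow> nat \<Rightarrow> real"
    and \<rho> :: "real \<Rightarrow> real" +
  fixes \<tau> r h \<epsilon> R :: real
  assumes tau: "0 < \<tau>" and r: "0 < r" and h: "0 < h" and eps: "0 < \<epsilon>"
    and cfl: "h * ((1 + real CARD('d)) / \<tau> + 2 * (C\<nu> / min 1 (r\<^sup>2)) + 2 * (real n0 * \<bar>Qb\<bar>)) \<le> 1"
begin

text \<open>Jumps and switching are counted twice because in the coupling each of the two components
  may move alone, while drift and diffusion moves are made jointly.\<close>

definition rate :: real where
  "rate = (1 + real CARD('d)) / \<tau> + 2 * (C\<nu> / min 1 (r\<^sup>2)) + 2 * (real n0 * \<bar>Qb\<bar>)"

text \<open>The radius \<open>R + 3\<close> is the support radius \<open>R + 2\<close> of the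
  mollified iterates plus the margin 1 of the consistency estimate.\<close>

abbreviation G :: "(nat \<Rightarrow> real^'d \<Rightarrow> real) \<Rightarrow> real^'d \<Rightarrow> real^'d \<Rightarrow> nat \<Rightarrow> real" where
  "G \<equiv> approx_gen \<tau> r (R + 3)"

definition jump_rate :: real where "jump_rate = C\<nu> / min 1 (r\<^sup>2)"

lemma jump_rate_nonneg: "0 \<le> jump_rate"
  using Cnu_nonneg r by (simp add: jump_rate_def)

lemma h_rate: "h * rate \<le> 1" using cfl by (simp add: rate_def)

lemma rate_nonneg: "0 \<le> rate"
  using tau jump_rate_nonneg by (simp add: rate_def jump_rate_def)

lemma nu_large_jumps:
  assumes k: "k \<in> {1..n0}"
  shows "integrable (\<nu> y k) (\<lambda>u. indicator {u. r \<le> norm u} u :: real)"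
    "(\<integral>u. indicator {u. r \<le> norm u} u \<partial>\<nu> y k) \<le> jump_rate"
proof -
  have "norm (indicator {u. r \<le> norm u} u :: real) \<le> 1 / min 1 (r\<^sup>2) * trunc_sq u" for u :: "real^'d"
    using trunc_sq_ge[OF r, of u] r by (auto simp: indicator_def)
  from nu_integrable[OF k _ this]
  show "integrable (\<nu> y k) (\<lambda>u. indicator {u. r \<le> norm u} u :: real)"
    "(\<integral>u. indicator {u. r \<le> norm u} u \<partial>\<nu> y k) \<le> jump_rate"
    by (auto simp: jump_rate_def)
qed

definition unit_valued :: "(nat \<Rightarrow> real^'d \<Rightarrow> real) \<Rightarrow> bool" where
  "unit_valued U \<longleftrightarrow> (\<forall>k\<in>{1..n0}. U k \<in> borel_measurable borel \<and> (\<forall>x. 0 \<le> U k x \<and> U k x \<le> 1))"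

lemma unit_valuedD:
  assumes "unit_valued U" "k \<in> {1..n0}"
  shows "U k \<in> borel_measurable borel" "0 \<le> U k x" "U k x \<le> 1" "\<bar>U k x\<bar> \<le> 1"
  using assms by (auto simp: unit_valued_def)

lemma unit_valued_compl: "unit_valued U \<Longrightarrow> unit_valued (\<lambda>k x. 1 - U k x)"
  by (auto simp: unit_valued_def)

lemma G_ge:
  assumes U: "unit_valued U" and k: "k \<in> {1..n0}"
  shows "- rate * U k x \<le> G U y x k"
proof -
  note u = unit_valuedD[OF U]
  have 1: "- (1 / \<tau>) * U k x \<le> 1 / \<tau> * (U k (x + \<tau> *\<^sub>R drift r (R+3) y k) - U k x)"
    using u(2)[OF k] tau by (simp add: right_diff_distrib)
  have "(\<Sum>j\<in>(UNIV::'d set). - (1 / \<tau>) * U k x) \<le> (\<Sum>j\<in>UNIV. 1 / (2 * \<tau>) * (U k (x + sqrt \<tau> *\<^sub>R diff_col (R+3) y k j)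
        + U k (x - sqrt \<tau> *\<^sub>R diff_col (R+3) y k j) - 2 * U k x))"
  proof (rule sum_mono)
    fix j
    have "1 / (2 * \<tau>) * (- 2 * U k x) \<le> 1 / (2 * \<tau>) * (U k (x + sqrt \<tau> *\<^sub>R diff_col (R+3) y k j)
        + U k (x - sqrt \<tau> *\<^sub>R diff_col (R+3) y k j) - 2 * U k x)"
      using u(2)[OF k] tau by (intro mult_left_mono) auto
    then show "- (1 / \<tau>) * U k x \<le> 1 / (2 * \<tau>) * (U k (x + sqrt \<tau> *\<^sub>R diff_col (R+3) y k j)
        + U k (x - sqrt \<tau> *\<^sub>R diff_col (R+3) y k j) - 2 * U k x)" by simp
  qed
  then have 2: "- (real CARD('d) / \<tau>) * U k x \<le> (\<Sum>j\<in>UNIV. 1 / (2 * \<tau>) * (U k (x + sqrt \<tau> *\<^sub>R diff_col (R+3) y k j)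
        + U k (x - sqrt \<tau> *\<^sub>R diff_col (R+3) y k j) - 2 * U k x))" by simp
  have 3: "- jump_rate * U k x \<le> jump_op r U y x k"
  proof -
    have "(\<integral>u. indicator {u. r \<le> norm u} u * (- U k x) \<partial>\<nu> y k) \<le> jump_op r U y x k"
      unfolding jump_op_def
      by (rule integral_mono[OF _ large_jump_integrable(1)[OF k r u(1)[OF k] u(4)[OF k]]])
        (use u(2)[OF k] nu_large_jumps(1)[OF k] in \<open>auto simp: indicator_def\<close>)
    moreover have "(\<integral>u. indicator {u. r \<le> norm u} u * (- U k x) \<partial>\<nu> y k)
      = (\<integral>u. indicator {u. r \<le> norm u} u \<partial>\<nu> y k) * (- U k x)" by simp
    moreover have "jump_rate * (- U k x) \<le> (\<integral>u. indicator {u. r \<le> norm u} u \<partial>\<nu> y k) * (- U k x)"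
      using nu_large_jumps(2)[OF k] u(2)[OF k] by (intro mult_right_mono_neg) auto
    ultimately show ?thesis by simp
  qed
  have "(\<Sum>l\<in>{1..n0}. - \<bar>Qb\<bar> * U k x) \<le> switch_part U y x k"
    unfolding switch_part_def
  proof (rule sum_mono)
    fix l assume l: "l \<in> {1..n0}"
    show "- \<bar>Qb\<bar> * U k x \<le> q y k l * (U l x - U k x)"
    proof (cases "l = k")
      case False
      have "0 \<le> q y k l" "q y k l \<le> \<bar>Qb\<bar>" using q_nonneg[OF k l, of y] q_bound[OF k l, of y] False by auto
      then have "- \<bar>Qb\<bar> * U k x \<le> q y k l * (- U k x)" using u(2)[OF k, of x] by (simp add: mult_right_mono)
      also have "\<dots> \<le> q y k l * (U l x - U k x)" using u(2)[OF l] \<open>0 \<le> q y k l\<close> by (intro mult_left_mono) auto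
      finally show ?thesis .
    qed (use u(2)[OF k] in simp)
  qed
  then have 4: "- (real n0 * \<bar>Qb\<bar>) * U k x \<le> switch_part U y x k" by simp
  have "- rate * U k x \<le> - (1 / \<tau>) * U k x + - (real CARD('d) / \<tau>) * U k x + - jump_rate * U k x + - (real n0 * \<bar>Qb\<bar>) * U k x"
    using u(2)[OF k, of x] jump_rate_nonneg
    by (simp add: rate_def jump_rate_def[symmetric] algebra_simps add_divide_distrib)
  also have "\<dots> \<le> G U y x k" unfolding approx_gen_def by (intro add_mono 1 2 3 4)
  finally show ?thesis .
qed

text \<open>The operator is linear and annihilates constants. This turns each lower bound into an
  upper bound for the complement.\<close>

lemma G_compl:
  "G (\<lambda>k x. 1 - U k x) y x k = - G U y x k"
proof -
  have 1: "jump_op r (\<lambda>k x. 1 - U k x) y x k = - jump_op r U y x k"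
    unfolding jump_op_def by (subst Bochner_Integration.integral_minus[symmetric])
      (intro Bochner_Integration.integral_cong, auto simp: algebra_simps)
  have 2: "switch_part (\<lambda>k x. 1 - U k x) y x k = - switch_part U y x k"
    unfolding switch_part_def by (simp add: sum_negf[symmetric] algebra_simps)
  have 3: "(\<Sum>j\<in>(UNIV::'d set). 1 / (2 * \<tau>) * ((1 - U k (x + sqrt \<tau> *\<^sub>R diff_col (R+3) y k j))
        + (1 - U k (x - sqrt \<tau> *\<^sub>R diff_col (R+3) y k j)) - 2 * (1 - U k x)))
     = - (\<Sum>j\<in>UNIV. 1 / (2 * \<tau>) * (U k (x + sqrt \<tau> *\<^sub>R diff_col (R+3) y k j)
        + U k (x - sqrt \<tau> *\<^sub>R diff_col (R+3) y k j) - 2 * U k x))"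
    unfolding sum_negf[symmetric] by (intro sum.cong refl) (simp add: algebra_simps)
  show ?thesis unfolding approx_gen_def 1 2 3 by (simp add: algebra_simps)
qed

lemma G_le:
  assumes U: "unit_valued U" and k: "k \<in> {1..n0}"
  shows "G U y x k \<le> rate * (1 - U k x)"
  using G_ge[OF unit_valued_compl[OF U] k, of x y] unfolding G_compl by simp

lemma abs_G_le:
  assumes U: "unit_valued U" and k: "k \<in> {1..n0}"
  shows "\<bar>G U y x k\<bar> \<le> rate"
proof -
  have "rate * (1 - U k x) \<le> rate * 1" "rate * U k x \<le> rate * 1"
    using unit_valuedD[OF U k] rate_nonneg by (intro mult_left_mono; simp)+
  then show ?thesis using G_ge[OF U k, of x y] G_le[OF U k, of y x] by simp
qed

definition step :: "(nat \<Rightarrow> real^'d \<Rightarrow> real) \<Rightarrow> real^'d \<Rightarrow> real^'d \<Rightarrow> nat \<Rightarrow> real" where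
  "step U y x k = U k x + h * G U y x k"

text \<open>\<open>h * rate \<le> 1\<close> leaves a nonnegative weight on the current value, so
  nonnegativity is preserved; the upper bound is the lower bound for the complement.\<close>

lemma step_unit:
  assumes U: "unit_valued U" and k: "k \<in> {1..n0}"
  shows "0 \<le> step U y x k" "step U y x k \<le> 1"
proof -
  have *: "0 \<le> step U y x k" if U: "unit_valued U" for U
  proof -
    have "h * (- rate * U k x) \<le> h * G U y x k" using G_ge[OF U k] h by (intro mult_left_mono) auto
    moreover have "h * rate * U k x \<le> 1 * U k x" using h_rate unit_valuedD[OF U k] by (intro mult_right_mono) auto
    ultimately show ?thesis unfolding step_def by simp
  qed
  show "0 \<le> step U y x k" by (rule *[OF U])
  have "step (\<lambda>k x. 1 - U k x) y x k = 1 - step U y x k" unfolding step_def G_compl by simp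
  with *[OF unit_valued_compl[OF U]] show "step U y x k \<le> 1" by simp
qed

definition lipschitz_valued :: "real \<Rightarrow> (nat \<Rightarrow> real^'d \<Rightarrow> real) \<Rightarrow> bool" where
  "lipschitz_valued K U \<longleftrightarrow> (\<forall>k\<in>{1..n0}. \<forall>x z. U k x \<le> U k z + K * norm (x - z))"

lemma lipschitz_valuedD:
  assumes "lipschitz_valued K U" "k \<in> {1..n0}"
  shows "\<bar>U k x - U k z\<bar> \<le> K * norm (x - z)"
proof -
  have "U k x \<le> U k z + K * norm (x - z)" "U k z \<le> U k x + K * norm (z - x)"
    using assms unfolding lipschitz_valued_def by blast+
  then show ?thesis by (simp add: norm_minus_commute abs_le_iff)
qed

lemma lipschitz_valued_measurable:
  assumes "lipschitz_valued K U" "k \<in> {1..n0}"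
  shows "U k \<in> borel_measurable borel"
proof (intro borel_measurable_continuous_onI continuous_at_imp_continuous_on ballI)
  fix x :: "real^'d"
  have "((\<lambda>z. K * norm (z - x)) \<longlongrightarrow> K * norm (x - x)) (at x)"
    by (intro tendsto_mult tendsto_const tendsto_norm tendsto_diff tendsto_ident_at)
  then have "((\<lambda>z. U k z - U k x) \<longlongrightarrow> 0) (at x)"
    by (intro Lim_null_comparison[of "\<lambda>z. U k z - U k x" "\<lambda>z. K * norm (z - x)"] always_eventually)
      (use lipschitz_valuedD[OF assms] in auto)
  then show "isCont (U k) x" unfolding isCont_def by (simp add: LIM_zero_iff)
qed

text \<open>The supremum over uncountably many frozen points need not be measurable by itself; a
  Lipschitz constant independent of \<open>y\<close> passes to the supremum and settles this. The
  constant deteriorates with every step, but only its existence is used.\<close>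

lemma step_lipschitz:
  assumes U: "unit_valued U" and L: "lipschitz_valued K U" and k: "k \<in> {1..n0}"
  shows "step U y x k \<le> step U y z k + (K + 2 * h * rate * K) * norm (x - z)"
proof -
  note l = lipschitz_valuedD[OF L]
  let ?e = "norm (x - z)"
  have Ke: "0 \<le> K * ?e" using l[OF k, of x z] by linarith
  have l': "U k (x + v) \<le> U k (z + v) + K * ?e" for v
    using l[OF k, of "x + v" "z + v"] by auto
  have l0: "U k z \<le> U k x + K * ?e" using l[OF k, of x z] by auto
  have 1: "1 / \<tau> * (U k (x + \<tau> *\<^sub>R drift r (R+3) y k) - U k x) \<le>
      1 / \<tau> * (U k (z + \<tau> *\<^sub>R drift r (R+3) y k) - U k z) + 1 / \<tau> * (2 * (K * ?e))"
    unfolding distrib_left[symmetric] using l0 l'[of "\<tau> *\<^sub>R drift r (R+3) y k"] tau by (intro mult_left_mono) auto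
  have "(\<Sum>j\<in>UNIV. 1 / (2 * \<tau>) * (U k (x + sqrt \<tau> *\<^sub>R diff_col (R+3) y k j)
        + U k (x - sqrt \<tau> *\<^sub>R diff_col (R+3) y k j) - 2 * U k x)) \<le>
      (\<Sum>j\<in>UNIV. 1 / (2 * \<tau>) * (U k (z + sqrt \<tau> *\<^sub>R diff_col (R+3) y k j)
        + U k (z - sqrt \<tau> *\<^sub>R diff_col (R+3) y k j) - 2 * U k z) + 1 / (2 * \<tau>) * (4 * (K * ?e)))"
  proof (rule sum_mono)
    fix j
    show "1 / (2 * \<tau>) * (U k (x + sqrt \<tau> *\<^sub>R diff_col (R+3) y k j)
        + U k (x - sqrt \<tau> *\<^sub>R diff_col (R+3) y k j) - 2 * U k x) \<le> 1 / (2 * \<tau>) * (U k (z + sqrt \<tau> *\<^sub>R diff_col (R+3) y k j)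
        + U k (z - sqrt \<tau> *\<^sub>R diff_col (R+3) y k j) - 2 * U k z) + 1 / (2 * \<tau>) * (4 * (K * ?e))"
      unfolding distrib_left[symmetric]
      using l0 l'[of "sqrt \<tau> *\<^sub>R diff_col (R+3) y k j"] l'[of "- (sqrt \<tau> *\<^sub>R diff_col (R+3) y k j)"] tau
      by (intro mult_left_mono) auto
  qed
  then have 2: "(\<Sum>j\<in>UNIV. 1 / (2 * \<tau>) * (U k (x + sqrt \<tau> *\<^sub>R diff_col (R+3) y k j)
        + U k (x - sqrt \<tau> *\<^sub>R diff_col (R+3) y k j) - 2 * U k x)) \<le>
      (\<Sum>j\<in>UNIV. 1 / (2 * \<tau>) * (U k (z + sqrt \<tau> *\<^sub>R diff_col (R+3) y k j)
        + U k (z - sqrt \<tau> *\<^sub>R diff_col (R+3) y k j) - 2 * U k z)) + real CARD('d) / \<tau> * (2 * (K * ?e))"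
    by (simp add: sum.distrib field_simps)
  have 3: "jump_op r U y x k \<le> jump_op r U y z k + jump_rate * (2 * (K * ?e))"
  proof -
    note u = unit_valuedD[OF U k]
    note i = large_jump_integrable(1)[OF k r u(1) u(4)] nu_large_jumps(1)[OF k]
    have "jump_op r U y x k \<le> (\<integral>u. indicator {u. r \<le> norm u} u * (U k (z + u) - U k z) + indicator {u. r \<le> norm u} u * (2 * (K * ?e)) \<partial>\<nu> y k)"
      unfolding jump_op_def
    proof (rule integral_mono)
      show "indicator {u. r \<le> norm u} u * (U k (x + u) - U k x) \<le>
        indicator {u. r \<le> norm u} u * (U k (z + u) - U k z) + indicator {u. r \<le> norm u} u * (2 * (K * ?e))" for u
        using l0 l'[of u] by (auto simp: indicator_def)
    qed (intro i Bochner_Integration.integrable_add integrable_mult_left)+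
    also have "\<dots> = jump_op r U y z k + (\<integral>u. indicator {u. r \<le> norm u} u \<partial>\<nu> y k) * (2 * (K * ?e))"
      using i unfolding jump_op_def by simp
    also have "(\<integral>u. indicator {u. r \<le> norm u} u \<partial>\<nu> y k) * (2 * (K * ?e)) \<le> jump_rate * (2 * (K * ?e))"
      using nu_large_jumps(2)[OF k] Ke by (intro mult_right_mono) auto
    finally show ?thesis by simp
  qed
  have "switch_part U y x k \<le> (\<Sum>l\<in>{1..n0}. q y k l * (U l z - U k z) + \<bar>Qb\<bar> * (2 * (K * ?e)))"
    unfolding switch_part_def
  proof (rule sum_mono)
    fix l' assume l': "l' \<in> {1..n0}"
    have "q y k l' * ((U l' x - U k x) - (U l' z - U k z)) \<le> \<bar>q y k l'\<bar> * \<bar>(U l' x - U k x) - (U l' z - U k z)\<bar>"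
      by (metis abs_ge_self abs_mult)
    also have "\<dots> \<le> \<bar>Qb\<bar> * (2 * (K * ?e))"
      using q_bound[OF k l', of y] l[OF k, of x z] l[OF l', of x z] by (intro mult_mono) auto
    finally show "q y k l' * (U l' x - U k x) \<le> q y k l' * (U l' z - U k z) + \<bar>Qb\<bar> * (2 * (K * ?e))"
      by (simp add: algebra_simps)
  qed
  then have 4: "switch_part U y x k \<le> switch_part U y z k + real n0 * \<bar>Qb\<bar> * (2 * (K * ?e))"
    by (simp add: sum.distrib switch_part_def)
  have "1 / \<tau> * (2 * (K * ?e)) + real CARD('d) / \<tau> * (2 * (K * ?e)) + jump_rate * (2 * (K * ?e)) + real n0 * \<bar>Qb\<bar> * (2 * (K * ?e))
    \<le> rate * (2 * (K * ?e))"
    unfolding distrib_right[symmetric]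
    using Ke jump_rate_nonneg by (intro mult_right_mono) (auto simp: rate_def jump_rate_def[symmetric] add_divide_distrib)
  with 1 2 3 4 have "G U y x k \<le> G U y z k + rate * (2 * (K * ?e))" unfolding approx_gen_def by linarith
  then have "h * G U y x k \<le> h * (G U y z k + rate * (2 * (K * ?e)))" using h by (intro mult_left_mono) auto
  then show ?thesis using l[OF k, of x z] unfolding step_def by (simp add: algebra_simps)
qed

text \<open>The maximum with this function makes the iterates equal to 1 beyond radius
  \<open>R + 1\<close>; their complements then have compact support and can be mollified into test
  functions.\<close>

definition cutoff :: "real^'d \<Rightarrow> real" where "cutoff x = min 1 (max 0 (norm x - R))"

lemma cutoff: "0 \<le> cutoff x" "cutoff x \<le> 1" "norm x \<le> R \<Longrightarrow> cutoff x = 0" "R + 1 \<le> norm x \<Longrightarrow> cutoff x = 1"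
  "cutoff x \<le> cutoff z + norm (x - z)"
  using norm_triangle_ineq2[of x z] norm_ge_zero[of "x - z"] unfolding cutoff_def min_def max_def
  by (auto simp del: norm_ge_zero)

text \<open>A Lipschitz substitute for the constraint that \<open>y\<close> be close to
  \<open>x\<close>. It vanishes within \<open>\<epsilon>\<close>, as the mollification requires, and
  is at least 1 beyond \<open>2 * \<epsilon>\<close>, where it outweighs any value of a step in the
  unit interval.\<close>

definition penalty :: "real^'d \<Rightarrow> real^'d \<Rightarrow> real" where
  "penalty x y = max 0 (norm (x - y) / \<epsilon> - 1)"

lemma penalty: "0 \<le> penalty x y" "norm (x - y) \<le> \<epsilon> \<Longrightarrow> penalty x y = 0" "2 * \<epsilon> \<le> norm (x - y) \<Longrightarrow> 1 \<le> penalty x y"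
  "penalty z y \<le> penalty x y + norm (x - z) / \<epsilon>"
proof -
  have "norm (z - y) / \<epsilon> \<le> (norm (x - y) + norm (x - z)) / \<epsilon>"
    using norm_triangle_ineq4[of "x - y" "x - z"] eps by (intro divide_right_mono) auto
  then show "penalty z y \<le> penalty x y + norm (x - z) / \<epsilon>"
  proof -
    have *: "max 0 A \<le> max 0 B + C" if "A \<le> B + C" "0 \<le> C" for A B C :: real
      using that by (auto simp: max_def)
    show ?thesis
      unfolding penalty_def using \<open>norm (z - y) / \<epsilon> \<le> _\<close> eps by (intro *) (auto simp: add_divide_distrib)
  qed
qed (use eps in \<open>auto simp: penalty_def divide_simps\<close>)

definition shaken :: "(nat \<Rightarrow> real^'d \<Rightarrow> real) \<Rightarrow> nat \<Rightarrow> real^'d \<Rightarrow> real" where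
  "shaken U k x = max (cutoff x) (SUP y. step U y x k - penalty x y)"

definition admissible :: "(nat \<Rightarrow> real^'d \<Rightarrow> real) \<Rightarrow> bool" where
  "admissible U \<longleftrightarrow> unit_valued U \<and> (\<exists>K\<ge>0. lipschitz_valued K U) \<and> (\<forall>k\<in>{1..n0}. \<forall>x. cutoff x \<le> U k x)"

lemma shaken_ge:
  assumes U: "unit_valued U" and k: "k \<in> {1..n0}"
  shows "step U y x k - penalty x y \<le> shaken U k x"
proof -
  have "step U y x k - penalty x y \<le> (SUP y. step U y x k - penalty x y)"
    using step_unit(2)[OF U k] penalty(1) by (intro cSUP_upper bdd_aboveI2[of _ _ 1]) (auto simp: diff_le_eq add_increasing2)
  then show ?thesis by (simp add: shaken_def)
qed

lemma shaken_le:
  assumes "cutoff x \<le> c" "\<And>y. step U y x k - penalty x y \<le> c"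
  shows "shaken U k x \<le> c"
  unfolding shaken_def using assms by (auto intro!: cSUP_least)

lemma admissible_shaken:
  assumes "admissible U" shows "admissible (shaken U)"
proof -
  obtain K where U: "unit_valued U" and K: "0 \<le> K" "lipschitz_valued K U"
    using assms by (auto simp: admissible_def)
  let ?K = "1 + (K + 2 * h * rate * K) + 1 / \<epsilon>"
  have K': "0 \<le> K + 2 * h * rate * K" using K h rate_nonneg by simp
  have L: "lipschitz_valued ?K (shaken U)"
    unfolding lipschitz_valued_def
  proof (intro ballI allI shaken_le)
    fix k and x z :: "real^'d" assume k: "k \<in> {1..n0}"
    have e: "norm (x - z) + (K + 2 * h * rate * K) * norm (x - z) + norm (x - z) / \<epsilon> = ?K * norm (x - z)"
      by (simp add: algebra_simps)
    have nn: "0 \<le> (K + 2 * h * rate * K) * norm (x - z)" "0 \<le> norm (x - z) / \<epsilon>" using K' eps by auto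
    show "cutoff x \<le> shaken U k z + ?K * norm (x - z)"
      using cutoff(5)[of x z] nn unfolding e[symmetric] shaken_def by linarith
    fix y
    show "step U y x k - penalty x y \<le> shaken U k z + ?K * norm (x - z)"
      using step_lipschitz[OF U K(2) k, of y x z] penalty(4)[of z y x] shaken_ge[OF U k, of y z] nn norm_ge_zero[of "x - z"]
      unfolding e[symmetric] by linarith
  qed
  have "0 \<le> shaken U k x \<and> shaken U k x \<le> 1" if k: "k \<in> {1..n0}" for k x
  proof
    show "0 \<le> shaken U k x" using cutoff(1)[of x] by (simp add: shaken_def)
    show "shaken U k x \<le> 1"
      using step_unit(2)[OF U k] penalty(1) by (intro shaken_le cutoff) (auto simp: diff_le_eq add_increasing2)
  qed
  then have "unit_valued (shaken U)"
    unfolding unit_valued_def using lipschitz_valued_measurable[OF L] by blast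
  moreover have "0 \<le> ?K" using K' eps by simp
  ultimately show ?thesis unfolding admissible_def using L by (auto simp: shaken_def)
qed

text \<open>Regularity in time. From below, the choice \<open>y = x\<close> carries no penalty; from
  above, the penalty only helps and the cut-off already lies below \<open>U\<close>.\<close>

lemma shaken_diff:
  assumes "admissible U" and k: "k \<in> {1..n0}"
  shows "\<bar>shaken U k x - U k x\<bar> \<le> h * rate"
proof -
  have U: "unit_valued U" and c: "cutoff x \<le> U k x" using assms by (auto simp: admissible_def)
  have hG: "\<bar>h * G U y x k\<bar> \<le> h * rate" for y
    using abs_G_le[OF U k, of y x] h by (simp add: abs_mult mult_left_mono)
  have "shaken U k x \<le> U k x + h * rate"
  proof (rule shaken_le)
    show "cutoff x \<le> U k x + h * rate" using c h rate_nonneg by (simp add: add_increasing2)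
    show "step U y x k - penalty x y \<le> U k x + h * rate" for y
      using hG[of y] penalty(1)[of x y] unfolding step_def by linarith
  qed
  moreover have "U k x - h * rate \<le> shaken U k x"
    using shaken_ge[OF U k, of x x] hG[of x] penalty(2)[of x x] eps unfolding step_def by simp
  ultimately show ?thesis by linarith
qed

definition iterate :: "(nat \<Rightarrow> real^'d \<Rightarrow> real) \<Rightarrow> nat \<Rightarrow> nat \<Rightarrow> real^'d \<Rightarrow> real" where
  "iterate g n = (shaken ^^ n) (\<lambda>k x. max (cutoff x) (g k x))"

lemma iterate_simps [simp]:
  "iterate g 0 = (\<lambda>k x. max (cutoff x) (g k x))" "iterate g (Suc n) = shaken (iterate g n)"
  by (simp_all add: iterate_def)

lemma admissible_iterate:
  assumes "lipschitz_valued K g" "0 \<le> K" "\<And>k x. k \<in> {1..n0} \<Longrightarrow> 0 \<le> g k x \<and> g k x \<le> 1"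
  shows "admissible (iterate g n)"
proof (induction n)
  case 0
  have L: "lipschitz_valued (K + 1) (\<lambda>k x. max (cutoff x) (g k x))"
    unfolding lipschitz_valued_def
  proof (intro ballI allI max.boundedI)
    fix k and x z :: "real^'d" assume k: "k \<in> {1..n0}"
    have "0 \<le> K * norm (x - z)" "0 \<le> norm (x - z)" using assms(2) by auto
    then show "cutoff x \<le> max (cutoff z) (g k z) + (K + 1) * norm (x - z)"
      "g k x \<le> max (cutoff z) (g k z) + (K + 1) * norm (x - z)"
      using cutoff(5)[of x z] lipschitz_valuedD[OF assms(1) k, of x z]
      unfolding distrib_right mult_1 max_def abs_le_iff by (auto simp del: norm_ge_zero)
  qed
  have "unit_valued (\<lambda>k x. max (cutoff x) (g k x))"
    unfolding unit_valued_def using lipschitz_valued_measurable[OF L] cutoff(1,2) assms(3)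
    by (auto simp: max_def)
  then show ?case using L assms(2) by (auto simp: admissible_def intro!: exI[of _ "K + 1"])
qed (simp add: admissible_shaken)

end

section \<open>Upper bounds from mollified iterates\<close>

lemma (in switching) bounded_test_facts:
  assumes W: "bounded_test M R' W" and out: "\<And>k. k \<notin> {1..n0} \<Longrightarrow> W k = (\<lambda>_. 0)"
  shows "(\<lambda>(x, k). W k x) \<in> test_A n0" "(\<lambda>(x, k). W k x) \<in> borel_measurable borel"
    "e \<in> UNIV \<times> {1..n0} \<Longrightarrow> \<bar>(\<lambda>(x, k). W k x) e\<bar> \<le> M"
proof -
  have W': "smooth_bounded (W k)" "\<And>x. \<bar>W k x\<bar> \<le> M" "\<And>x. x \<notin> cball 0 R' \<Longrightarrow> W k x = 0" if "k \<in> {1..n0}" for k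
    using W that unfolding bounded_test_def by blast+
  show "(\<lambda>(x, k). W k x) \<in> test_A n0"
    unfolding test_A_def using smooth_bounded_imp_C_c_inf[OF W'(1,3)] by auto
  show "(\<lambda>(x, k). W k x) \<in> borel_measurable borel"
  proof (rule borel_measurable_pair_countable)
    show "W k \<in> borel_measurable borel" for k
      using smooth_bounded_measurable[OF W'(1), of k "[]"] out[of k] by (cases "k \<in> {1..n0}") auto
  qed
  show "e \<in> UNIV \<times> {1..n0} \<Longrightarrow> \<bar>(\<lambda>(x, k). W k x) e\<bar> \<le> M" using W'(2) by auto
qed

locale mollified_scheme = scheme n0 \<epsilon>0 H C\<nu> Qb a \<sigma> b \<nu> q \<rho> \<tau> r h \<epsilon> R
  for n0 :: nat and \<epsilon>0 H C\<nu> Qb :: real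
    and a \<sigma> :: "real^'d::finite \<Rightarrow> nat \<Rightarrow> real^'d^'d"
    and b :: "real^'d \<Rightarrow> nat \<Rightarrow> real^'d"
    and \<nu> :: "real^'d \<Rightarrow> nat \<Rightarrow> (real^'d) measure"
    and q :: "real^'d \<Rightarrow> nat \<Rightarrow> nat \<Rightarrow> real"
    and \<rho> :: "real \<Rightarrow> real" and \<tau> r h \<epsilon> R :: real +
  fixes \<eta> :: "real^'d \<Rightarrow> real" and M\<eta> :: real
  assumes eta_smooth: "smooth_bounded \<eta>" and eta_nonneg: "\<And>x. 0 \<le> \<eta> x"
    and eta_supp: "\<And>x. \<epsilon> \<le> norm x \<Longrightarrow> \<eta> x = 0"
    and eta_integral: "(\<integral>x. \<eta> x \<partial>lborel) = 1" and eta_integrable: "integrable lborel \<eta>"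
    and eta_bounds: "\<And>x. \<bar>\<eta> x\<bar> \<le> M\<eta>" "\<And>i x. \<bar>iter_partial [i] \<eta> x\<bar> \<le> M\<eta>"
      "\<And>i j x. \<bar>iter_partial [i,j] \<eta> x\<bar> \<le> M\<eta>" "\<And>i j l x. \<bar>iter_partial [i,j,l] \<eta> x\<bar> \<le> M\<eta>"
    and eps_le: "\<epsilon> \<le> 1"
begin

lemma eta_measurable [measurable]: "\<eta> \<in> borel_measurable borel"
  using smooth_bounded_measurable[OF eta_smooth, of "[]"] by simp

definition average :: "(nat \<Rightarrow> real^'d \<Rightarrow> real) \<Rightarrow> nat \<Rightarrow> real^'d \<Rightarrow> real" where
  "average \<zeta> k x = (\<integral>w. \<eta> w * \<zeta> k (x - w) \<partial>lborel)"

lemma average_integrable: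
  assumes "unit_valued \<zeta>" and k: "k \<in> {1..n0}"
  shows "integrable lborel (\<lambda>w. \<eta> w * \<zeta> k (x - w))"
proof (rule Bochner_Integration.integrable_bound[OF eta_integrable])
  note u = unit_valuedD[OF assms]
  show "(\<lambda>w. \<eta> w * \<zeta> k (x - w)) \<in> borel_measurable lborel" using u(1) by measurable
  show "AE w in lborel. norm (\<eta> w * \<zeta> k (x - w)) \<le> norm (\<eta> w)"
    using u(4) eta_nonneg by (intro AE_I2) (auto simp: abs_mult intro!: mult_left_le)
qed

lemma average_has_integral:
  assumes "unit_valued \<zeta>" and k: "k \<in> {1..n0}"
  shows "has_bochner_integral lborel (\<lambda>w. \<eta> w * \<zeta> k (x - w + v)) (average \<zeta> k (x + v))"
  using average_integrable[OF assms, of "x + v"]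
  by (auto simp: has_bochner_integral_iff average_def algebra_simps)

text \<open>Fubini for the mollifier and the jump measure; absolute integrability holds because the
  jumps of size at least \<open>r\<close> have finite mass and the function takes values in the unit
  interval.\<close>

lemma jump_op_average:
  assumes U: "unit_valued \<zeta>" and k: "k \<in> {1..n0}"
  shows "has_bochner_integral lborel (\<lambda>w. \<eta> w * jump_op r \<zeta> y (x - w) k) (jump_op r (average \<zeta>) y x k)"
proof -
  note u = unit_valuedD[OF U k]
  interpret nu: sigma_finite_measure "\<nu> y k" by (rule nu_sfin[OF k])
  interpret pair: pair_sigma_finite lborel "\<nu> y k" ..
  let ?f = "\<lambda>w u. \<eta> w * (indicator {u. r \<le> norm u} u * (\<zeta> k (x - w + u) - \<zeta> k (x - w)))"
  have sets: "sets (lborel \<Otimes>\<^sub>M \<nu> y k) = sets (borel \<Otimes>\<^sub>M borel)"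
    by (intro sets_pair_measure_cong) (simp_all add: sets_nu[OF k])
  note [measurable] = u(1)
  have "(\<lambda>(w, u). ?f w u) \<in> borel_measurable (borel \<Otimes>\<^sub>M borel)"
    unfolding case_prod_beta by measurable
  then have m: "(\<lambda>(w, u). ?f w u) \<in> borel_measurable (lborel \<Otimes>\<^sub>M \<nu> y k)"
    by (simp add: measurable_cong_sets[OF sets refl])
  have i: "integrable (\<nu> y k) (?f w)" for w
    by (intro integrable_mult_right large_jump_integrable(1)[OF k r u(1) u(4)])
  have int: "integrable (lborel \<Otimes>\<^sub>M \<nu> y k) (\<lambda>(w, u). ?f w u)"
  proof (rule pair.Fubini_integrable[OF m])
    show "AE w in lborel. integrable (\<nu> y k) (\<lambda>u. case (w, u) of (w, u) \<Rightarrow> ?f w u)" using i by simp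
    show "integrable lborel (\<lambda>w. \<integral>u. norm (case (w, u) of (w, u) \<Rightarrow> ?f w u) \<partial>\<nu> y k)"
    proof (rule Bochner_Integration.integrable_bound[OF integrable_mult_left[OF eta_integrable, where c="jump_rate"]])
      have "(\<lambda>w. \<integral>u. norm (?f w u) \<partial>\<nu> y k) \<in> borel_measurable lborel"
        by (rule nu.borel_measurable_lebesgue_integral) (use m in measurable)
      then show "(\<lambda>w. \<integral>u. norm (case (w, u) of (w, u) \<Rightarrow> ?f w u) \<partial>\<nu> y k) \<in> borel_measurable lborel" by simp
      have "norm (\<integral>u. norm (?f w u) \<partial>\<nu> y k) \<le> norm (\<eta> w * jump_rate)" for w
      proof -
        have "(\<integral>u. norm (?f w u) \<partial>\<nu> y k) \<le> (\<integral>u. \<eta> w * indicator {u. r \<le> norm u} u \<partial>\<nu> y k)"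
        proof (rule integral_mono)
          show "norm (?f w u) \<le> \<eta> w * indicator {u. r \<le> norm u} u" for u
            using u(2,3)[of "x - w + u"] u(2,3)[of "x - w"] eta_nonneg[of w]
            by (auto simp: indicator_def abs_mult abs_le_iff intro!: mult_left_le)
        qed (intro integrable_norm i integrable_mult_right nu_large_jumps(1)[OF k])+
        also have "\<dots> = \<eta> w * (\<integral>u. indicator {u. r \<le> norm u} u \<partial>\<nu> y k)" by simp
        also have "\<dots> \<le> \<eta> w * jump_rate" using nu_large_jumps(2)[OF k] eta_nonneg by (intro mult_left_mono)
        finally show ?thesis using eta_nonneg[of w] jump_rate_nonneg by simp
      qed
      then show "AE w in lborel. norm (\<integral>u. norm (case (w, u) of (w, u) \<Rightarrow> ?f w u) \<partial>\<nu> y k) \<le> norm (\<eta> w * jump_rate)"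
        by (intro AE_I2) simp
    qed
  qed
  have 1: "(\<integral>u. ?f w u \<partial>\<nu> y k) = \<eta> w * jump_op r \<zeta> y (x - w) k" for w
    unfolding jump_op_def by simp
  have 2: "(\<integral>w. ?f w u \<partial>lborel) = indicator {u. r \<le> norm u} u * (average \<zeta> k (x + u) - average \<zeta> k x)" for u
  proof -
    have "has_bochner_integral lborel (\<lambda>w. indicator {u. r \<le> norm u} u * (\<eta> w * \<zeta> k (x - w + u) - \<eta> w * \<zeta> k (x - w + 0)))
      (indicator {u. r \<le> norm u} u * (average \<zeta> k (x + u) - average \<zeta> k (x + 0)))"
      by (intro has_bochner_integral_mult_right has_bochner_integral_diff average_has_integral U k)
    then show ?thesis by (simp add: has_bochner_integral_iff algebra_simps)
  qed
  show ?thesis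
    unfolding has_bochner_integral_iff
  proof
    show "integrable lborel (\<lambda>w. \<eta> w * jump_op r \<zeta> y (x - w) k)"
      using pair.integrable_fst[OF int] unfolding 1[symmetric] by (simp only: prod.case)
    have "(\<integral>w. \<eta> w * jump_op r \<zeta> y (x - w) k \<partial>lborel) = (\<integral>w. (\<integral>u. ?f w u \<partial>\<nu> y k) \<partial>lborel)" unfolding 1 ..
    also have "\<dots> = (\<integral>u. (\<integral>w. ?f w u \<partial>lborel) \<partial>\<nu> y k)" by (rule pair.Fubini_integral[OF int, symmetric])
    also have "\<dots> = jump_op r (average \<zeta>) y x k" unfolding 2 jump_op_def ..
    finally show "(\<integral>w. \<eta> w * jump_op r \<zeta> y (x - w) k \<partial>lborel) = jump_op r (average \<zeta>) y x k" .
  qed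
qed

text \<open>With coefficients frozen at \<open>y\<close> the operator is translation invariant in
  \<open>x\<close>, hence commutes with averaging over translates.\<close>

lemma G_average:
  assumes U: "unit_valued \<zeta>" and k: "k \<in> {1..n0}"
  shows "has_bochner_integral lborel (\<lambda>w. \<eta> w * G \<zeta> y (x - w) k) (G (average \<zeta>) y x k)"
proof -
  note A = average_has_integral[OF U]
  have A0: "has_bochner_integral lborel (\<lambda>w. \<eta> w * \<zeta> l (x - w)) (average \<zeta> l x)" if "l \<in> {1..n0}" for l
    using A[OF that, of x 0] by simp
  have Am: "has_bochner_integral lborel (\<lambda>w. \<eta> w * \<zeta> k (x - w - v)) (average \<zeta> k (x - v))" for v
    using A[OF k, of x "- v"] by simp
  let ?s = "\<lambda>j. sqrt \<tau> *\<^sub>R diff_col (R+3) y k j"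
  have sw: "has_bochner_integral lborel (\<lambda>w. \<Sum>l\<in>{1..n0}. q y k l * (\<eta> w * \<zeta> l (x - w) - \<eta> w * \<zeta> k (x - w)))
      (\<Sum>l\<in>{1..n0}. q y k l * (average \<zeta> l x - average \<zeta> k x))"
    by (intro has_bochner_integral_sum has_bochner_integral_mult_right has_bochner_integral_diff A0 k)
  have "has_bochner_integral lborel (\<lambda>w.
      1 / \<tau> * (\<eta> w * \<zeta> k (x - w + \<tau> *\<^sub>R drift r (R+3) y k) - \<eta> w * \<zeta> k (x - w))
      + (\<Sum>j\<in>UNIV. 1 / (2 * \<tau>) * (\<eta> w * \<zeta> k (x - w + ?s j) + \<eta> w * \<zeta> k (x - w - ?s j) - 2 * (\<eta> w * \<zeta> k (x - w))))
      + \<eta> w * jump_op r \<zeta> y (x - w) k + (\<Sum>l\<in>{1..n0}. q y k l * (\<eta> w * \<zeta> l (x - w) - \<eta> w * \<zeta> k (x - w))))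
    (G (average \<zeta>) y x k)"
    unfolding approx_gen_def switch_part_def
    by (intro has_bochner_integral_add has_bochner_integral_sum has_bochner_integral_mult_right
        has_bochner_integral_diff A A0 Am k jump_op_average U sw)
  moreover have "1 / \<tau> * (\<eta> w * \<zeta> k (x - w + \<tau> *\<^sub>R drift r (R+3) y k) - \<eta> w * \<zeta> k (x - w))
      + (\<Sum>j\<in>UNIV. 1 / (2 * \<tau>) * (\<eta> w * \<zeta> k (x - w + ?s j) + \<eta> w * \<zeta> k (x - w - ?s j) - 2 * (\<eta> w * \<zeta> k (x - w))))
      + \<eta> w * jump_op r \<zeta> y (x - w) k + (\<Sum>l\<in>{1..n0}. q y k l * (\<eta> w * \<zeta> l (x - w) - \<eta> w * \<zeta> k (x - w)))
      = \<eta> w * G \<zeta> y (x - w) k" for w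
    unfolding approx_gen_def switch_part_def distrib_left sum_distrib_left
    by (intro arg_cong2[of _ _ _ _ "(+)"] sum.cong refl) (simp_all add: algebra_simps)
  ultimately show ?thesis by simp
qed

text \<open>Built from the mollifier and \<open>R\<close> only; it involves neither the number of
  steps nor \<open>\<tau>\<close>, \<open>r\<close>, \<open>h\<close>, which may therefore be chosen
  after it.\<close>

definition M\<^sub>Z :: real where "M\<^sub>Z = M\<eta> * measure lborel (cball 0 (R + 1) :: (real^'d) set)"

text \<open>Derivatives fall on the mollifier, so \<open>\<zeta>\<close> contributes only its
  supremum \<open>s\<close>; the support grows by at most \<open>\<epsilon> \<le> 1\<close>.\<close>

lemma bounded_test_conv:
  assumes \<zeta>: "\<And>k. k \<in> {1..n0} \<Longrightarrow> convolvable (\<zeta> k) (R + 1) s"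
  shows "bounded_test (s * M\<^sub>Z) (R + 2) (\<lambda>k. if k \<in> {1..n0} then conv (\<zeta> k) \<eta> else (\<lambda>_. 0))"
  unfolding bounded_test_def
proof (intro ballI conjI allI impI)
  fix k assume k: "k \<in> {1..n0}"
  have "\<bar>iter_partial is (conv (\<zeta> k) \<eta>) x\<bar> \<le> s * M\<^sub>Z" if "\<And>x. \<bar>iter_partial is \<eta> x\<bar> \<le> M\<eta>" for "is" x
    unfolding iter_partial_conv[OF \<zeta>[OF k] eta_smooth] M\<^sub>Z_def
    using convolvable.abs_conv_le[OF \<zeta>[OF k] that smooth_bounded_measurable[OF eta_smooth], of x] by (simp add: mult_ac)
  note B = this
  show "smooth_bounded ((if k \<in> {1..n0} then conv (\<zeta> k) \<eta> else (\<lambda>_. 0)))"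
    using k smooth_bounded_conv[OF \<zeta>[OF k] eta_smooth] by simp
  show "\<bar>(if k \<in> {1..n0} then conv (\<zeta> k) \<eta> else (\<lambda>_. 0)) x\<bar> \<le> s * M\<^sub>Z" for x
    using B[of "[]" x] eta_bounds(1) k by simp
  show "\<bar>iter_partial [i] (if k \<in> {1..n0} then conv (\<zeta> k) \<eta> else (\<lambda>_. 0)) x\<bar> \<le> s * M\<^sub>Z" for i x
    using B[of "[i]" x] eta_bounds(2) k by (simp del: iter_partial.simps)
  show "\<bar>iter_partial [i, j] (if k \<in> {1..n0} then conv (\<zeta> k) \<eta> else (\<lambda>_. 0)) x\<bar> \<le> s * M\<^sub>Z" for i j x
    using B[of "[i, j]" x] eta_bounds(3) k by (simp del: iter_partial.simps)
  show "\<bar>iter_partial [i, j, l] (if k \<in> {1..n0} then conv (\<zeta> k) \<eta> else (\<lambda>_. 0)) x\<bar> \<le> s * M\<^sub>Z" for i j l x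
    using B[of "[i, j, l]" x] eta_bounds(4) k by (simp del: iter_partial.simps)
  fix x :: "real^'d" assume x: "x \<notin> cball 0 (R + 2)"
  have "\<zeta> k y * \<eta> (x - y) = 0" for y
  proof (cases "y \<in> cball 0 (R + 1)")
    case True
    then have "\<epsilon> \<le> norm (x - y)" using x eps_le norm_triangle_ineq2[of x y] by simp
    then show ?thesis using eta_supp by simp
  qed (simp add: convolvable.supp[OF \<zeta>[OF k]])
  then have "conv (\<zeta> k) \<eta> x = 0" unfolding conv_def by (simp only: Bochner_Integration.integral_zero)
  then show "(if k \<in> {1..n0} then conv (\<zeta> k) \<eta> else (\<lambda>_. 0)) x = 0"
    using k by simp
qed

end

locale scheme_data = mollified_scheme n0 \<epsilon>0 H C\<nu> Qb a \<sigma> b \<nu> q \<rho> \<tau> r h \<epsilon> R \<eta> M\<eta>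
  for n0 :: nat and \<epsilon>0 H C\<nu> Qb :: real
    and a \<sigma> :: "real^'d::finite \<Rightarrow> nat \<Rightarrow> real^'d^'d"
    and b :: "real^'d \<Rightarrow> nat \<Rightarrow> real^'d"
    and \<nu> :: "real^'d \<Rightarrow> nat \<Rightarrow> (real^'d) measure"
    and q :: "real^'d \<Rightarrow> nat \<Rightarrow> nat \<Rightarrow> real"
    and \<rho> :: "real \<Rightarrow> real" and \<tau> r h \<epsilon> R :: real
    and \<eta> :: "real^'d \<Rightarrow> real" and M\<eta> :: real +
  fixes g :: "nat \<Rightarrow> real^'d \<Rightarrow> real" and L CA \<kappa> :: real
  assumes g_lip: "lipschitz_valued L g" and L: "0 \<le> L"
    and g_unit: "\<And>k x. k \<in> {1..n0} \<Longrightarrow> 0 \<le> g k x \<and> g k x \<le> 1"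
    and CA: "\<And>M Z x k. bounded_test M (R + 2) Z \<Longrightarrow> k \<in> {1..n0} \<Longrightarrow>
      \<bar>gen_A n0 a b \<nu> \<epsilon>0 q (\<lambda>(x, k). Z k x) (x, k)\<bar> \<le> CA * M"
    and consistent: "\<And>Z x k. bounded_test M\<^sub>Z (R + 2) Z \<Longrightarrow> k \<in> {1..n0} \<Longrightarrow>
      \<bar>gen_A n0 a b \<nu> \<epsilon>0 q (\<lambda>(x, k). Z k x) (x, k) - G Z x x k\<bar> \<le> \<kappa>"
begin

abbreviation U :: "nat \<Rightarrow> nat \<Rightarrow> real^'d \<Rightarrow> real" where "U \<equiv> iterate g"

lemmas adm = admissible_iterate[OF g_lip L g_unit]

lemma U_unit: "unit_valued (U n)" using adm[of n] by (simp add: admissible_def)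

lemma U_outside: "k \<in> {1..n0} \<Longrightarrow> x \<notin> cball 0 (R + 1) \<Longrightarrow> U n k x = 1"
proof -
  assume k: "k \<in> {1..n0}" and x: "x \<notin> cball 0 (R + 1)"
  have "cutoff x \<le> U n k x" using adm[of n] k by (auto simp: admissible_def)
  then show ?thesis using cutoff(4)[of x] x unit_valuedD(3)[OF U_unit k, of n x] by simp
qed

text \<open>The complement is mollified because it is the function with compact support.
  Subsolutions for it correspond to supersolutions for the iterates.\<close>

definition Z :: "nat \<Rightarrow> nat \<Rightarrow> real^'d \<Rightarrow> real" where
  "Z n k = (if k \<in> {1..n0} then conv (\<lambda>x. 1 - U n k x) \<eta> else (\<lambda>_. 0))"

lemma conv_U: "k \<in> {1..n0} \<Longrightarrow> convolvable (\<lambda>x. 1 - U n k x) (R + 1) 1"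
  using unit_valuedD[OF unit_valued_compl[OF U_unit[of n]]] U_outside
  by unfold_locales auto

lemma conv_U_diff: "k \<in> {1..n0} \<Longrightarrow> convolvable (\<lambda>x. U n k x - U (Suc n) k x) (R + 1) (h * rate)"
proof unfold_locales
  assume k: "k \<in> {1..n0}"
  show "(\<lambda>x. U n k x - U (Suc n) k x) \<in> borel_measurable borel"
    using unit_valuedD(1)[OF U_unit k, of n] unit_valuedD(1)[OF U_unit k, of "Suc n"] by measurable
  show "\<bar>U n k y - U (Suc n) k y\<bar> \<le> h * rate" for y
    using shaken_diff[OF adm k, of n y] by (simp add: abs_minus_commute)
  show "U n k y - U (Suc n) k y = 0" if "y \<notin> cball 0 (R + 1)" for y
    using U_outside[OF k that, of n] U_outside[OF k that, of "Suc n"] by simp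
qed

lemma Z_average: "k \<in> {1..n0} \<Longrightarrow> Z n k x = average (\<lambda>k x. 1 - U n k x) k x"
proof -
  assume k: "k \<in> {1..n0}"
  have "(\<lambda>x. 1 - U n k x) \<in> borel_measurable borel" using unit_valuedD(1)[OF U_unit k] by measurable
  then show ?thesis using k by (simp add: Z_def average_def conv_swap)
qed

lemma bounded_test_Z: "bounded_test M\<^sub>Z (R + 2) (Z n)"
  using bounded_test_conv[of "\<lambda>k x. 1 - U n k x" 1, OF conv_U] unfolding Z_def[abs_def] by simp

lemma Z_diff: "k \<in> {1..n0} \<Longrightarrow> Z (Suc n) k x - Z n k x = conv (\<lambda>x. U n k x - U (Suc n) k x) \<eta> x"
proof -
  assume k: "k \<in> {1..n0}"
  note i = convolvable.integrable_conv[OF conv_U[OF k] eta_measurable eta_bounds(1)]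
  have "conv (\<lambda>x. 1 - U (Suc n) k x) \<eta> x - conv (\<lambda>x. 1 - U n k x) \<eta> x =
    (\<integral>y. (1 - U (Suc n) k y) * \<eta> (x - y) - (1 - U n k y) * \<eta> (x - y) \<partial>lborel)"
    unfolding conv_def using i[of "Suc n" x] i[of n x] by (intro Bochner_Integration.integral_diff[symmetric])
  also have "\<dots> = conv (\<lambda>x. U n k x - U (Suc n) k x) \<eta> x"
    unfolding conv_def by (intro Bochner_Integration.integral_cong) (simp_all add: algebra_simps)
  finally show ?thesis using k by (simp add: Z_def)
qed

text \<open>Shaking the coefficients by at most \<open>\<epsilon>\<close> makes the mollification at scale \<open>\<epsilon>\<close> a subsolution of the
  scheme with the unperturbed coefficients.\<close>
lemma Z_step: "k \<in> {1..n0} \<Longrightarrow> Z (Suc n) k x \<le> Z n k x + h * G (Z n) x x k"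
proof -
  assume k: "k \<in> {1..n0}"
  let ?\<zeta> = "\<lambda>k x. 1 - U n k x"
  have un: "unit_valued ?\<zeta>" by (rule unit_valued_compl[OF U_unit])
  have e: "Z n l = average ?\<zeta> l" if "l \<in> {1..n0}" for l using Z_average[OF that] by auto
  have "switch_part (Z n) x x k = switch_part (average ?\<zeta>) x x k"
    unfolding switch_part_def by (intro sum.cong refl) (simp only: e k)
  then have G_Z: "G (Z n) x x k = G (average ?\<zeta>) x x k"
    unfolding approx_gen_def jump_op_def by (simp only: e[OF k])
  have hb: "has_bochner_integral lborel (\<lambda>w. \<eta> w * ?\<zeta> k (x - w) + h * (\<eta> w * G ?\<zeta> x (x - w) k))
    (average ?\<zeta> k x + h * G (average ?\<zeta>) x x k)"
    using average_has_integral[OF un k, of x 0]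
    by (intro has_bochner_integral_add has_bochner_integral_mult_right G_average[OF un k]) simp
  have i: "integrable lborel (\<lambda>w. \<eta> w * (1 - U (Suc n) k (x - w)))"
    by (rule average_integrable[OF unit_valued_compl[OF U_unit[of "Suc n"]] k])
  have "average (\<lambda>k x. 1 - U (Suc n) k x) k x \<le> average ?\<zeta> k x + h * G (average ?\<zeta>) x x k"
    unfolding has_bochner_integral_integral_eq[OF hb, symmetric] unfolding average_def
  proof (rule integral_mono[OF i integrable.intros[OF hb]])
    fix w
    show "\<eta> w * (1 - U (Suc n) k (x - w)) \<le> \<eta> w * ?\<zeta> k (x - w) + h * (\<eta> w * G ?\<zeta> x (x - w) k)"
    proof (cases "norm w < \<epsilon>")
      case True
      then have "penalty (x - w) x = 0" by (intro penalty(2)) simp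
      then have "step (U n) x (x - w) k \<le> U (Suc n) k (x - w)"
        using shaken_ge[OF U_unit k, of n x "x - w"] by simp
      then have "1 - U (Suc n) k (x - w) \<le> ?\<zeta> k (x - w) + h * G ?\<zeta> x (x - w) k"
        unfolding G_compl by (simp add: step_def)
      from mult_left_mono[OF this eta_nonneg[of w]] show ?thesis by (simp add: algebra_simps)
    qed (simp add: eta_supp)
  qed
  then show ?thesis unfolding G_Z using Z_average[OF k] by simp
qed

lemma CA_nonneg: "k \<in> {1..n0} \<Longrightarrow> bounded_test M (R + 2) W \<Longrightarrow> 0 \<le> CA * M"
  using CA[of M W k undefined] by (meson abs_ge_zero order.trans)

text \<open>\<open>\<kappa>\<close> is the consistency error. The second term comes from replacing
  the difference quotient in the time index, during a whole step, by its value at the start of the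
  step.\<close>

definition err :: real where "err = \<kappa> + CA * (h * rate * M\<^sub>Z)"

lemma Z0_le:
  assumes k: "k \<in> {1..n0}" shows "Z 0 k x \<le> 1 - g k x + L * \<epsilon>"
proof -
  have i: "integrable lborel (\<lambda>w. \<eta> w * (1 - U 0 k (x - w)))"
    by (rule average_integrable[OF unit_valued_compl[OF U_unit[of 0]] k])
  have "Z 0 k x \<le> (\<integral>w. \<eta> w * (1 - g k x + L * \<epsilon>) \<partial>lborel)"
    unfolding Z_average[OF k] average_def
  proof (rule integral_mono[OF i integrable_mult_left[OF eta_integrable]])
    fix w
    show "\<eta> w * (1 - U 0 k (x - w)) \<le> \<eta> w * (1 - g k x + L * \<epsilon>)"
    proof (cases "norm w < \<epsilon>")
      case True
      have "g k x - g k (x - w) \<le> L * norm w" using lipschitz_valuedD[OF g_lip k, of x "x - w"] by simp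
      also have "\<dots> \<le> L * \<epsilon>" using True L by (intro mult_left_mono) auto
      finally have "1 - U 0 k (x - w) \<le> 1 - g k x + L * \<epsilon>" by simp
      then show ?thesis using eta_nonneg by (intro mult_left_mono)
    qed (simp add: eta_supp)
  qed
  then show ?thesis using eta_integral by simp
qed

text \<open>The expectation of \<open>Z n\<close> after a step of length \<open>h\<close> is at
  least that of \<open>Z (Suc n)\<close> before it, up to \<open>h * err\<close>. Chaining this over
  \<open>N\<close> steps leads from the deterministic value of \<open>Z N\<close> at the start to
  the expectation of \<open>Z 0\<close>, which is close to that of \<open>1 - g\<close>.\<close>

lemma upper_bound:
  assumes P: "mp_solution (UNIV \<times> {1..n0}) (test_A n0) (gen_A n0 a b \<nu> \<epsilon>0 q) (x0, k0) P"
    and k0: "k0 \<in> {1..n0}"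
  shows "(\<integral>\<omega>. (case \<omega> (real N * h) of (x, k) \<Rightarrow> g k x) \<partial>P) \<le> 1 - Z N k0 x0 + L * \<epsilon> + real N * (h * err)"
proof -
  interpret mp_sol "UNIV \<times> {1..n0}" "test_A n0" "gen_A n0 a b \<nu> \<epsilon>0 q" "(x0, k0)" P
    by unfold_locales (rule P, rule measurable_evaluation_pair_nat)
  have Zout: "\<forall>k. k \<notin> {1..n0} \<longrightarrow> Z n k = (\<lambda>_. 0)" for n unfolding Z_def by (intro allI impI if_not_P)
  \<comment> \<open>The increment between consecutive mollified iterates is itself a test function,
    of size \<open>h * rate * M\<^sub>Z\<close> with its derivatives. Its own evolution shows that
    its expectation hardly moves within one step, so no separate modulus of continuity in time is
    needed.\<close>
  define D where "D = (\<lambda>n k. if k \<in> {1..n0} then conv (\<lambda>x. U n k x - U (Suc n) k x) \<eta> else (\<lambda>_. 0))"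
  have Dt: "bounded_test (h * rate * M\<^sub>Z) (R + 2) (D n)" for n
    unfolding D_def by (rule bounded_test_conv[OF conv_U_diff])
  have Dout: "\<forall>k. k \<notin> {1..n0} \<longrightarrow> D n k = (\<lambda>_. 0)" for n unfolding D_def by (intro allI impI if_not_P)
  have DZ: "D n k x = Z (Suc n) k x - Z n k x" for n k x
    using Z_diff[of k n x] Zout unfolding D_def by (cases "k \<in> {1..n0}") auto
  define F where "F = (\<lambda>W :: nat \<Rightarrow> real^'d \<Rightarrow> real. \<lambda>(x, k). W k x)"
  \<comment> \<open>Paths visit only regimes in \<open>{1..n0}\<close>; the value 0 elsewhere makes
    the generator measurable on the whole product.\<close>
  define A where "A = (\<lambda>W :: nat \<Rightarrow> real^'d \<Rightarrow> real. \<lambda>(x, k). if k \<in> {1..n0} then gen_A n0 a b \<nu> \<epsilon>0 q (F W) (x, k) else 0)"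
  have tst: "F W \<in> test_A n0" "F W \<in> borel_measurable borel" "\<And>e. e \<in> UNIV \<times> {1..n0} \<Longrightarrow> \<bar>F W e\<bar> \<le> M"
    "A W \<in> borel_measurable borel" "\<And>e. e \<in> UNIV \<times> {1..n0} \<Longrightarrow> gen_A n0 a b \<nu> \<epsilon>0 q (F W) e = A W e"
    "\<And>e. e \<in> UNIV \<times> {1..n0} \<Longrightarrow> \<bar>A W e\<bar> \<le> CA * M"
    if "bounded_test M (R + 2) W" "\<forall>k. k \<notin> {1..n0} \<longrightarrow> W k = (\<lambda>_. 0)" for M W
    using bounded_test_facts[OF that(1)] gen_measurable[OF that(1)] CA[OF that(1)] that(2)
    unfolding A_def F_def by auto
  have Ti: "integrable P (\<lambda>\<omega>. F W (\<omega> t))" "integrable P (\<lambda>\<omega>. A W (\<omega> t))"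
    if "bounded_test M (R + 2) W" "\<forall>k. k \<notin> {1..n0} \<longrightarrow> W k = (\<lambda>_. 0)" "0 \<le> t" for M W t
  proof -
    note T = tst[OF that(1,2)]
    show "integrable P (\<lambda>\<omega>. F W (\<omega> t))"
      by (rule integrable_test[where B=M and C="CA * M", OF T(1,2) _ T(4) _ _ that(3)]) (erule T(3), erule T(5), erule T(6))
    show "integrable P (\<lambda>\<omega>. A W (\<omega> t))"
      by (rule integrable_gen[where B=M and C="CA * M", OF T(1,2) _ T(4) _ _ that(3)]) (erule T(3), erule T(5), erule T(6))
  qed
  have Zinc: "c * h \<le> expectation (\<lambda>\<omega>. F (Z n) (\<omega> (t + h))) - expectation (\<lambda>\<omega>. F (Z n) (\<omega> t))"
    if "0 \<le> t" "\<And>s. t \<le> s \<Longrightarrow> s \<le> t + h \<Longrightarrow> c \<le> expectation (\<lambda>\<omega>. A (Z n) (\<omega> s))" for n t c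
  proof -
    note T = tst[OF bounded_test_Z[of n] Zout[of n]]
    show ?thesis
      by (rule increment_ge[where B="M\<^sub>Z" and C="CA * M\<^sub>Z", OF T(1,2) _ T(4) _ _ that(1) less_imp_le[OF h]])
        (erule T(3), erule T(5), erule T(6), rule that(2))
  qed
  have Dinc: "\<bar>expectation (\<lambda>\<omega>. F (D n) (\<omega> (t + s))) - expectation (\<lambda>\<omega>. F (D n) (\<omega> t))\<bar> \<le> CA * (h * rate * M\<^sub>Z) * s"
    if "0 \<le> t" "0 \<le> s" for n t s
  proof -
    note T = tst[OF Dt[of n] Dout[of n]]
    show ?thesis
      by (rule increment_abs_le[where B="h * rate * M\<^sub>Z" and C="CA * (h * rate * M\<^sub>Z)", OF T(1,2) _ T(4) _ _ that])
        (erule T(3), erule T(5), erule T(6))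
  qed
  note Zi = Ti(1)[OF bounded_test_Z Zout] and Zg = Ti(2)[OF bounded_test_Z Zout] and Di = Ti(1)[OF Dt Dout]
  define e where "e = (\<lambda>n t. expectation (\<lambda>\<omega>. F (Z n) (\<omega> t)))"
  have step: "e (Suc n) t - h * err \<le> e n (t + h)" if t: "0 \<le> t" for n t
  proof -
    let ?E = "\<lambda>s. expectation (\<lambda>\<omega>. F (D n) (\<omega> s))"
    have Et: "?E t = e (Suc n) t - e n t"
      unfolding e_def Bochner_Integration.integral_diff[OF Zi[OF t] Zi[OF t], symmetric]
      by (intro Bochner_Integration.integral_cong) (auto simp: DZ F_def split: prod.splits)
    \<comment> \<open>At each time \<open>s\<close> of the step the generator of \<open>Z n\<close>
      dominates \<open>D n / h - \<kappa>\<close>; the expectation of \<open>D n\<close> at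
      \<open>s\<close> is then moved back to \<open>t\<close>.\<close>
    have "(?E t / h - err) * h \<le> e n (t + h) - e n t"
      unfolding e_def
    proof (rule Zinc[OF t])
      fix s assume s: "t \<le> s" "s \<le> t + h"
      have s0: "0 \<le> s" using s t by simp
      have "\<bar>?E (t + (s - t)) - ?E t\<bar> \<le> CA * (h * rate * M\<^sub>Z) * (s - t)"
        by (rule Dinc) (use s t in auto)
      also have "\<dots> \<le> CA * (h * rate * M\<^sub>Z) * h"
        using s CA_nonneg[OF k0 Dt] by (intro mult_left_mono) auto
      finally have "?E t - CA * (h * rate * M\<^sub>Z) * h \<le> ?E s" by (simp add: abs_le_iff)
      then have "(?E t - CA * (h * rate * M\<^sub>Z) * h) / h \<le> ?E s / h" using h by (intro divide_right_mono) auto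
      then have "?E t / h - err \<le> ?E s / h - \<kappa>" using h by (simp add: diff_divide_distrib err_def)
      also have "\<dots> = expectation (\<lambda>\<omega>. F (D n) (\<omega> s) / h - \<kappa>)"
        using Di[OF s0] by (simp add: prob_space)
      also have "\<dots> \<le> expectation (\<lambda>\<omega>. A (Z n) (\<omega> s))"
      proof (rule integral_mono[OF _ Zg[OF s0]])
        show "integrable P (\<lambda>\<omega>. F (D n) (\<omega> s) / h - \<kappa>)" using Di[OF s0] by simp
        fix \<omega> assume "\<omega> \<in> space P"
        from in_E[OF this, of s] obtain x k where xk: "\<omega> s = (x, k)" "k \<in> {1..n0}" by auto
        have "D n k x \<le> h * G (Z n) x x k" using Z_step[OF xk(2), of n x] DZ[of n k x] by linarith
        then have "D n k x / h \<le> G (Z n) x x k" using h by (simp add: divide_le_eq mult.commute)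
        then have "D n k x / h - \<kappa> \<le> gen_A n0 a b \<nu> \<epsilon>0 q (\<lambda>(x, k). Z n k x) (x, k)"
          using consistent[OF bounded_test_Z[of n] xk(2), of x] by linarith
        then show "F (D n) (\<omega> s) / h - \<kappa> \<le>
            A (Z n) (\<omega> s)"
          using xk by (simp add: A_def F_def)
      qed
      finally show "?E t / h - err \<le> expectation (\<lambda>\<omega>. A (Z n) (\<omega> s))" .
    qed
    moreover have "(?E t / h - err) * h = ?E t - h * err" using h by (simp add: left_diff_distrib)
    ultimately show ?thesis using Et by linarith
  qed
  \<comment> \<open>The index falls while time rises, as in a backward equation.\<close>
  have chain: "e (n + m) 0 - real m * (h * err) \<le> e n (real m * h)" for n m
  proof (induction m arbitrary: n)
    case (Suc m)
    have "e (Suc n) (real m * h) - h * err \<le> e n (real m * h + h)" by (rule step) (use h in simp)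
    with Suc[of "Suc n"] show ?case by (simp add: algebra_simps)
  qed simp
  have "e N 0 = Z N k0 x0"
    unfolding e_def using start[OF tst(2)[OF bounded_test_Z Zout]] by (simp add: F_def)
  with chain[of 0 N] have lower: "Z N k0 x0 - real N * (h * err) \<le> e 0 (real N * h)" by simp
  have Nh: "0 \<le> real N * h" using h by simp
  have gm: "(\<lambda>(x, k). if k \<in> {1..n0} then g k x else 0) \<in> borel_measurable borel"
  proof (rule borel_measurable_pair_countable)
    show "(\<lambda>x. if k \<in> {1..n0} then g k x else 0) \<in> borel_measurable borel" for k
      using lipschitz_valued_measurable[OF g_lip, of k] by (cases "k \<in> {1..n0}") (auto simp del: atLeastAtMost_iff)
  qed
  have gi: "integrable P (\<lambda>\<omega>. (\<lambda>(x, k). if k \<in> {1..n0} then g k x else 0) (\<omega> (real N * h)))"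
  proof (rule integrable_const_bound[of _ 1])
    show "AE \<omega> in P. norm ((\<lambda>(x, k). if k \<in> {1..n0} then g k x else 0) (\<omega> (real N * h))) \<le> 1"
      using g_unit by (intro AE_I2) (auto split: prod.splits)
  qed (rule measurable_compose[OF coordinate_measurable[OF Nh] gm])
  have "e 0 (real N * h) \<le> expectation (\<lambda>\<omega>. 1 - (\<lambda>(x, k). if k \<in> {1..n0} then g k x else 0) (\<omega> (real N * h)) + L * \<epsilon>)"
    unfolding e_def
  proof (rule integral_mono[OF Zi[OF Nh]])
    show "integrable P (\<lambda>\<omega>. 1 - (\<lambda>(x, k). if k \<in> {1..n0} then g k x else 0) (\<omega> (real N * h)) + L * \<epsilon>)"
      using gi by simp
    fix \<omega> assume "\<omega> \<in> space P"
    from in_E[OF this, of "real N * h"] obtain x k where xk: "\<omega> (real N * h) = (x, k)" "k \<in> {1..n0}" by auto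
    then show "F (Z 0) (\<omega> (real N * h)) \<le> 1 - (\<lambda>(x, k). if k \<in> {1..n0} then g k x else 0) (\<omega> (real N * h)) + L * \<epsilon>"
      using Z0_le[OF xk(2), of x] by (simp add: F_def)
  qed
  also have "\<dots> = 1 - expectation (\<lambda>\<omega>. (\<lambda>(x, k). if k \<in> {1..n0} then g k x else 0) (\<omega> (real N * h))) + L * \<epsilon>"
    using gi by (simp add: prob_space)
  also have "expectation (\<lambda>\<omega>. (\<lambda>(x, k). if k \<in> {1..n0} then g k x else 0) (\<omega> (real N * h)))
    = (\<integral>\<omega>. (case \<omega> (real N * h) of (x, k) \<Rightarrow> g k x) \<partial>P)"
  proof (rule Bochner_Integration.integral_cong[OF refl])
    fix \<omega> assume "\<omega> \<in> space P"
    from in_E[OF this, of "real N * h"] show "(\<lambda>(x, k). if k \<in> {1..n0} then g k x else 0) (\<omega> (real N * h))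
      = (case \<omega> (real N * h) of (x, k) \<Rightarrow> g k x)" by auto
  qed
  finally show ?thesis using lower by linarith
qed

end

section \<open>Coupling\<close>

definition soft_norm :: "real \<Rightarrow> 'a::real_inner \<Rightarrow> real" where
  "soft_norm \<delta> v = sqrt ((norm v)\<^sup>2 + \<delta>\<^sup>2)"

lemma soft_norm_ge: "norm v \<le> soft_norm \<delta> v" "\<bar>\<delta>\<bar> \<le> soft_norm \<delta> v" "0 \<le> soft_norm \<delta> v"
  by (auto simp: soft_norm_def intro!: real_le_rsqrt abs_le_square_iff[THEN iffD1])

lemma soft_norm_sq: "(soft_norm \<delta> v)\<^sup>2 = (norm v)\<^sup>2 + \<delta>\<^sup>2"
  by (simp add: soft_norm_def)

lemma soft_norm_le: "0 \<le> \<delta> \<Longrightarrow> soft_norm \<delta> v \<le> norm v + \<delta>"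
  unfolding soft_norm_def by (rule real_le_lsqrt) (auto simp: power2_sum)

text \<open>The tangent bound for the concave square root, from
  \<open>2 D E \<le> D^2 + E^2\<close>. It has no remainder term, and the smoothing by
  \<open>\<delta>\<close> keeps the denominator away from 0.\<close>

lemma soft_norm_add_sq:
  assumes "0 < \<delta>"
  shows "soft_norm \<delta> (v + w) \<le> soft_norm \<delta> v + (2 * (v \<bullet> w) + (norm w)\<^sup>2) / (2 * soft_norm \<delta> v)"
proof -
  let ?D = "soft_norm \<delta> v" and ?E = "soft_norm \<delta> (v + w)"
  have D: "?D > 0" using soft_norm_ge(2)[of \<delta> v] assms by linarith
  have "?E\<^sup>2 = ?D\<^sup>2 + (2 * (v \<bullet> w) + (norm w)\<^sup>2)"
    by (simp add: soft_norm_sq power2_norm_eq_inner inner_add_left inner_add_right inner_commute)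
  moreover have "2 * ?D * ?E \<le> ?D\<^sup>2 + ?E\<^sup>2"
    using zero_le_power2[of "?D - ?E"] by (simp add: power2_diff)
  ultimately have "2 * ?D * ?E \<le> 2 * ?D * ?D + (2 * (v \<bullet> w) + (norm w)\<^sup>2)"
    by (simp add: power2_eq_square)
  then have "?E \<le> (2 * ?D * ?D + (2 * (v \<bullet> w) + (norm w)\<^sup>2)) / (2 * ?D)"
    using D by (simp add: pos_le_divide_eq mult_ac)
  also have "\<dots> = ?D + (2 * (v \<bullet> w) + (norm w)\<^sup>2) / (2 * ?D)"
    using D by (simp add: add_divide_distrib)
  finally show ?thesis .
qed

lemma soft_norm_lipschitz:
  assumes "0 < \<delta>" shows "soft_norm \<delta> (v + w) \<le> soft_norm \<delta> v + norm w"
proof -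
  have "v \<bullet> w \<le> norm v * norm w" by (rule norm_cauchy_schwarz)
  also have "\<dots> \<le> soft_norm \<delta> v * norm w" using soft_norm_ge(1) by (intro mult_right_mono) auto
  finally have "(soft_norm \<delta> (v + w))\<^sup>2 \<le> (soft_norm \<delta> v + norm w)\<^sup>2"
    by (simp add: soft_norm_sq power2_sum)
      (simp add: power2_norm_eq_inner inner_add_left inner_add_right inner_commute)
  then show ?thesis using soft_norm_ge(3)[of \<delta> v] by (simp add: power2_le_iff_abs_le)
qed

section \<open>Synchronous coupling of two frozen schemes\<close>

context scheme begin

text \<open>Drift and diffusion acting on the smoothed distance when both components receive the
  same random-walk increment: along each column the two signs are chosen jointly, so only the
  differences of the coefficients enter.\<close>

definition pair_gen :: "real \<Rightarrow> real^'d \<Rightarrow> real^'d \<Rightarrow> real^'d \<Rightarrow> nat \<Rightarrow> real" where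
  "pair_gen \<delta> v y y' k = 1 / \<tau> * (soft_norm \<delta> (v + \<tau> *\<^sub>R (drift r (R+3) y k - drift r (R+3) y' k)) - soft_norm \<delta> v)
    + (\<Sum>j\<in>UNIV. 1 / (2 * \<tau>) * (soft_norm \<delta> (v + sqrt \<tau> *\<^sub>R (diff_col (R+3) y k j - diff_col (R+3) y' k j))
        + soft_norm \<delta> (v - sqrt \<tau> *\<^sub>R (diff_col (R+3) y k j - diff_col (R+3) y' k j)) - 2 * soft_norm \<delta> v))"

context
  fixes U U' :: "nat \<Rightarrow> real^'d \<Rightarrow> real" and V :: "real^'d \<Rightarrow> real" and A \<beta>0 \<delta> :: real
  assumes U: "unit_valued U" and U': "unit_valued U'"
    and V: "V \<in> borel_measurable borel" "\<And>x. 0 \<le> V x" "\<And>x. V x \<le> 1"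
    and A: "0 \<le> A" and \<delta>: "0 < \<delta>" and \<beta>0: "0 \<le> \<beta>0"
    and dom: "\<And>k x z. k \<in> {1..n0} \<Longrightarrow> U k x + U' k z - 1 \<le> A * soft_norm \<delta> (x - z) + \<beta>0 + V x + V z"
begin

private abbreviation D :: "real^'d \<Rightarrow> real" where "D \<equiv> soft_norm \<delta>"

lemma V_unit: "unit_valued (\<lambda>_. V)" using V by (simp add: unit_valued_def)

text \<open>On the common part of the two densities both components jump by \<open>u\<close> and the
  distance is unchanged; on the excess only one jumps and the distance changes by at most
  \<open>norm u\<close>, which is the weight in the jump condition of F1. The slack \<open>e\<close>
  is charged to the total mass of both measures.\<close>

lemma jump_coupling:
  assumes k: "k \<in> {1..n0}"
    and e: "e = A * D (x - z) + \<beta>0 + V x + V z - (U k x + U' k z - 1)"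
  shows "jump_op r U y x k + jump_op r U' y' z k \<le> A * (H * \<rho> (norm (y - y')))
    + jump_op r (\<lambda>_. V) y x k + jump_op r (\<lambda>_. V) y' z k + 2 * jump_rate * e"
proof -
  have e0: "0 \<le> e" using dom[OF k, of x z] by (simp add: e)
  obtain m f1 f2 where m: "sets m = sets borel" "f1 \<in> borel_measurable borel" "f2 \<in> borel_measurable borel"
    and f: "\<And>u. 0 \<le> f1 u" "\<And>u. 0 \<le> f2 u"
    and d: "\<nu> y k = density m (\<lambda>u. ennreal (f1 u))" "\<nu> y' k = density m (\<lambda>u. ennreal (f2 u))"
    and tv: "integrable m (\<lambda>u. norm u * \<bar>f1 u - f2 u\<bar>)"
    "(\<integral>u. norm u * \<bar>f1 u - f2 u\<bar> \<partial>m) \<le> H * \<rho> (norm (y - y'))"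
    by (rule nu_densities[OF k, of y y']) (rule that)
  have M: "w \<in> borel_measurable borel \<Longrightarrow> w \<in> borel_measurable m" for w :: "real^'d \<Rightarrow> real"
    by (simp add: measurable_cong_sets[OF m(1) refl])
  have nn: "AE u in m. 0 \<le> f1 u" "AE u in m. 0 \<le> f2 u" using f by auto
  let ?i = "\<lambda>u. indicator {u::real^'d. r \<le> norm u} u :: real"
  have T: "integrable m (\<lambda>u. f1 u * w u)" "(\<integral>u. w u \<partial>\<nu> y k) = (\<integral>u. f1 u * w u \<partial>m)"
    if "integrable (\<nu> y k) w" "w \<in> borel_measurable borel" for w :: "real^'d \<Rightarrow> real"
    using that(1) integrable_density[OF M[OF that(2)] M[OF m(2)] nn(1)] integral_density[OF M[OF that(2)] M[OF m(2)] nn(1)]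
    unfolding d by simp_all
  have T': "integrable m (\<lambda>u. f2 u * w u)" "(\<integral>u. w u \<partial>\<nu> y' k) = (\<integral>u. f2 u * w u \<partial>m)"
    if "integrable (\<nu> y' k) w" "w \<in> borel_measurable borel" for w :: "real^'d \<Rightarrow> real"
    using that(1) integrable_density[OF M[OF that(2)] M[OF m(3)] nn(2)] integral_density[OF M[OF that(2)] M[OF m(3)] nn(2)]
    unfolding d by simp_all
  note u = unit_valuedD[OF U k] and u' = unit_valuedD[OF U' k] and v = unit_valuedD[OF V_unit k]
  note [measurable] = u(1) u'(1) V(1)
  have J: "integrable (\<nu> y k) (\<lambda>u. ?i u * (U k (x + u) - U k x))" "(\<lambda>u. ?i u * (U k (x + u) - U k x)) \<in> borel_measurable borel"
    "integrable (\<nu> y' k) (\<lambda>u. ?i u * (U' k (z + u) - U' k z))" "(\<lambda>u. ?i u * (U' k (z + u) - U' k z)) \<in> borel_measurable borel"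
    "integrable (\<nu> y k) (\<lambda>u. ?i u * (V (x + u) - V x))" "(\<lambda>u. ?i u * (V (x + u) - V x)) \<in> borel_measurable borel"
    "integrable (\<nu> y' k) (\<lambda>u. ?i u * (V (z + u) - V z))" "(\<lambda>u. ?i u * (V (z + u) - V z)) \<in> borel_measurable borel"
    "?i \<in> borel_measurable borel"
    using large_jump_integrable(1)[OF k r u(1) u(4)] large_jump_integrable(1)[OF k r u'(1) u'(4)]
      large_jump_integrable(1)[OF k r v(1) v(4)] by (auto, measurable)
  note J1 = T[OF J(1,2)] T'[OF J(3,4)] T[OF J(5,6)] T'[OF J(7,8)] T[OF nu_large_jumps(1)[OF k] J(9)] T'[OF nu_large_jumps(1)[OF k] J(9)]
  have "f1 u * (?i u * (U k (x + u) - U k x)) + f2 u * (?i u * (U' k (z + u) - U' k z))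
    \<le> A * (norm u * \<bar>f1 u - f2 u\<bar>) + f1 u * (?i u * (V (x + u) - V x)) + f2 u * (?i u * (V (z + u) - V z))
      + e * (f1 u * ?i u + f2 u * ?i u)" for u
  proof (cases "r \<le> norm u")
    case True
    let ?X = "U k (x + u) - U k x" and ?Y = "U' k (z + u) - U' k z"
      and ?v = "V (x + u) - V x" and ?w = "V (z + u) - V z"
    have D1: "A * D (x + u - z) \<le> A * D (x - z) + A * norm u"
      using mult_left_mono[OF soft_norm_lipschitz[OF \<delta>, of "x - z" u] A] by (simp add: algebra_simps)
    have D2: "A * D (x - (z + u)) \<le> A * D (x - z) + A * norm u"
      using mult_left_mono[OF soft_norm_lipschitz[OF \<delta>, of "x - z" "- u"] A] by (simp add: algebra_simps)
    have X: "?X \<le> A * norm u + ?v + e" using dom[OF k, of "x + u" z] D1 by (simp add: e)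
    have Y: "?Y \<le> A * norm u + ?w + e" using dom[OF k, of x "z + u"] D2 by (simp add: e)
    have XY: "?X + ?Y \<le> ?v + ?w + e" using dom[OF k, of "x + u" "z + u"] by (simp add: e)
    \<comment> \<open>The smaller density multiplies the joint jump and the difference of the
      densities multiplies a single jump.\<close>
    have "f1 u * ?X + f2 u * ?Y \<le> A * (norm u * \<bar>f1 u - f2 u\<bar>) + f1 u * ?v + f2 u * ?w + e * (f1 u + f2 u)"
    proof (cases "f2 u \<le> f1 u")
      case True
      have "f1 u * ?X + f2 u * ?Y = f2 u * (?X + ?Y) + (f1 u - f2 u) * ?X" by (simp add: algebra_simps)
      also have "\<dots> \<le> f2 u * (?v + ?w + e) + (f1 u - f2 u) * (A * norm u + ?v + e)"
        by (rule add_mono[OF mult_left_mono[OF XY f(2)] mult_left_mono[OF X]]) (use True in simp)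
      also have "\<dots> = A * (norm u * \<bar>f1 u - f2 u\<bar>) + f1 u * ?v + f2 u * ?w + e * f1 u"
        using True by (simp add: algebra_simps)
      also have "e * f1 u \<le> e * (f1 u + f2 u)" using e0 f(2)[of u] by (intro mult_left_mono) auto
      finally show ?thesis by simp
    next
      case False
      have "f1 u * ?X + f2 u * ?Y = f1 u * (?X + ?Y) + (f2 u - f1 u) * ?Y" by (simp add: algebra_simps)
      also have "\<dots> \<le> f1 u * (?v + ?w + e) + (f2 u - f1 u) * (A * norm u + ?w + e)"
        by (rule add_mono[OF mult_left_mono[OF XY f(1)] mult_left_mono[OF Y]]) (use False in simp)
      also have "\<dots> = A * (norm u * \<bar>f1 u - f2 u\<bar>) + f1 u * ?v + f2 u * ?w + e * f2 u"
        using False by (simp add: algebra_simps)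
      also have "e * f2 u \<le> e * (f1 u + f2 u)" using e0 f(1)[of u] by (intro mult_left_mono) auto
      finally show ?thesis by simp
    qed
    then show ?thesis using True by simp
  next
    case False
    then show ?thesis using A by simp
  qed
  then have "(\<integral>u. f1 u * (?i u * (U k (x + u) - U k x)) + f2 u * (?i u * (U' k (z + u) - U' k z)) \<partial>m)
    \<le> (\<integral>u. A * (norm u * \<bar>f1 u - f2 u\<bar>) + f1 u * (?i u * (V (x + u) - V x)) + f2 u * (?i u * (V (z + u) - V z))
      + e * (f1 u * ?i u + f2 u * ?i u) \<partial>m)"
    by (intro integral_mono Bochner_Integration.integrable_add integrable_mult_right tv(1) J1)
  also have "\<dots> = A * (\<integral>u. norm u * \<bar>f1 u - f2 u\<bar> \<partial>m) + jump_op r (\<lambda>_. V) y x k + jump_op r (\<lambda>_. V) y' z k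
      + e * ((\<integral>u. ?i u \<partial>\<nu> y k) + (\<integral>u. ?i u \<partial>\<nu> y' k))"
    unfolding jump_op_def J1
    by (subst Bochner_Integration.integral_add, (intro Bochner_Integration.integrable_add integrable_mult_right tv(1) J1)+)+
      (simp add: J1 Bochner_Integration.integral_add[OF J1(9) J1(11)])
  also have "(\<integral>u. f1 u * (?i u * (U k (x + u) - U k x)) + f2 u * (?i u * (U' k (z + u) - U' k z)) \<partial>m)
      = jump_op r U y x k + jump_op r U' y' z k"
    unfolding jump_op_def J1 by (intro Bochner_Integration.integral_add J1)
  finally have "jump_op r U y x k + jump_op r U' y' z k \<le> A * (\<integral>u. norm u * \<bar>f1 u - f2 u\<bar> \<partial>m)
      + jump_op r (\<lambda>_. V) y x k + jump_op r (\<lambda>_. V) y' z k + e * ((\<integral>u. ?i u \<partial>\<nu> y k) + (\<integral>u. ?i u \<partial>\<nu> y' k))" .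
  moreover have "A * (\<integral>u. norm u * \<bar>f1 u - f2 u\<bar> \<partial>m) \<le> A * (H * \<rho> (norm (y - y')))"
    using tv(2) A by (rule mult_left_mono)
  moreover have "e * ((\<integral>u. ?i u \<partial>\<nu> y k) + (\<integral>u. ?i u \<partial>\<nu> y' k)) \<le> e * (2 * jump_rate)"
    using nu_large_jumps(2)[OF k, of y] nu_large_jumps(2)[OF k, of y'] e0 by (intro mult_left_mono) auto
  ultimately show ?thesis by (simp add: mult_ac)
qed

text \<open>Domination is available only for equal regimes. At the common rate both components
  switch and it applies again; at the excess rate one switches alone and the crude bound 1 on its
  increment is used, at the cost of the rate difference controlled by F2.\<close>

lemma switch_coupling:
  assumes k: "k \<in> {1..n0}"
    and e: "e = A * D (x - z) + \<beta>0 + V x + V z - (U k x + U' k z - 1)"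
  shows "switch_part U y x k + switch_part U' y' z k \<le> real n0 * (H * norm (y - y')) + 2 * (real n0 * \<bar>Qb\<bar>) * e"
proof -
  have e0: "0 \<le> e" using dom[OF k, of x z] by (simp add: e)
  have Phi0: "0 \<le> A * D (x - z) + \<beta>0 + V x + V z"
    using A \<beta>0 V soft_norm_ge(3)[of \<delta> "x - z"] by (simp add: add_nonneg_nonneg)
  have "switch_part U y x k + switch_part U' y' z k
    = (\<Sum>l\<in>{1..n0}. q y k l * (U l x - U k x) + q y' k l * (U' l z - U' k z))"
    by (simp add: switch_part_def sum.distrib)
  also have "\<dots> \<le> (\<Sum>l\<in>{1..n0}. H * norm (y - y') + 2 * \<bar>Qb\<bar> * e)"
  proof (rule sum_mono)
    fix l assume l: "l \<in> {1..n0}"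
    show "q y k l * (U l x - U k x) + q y' k l * (U' l z - U' k z) \<le> H * norm (y - y') + 2 * \<bar>Qb\<bar> * e"
    proof (cases "l = k")
      case True
      then show ?thesis using H_pos e0 by simp
    next
      case False
      let ?X = "U l x - U k x" and ?Y = "U' l z - U' k z" and ?p = "q y k l" and ?q = "q y' k l"
      have p: "0 \<le> ?p" "0 \<le> ?q" using q_nonneg[OF k l] False by auto
      have pq: "?p \<le> \<bar>Qb\<bar>" "?q \<le> \<bar>Qb\<bar>" using q_bound[OF k l, of y] q_bound[OF k l, of y'] by auto
      have X: "?X \<le> 1 + e" "?Y \<le> 1 + e" and XY: "?X + ?Y \<le> e"
        using unit_valuedD(2,3)[OF U l, of x] unit_valuedD(2,3)[OF U k, of x] unit_valuedD(2,3)[OF U' l, of z] unit_valuedD(2,3)[OF U' k, of z]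
          dom[OF l, of x z] Phi0 e0 by (auto simp: e)
      have "?p * ?X + ?q * ?Y \<le> \<bar>?p - ?q\<bar> + (?p + ?q) * e"
      proof (cases "?q \<le> ?p")
        case True
        have "?p * ?X + ?q * ?Y = ?q * (?X + ?Y) + (?p - ?q) * ?X" by (simp add: algebra_simps)
        also have "\<dots> \<le> ?q * e + (?p - ?q) * (1 + e)" by (rule add_mono[OF mult_left_mono[OF XY p(2)] mult_left_mono[OF X(1)]]) (use True in simp)
        also have "\<dots> = \<bar>?p - ?q\<bar> + ?p * e" using True by (simp add: algebra_simps)
        finally show ?thesis using mult_nonneg_nonneg[OF p(2) e0] by (simp add: distrib_right)
      next
        case False
        have "?p * ?X + ?q * ?Y = ?p * (?X + ?Y) + (?q - ?p) * ?Y" by (simp add: algebra_simps)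
        also have "\<dots> \<le> ?p * e + (?q - ?p) * (1 + e)" by (rule add_mono[OF mult_left_mono[OF XY p(1)] mult_left_mono[OF X(2)]]) (use False in simp)
        also have "\<dots> = \<bar>?p - ?q\<bar> + ?q * e" using False by (simp add: algebra_simps)
        finally show ?thesis using mult_nonneg_nonneg[OF p(1) e0] by (simp add: distrib_right)
      qed
      moreover have "\<bar>?p - ?q\<bar> \<le> H * norm (y - y')" using F2[OF k l] False by auto
      moreover have "(?p + ?q) * e \<le> (2 * \<bar>Qb\<bar>) * e" using pq e0 by (intro mult_right_mono) auto
      ultimately show ?thesis by linarith
    qed
  qed
  finally show ?thesis by (simp add: algebra_simps)
qed

text \<open>Both schemes are driven by the same random-walk increments, the common part of the two jump measures and the
  common part of the two switching rates; the slack \<open>e\<close> in the domination is absorbed by the CFL condition.\<close>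
lemma step_coupling:
  assumes k: "k \<in> {1..n0}"
  shows "step U y x k + step U' y' z k - 1 \<le> A * D (x - z) + \<beta>0 + V x + V z
    + h * (A * (pair_gen \<delta> (x - z) y y' k + H * \<rho> (norm (y - y'))) + G (\<lambda>_. V) y x k + G (\<lambda>_. V) y' z k
      + real n0 * (H * norm (y - y')))"
proof -
  define e where "e = A * D (x - z) + \<beta>0 + V x + V z - (U k x + U' k z - 1)"
  have e0: "0 \<le> e" using dom[OF k, of x z] by (simp add: e_def)
  let ?b = "\<lambda>y. \<tau> *\<^sub>R drift r (R+3) y k" and ?s = "\<lambda>y j. sqrt \<tau> *\<^sub>R diff_col (R+3) y k j"
  \<comment> \<open>Domination at the moved pair minus the defining equation of \<open>e\<close> at
    the present pair; the drift and diffusion estimates are instances of this.\<close>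
  have gen: "U k p + U' k p' - (U k x + U' k z) \<le> A * (D (p - p') - D (x - z)) + (V p - V x) + (V p' - V z) + e" for p p'
    using dom[OF k, of p p'] by (simp add: e_def algebra_simps)
  have 1: "1 / \<tau> * (U k (x + ?b y) - U k x) + 1 / \<tau> * (U' k (z + ?b y') - U' k z) \<le>
      A * (1 / \<tau> * (D (x - z + \<tau> *\<^sub>R (drift r (R+3) y k - drift r (R+3) y' k)) - D (x - z)))
      + 1 / \<tau> * (V (x + ?b y) - V x) + 1 / \<tau> * (V (z + ?b y') - V z) + 1 / \<tau> * e"
  proof -
    have d: "x + ?b y - (z + ?b y') = x - z + \<tau> *\<^sub>R (drift r (R+3) y k - drift r (R+3) y' k)"
      by (simp add: algebra_simps)
    have "1 / \<tau> * (U k (x + ?b y) + U' k (z + ?b y') - (U k x + U' k z)) \<le>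
      1 / \<tau> * (A * (D (x + ?b y - (z + ?b y')) - D (x - z)) + (V (x + ?b y) - V x) + (V (z + ?b y') - V z) + e)"
      using gen tau by (intro mult_left_mono) auto
    then show ?thesis unfolding d by (simp add: algebra_simps)
  qed
  let ?a1 = "\<lambda>j. 1 / (2 * \<tau>) * (U k (x + ?s y j) + U k (x - ?s y j) - 2 * U k x)"
  let ?a2 = "\<lambda>j. 1 / (2 * \<tau>) * (U' k (z + ?s y' j) + U' k (z - ?s y' j) - 2 * U' k z)"
  let ?dd = "\<lambda>j. 1 / (2 * \<tau>) * (D (x - z + sqrt \<tau> *\<^sub>R (diff_col (R+3) y k j - diff_col (R+3) y' k j))
        + D (x - z - sqrt \<tau> *\<^sub>R (diff_col (R+3) y k j - diff_col (R+3) y' k j)) - 2 * D (x - z))"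
  let ?v1 = "\<lambda>j. 1 / (2 * \<tau>) * (V (x + ?s y j) + V (x - ?s y j) - 2 * V x)"
  let ?v2 = "\<lambda>j. 1 / (2 * \<tau>) * (V (z + ?s y' j) + V (z - ?s y' j) - 2 * V z)"
  have 2: "1 / (2 * \<tau>) * (U k (x + ?s y j) + U k (x - ?s y j) - 2 * U k x)
      + 1 / (2 * \<tau>) * (U' k (z + ?s y' j) + U' k (z - ?s y' j) - 2 * U' k z) \<le>
      A * (1 / (2 * \<tau>) * (D (x - z + sqrt \<tau> *\<^sub>R (diff_col (R+3) y k j - diff_col (R+3) y' k j))
        + D (x - z - sqrt \<tau> *\<^sub>R (diff_col (R+3) y k j - diff_col (R+3) y' k j)) - 2 * D (x - z)))
      + 1 / (2 * \<tau>) * (V (x + ?s y j) + V (x - ?s y j) - 2 * V x)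
      + 1 / (2 * \<tau>) * (V (z + ?s y' j) + V (z - ?s y' j) - 2 * V z) + 1 / \<tau> * e" for j
  proof -
    have d: "x + ?s y j - (z + ?s y' j) = x - z + sqrt \<tau> *\<^sub>R (diff_col (R+3) y k j - diff_col (R+3) y' k j)"
      "x - ?s y j - (z - ?s y' j) = x - z - sqrt \<tau> *\<^sub>R (diff_col (R+3) y k j - diff_col (R+3) y' k j)"
      by (simp_all add: algebra_simps)
    have "1 / (2 * \<tau>) * ((U k (x + ?s y j) + U' k (z + ?s y' j) - (U k x + U' k z)) + (U k (x - ?s y j) + U' k (z - ?s y' j) - (U k x + U' k z)))
      \<le> 1 / (2 * \<tau>) * ((A * (D (x + ?s y j - (z + ?s y' j)) - D (x - z)) + (V (x + ?s y j) - V x) + (V (z + ?s y' j) - V z) + e)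
        + (A * (D (x - ?s y j - (z - ?s y' j)) - D (x - z)) + (V (x - ?s y j) - V x) + (V (z - ?s y' j) - V z) + e))"
      by (rule mult_left_mono[OF add_mono[OF gen gen]]) (use tau in simp)
    moreover have "1 / \<tau> * e = 1 / (2 * \<tau>) * (2 * e)" by simp
    ultimately show ?thesis unfolding d by (simp add: algebra_simps)
  qed
  have 2: "(\<Sum>j\<in>UNIV. 1 / (2 * \<tau>) * (U k (x + ?s y j) + U k (x - ?s y j) - 2 * U k x))
      + (\<Sum>j\<in>UNIV. 1 / (2 * \<tau>) * (U' k (z + ?s y' j) + U' k (z - ?s y' j) - 2 * U' k z)) \<le>
      A * (\<Sum>j\<in>UNIV. 1 / (2 * \<tau>) * (D (x - z + sqrt \<tau> *\<^sub>R (diff_col (R+3) y k j - diff_col (R+3) y' k j))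
        + D (x - z - sqrt \<tau> *\<^sub>R (diff_col (R+3) y k j - diff_col (R+3) y' k j)) - 2 * D (x - z)))
      + (\<Sum>j\<in>UNIV. 1 / (2 * \<tau>) * (V (x + ?s y j) + V (x - ?s y j) - 2 * V x))
      + (\<Sum>j\<in>UNIV. 1 / (2 * \<tau>) * (V (z + ?s y' j) + V (z - ?s y' j) - 2 * V z)) + real CARD('d) * (1 / \<tau> * e)"
  proof -
    have "(\<Sum>j\<in>(UNIV::'d set). 1 / \<tau> * e) = real CARD('d) * (1 / \<tau> * e)" by simp
    moreover have "(\<Sum>j\<in>UNIV. ?a1 j + ?a2 j) \<le> (\<Sum>j\<in>UNIV. A * ?dd j + ?v1 j + ?v2 j + 1 / \<tau> * e)"
      by (intro sum_mono 2)
    ultimately show ?thesis by (simp only: sum.distrib sum_distrib_left)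
  qed
  note 3 = jump_coupling[OF k e_def, of y y']
  note 4 = switch_coupling[OF k e_def, of y y']
  have V0: "switch_part (\<lambda>_. V) w p k = 0" for w p by (simp add: switch_part_def)
  have rate: "rate * e = 1 / \<tau> * e + real CARD('d) * (1 / \<tau> * e) + 2 * jump_rate * e + 2 * (real n0 * \<bar>Qb\<bar>) * e"
    by (simp add: rate_def jump_rate_def add_divide_distrib distrib_right)
  have "G U y x k + G U' y' z k \<le> A * (pair_gen \<delta> (x - z) y y' k + H * \<rho> (norm (y - y'))) + G (\<lambda>_. V) y x k + G (\<lambda>_. V) y' z k
      + real n0 * (H * norm (y - y')) + rate * e"
    unfolding approx_gen_def pair_gen_def V0 rate distrib_left[of A] using 1 2 3 4 by linarith
  then have "h * (G U y x k + G U' y' z k) \<le> h * (A * (pair_gen \<delta> (x - z) y y' k + H * \<rho> (norm (y - y'))) + G (\<lambda>_. V) y x k + G (\<lambda>_. V) y' z k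
      + real n0 * (H * norm (y - y')) + rate * e)" using h by (intro mult_left_mono) auto
  moreover have "h * rate * e \<le> 1 * e" using h_rate e0 by (intro mult_right_mono)
  ultimately show ?thesis unfolding step_def e_def[symmetric] by (simp add: e_def algebra_simps)
qed

end

lemma pair_gen_le:
  assumes k: "k \<in> {1..n0}" and \<delta>: "0 < \<delta>" and y: "norm y \<le> R + 3" "norm y' \<le> R + 3"
    and xy: "norm (x - y) \<le> 2 * \<epsilon>" "norm (z - y') \<le> 2 * \<epsilon>" and \<epsilon>\<delta>: "4 * \<epsilon> \<le> \<delta>"
    and B: "norm (b y k) \<le> B" "norm (b y' k) \<le> B"
    and B\<beta>: "norm (drift r (R+3) y k) \<le> B\<beta>" "norm (drift r (R+3) y' k) \<le> B\<beta>"
  shows "pair_gen \<delta> (x - z) y y' k + H * \<rho> (norm (y - y')) \<le>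
      6 * H * \<rho> (soft_norm \<delta> (x - z)) + (8 * \<epsilon> * B + 2 * \<tau> * B\<beta>\<^sup>2) / \<delta>"
    and "norm (y - y') \<le> soft_norm \<delta> (x - z) + 4 * \<epsilon>"
proof -
  let ?v = "x - z" and ?w = "y - y'"
  define D where "D = soft_norm \<delta> ?v"
  have D: "\<delta> \<le> D" "0 < D" "norm ?v \<le> D" using soft_norm_ge(1)[of ?v \<delta>] soft_norm_ge(2)[of \<delta> ?v] \<delta> by (auto simp: D_def)
  have vw: "norm (?v - ?w) \<le> 4 * \<epsilon>"
  proof -
    have "?v - ?w = (x - y) - (z - y')" by simp
    then have "norm (?v - ?w) \<le> norm (x - y) + norm (z - y')" using norm_triangle_ineq4[of "x - y" "z - y'"] by (simp only:)
    then show ?thesis using xy by linarith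
  qed
  have w: "norm ?w \<le> norm ?v + 4 * \<epsilon>"
    using norm_triangle_ineq4[of ?v "?v - ?w"] vw by simp
  then show "norm (y - y') \<le> soft_norm \<delta> (x - z) + 4 * \<epsilon>" using D by (simp add: D_def)
  have w2: "norm ?w \<le> 2 * D" using w D \<epsilon>\<delta> by linarith
  have rho: "\<rho> (norm ?w) \<le> 2 * \<rho> D"
  proof -
    have "\<rho> (norm ?w) \<le> \<rho> (2 * D)" using w2 by (intro rho_le) auto
    also have "\<dots> \<le> (2 * D / D) * \<rho> D" using D by (intro rho_slope) auto
    finally show ?thesis using D by simp
  qed
  let ?\<beta> = "drift r (R+3) y k - drift r (R+3) y' k"
  let ?b = "b y k - b y' k" and ?c = "compensator r y k - compensator r y' k" and ?\<sigma> = "\<sigma> y k - \<sigma> y' k"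
  have \<beta>: "?\<beta> = ?b - ?c" using y by (simp add: drift_def)
  have n\<beta>: "norm ?\<beta> \<le> 2 * B\<beta>" using norm_triangle_ineq4[of "drift r (R+3) y k" "drift r (R+3) y' k"] B\<beta> by linarith
  have d1: "1 / \<tau> * (soft_norm \<delta> (?v + \<tau> *\<^sub>R ?\<beta>) - D) \<le> (2 * (?v \<bullet> ?\<beta>) + \<tau> * (norm ?\<beta>)\<^sup>2) / (2 * D)"
  proof -
    have "soft_norm \<delta> (?v + \<tau> *\<^sub>R ?\<beta>) - D \<le> (2 * (?v \<bullet> (\<tau> *\<^sub>R ?\<beta>)) + (norm (\<tau> *\<^sub>R ?\<beta>))\<^sup>2) / (2 * D)"
      using soft_norm_add_sq[OF \<delta>, of ?v "\<tau> *\<^sub>R ?\<beta>"] by (simp add: D_def)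
    also have "2 * (?v \<bullet> (\<tau> *\<^sub>R ?\<beta>)) + (norm (\<tau> *\<^sub>R ?\<beta>))\<^sup>2 = \<tau> * (2 * (?v \<bullet> ?\<beta>) + \<tau> * (norm ?\<beta>)\<^sup>2)"
      unfolding norm_scaleR inner_scaleR_right by (simp add: power_mult_distrib power2_eq_square[of \<tau>] distrib_left)
    finally show ?thesis using tau by (simp add: divide_le_eq mult.commute)
  qed
  have d2: "1 / (2 * \<tau>) * (soft_norm \<delta> (?v + sqrt \<tau> *\<^sub>R (diff_col (R+3) y k j - diff_col (R+3) y' k j))
        + soft_norm \<delta> (?v - sqrt \<tau> *\<^sub>R (diff_col (R+3) y k j - diff_col (R+3) y' k j)) - 2 * D)
      \<le> (norm (column j ?\<sigma>))\<^sup>2 / (2 * D)" for j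
  proof -
    let ?s = "column j ?\<sigma>"
    have s: "diff_col (R+3) y k j - diff_col (R+3) y' k j = ?s"
      using y by (simp add: diff_col_def column_def vec_eq_iff)
    have "soft_norm \<delta> (?v + sqrt \<tau> *\<^sub>R ?s) + soft_norm \<delta> (?v - sqrt \<tau> *\<^sub>R ?s) - 2 * D
      \<le> (2 * (?v \<bullet> (sqrt \<tau> *\<^sub>R ?s)) + (norm (sqrt \<tau> *\<^sub>R ?s))\<^sup>2) / (2 * D)
        + (2 * (?v \<bullet> (- (sqrt \<tau> *\<^sub>R ?s))) + (norm (- (sqrt \<tau> *\<^sub>R ?s)))\<^sup>2) / (2 * D)"
      using soft_norm_add_sq[OF \<delta>, of ?v "sqrt \<tau> *\<^sub>R ?s"] soft_norm_add_sq[OF \<delta>, of ?v "- (sqrt \<tau> *\<^sub>R ?s)"]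
      by (simp add: D_def)
    also have "\<dots> = 2 * \<tau> * ((norm ?s)\<^sup>2 / (2 * D))"
      using tau by (simp add: power_mult_distrib add_divide_distrib[symmetric])
    finally show ?thesis unfolding s using tau by (simp add: divide_le_eq mult.commute)
  qed
  have "(\<Sum>j\<in>UNIV. 1 / (2 * \<tau>) * (soft_norm \<delta> (?v + sqrt \<tau> *\<^sub>R (diff_col (R+3) y k j - diff_col (R+3) y' k j))
        + soft_norm \<delta> (?v - sqrt \<tau> *\<^sub>R (diff_col (R+3) y k j - diff_col (R+3) y' k j)) - 2 * D))
      \<le> (\<Sum>j\<in>UNIV. (norm (column j ?\<sigma>))\<^sup>2 / (2 * D))" by (intro sum_mono d2)
  also have "\<dots> = (norm ?\<sigma>)\<^sup>2 / (2 * D)" by (simp add: sum_divide_distrib[symmetric] sum_norm_column)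
  finally have pg: "pair_gen \<delta> ?v y y' k \<le> (2 * (?v \<bullet> ?\<beta>) + \<tau> * (norm ?\<beta>)\<^sup>2 + (norm ?\<sigma>)\<^sup>2) / (2 * D)"
    using d1 unfolding pair_gen_def D_def[symmetric] by (simp add: add_divide_distrib)
  \<comment> \<open>F1 pairs the increment of \<open>b\<close> with \<open>y - y'\<close>, whereas
    the distance grows along \<open>x - z\<close>; the mismatch has norm at most
    \<open>4 * \<epsilon>\<close> and is charged to the local bound of \<open>b\<close>.\<close>
  have "2 * (?v \<bullet> ?\<beta>) = 2 * (?w \<bullet> ?b) + 2 * ((?v - ?w) \<bullet> ?b) - 2 * (?v \<bullet> ?c)"
    unfolding \<beta> by (simp add: inner_diff_left inner_diff_right)
  moreover have "(norm ?\<sigma>)\<^sup>2 + 2 * (?w \<bullet> ?b) \<le> H * norm ?w * \<rho> (norm ?w)" by (rule F1[OF k])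
  moreover have "H * norm ?w * \<rho> (norm ?w) \<le> H * (2 * D) * (2 * \<rho> D)"
    by (rule mult_mono[OF mult_left_mono[OF w2] rho]) (use H_pos D rho_nonneg[of "norm ?w"] in auto)
  moreover have "(?v - ?w) \<bullet> ?b \<le> 4 * \<epsilon> * (2 * B)"
  proof -
    have "(?v - ?w) \<bullet> ?b \<le> norm (?v - ?w) * norm ?b" by (rule norm_cauchy_schwarz)
    also have "norm ?b \<le> 2 * B" using norm_triangle_ineq4[of "b y k" "b y' k"] B by linarith
    then have "norm (?v - ?w) * norm ?b \<le> 4 * \<epsilon> * (2 * B)" using vw eps by (intro mult_mono) auto
    finally show ?thesis .
  qed
  moreover have "- (?v \<bullet> ?c) \<le> D * (H * (2 * \<rho> D))"
  proof -
    have "- (?v \<bullet> ?c) \<le> norm ?v * norm ?c" using Cauchy_Schwarz_ineq2[of ?v ?c] by linarith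
    also have "\<dots> \<le> D * (H * \<rho> (norm ?w))"
      using compensator_diff[OF k r, of y y'] D by (intro mult_mono) auto
    also have "\<dots> \<le> D * (H * (2 * \<rho> D))" using rho H_pos D by (intro mult_left_mono) auto
    finally show ?thesis .
  qed
  moreover have "\<tau> * (norm ?\<beta>)\<^sup>2 \<le> \<tau> * (2 * B\<beta>)\<^sup>2"
    using n\<beta> tau by (intro mult_left_mono power_mono) auto
  ultimately have "2 * (?v \<bullet> ?\<beta>) + \<tau> * (norm ?\<beta>)\<^sup>2 + (norm ?\<sigma>)\<^sup>2 \<le> 8 * D * (H * \<rho> D) + 2 * (8 * \<epsilon> * B + 2 * \<tau> * B\<beta>\<^sup>2)"
    by (simp add: power_mult_distrib algebra_simps)
  then have "(2 * (?v \<bullet> ?\<beta>) + \<tau> * (norm ?\<beta>)\<^sup>2 + (norm ?\<sigma>)\<^sup>2) / (2 * D) \<le> (8 * D * (H * \<rho> D) + 2 * (8 * \<epsilon> * B + 2 * \<tau> * B\<beta>\<^sup>2)) / (2 * D)"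
    using D by (intro divide_right_mono) auto
  also have "\<dots> = 4 * (H * \<rho> D) + (8 * \<epsilon> * B + 2 * \<tau> * B\<beta>\<^sup>2) / D"
  proof -
    have "(8 * D * p + 2 * E) / (2 * D) = 4 * p + E / D" for p E using D by (simp add: add_divide_distrib)
    then show ?thesis by blast
  qed
  also have "(8 * \<epsilon> * B + 2 * \<tau> * B\<beta>\<^sup>2) / D \<le> (8 * \<epsilon> * B + 2 * \<tau> * B\<beta>\<^sup>2) / \<delta>"
  proof (rule divide_left_mono)
    have "0 \<le> B" using B(1) norm_ge_zero order.trans by blast
    then show "0 \<le> 8 * \<epsilon> * B + 2 * \<tau> * B\<beta>\<^sup>2" using eps tau by simp
  qed (use D \<delta> in auto)
  finally have "pair_gen \<delta> ?v y y' k \<le> 4 * (H * \<rho> D) + (8 * \<epsilon> * B + 2 * \<tau> * B\<beta>\<^sup>2) / \<delta>" using pg by linarith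
  moreover have "H * \<rho> (norm ?w) \<le> H * (2 * \<rho> D)" using rho H_pos by (intro mult_left_mono) auto
  ultimately show "pair_gen \<delta> (x - z) y y' k + H * \<rho> (norm (y - y')) \<le>
      6 * H * \<rho> (soft_norm \<delta> (x - z)) + (8 * \<epsilon> * B + 2 * \<tau> * B\<beta>\<^sup>2) / \<delta>"
    by (simp add: D_def)
qed

end

section \<open>The Lyapunov function\<close>

lemma ln_norm_increment:
  fixes x v :: "'a::real_inner"
  shows "ln (1 + (norm (x + v))\<^sup>2) - ln (1 + (norm x)\<^sup>2) \<le> (2 * (x \<bullet> v) + (norm v)\<^sup>2) / (1 + (norm x)\<^sup>2)"
proof -
  let ?a = "1 + (norm x)\<^sup>2" and ?b = "1 + (norm (x + v))\<^sup>2"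
  have a: "?a > 0" "?b > 0" by (auto intro: add_pos_nonneg)
  have "ln ?b - ln ?a = ln (?b / ?a)" using a by (simp add: ln_div)
  also have "\<dots> \<le> ?b / ?a - 1" using a by (intro ln_le_minus_one) auto
  also have "\<dots> = (?b - ?a) / ?a"
  proof -
    have "d / c - 1 = (d - c) / c" if "c > 0" for c d :: real using that by (simp add: diff_divide_distrib)
    from this[OF a(1)] show ?thesis .
  qed
  also have "?b - ?a = 2 * (x \<bullet> v) + (norm v)\<^sup>2"
    by (simp add: power2_norm_eq_inner inner_add_left inner_add_right inner_commute)
  finally show ?thesis .
qed

section \<open>Tails of the jump measures\<close>

context switching begin

lemma nu_tail:
  assumes k: "k \<in> {1..n0}" and K: "0 < K"
  shows "integrable (\<nu> y k) (\<lambda>u. indicator {u. K < norm u} u :: real)"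
proof (rule nu_integrable(1)[OF k])
  show "norm (indicator {u. K < norm u} u :: real) \<le> 1 / min 1 (K\<^sup>2) * trunc_sq u" for u :: "real^'d"
    using trunc_sq_ge[OF K, of u] K by (auto simp: indicator_def)
qed measurable

text \<open>The threshold grows with \<open>norm x\<close>, and the indicator is at most
  \<open>norm u\<close> divided by the threshold. Comparison with the measure at the origin then
  costs a multiple of \<open>\<rho> (norm y)\<close>, whose linear growth cancels against
  \<open>1 + norm x\<close>; the bound is uniform in space.\<close>

lemma nu_tail_le:
  fixes x y :: "real^'d"
  assumes k: "k \<in> {1..n0}" and K: "0 < K" and x: "norm y \<le> norm x + 1"
  shows "(\<integral>u. indicator {u. K * (1 + norm x) < norm u} u \<partial>\<nu> y k) \<le> (\<integral>u. indicator {u. K < norm u} u \<partial>\<nu> 0 k) + 2 * H * \<rho> 1 / K"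
proof -
  let ?c = "K * (1 + norm x)"
  have c: "0 < ?c" using K by (intro mult_pos_pos) (auto intro: add_pos_nonneg)
  have "norm (indicator {u. ?c < norm u} u :: real) \<le> 1 / ?c * norm u" for u :: "real^'d"
    using c by (auto simp: indicator_def le_divide_eq)
  from nu_integral_diff[OF k _ nu_tail[OF k c, of y] nu_tail[OF k c, of 0] this]
  have 1: "(\<integral>u. indicator {u. ?c < norm u} u \<partial>\<nu> y k) \<le> (\<integral>u. indicator {u. ?c < norm u} u \<partial>\<nu> 0 k) + 1 / ?c * (H * \<rho> (norm y))"
    using c by (auto simp: abs_le_iff)
  have 2: "(\<integral>u. (indicator {u. ?c < norm u} u :: real) \<partial>\<nu> 0 k) \<le> (\<integral>u. indicator {u. K < norm u} u \<partial>\<nu> 0 k)"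
  proof (rule integral_mono[OF nu_tail[OF k c] nu_tail[OF k K]])
    have "K * 1 \<le> ?c" using K by (intro mult_left_mono) auto
    then show "indicator {u. ?c < norm u} u \<le> (indicator {u. K < norm u} u :: real)" for u :: "real^'d"
      by (auto simp: indicator_def)
  qed
  have "\<rho> (norm y) \<le> \<rho> 1 * (1 + norm y)" by (rule rho_linear) simp
  also have "\<dots> \<le> \<rho> 1 * (2 * (1 + norm x))"
  proof (rule mult_left_mono)
    show "1 + norm y \<le> 2 * (1 + norm x)" unfolding distrib_left using x norm_ge_zero[of x] by linarith
  qed (simp add: rho_nonneg)
  finally have "1 / ?c * (H * \<rho> (norm y)) \<le> 1 / ?c * (H * (\<rho> 1 * (2 * (1 + norm x))))"
    using c H_pos by (intro mult_left_mono) auto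
  also have "\<dots> = 2 * H * \<rho> 1 / K"
  proof -
    have "1 + norm x \<noteq> 0" using norm_ge_zero[of x] by linarith
    moreover have "1 / (K * n) * (H * (p * (2 * n))) = 2 * H * p / K" if "n \<noteq> 0" for n p :: real
      using that K by (simp add: field_simps)
    ultimately show ?thesis by blast
  qed
  finally show ?thesis using 1 2 by linarith
qed

end

context scheme begin

text \<open>Normalised to reach 1 at radius \<open>R\<close> and capped there, so that it dominates
  the excess where the cut-off acts. As \<open>R\<close> grows it tends to 0 on bounded sets; the
  logarithm is slow enough to tolerate heavy-tailed jumps.\<close>

definition lyap :: "real^'d \<Rightarrow> real" where
  "lyap x = min 1 (ln (1 + (norm x)\<^sup>2) / ln (1 + R\<^sup>2))"

lemma lyap_props:
  assumes R: "0 < R"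
  shows "lyap \<in> borel_measurable borel" "0 \<le> lyap x" "lyap x \<le> 1" "R \<le> norm x \<Longrightarrow> lyap x = 1"
    "lyap x \<le> ln (1 + (norm x)\<^sup>2) / ln (1 + R\<^sup>2)"
    "norm x \<le> R \<Longrightarrow> lyap x = ln (1 + (norm x)\<^sup>2) / ln (1 + R\<^sup>2)"
proof -
  have l: "0 < ln (1 + R\<^sup>2)" using R by (intro ln_gt_zero) simp
  show "lyap \<in> borel_measurable borel" unfolding lyap_def[abs_def] by measurable
  show "0 \<le> lyap x" using l by (auto simp: lyap_def intro!: divide_nonneg_pos ln_ge_zero)
  show "R \<le> norm x \<Longrightarrow> lyap x = 1"
  proof -
    assume "R \<le> norm x"
    then have "ln (1 + R\<^sup>2) \<le> ln (1 + (norm x)\<^sup>2)" using R by (subst ln_le_cancel_iff) (auto intro: add_pos_nonneg)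
    then show "lyap x = 1" using l by (simp add: lyap_def min_def le_divide_eq)
  qed
  assume "norm x \<le> R"
  then have "ln (1 + (norm x)\<^sup>2) \<le> ln (1 + R\<^sup>2)" using R by (subst ln_le_cancel_iff) (auto intro: add_pos_nonneg power_mono)
  then show "lyap x = ln (1 + (norm x)\<^sup>2) / ln (1 + R\<^sup>2)" using l by (simp add: lyap_def min_def divide_le_eq)
qed (auto simp: lyap_def)

lemma lyap_increment:
  assumes R: "0 < R" and x: "norm x \<le> R"
  shows "lyap (x + v) - lyap x \<le> (2 * (x \<bullet> v) + (norm v)\<^sup>2) / (1 + (norm x)\<^sup>2) / ln (1 + R\<^sup>2)"
proof -
  have l: "0 < ln (1 + R\<^sup>2)" using R by (intro ln_gt_zero) simp
  have "lyap (x + v) - lyap x \<le> (ln (1 + (norm (x + v))\<^sup>2) - ln (1 + (norm x)\<^sup>2)) / ln (1 + R\<^sup>2)"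
    using lyap_props(5)[OF R, of "x + v"] lyap_props(6)[OF R x] by (simp add: diff_divide_distrib)
  also have "\<dots> \<le> (2 * (x \<bullet> v) + (norm v)\<^sup>2) / (1 + (norm x)\<^sup>2) / ln (1 + R\<^sup>2)"
    using ln_norm_increment[of x v] l by (intro divide_right_mono) auto
  finally show ?thesis .
qed

text \<open>The jumps are split in three: those below \<open>\<epsilon>0\<close> enter through their
  second moment, those up to \<open>K * (1 + norm x)\<close> change the logarithm by a constant, and
  larger ones are paid for by the cap and the tail. The first two gain the factor
  \<open>1 / ln (1 + R^2)\<close>; the third does not and must be made small by \<open>K\<close>,
  which is why \<open>K\<close> is chosen before \<open>R\<close>.\<close>

lemma G_lyap_le:
  assumes k: "k \<in> {1..n0}" and R: "0 < R" and x: "norm x \<le> R" and xy: "norm (x - y) \<le> 2 * \<epsilon>"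
    and \<epsilon>: "2 * \<epsilon> \<le> 1" and re: "r \<le> \<epsilon>0"
    and Cg: "0 \<le> Cg" "2 * (y \<bullet> b y k) + (norm (\<sigma> y k))\<^sup>2 \<le> Cg * (1 + (norm y)\<^sup>2)"
    and B: "norm (b y k) \<le> B" "4 * \<epsilon> * B \<le> 1"
    and B\<beta>: "norm (drift r (R+3) y k) \<le> B\<beta>" "\<tau> * B\<beta>\<^sup>2 \<le> 1"
    and K: "0 < K" and \<theta>: "(\<integral>u. indicator {u. K < norm u} u \<partial>\<nu> 0 k) \<le> \<theta>"
  shows "G (\<lambda>_. lyap) y x k \<le> (3 * Cg + 2 + max 1 (\<epsilon>0\<^sup>2) * C\<nu> + ln (3 + 4 * K\<^sup>2) * (C\<nu> / min 1 (\<epsilon>0\<^sup>2))) / ln (1 + R\<^sup>2)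
      + \<theta> + 2 * H * \<rho> 1 / K"
proof -
  define ell where "ell = ln (1 + R\<^sup>2)"
  define a where "a = 1 + (norm x)\<^sup>2"
  have l: "0 < ell" using R unfolding ell_def by (intro ln_gt_zero) simp
  have a: "1 \<le> a" by (simp add: a_def)
  have al: "0 < a * ell" using a l by simp
  have yx: "norm y \<le> norm x + 1" using norm_triangle_ineq2[of y x] xy \<epsilon> by (simp add: norm_minus_commute)
  have yR: "norm y \<le> R + 3" using yx x by linarith
  let ?\<beta> = "drift r (R+3) y k" and ?c = "compensator r y k"
  have \<beta>: "?\<beta> = b y k - ?c" using yR by (simp add: drift_def)
  note inc = lyap_increment[OF R x, folded a_def ell_def]
  have inc': "lyap (x + v) - lyap x \<le> (2 * (x \<bullet> v) + (norm v)\<^sup>2) / (a * ell)" for v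
    using inc[of v] by simp
  have 1: "1 / \<tau> * (lyap (x + \<tau> *\<^sub>R ?\<beta>) - lyap x) \<le> (2 * (x \<bullet> ?\<beta>) + \<tau> * (norm ?\<beta>)\<^sup>2) / (a * ell)"
  proof -
    have "lyap (x + \<tau> *\<^sub>R ?\<beta>) - lyap x \<le> (2 * (x \<bullet> (\<tau> *\<^sub>R ?\<beta>)) + (norm (\<tau> *\<^sub>R ?\<beta>))\<^sup>2) / (a * ell)" by (rule inc')
    also have "2 * (x \<bullet> (\<tau> *\<^sub>R ?\<beta>)) + (norm (\<tau> *\<^sub>R ?\<beta>))\<^sup>2 = \<tau> * (2 * (x \<bullet> ?\<beta>) + \<tau> * (norm ?\<beta>)\<^sup>2)"
      using tau by (simp add: power_mult_distrib power2_eq_square[of \<tau>] algebra_simps)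
    finally show ?thesis using tau by (simp add: divide_le_eq mult.commute)
  qed
  have "1 / (2 * \<tau>) * (lyap (x + sqrt \<tau> *\<^sub>R diff_col (R+3) y k j) + lyap (x - sqrt \<tau> *\<^sub>R diff_col (R+3) y k j) - 2 * lyap x)
      \<le> (norm (column j (\<sigma> y k)))\<^sup>2 / (a * ell)" for j
  proof -
    let ?s = "column j (\<sigma> y k)"
    have s: "diff_col (R+3) y k j = ?s" using yR by (simp add: diff_col_def)
    have "lyap (x + sqrt \<tau> *\<^sub>R ?s) + lyap (x - sqrt \<tau> *\<^sub>R ?s) - 2 * lyap x
      \<le> (2 * (x \<bullet> (sqrt \<tau> *\<^sub>R ?s)) + (norm (sqrt \<tau> *\<^sub>R ?s))\<^sup>2) / (a * ell)
        + (2 * (x \<bullet> (- (sqrt \<tau> *\<^sub>R ?s))) + (norm (- (sqrt \<tau> *\<^sub>R ?s)))\<^sup>2) / (a * ell)"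
      using inc'[of "sqrt \<tau> *\<^sub>R ?s"] inc'[of "- (sqrt \<tau> *\<^sub>R ?s)"] by simp
    also have "\<dots> = 2 * \<tau> * ((norm ?s)\<^sup>2 / (a * ell))"
      using tau by (simp add: power_mult_distrib add_divide_distrib[symmetric])
    finally show ?thesis unfolding s using tau by (simp add: divide_le_eq mult.commute)
  qed
  then have "(\<Sum>j\<in>UNIV. 1 / (2 * \<tau>) * (lyap (x + sqrt \<tau> *\<^sub>R diff_col (R+3) y k j) + lyap (x - sqrt \<tau> *\<^sub>R diff_col (R+3) y k j) - 2 * lyap x))
      \<le> (\<Sum>j\<in>UNIV. (norm (column j (\<sigma> y k)))\<^sup>2 / (a * ell))" by (intro sum_mono)
  also have "\<dots> = (norm (\<sigma> y k))\<^sup>2 / (a * ell)" by (simp add: sum_divide_distrib[symmetric] sum_norm_column)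
  finally have 2: "(\<Sum>j\<in>UNIV. 1 / (2 * \<tau>) * (lyap (x + sqrt \<tau> *\<^sub>R diff_col (R+3) y k j) + lyap (x - sqrt \<tau> *\<^sub>R diff_col (R+3) y k j) - 2 * lyap x))
      \<le> (norm (\<sigma> y k))\<^sup>2 / (a * ell)" .
  have K1: "0 < K * (1 + norm x)" using K by (intro mult_pos_pos) (auto intro: add_pos_nonneg)
  let ?i = "\<lambda>u::real^'d. indicator {u. r \<le> norm u \<and> norm u < \<epsilon>0} u *\<^sub>R u"
  have i3: "integrable (\<nu> y k) (\<lambda>u. indicator {u. \<epsilon>0 \<le> norm u} u :: real)" "(\<integral>u. indicator {u. \<epsilon>0 \<le> norm u} u \<partial>\<nu> y k) \<le> C\<nu> / min 1 (\<epsilon>0\<^sup>2)"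
  proof -
    have "norm (indicator {u. \<epsilon>0 \<le> norm u} u :: real) \<le> 1 / min 1 (\<epsilon>0\<^sup>2) * trunc_sq u" for u :: "real^'d"
      using trunc_sq_ge[OF eps0, of u] eps0 by (auto simp: indicator_def)
    from nu_integrable[OF k _ this]
    show "integrable (\<nu> y k) (\<lambda>u. indicator {u. \<epsilon>0 \<le> norm u} u :: real)" "(\<integral>u. indicator {u. \<epsilon>0 \<le> norm u} u \<partial>\<nu> y k) \<le> C\<nu> / min 1 (\<epsilon>0\<^sup>2)"
      by auto
  qed
  have lnK: "0 \<le> ln (3 + 4 * K\<^sup>2)" by (intro ln_ge_zero) (simp add: add_increasing2)
  have 3: "jump_op r (\<lambda>_. lyap) y x k \<le> (2 * (x \<bullet> ?c) + small_jumps \<epsilon>0 y k) / (a * ell)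
      + ln (3 + 4 * K\<^sup>2) / ell * (C\<nu> / min 1 (\<epsilon>0\<^sup>2)) + (\<theta> + 2 * H * \<rho> 1 / K)"
  proof -
    have v: "unit_valued (\<lambda>_. lyap)" using lyap_props[OF R] by (simp add: unit_valued_def)
    have "jump_op r (\<lambda>_. lyap) y x k \<le> (\<integral>u. (2 * (x \<bullet> ?i u) + indicator {u. norm u < \<epsilon>0} u * (norm u)\<^sup>2) / (a * ell)
        + ln (3 + 4 * K\<^sup>2) / ell * indicator {u. \<epsilon>0 \<le> norm u} u + indicator {u. K * (1 + norm x) < norm u} u \<partial>\<nu> y k)"
      unfolding jump_op_def
    proof (rule integral_mono)
      show "integrable (\<nu> y k) (\<lambda>u. indicator {u. r \<le> norm u} u * (lyap (x + u) - lyap x))"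
        by (rule large_jump_integrable(1)[OF k r unit_valuedD(1,4)[OF v k]])
      show "integrable (\<nu> y k) (\<lambda>u. (2 * (x \<bullet> ?i u) + indicator {u. norm u < \<epsilon>0} u * (norm u)\<^sup>2) / (a * ell)
        + ln (3 + 4 * K\<^sup>2) / ell * indicator {u. \<epsilon>0 \<le> norm u} u + indicator {u. K * (1 + norm x) < norm u} u)"
        by (intro Bochner_Integration.integrable_add integrable_divide integrable_mult_right integrable_inner_right
            compensator_integrable(1)[OF k r] small_jumps_integrable(1)[OF k eps0] i3 nu_tail[OF k K1])
      fix u :: "real^'d"
      consider "norm u < r" | "r \<le> norm u" "norm u < \<epsilon>0" | "\<epsilon>0 \<le> norm u" "norm u \<le> K * (1 + norm x)" | "\<epsilon>0 \<le> norm u" "K * (1 + norm x) < norm u"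
        by linarith
      then show "indicator {u. r \<le> norm u} u * (lyap (x + u) - lyap x) \<le>
        (2 * (x \<bullet> ?i u) + indicator {u. norm u < \<epsilon>0} u * (norm u)\<^sup>2) / (a * ell)
        + ln (3 + 4 * K\<^sup>2) / ell * indicator {u. \<epsilon>0 \<le> norm u} u + indicator {u. K * (1 + norm x) < norm u} u"
      proof cases
        case 1
        then show ?thesis using al re l lnK by (auto simp: indicator_def)
      next
        case 2
        then have "indicator {u. r \<le> norm u} u * (lyap (x + u) - lyap x) \<le> (2 * (x \<bullet> ?i u) + indicator {u. norm u < \<epsilon>0} u * (norm u)\<^sup>2) / (a * ell)"
          using inc'[of u] by simp
        moreover have "0 \<le> ln (3 + 4 * K\<^sup>2) / ell * indicator {u. \<epsilon>0 \<le> norm u} u" "0 \<le> (indicator {u. K * (1 + norm x) < norm u} u :: real)"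
          using l lnK by auto
        ultimately show ?thesis by linarith
      next
        case 3
        \<comment> \<open>A jump of size at most \<open>K * (1 + norm x)\<close> multiplies one plus
          the squared norm by at most \<open>3 + 4 K^2\<close>.\<close>
        have "lyap (x + u) - lyap x \<le> ln (3 + 4 * K\<^sup>2) / ell"
        proof -
          have "(norm (x + u))\<^sup>2 \<le> (norm x + norm u)\<^sup>2" by (intro power_mono norm_triangle_ineq) auto
          also have "\<dots> \<le> 2 * (norm x)\<^sup>2 + 2 * (norm u)\<^sup>2"
            using zero_le_power2[of "norm x - norm u"] by (simp add: power2_sum power2_diff)
          also have "(norm u)\<^sup>2 \<le> (K * (1 + norm x))\<^sup>2" using 3 by (intro power_mono) auto
          also have "\<dots> = K\<^sup>2 * (1 + norm x)\<^sup>2" by (simp add: power_mult_distrib)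
          also have "(1 + norm x)\<^sup>2 \<le> 2 * a" using zero_le_power2[of "1 - norm x"] by (simp add: a_def power2_sum power2_diff)
          finally have "(norm (x + u))\<^sup>2 \<le> 2 * (norm x)\<^sup>2 + 2 * (K\<^sup>2 * (2 * a))" by (simp add: mult_left_mono)
          moreover have "(3 + 4 * K\<^sup>2) * a = 3 + 3 * (norm x)\<^sup>2 + 2 * (K\<^sup>2 * (2 * a))" by (simp add: a_def algebra_simps)
          ultimately have "1 + (norm (x + u))\<^sup>2 \<le> (3 + 4 * K\<^sup>2) * a" using zero_le_power2[of "norm x"] by linarith
          then have "ln (1 + (norm (x + u))\<^sup>2) \<le> ln ((3 + 4 * K\<^sup>2) * a)"
            using a by (subst ln_le_cancel_iff) (auto intro!: add_pos_nonneg mult_pos_pos)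
          also have "\<dots> = ln (3 + 4 * K\<^sup>2) + ln a"
          proof -
            have "0 < 3 + 4 * K\<^sup>2" by (simp add: add_pos_nonneg)
            then show ?thesis using a by (simp add: ln_mult_pos)
          qed
          finally have "ln (1 + (norm (x + u))\<^sup>2) / ell \<le> (ln (3 + 4 * K\<^sup>2) + ln a) / ell" using l by (intro divide_right_mono) auto
          then show ?thesis
            using lyap_props(5)[OF R, of "x + u"] lyap_props(6)[OF R x] unfolding ell_def[symmetric] a_def[symmetric]
            by (simp add: add_divide_distrib)
        qed
        then show ?thesis using 3 re by simp
      next
        case 4
        have "lyap (x + u) - lyap x \<le> 1" using lyap_props(3)[OF R, of "x + u"] lyap_props(2)[OF R, of x] by linarith
        moreover have "0 \<le> ln (3 + 4 * K\<^sup>2) / ell" using l lnK by simp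
        ultimately show ?thesis using 4 re by simp
      qed
    qed
    also have "\<dots> = (2 * (x \<bullet> ?c) + small_jumps \<epsilon>0 y k) / (a * ell)
        + ln (3 + 4 * K\<^sup>2) / ell * (\<integral>u. indicator {u. \<epsilon>0 \<le> norm u} u \<partial>\<nu> y k) + (\<integral>u. indicator {u. K * (1 + norm x) < norm u} u \<partial>\<nu> y k)"
    proof -
      have c: "has_bochner_integral (\<nu> y k) (\<lambda>u. x \<bullet> ?i u) (x \<bullet> ?c)"
        unfolding compensator_def has_bochner_integral_iff
        using compensator_integrable(1)[OF k r, of y] integrable_inner_right integral_inner_right by blast
      have s: "has_bochner_integral (\<nu> y k) (\<lambda>u. indicator {u. norm u < \<epsilon>0} u * (norm u)\<^sup>2) (small_jumps \<epsilon>0 y k)"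
        unfolding small_jumps_def using small_jumps_integrable(1)[OF k eps0] by (rule has_bochner_integral_integrable)
      show ?thesis
        by (rule has_bochner_integral_integral_eq)
          (intro has_bochner_integral_add has_bochner_integral_divide_zero has_bochner_integral_mult_right c s
            has_bochner_integral_integrable[OF i3(1)] has_bochner_integral_integrable[OF nu_tail[OF k K1]])
    qed
    also have "\<dots> \<le> (2 * (x \<bullet> ?c) + small_jumps \<epsilon>0 y k) / (a * ell)
        + ln (3 + 4 * K\<^sup>2) / ell * (C\<nu> / min 1 (\<epsilon>0\<^sup>2)) + (\<theta> + 2 * H * \<rho> 1 / K)"
      using i3(2) nu_tail_le[OF k K yx] \<theta> l lnK by (intro add_mono mult_left_mono order.refl) auto
    finally show ?thesis .
  qed
  have 4: "switch_part (\<lambda>_. lyap) y x k = 0" by (simp add: switch_part_def)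
  have "G (\<lambda>_. lyap) y x k \<le> (2 * (x \<bullet> ?\<beta>) + \<tau> * (norm ?\<beta>)\<^sup>2) / (a * ell) + (norm (\<sigma> y k))\<^sup>2 / (a * ell)
      + ((2 * (x \<bullet> ?c) + small_jumps \<epsilon>0 y k) / (a * ell)
      + ln (3 + 4 * K\<^sup>2) / ell * (C\<nu> / min 1 (\<epsilon>0\<^sup>2)) + (\<theta> + 2 * H * \<rho> 1 / K))"
    unfolding approx_gen_def 4 using 1 2 3 by linarith
  also have "\<dots> = (2 * (x \<bullet> ?\<beta>) + 2 * (x \<bullet> ?c) + \<tau> * (norm ?\<beta>)\<^sup>2 + (norm (\<sigma> y k))\<^sup>2 + small_jumps \<epsilon>0 y k) / (a * ell)
      + ln (3 + 4 * K\<^sup>2) * (C\<nu> / min 1 (\<epsilon>0\<^sup>2)) / ell + \<theta> + 2 * H * \<rho> 1 / K"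
    by (simp add: add_divide_distrib)
  \<comment> \<open>The compensator inside the drift cancels the mean of the jumps between
    \<open>r\<close> and \<open>\<epsilon>0\<close>, so the bound does not deteriorate as
    \<open>r\<close> tends to 0.\<close>
  also have "2 * (x \<bullet> ?\<beta>) + 2 * (x \<bullet> ?c) = 2 * (x \<bullet> b y k)" unfolding \<beta> by (simp add: inner_diff_right)
  finally have G: "G (\<lambda>_. lyap) y x k \<le> (2 * (x \<bullet> b y k) + \<tau> * (norm ?\<beta>)\<^sup>2 + (norm (\<sigma> y k))\<^sup>2 + small_jumps \<epsilon>0 y k) / (a * ell)
      + ln (3 + 4 * K\<^sup>2) * (C\<nu> / min 1 (\<epsilon>0\<^sup>2)) / ell + \<theta> + 2 * H * \<rho> 1 / K" .
  have "2 * (x \<bullet> b y k) = 2 * (y \<bullet> b y k) + 2 * ((x - y) \<bullet> b y k)" by (simp add: inner_diff_left)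
  moreover have "(x - y) \<bullet> b y k \<le> 2 * \<epsilon> * B"
  proof -
    have "(x - y) \<bullet> b y k \<le> norm (x - y) * norm (b y k)" by (rule norm_cauchy_schwarz)
    also have "\<dots> \<le> 2 * \<epsilon> * B" using xy B(1) eps by (intro mult_mono) auto
    finally show ?thesis .
  qed
  moreover have "\<tau> * (norm ?\<beta>)\<^sup>2 \<le> 1"
  proof -
    have "\<tau> * (norm ?\<beta>)\<^sup>2 \<le> \<tau> * B\<beta>\<^sup>2" using B\<beta>(1) tau by (intro mult_left_mono power_mono) auto
    then show ?thesis using B\<beta>(2) by linarith
  qed
  moreover have "1 + (norm y)\<^sup>2 \<le> 3 * a"
  proof -
    have "(norm y)\<^sup>2 \<le> (norm x + 1)\<^sup>2" using yx by (intro power_mono) auto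
    also have "\<dots> \<le> 2 * a" using zero_le_power2[of "1 - norm x"] by (simp add: a_def power2_sum power2_diff)
    finally show ?thesis using a by linarith
  qed
  then have "Cg * (1 + (norm y)\<^sup>2) \<le> Cg * (3 * a)" using Cg(1) by (intro mult_left_mono)
  moreover have "small_jumps \<epsilon>0 y k \<le> max 1 (\<epsilon>0\<^sup>2) * C\<nu>" using small_jumps_integrable(2)[OF k eps0, of y] by linarith
  ultimately have "2 * (x \<bullet> b y k) + \<tau> * (norm ?\<beta>)\<^sup>2 + (norm (\<sigma> y k))\<^sup>2 + small_jumps \<epsilon>0 y k
    \<le> 3 * Cg * a + 2 + max 1 (\<epsilon>0\<^sup>2) * C\<nu>"
    using Cg(2) B(2) by linarith
  also have "\<dots> \<le> (3 * Cg + 2 + max 1 (\<epsilon>0\<^sup>2) * C\<nu>) * a"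
  proof -
    have "0 \<le> 2 + max 1 (\<epsilon>0\<^sup>2) * C\<nu>" using Cnu_nonneg by simp
    from mult_left_mono[OF a this] show ?thesis by (simp add: algebra_simps)
  qed
  finally have "(2 * (x \<bullet> b y k) + \<tau> * (norm ?\<beta>)\<^sup>2 + (norm (\<sigma> y k))\<^sup>2 + small_jumps \<epsilon>0 y k) / (a * ell)
    \<le> (3 * Cg + 2 + max 1 (\<epsilon>0\<^sup>2) * C\<nu>) * a / (a * ell)"
    using al by (intro divide_right_mono) auto
  also have "\<dots> = (3 * Cg + 2 + max 1 (\<epsilon>0\<^sup>2) * C\<nu>) / ell" using a by simp
  finally show ?thesis using G unfolding ell_def[symmetric] by (simp add: add_divide_distrib)
qed

end

section \<open>Comparison along the Euler sequence\<close>

context switching begin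

fun euler_seq :: "real \<Rightarrow> real \<Rightarrow> nat \<Rightarrow> real" where
  "euler_seq c s 0 = s"
| "euler_seq c s (Suc n) = euler_seq c s n + c * \<rho> (euler_seq c s n)"

lemma euler_seq_ge:
  assumes "0 \<le> c" "0 < s" shows "s \<le> euler_seq c s n"
proof (induction n)
  case (Suc n)
  then have "0 \<le> c * \<rho> (euler_seq c s n)" using assms rho_nonneg[of "euler_seq c s n"] by simp
  then show ?case using Suc by simp
qed simp

text \<open>Since \<open>1 / \<rho>\<close> is nonincreasing, one Euler step of size
  \<open>h\<close> uses up at most \<open>h\<close> of the integral of \<open>1 / \<rho>\<close>;
  after \<open>N\<close> steps at most \<open>T\<close> is used. Divergence at 0 provides a start
  \<open>s\<close> for which the integral from \<open>s\<close> to \<open>c\<close> exceeds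
  \<open>T\<close>, so \<open>c\<close> is not passed. The start depends on neither \<open>h\<close>
  nor \<open>N\<close>.\<close>

lemma euler_seq_osgood:
  assumes osgood: "\<forall>c>0. (\<integral>\<^sup>+r. indicator {0<..c} r * ennreal (1 / \<rho> r) \<partial>lborel) = \<infinity>"
    and c: "0 < c" and T: "0 \<le> T"
  obtains s where "0 < s" "\<And>h N. 0 \<le> h \<Longrightarrow> real N * h \<le> T \<Longrightarrow> euler_seq h s N \<le> c"
proof -
  \<comment> \<open>Composing with \<open>max 0\<close> makes \<rho> monotone on the whole line,
    hence Borel measurable.\<close>
  define f where "f = (\<lambda>r. ennreal (1 / \<rho> (max 0 r)))"
  have "mono (\<lambda>r. \<rho> (max 0 r))" by (intro monoI rho_le) auto
  then have [measurable]: "(\<lambda>r. \<rho> (max 0 r)) \<in> borel_measurable borel" by (rule borel_measurable_mono)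
  have [measurable]: "f \<in> borel_measurable borel" unfolding f_def by measurable
  have "(\<integral>\<^sup>+r. indicator {0<..c} r * f r \<partial>lborel) = (\<integral>\<^sup>+r. indicator {0<..c} r * ennreal (1 / \<rho> r) \<partial>lborel)"
    by (intro nn_integral_cong) (auto simp: f_def indicator_def)
  then have inf: "(\<integral>\<^sup>+r. indicator {0<..c} r * f r \<partial>lborel) = \<infinity>" using osgood c by simp
  have "(SUP n. indicator {1 / real (Suc n)<..c} r * f r) = indicator {0<..c} r * f r" for r
  proof (cases "0 < r \<and> r \<le> c")
    case True
    then obtain n where n: "1 / real (Suc n) < r" using reals_Archimedean[of r] by (auto simp: inverse_eq_divide)
    show ?thesis
    proof (rule antisym)
      show "(SUP n. indicator {1 / real (Suc n)<..c} r * f r) \<le> indicator {0<..c} r * f r"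
        using True by (intro SUP_least) (auto simp: indicator_def)
      have "indicator {0<..c} r * f r = indicator {1 / real (Suc n)<..c} r * f r" using n True by (simp add: indicator_def)
      also have "\<dots> \<le> (SUP n. indicator {1 / real (Suc n)<..c} r * f r)" by (rule SUP_upper) simp
      finally show "indicator {0<..c} r * f r \<le> (SUP n. indicator {1 / real (Suc n)<..c} r * f r)" .
    qed
  next
    case False
    have "\<not> (1 / real (Suc n) < r \<and> r \<le> c)" for n
    proof -
      have "0 < 1 / real (Suc n)" by simp
      then show ?thesis using False by (meson order.strict_trans)
    qed
    then have z: "indicator {1 / real (Suc n)<..c} r * f r = 0" for n by (simp add: indicator_def)
    have "indicator {0<..c} r * f r = 0" using False by (auto simp: indicator_def)
    then show ?thesis unfolding z by simp
  qed
  then have "(\<integral>\<^sup>+r. (SUP n. indicator {1 / real (Suc n)<..c} r * f r) \<partial>lborel) = \<infinity>" using inf by simp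
  moreover have "(\<integral>\<^sup>+r. (SUP n. indicator {1 / real (Suc n)<..c} r * f r) \<partial>lborel)
      = (SUP n. \<integral>\<^sup>+r. indicator {1 / real (Suc n)<..c} r * f r \<partial>lborel)"
  proof (rule nn_integral_monotone_convergence_SUP)
    show "incseq (\<lambda>n r. indicator {1 / real (Suc n)<..c} r * f r)"
    proof (rule incseq_SucI, rule le_funI)
      fix n r
      have "1 / real (Suc (Suc n)) \<le> 1 / real (Suc n)" by (intro divide_left_mono) auto
      then show "indicator {1 / real (Suc n)<..c} r * f r \<le> indicator {1 / real (Suc (Suc n))<..c} r * f r"
        by (auto simp: indicator_def)
    qed
  qed measurable
  ultimately have "ennreal T < (SUP n. \<integral>\<^sup>+r. indicator {1 / real (Suc n)<..c} r * f r \<partial>lborel)" by simp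
  then obtain n where n: "ennreal T < (\<integral>\<^sup>+r. indicator {1 / real (Suc n)<..c} r * f r \<partial>lborel)"
    unfolding less_SUP_iff by auto
  define s where "s = 1 / real (Suc n)"
  have s: "0 < s" by (simp add: s_def)
  have "euler_seq h s N \<le> c" if h: "0 \<le> h" and N: "real N * h \<le> T" for h N
  proof (rule ccontr)
    let ?e = "euler_seq h s"
    have ge: "s \<le> ?e m" for m by (rule euler_seq_ge[OF h s])
    assume "\<not> ?e N \<le> c"
    have "(\<integral>\<^sup>+r. indicator {s<..?e m} r * f r \<partial>lborel) \<le> ennreal (real m * h)" for m
    proof (induction m)
      case (Suc m)
      let ?x = "?e m"
      have x: "0 < ?x" "s \<le> ?x" using ge[of m] s by auto
      have \<rho>: "0 < \<rho> ?x" using rho_pos x by simp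
      have "(\<integral>\<^sup>+r. indicator {s<..?e (Suc m)} r * f r \<partial>lborel)
        \<le> (\<integral>\<^sup>+r. indicator {s<..?x} r * f r + indicator {?x<..?e (Suc m)} r * ennreal (1 / \<rho> ?x) \<partial>lborel)"
      proof (rule nn_integral_mono)
        fix r
        have "f r \<le> ennreal (1 / \<rho> ?x)" if "?x < r"
          unfolding f_def using that x \<rho> by (intro ennreal_leI divide_left_mono rho_le mult_pos_pos rho_pos) auto
        then show "indicator {s<..?e (Suc m)} r * f r \<le> indicator {s<..?x} r * f r + indicator {?x<..?e (Suc m)} r * ennreal (1 / \<rho> ?x)"
          by (cases "r \<le> ?x") (auto simp: indicator_def not_le simp del: euler_seq.simps)
      qed
      also have "\<dots> = (\<integral>\<^sup>+r. indicator {s<..?x} r * f r \<partial>lborel) + (\<integral>\<^sup>+r. indicator {?x<..?e (Suc m)} r * ennreal (1 / \<rho> ?x) \<partial>lborel)"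
        by (rule nn_integral_add) measurable
      also have "(\<integral>\<^sup>+r. indicator {?x<..?e (Suc m)} r * ennreal (1 / \<rho> ?x) \<partial>lborel) = ennreal h"
      proof -
        have "(\<integral>\<^sup>+r. indicator {?x<..?e (Suc m)} r * ennreal (1 / \<rho> ?x) \<partial>lborel)
          = emeasure lborel {?x<..?e (Suc m)} * ennreal (1 / \<rho> ?x)"
          by (subst nn_integral_multc) auto
        also have "emeasure lborel {?x<..?e (Suc m)} = ennreal (h * \<rho> ?x)" using h \<rho> by simp
        also have "ennreal (h * \<rho> ?x) * ennreal (1 / \<rho> ?x) = ennreal h"
          using h \<rho> by (simp add: ennreal_mult'[symmetric])
        finally show ?thesis .
      qed
      also have "(\<integral>\<^sup>+r. indicator {s<..?x} r * f r \<partial>lborel) + ennreal h \<le> ennreal (real m * h) + ennreal h"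
        using Suc by (rule add_right_mono)
      also have "\<dots> = ennreal (real (Suc m) * h)" using h by (simp add: ennreal_plus[symmetric] distrib_right del: ennreal_plus)
      finally show ?case .
    qed simp
    from this[of N] have "(\<integral>\<^sup>+r. indicator {s<..?e N} r * f r \<partial>lborel) \<le> ennreal T"
      using N ennreal_leI order.trans by blast
    moreover have "(\<integral>\<^sup>+r. indicator {s<..c} r * f r \<partial>lborel) \<le> (\<integral>\<^sup>+r. indicator {s<..?e N} r * f r \<partial>lborel)"
      using \<open>\<not> ?e N \<le> c\<close> by (intro nn_integral_mono) (auto simp: indicator_def)
    ultimately show False using n unfolding s_def by (meson leD order.trans)
  qed
  then show ?thesis using that s by blast
qed

end

section \<open>Induction over the time steps\<close>

context scheme begin

text \<open>The induction carries an affine barrier \<open>A * D + \<beta>\<close> whose value is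
  controlled only at the point \<open>s (N - n)\<close> of the Euler sequence, traversed backwards.
  After \<open>N\<close> steps this point is \<open>s0\<close>, and the controlled value is
  \<open>A0\<close> times the last Euler term plus the accumulated errors.\<close>

lemma comparison:
  fixes g :: "nat \<Rightarrow> real^'d \<Rightarrow> real"
  assumes g_lip: "lipschitz_valued L g" and L: "0 \<le> L"
    and g_unit: "\<And>k x. k \<in> {1..n0} \<Longrightarrow> 0 \<le> g k x \<and> g k x \<le> 1"
    and A0: "1 \<le> A0" "L \<le> A0" and \<delta>: "0 < \<delta>" and s0: "0 < s0" and R: "0 < R"
    and C: "C = 6 * H + real n0 * H / \<rho> 1"
    and Amax: "A0 * exp (h * C * (\<rho> s0 / s0) * real N) \<le> Amax"
    and \<epsilon>s: "4 * \<epsilon> \<le> \<delta>" "2 * \<epsilon> \<le> 1"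
    and B: "0 \<le> B" "\<And>k y. k \<in> {1..n0} \<Longrightarrow> norm y \<le> R + 3 \<Longrightarrow> norm (b y k) \<le> B"
    and B\<beta>: "\<And>k y. k \<in> {1..n0} \<Longrightarrow> norm y \<le> R + 3 \<Longrightarrow> norm (drift r (R+3) y k) \<le> B\<beta>"
    and lyap_le: "\<And>k x y. k \<in> {1..n0} \<Longrightarrow> norm x \<le> R \<Longrightarrow> norm (x - y) \<le> 2 * \<epsilon> \<Longrightarrow> G (\<lambda>_. lyap) y x k \<le> \<eta>"
    and \<zeta>: "Amax * ((8 * \<epsilon> * B + 2 * \<tau> * B\<beta>\<^sup>2) / \<delta>) + 2 * \<eta> + 4 * (real n0 * H) * \<epsilon> \<le> \<zeta>" "0 \<le> \<zeta>"
    and k: "k \<in> {1..n0}" and xz: "soft_norm \<delta> (x - z) \<le> s0"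
  shows "iterate g N k x + iterate (\<lambda>k x. 1 - g k x) N k z - 1
    \<le> A0 * euler_seq (h * C) s0 N + real N * (h * \<zeta>) + lyap x + lyap z"
proof -
  let ?g' = "\<lambda>k x. 1 - g k x"
  let ?U = "iterate g" and ?U' = "iterate ?g'"
  define p0 where "p0 = \<rho> s0 / s0"
  have C0: "0 \<le> C" using H_pos rho_nonneg[of 1] by (simp add: C)
  have p0: "0 \<le> p0" using s0 rho_nonneg[of s0] by (simp add: p0_def)
  have g'_lip: "lipschitz_valued L ?g'"
    unfolding lipschitz_valued_def
  proof (intro ballI allI)
    fix k x z assume "k \<in> {1..n0}"
    from lipschitz_valuedD[OF g_lip this, of x z] show "1 - g k x \<le> 1 - g k z + L * norm (x - z)" by linarith
  qed
  note adm = admissible_iterate[OF g_lip L g_unit]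
  have adm': "admissible (?U' n)" for n by (rule admissible_iterate[OF g'_lip L]) (use g_unit in auto)
  have u: "unit_valued (?U n)" "unit_valued (?U' n)" for n
    using adm[of n] adm'[of n] by (auto simp: admissible_def)
  note V = lyap_props[OF R]
  have hC: "0 \<le> h * C" using h C0 by simp
  define s where "s = euler_seq (h * C) s0"
  have s_ge: "s0 \<le> s n" for n unfolding s_def by (rule euler_seq_ge[OF hC s0])
  have "n \<le> N \<Longrightarrow> \<exists>A \<beta>. A0 \<le> A \<and> A \<le> A0 * (1 + h * C * p0) ^ n \<and> 0 \<le> \<beta> \<and>
    A * s (N - n) + \<beta> \<le> A0 * s N + real n * (h * \<zeta>) \<and>
    (\<forall>k\<in>{1..n0}. \<forall>x z. ?U n k x + ?U' n k z - 1 \<le> A * soft_norm \<delta> (x - z) + \<beta> + lyap x + lyap z)" for n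
  proof (induction n)
    case 0
    have "?U 0 k x + ?U' 0 k z - 1 \<le> A0 * soft_norm \<delta> (x - z) + 0 + lyap x + lyap z" if k: "k \<in> {1..n0}" for k x z
    proof -
      have D0: "0 \<le> A0 * soft_norm \<delta> (x - z)" using A0 soft_norm_ge(3)[of \<delta> "x - z"] by simp
      show ?thesis
      proof (cases "R \<le> norm x \<or> R \<le> norm z")
        case True
        then have "1 \<le> lyap x + lyap z" using V(4)[of x] V(4)[of z] V(2)[of x] V(2)[of z] by auto
        moreover have "?U 0 k x \<le> 1" "?U' 0 k z \<le> 1" using unit_valuedD(3)[OF u(1) k] unit_valuedD(3)[OF u(2) k] by blast+
        ultimately show ?thesis using D0 by linarith
      next
        case False
        then have c: "cutoff x = 0" "cutoff z = 0" using cutoff(3) by auto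
        have "g k x - g k z \<le> L * norm (x - z)" using lipschitz_valuedD[OF g_lip k, of x z] by linarith
        also have "\<dots> \<le> A0 * soft_norm \<delta> (x - z)"
          using A0 soft_norm_ge(1)[of "x - z" \<delta>] by (intro mult_mono) auto
        finally show ?thesis using c g_unit[OF k, of x] g_unit[OF k, of z] V(2)[of x] V(2)[of z] by (simp add: max_def)
      qed
    qed
    then show ?case by (intro exI[of _ A0] exI[of _ 0]) simp
  next
    case (Suc n)
    then obtain A \<beta> where A: "A0 \<le> A" "A \<le> A0 * (1 + h * C * p0) ^ n" and \<beta>: "0 \<le> \<beta>"
      and As: "A * s (N - n) + \<beta> \<le> A0 * s N + real n * (h * \<zeta>)"
      and dom: "\<And>k x z. k \<in> {1..n0} \<Longrightarrow> ?U n k x + ?U' n k z - 1 \<le> A * soft_norm \<delta> (x - z) + \<beta> + lyap x + lyap z"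
      by (auto simp: Suc_le_eq)
    have A1: "1 \<le> A" using A A0 by linarith
    \<comment> \<open>The slopes are bounded through the total time \<open>h * N\<close> only, so
      the errors that they multiply can be made small by \<open>\<epsilon>\<close> and
      \<open>\<tau>\<close>.\<close>
    have AM: "A \<le> Amax"
    proof -
      have "(1 + h * C * p0) ^ n \<le> exp (h * C * p0) ^ n"
        using hC p0 by (intro power_mono exp_ge_add_one_self) auto
      also have "\<dots> = exp (h * C * p0 * real n)" by (simp add: exp_of_nat2_mult)
      also have "\<dots> \<le> exp (h * C * p0 * real N)" using hC p0 Suc.prems by (simp add: mult_left_mono)
      finally have "A0 * (1 + h * C * p0) ^ n \<le> A0 * exp (h * C * p0 * real N)" using A0 by (intro mult_left_mono) auto
      then show ?thesis using A(2) Amax by (simp add: p0_def)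
    qed
    \<comment> \<open>The tangent point is the next Euler term going backwards: up to
      \<open>h * \<zeta>\<close>, the new barrier at \<open>t\<close> equals the old barrier at
      \<open>t + h * C * \<rho> t\<close>, which is \<open>s (N - n)\<close>. This preserves the
      controlled value.\<close>
    define t where "t = s (N - Suc n)"
    have t: "s0 \<le> t" "0 < t" using s_ge[of "N - Suc n"] s0 by (auto simp: t_def)
    have "N - n = Suc (N - Suc n)" using Suc.prems by simp
    then have st: "s (N - n) = t + h * C * \<rho> t" by (simp add: s_def t_def)
    obtain p where p: "0 \<le> p" "p \<le> \<rho> t / t" "\<And>r. 0 \<le> r \<Longrightarrow> \<rho> r \<le> \<rho> t + p * (r - t)"
      using rho_supergradient[OF t(2)] by blast
    have pp0: "p \<le> p0"
    proof -
      have "\<rho> t \<le> (t / s0) * \<rho> s0" using t s0 by (intro rho_slope) auto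
      then have "\<rho> t / t \<le> ((t / s0) * \<rho> s0) / t" using t by (intro divide_right_mono) auto
      then show ?thesis using p(2) t by (simp add: p0_def)
    qed
    have pt: "0 \<le> \<rho> t - p * t" using p(2) t by (simp add: pos_le_divide_eq)
    define A' where "A' = A * (1 + h * C * p)"
    define \<beta>' where "\<beta>' = \<beta> + A * (h * C) * (\<rho> t - p * t) + h * \<zeta>"
    have AA': "A \<le> A'"
    proof -
      have "A * 1 \<le> A * (1 + h * C * p)" using A1 hC p(1) by (intro mult_left_mono) auto
      then show ?thesis by (simp add: A'_def)
    qed
    have \<beta>': "0 \<le> \<beta>'" unfolding \<beta>'_def using \<beta> A1 hC C0 pt h \<zeta>(2) by (intro add_nonneg_nonneg mult_nonneg_nonneg) auto
    have A'_le: "A' \<le> A0 * (1 + h * C * p0) ^ Suc n"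
    proof -
      have "A' \<le> (A0 * (1 + h * C * p0) ^ n) * (1 + h * C * p0)"
        unfolding A'_def using A A1 A0 hC p p0 pp0 by (intro mult_mono add_mono mult_left_mono) auto
      then show ?thesis by (simp add: mult_ac)
    qed
    have key: "A' * D + \<beta>' = A * D + \<beta> + h * (A * (C * (\<rho> t + p * (D - t))) + \<zeta>)" for D
      by (simp add: A'_def \<beta>'_def algebra_simps)
    have "A' * t + \<beta>' = A * s (N - n) + \<beta> + h * \<zeta>" unfolding key st by (simp add: algebra_simps)
    then have As': "A' * s (N - Suc n) + \<beta>' \<le> A0 * s N + real (Suc n) * (h * \<zeta>)"
      using As unfolding t_def[symmetric] by (simp add: algebra_simps)
    have "?U (Suc n) k x + ?U' (Suc n) k z - 1 \<le> A' * soft_norm \<delta> (x - z) + \<beta>' + lyap x + lyap z"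
      if k: "k \<in> {1..n0}" for k x z
    proof -
      define D where "D = soft_norm \<delta> (x - z)"
      define \<Phi> where "\<Phi> = A' * D + \<beta>' + lyap x + lyap z"
      have D: "0 < D" using soft_norm_ge(2)[of \<delta> "x - z"] \<delta> by (simp add: D_def)
      have A'D: "0 \<le> A' * D" using AA' A1 D by simp
      have \<Phi>0: "0 \<le> \<Phi>" unfolding \<Phi>_def using A'D \<beta>' V(2) by (intro add_nonneg_nonneg) auto
      have triv: "?U (Suc n) k x \<le> 1" "?U' (Suc n) k z \<le> 1"
        using unit_valuedD(3)[OF u(1) k] unit_valuedD(3)[OF u(2) k] by blast+
      show ?thesis
      proof (cases "R \<le> norm x \<or> R \<le> norm z \<or> 1 \<le> D")
        case True
        \<comment> \<open>The excess never exceeds 1, so nothing is to be shown where the barrier is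
          at least 1: beyond \<open>R\<close> by the Lyapunov term, at distance at least 1 because
          all slopes are at least 1.\<close>
        have "1 \<le> \<Phi>"
        proof (cases "1 \<le> D")
          case True
          have "1 * 1 \<le> A' * D" using True AA' A1 by (intro mult_mono) auto
          then show ?thesis unfolding \<Phi>_def using \<beta>' V(2)[of x] V(2)[of z] by linarith
        next
          case False
          then have "1 \<le> lyap x + lyap z" using True V(4)[of x] V(4)[of z] V(2)[of x] V(2)[of z] by auto
          then show ?thesis unfolding \<Phi>_def using \<beta>' A'D by linarith
        qed
        then show ?thesis using triv unfolding \<Phi>_def D_def by linarith
      next
        case False
        then have xR: "norm x \<le> R" "norm z \<le> R" and D1: "D < 1" by auto
        have c: "cutoff x = 0" "cutoff z = 0" using cutoff(3) xR by auto
        \<comment> \<open>Below distance 1 concavity turns the Lipschitz cost of F2 into a multiple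
          of \<open>\<rho> D\<close>; this is the origin of \<open>real n0 * H / \<rho> 1\<close> in
          \<open>C\<close>.\<close>
        have D\<rho>: "D \<le> \<rho> D / \<rho> 1"
        proof -
          have "\<rho> 1 \<le> (1 / D) * \<rho> D" using D D1 by (intro rho_slope) auto
          then show ?thesis using D rho_pos[of 1] by (simp add: field_simps)
        qed
        have main: "step (?U n) y x k + step (?U' n) y' z k - 1 \<le> \<Phi>"
          if xy: "norm (x - y) \<le> 2 * \<epsilon>" "norm (z - y') \<le> 2 * \<epsilon>" for y y'
        proof -
          have yR: "norm y \<le> R + 3" "norm y' \<le> R + 3"
            using xy xR \<epsilon>s norm_triangle_ineq2[of y x] norm_triangle_ineq2[of y' z] by (auto simp: norm_minus_commute)
          note pg = pair_gen_le[OF k \<delta> yR xy \<epsilon>s(1) B(2)[OF k yR(1)] B(2)[OF k yR(2)] B\<beta>[OF k yR(1)] B\<beta>[OF k yR(2)], folded D_def]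
          have "A * (pair_gen \<delta> (x - z) y y' k + H * \<rho> (norm (y - y')))
            \<le> A * (6 * H * \<rho> D + (8 * \<epsilon> * B + 2 * \<tau> * B\<beta>\<^sup>2) / \<delta>)"
            using pg(1) A1 by (intro mult_left_mono) auto
          moreover have "A * ((8 * \<epsilon> * B + 2 * \<tau> * B\<beta>\<^sup>2) / \<delta>) \<le> Amax * ((8 * \<epsilon> * B + 2 * \<tau> * B\<beta>\<^sup>2) / \<delta>)"
            using AM \<delta> eps B(1) tau by (intro mult_right_mono) auto
          moreover have "real n0 * (H * norm (y - y')) \<le> A * (real n0 * H / \<rho> 1 * \<rho> D) + 4 * (real n0 * H) * \<epsilon>"
          proof -
            have "real n0 * H * norm (y - y') \<le> real n0 * H * (D + 4 * \<epsilon>)"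
              using pg(2) H_pos by (intro mult_left_mono) auto
            also have "\<dots> \<le> real n0 * H * (\<rho> D / \<rho> 1 + 4 * \<epsilon>)" using D\<rho> H_pos by (intro mult_left_mono add_right_mono) auto
            also have "\<dots> = 1 * (real n0 * H / \<rho> 1 * \<rho> D) + 4 * (real n0 * H) * \<epsilon>" by (simp add: algebra_simps)
            also have "\<dots> \<le> A * (real n0 * H / \<rho> 1 * \<rho> D) + 4 * (real n0 * H) * \<epsilon>"
              using A1 H_pos rho_pos[of 1] rho_pos[OF D] by (intro add_right_mono mult_right_mono) auto
            finally show ?thesis by (simp add: mult_ac)
          qed
          moreover have "G (\<lambda>_. lyap) y x k \<le> \<eta>" "G (\<lambda>_. lyap) y' z k \<le> \<eta>"
            using lyap_le[OF k] xR xy by auto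
          ultimately have "A * (pair_gen \<delta> (x - z) y y' k + H * \<rho> (norm (y - y'))) + G (\<lambda>_. lyap) y x k + G (\<lambda>_. lyap) y' z k
              + real n0 * (H * norm (y - y')) \<le> A * (6 * H * \<rho> D) + A * (real n0 * H / \<rho> 1 * \<rho> D) + \<zeta>"
            using \<zeta>(1) unfolding distrib_left by linarith
          also have "\<dots> = A * (C * \<rho> D) + \<zeta>" by (simp add: C algebra_simps)
          also have "\<dots> \<le> A * (C * (\<rho> t + p * (D - t))) + \<zeta>"
            using p(3)[of D] D A1 C0 by (intro add_right_mono mult_left_mono) auto
          finally have "h * (A * (pair_gen \<delta> (x - z) y y' k + H * \<rho> (norm (y - y'))) + G (\<lambda>_. lyap) y x k + G (\<lambda>_. lyap) y' z k
              + real n0 * (H * norm (y - y'))) \<le> h * (A * (C * (\<rho> t + p * (D - t))) + \<zeta>)"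
            using h by (intro mult_left_mono) auto
          moreover have "step (?U n) y x k + step (?U' n) y' z k - 1 \<le> A * D + \<beta> + lyap x + lyap z
            + h * (A * (pair_gen \<delta> (x - z) y y' k + H * \<rho> (norm (y - y'))) + G (\<lambda>_. lyap) y x k + G (\<lambda>_. lyap) y' z k
              + real n0 * (H * norm (y - y')))"
            unfolding D_def
            by (rule step_coupling[OF u V(1-3) _ \<delta> \<beta> dom k]) (use A1 in auto)
          ultimately show ?thesis unfolding \<Phi>_def key by linarith
        qed
        \<comment> \<open>The two suprema range over independent points: the one at \<open>z\<close>
          is bounded for each fixed \<open>y\<close>, and the outcome is then read as a bound for
          the supremum at \<open>x\<close>.\<close>
        have "shaken (?U' n) k z \<le> \<Phi> + 1 - (step (?U n) y x k - penalty x y)" for y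
        proof (rule shaken_le)
          note st = step_unit[OF u(1) k, of n y x]
          show "cutoff z \<le> \<Phi> + 1 - (step (?U n) y x k - penalty x y)"
            using st c \<Phi>0 penalty(1)[of x y] by linarith
          fix y'
          note st' = step_unit[OF u(2) k, of n y' z]
          \<comment> \<open>A frozen point farther than \<open>2 * \<epsilon>\<close> pays at least
            1 and thereby cancels one of the two steps; only close frozen points need the coupling
            estimate.\<close>
          consider "2 * \<epsilon> \<le> norm (x - y)" | "2 * \<epsilon> \<le> norm (z - y')" | "norm (x - y) \<le> 2 * \<epsilon>" "norm (z - y') \<le> 2 * \<epsilon>" by linarith
          then show "step (?U' n) y' z k - penalty z y' \<le> \<Phi> + 1 - (step (?U n) y x k - penalty x y)"
          proof cases
            case 1
            then show ?thesis using penalty(3)[OF 1] penalty(1)[of z y'] st st' \<Phi>0 by linarith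
          next
            case 2
            then show ?thesis using penalty(3)[OF 2] penalty(1)[of x y] st st' \<Phi>0 by linarith
          next
            case 3
            then show ?thesis using main[OF 3] penalty(1)[of x y] penalty(1)[of z y'] by linarith
          qed
        qed
        then have "shaken (?U n) k x \<le> \<Phi> + 1 - shaken (?U' n) k z"
          using c triv(2) \<Phi>0 by (intro shaken_le) (auto simp: algebra_simps)
        then show ?thesis unfolding \<Phi>_def D_def by simp
      qed
    qed
    then show ?case using A A0 AA' \<beta>' A'_le As' by (intro exI[of _ A'] exI[of _ \<beta>']) auto
  qed
  from this[of N] obtain A \<beta> where "A0 \<le> A" "0 \<le> \<beta>" and As: "A * s 0 + \<beta> \<le> A0 * s N + real N * (h * \<zeta>)"
    and dom: "\<And>k x z. k \<in> {1..n0} \<Longrightarrow> ?U N k x + ?U' N k z - 1 \<le> A * soft_norm \<delta> (x - z) + \<beta> + lyap x + lyap z"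
    by auto
  have "A * soft_norm \<delta> (x - z) \<le> A * s0" using xz \<open>A0 \<le> A\<close> A0 by (intro mult_left_mono) auto
  then show ?thesis using dom[OF k, of x z] As by (simp add: s_def)
qed

end

section \<open>Continuity of the marginals\<close>

lemma eventually_linear_le:
  fixes c d :: real
  assumes "0 < d" shows "\<forall>\<^sub>F t in at_right 0. c * t \<le> d"
proof -
  have "((\<lambda>t. c * t) \<longlongrightarrow> c * 0) (at_right 0)" by (intro tendsto_intros tendsto_ident_at)
  then have "\<forall>\<^sub>F t in at_right 0. c * t < d" by (rule order_tendstoD(2)) (use assms in simp)
  then show ?thesis by (rule eventually_mono) simp
qed

context switching begin

lemma nu_tail_small:
  assumes "0 < \<kappa>"
  obtains K where "0 < K" "\<And>k. k \<in> {1..n0} \<Longrightarrow> (\<integral>u. indicator {u. K < norm u} u \<partial>\<nu> 0 k) \<le> \<kappa>" "2 * H * \<rho> 1 / K \<le> \<kappa>"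
proof -
  have lim: "(\<lambda>n. \<integral>u. (indicator {u. real (Suc n) < norm u} u :: real) \<partial>\<nu> 0 k) \<longlonglongrightarrow> 0" if k: "k \<in> {1..n0}" for k
  proof -
    have "(\<lambda>n. \<integral>u. (indicator {u. real (Suc n) < norm u} u :: real) \<partial>\<nu> 0 k) \<longlonglongrightarrow> (\<integral>u. 0 \<partial>\<nu> 0 k)"
    proof (rule integral_dominated_convergence[where w="\<lambda>u. trunc_sq u"])
      show "AE u in \<nu> 0 k. (\<lambda>n. indicator {u. real (Suc n) < norm u} u :: real) \<longlonglongrightarrow> 0"
      proof (rule AE_I2)
        fix u :: "real^'d"
        obtain N where N: "norm u \<le> real N" using real_arch_simple by blast
        have "\<forall>\<^sub>F n in sequentially. (indicator {u. real (Suc n) < norm u} u :: real) = 0"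
          unfolding eventually_sequentially
        proof (intro exI[of _ N] allI impI)
          fix n assume "N \<le> n"
          then have "norm u \<le> real (Suc n)" using N by linarith
          then show "(indicator {u. real (Suc n) < norm u} u :: real) = 0" by (simp add: indicator_def)
        qed
        then show "(\<lambda>n. indicator {u. real (Suc n) < norm u} u :: real) \<longlonglongrightarrow> 0" by (rule tendsto_eventually)
      qed
      show "AE u in \<nu> 0 k. norm (indicator {u. real (Suc n) < norm u} u :: real) \<le> trunc_sq u" for n
      proof (rule AE_I2)
        fix u :: "real^'d"
        have "1 \<le> (norm u)\<^sup>2" if "real (Suc n) < norm u"
        proof -
          have "1 \<le> norm u" using that by simp
          then show ?thesis by (simp add: one_le_power)
        qed
        then show "norm (indicator {u. real (Suc n) < norm u} u :: real) \<le> trunc_sq u" by (simp add: indicator_def)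
      qed
    qed (use nu_integrable_trunc_sq(1)[OF k] borel_measurable_integrable[OF nu_tail[OF k]] in auto)
    then show ?thesis by simp
  qed
  have "\<forall>\<^sub>F n in sequentially. \<forall>k\<in>{1..n0}. (\<integral>u. (indicator {u. real (Suc n) < norm u} u :: real) \<partial>\<nu> 0 k) < \<kappa>"
    using order_tendstoD(2)[OF lim] assms by (intro eventually_ball_finite) auto
  moreover have "(\<lambda>n. 2 * H * \<rho> 1 * (1 / real (Suc n))) \<longlonglongrightarrow> 2 * H * \<rho> 1 * 0"
    by (intro tendsto_intros LIMSEQ_Suc[OF lim_1_over_n])
  then have "\<forall>\<^sub>F n in sequentially. 2 * H * \<rho> 1 * (1 / real (Suc n)) < \<kappa>"
    by (rule order_tendstoD(2)) (use assms in simp)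
  ultimately have "\<forall>\<^sub>F n in sequentially. (\<forall>k\<in>{1..n0}. (\<integral>u. (indicator {u. real (Suc n) < norm u} u :: real) \<partial>\<nu> 0 k) < \<kappa>) \<and>
      2 * H * \<rho> 1 * (1 / real (Suc n)) < \<kappa>" by (rule eventually_conj)
  then obtain n where n: "\<forall>k\<in>{1..n0}. (\<integral>u. (indicator {u. real (Suc n) < norm u} u :: real) \<partial>\<nu> 0 k) < \<kappa>"
      "2 * H * \<rho> 1 * (1 / real (Suc n)) < \<kappa>" using eventually_happens'[OF sequentially_bot] by blast
  show ?thesis
  proof (rule that[of "real (Suc n)"])
    show "(\<integral>u. indicator {u. real (Suc n) < norm u} u \<partial>\<nu> 0 k) \<le> \<kappa>" if "k \<in> {1..n0}" for k
      using n(1) that by (auto intro: less_imp_le)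
    show "2 * H * \<rho> 1 / real (Suc n) \<le> \<kappa>" using n(2) by simp
  qed simp
qed

lemma integrable_marginal:
  assumes P: "mp_solution (UNIV \<times> {1..n0}) T G e P" and t: "0 \<le> t"
    and g: "\<And>k. k \<in> {1..n0} \<Longrightarrow> g k \<in> borel_measurable borel" "\<And>k x. k \<in> {1..n0} \<Longrightarrow> \<bar>g k x\<bar> \<le> (M::real)"
  shows "integrable P (\<lambda>\<omega>. case \<omega> t of (x :: real^'d, k) \<Rightarrow> g k x)"
proof -
  interpret mp_sol "UNIV \<times> {1..n0}" T G e P
    by unfold_locales (rule P, rule measurable_evaluation_pair_nat)
  define f where "f = (\<lambda>(x :: real^'d, k). if k \<in> {1..n0} then g k x else 0)"
  have fm: "f \<in> borel_measurable borel"
    unfolding f_def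
  proof (rule borel_measurable_pair_countable)
    show "(\<lambda>x. if k \<in> {1..n0} then g k x else 0) \<in> borel_measurable borel" for k
      using g(1)[of k] by (cases "k \<in> {1..n0}") (auto simp del: atLeastAtMost_iff)
  qed
  have eq: "f (\<omega> t) = (case \<omega> t of (x, k) \<Rightarrow> g k x)" if "\<omega> \<in> space P" for \<omega>
    using in_E[OF that, of t] by (auto simp: f_def)
  have "integrable P (\<lambda>\<omega>. f (\<omega> t))"
  proof (rule integrable_const_bound[of _ M])
    show "AE \<omega> in P. norm (f (\<omega> t)) \<le> M"
    proof (rule AE_I2)
      fix \<omega> assume "\<omega> \<in> space P"
      from in_E[OF this, of t] show "norm (f (\<omega> t)) \<le> M" using g(2) by (auto simp: f_def)
    qed
  qed (rule measurable_compose[OF coordinate_measurable[OF t] fm])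
  then show ?thesis by (rule Bochner_Integration.integrable_cong[THEN iffD1, rotated -1]) (use eq in auto)
qed

end

lemma (in mollified_scheme) average_le:
  assumes "unit_valued \<zeta>" "k \<in> {1..n0}" "\<And>w. norm w < \<epsilon> \<Longrightarrow> \<zeta> k (x - w) \<le> c"
  shows "average \<zeta> k x \<le> c"
proof -
  have "average \<zeta> k x \<le> (\<integral>w. \<eta> w * c \<partial>lborel)"
    unfolding average_def
  proof (rule integral_mono[OF average_integrable[OF assms(1,2)] integrable_mult_left[OF eta_integrable]])
    show "\<eta> w * \<zeta> k (x - w) \<le> \<eta> w * c" for w
      using assms(3)[of w] eta_nonneg[of w] eta_supp[of w] by (cases "norm w < \<epsilon>") (auto intro: mult_left_mono)
  qed
  then show ?thesis using eta_integral by simp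
qed

text \<open>The upper bound is applied to \<open>g\<close> started at \<open>x\<close> and to
  \<open>1 - g\<close> started at \<open>z\<close>; adding the two leaves the difference of the
  expectations of \<open>g\<close> against the excess of the averaged iterates over 1. The averages
  are independent, so domination is asked for at all pairs near \<open>(x, z)\<close>.\<close>

lemma (in mollified_scheme) expectation_diff_le:
  fixes g :: "nat \<Rightarrow> real^'d \<Rightarrow> real"
  assumes g_lip: "lipschitz_valued L g" and L: "0 \<le> L"
    and g_unit: "\<And>k x. k \<in> {1..n0} \<Longrightarrow> 0 \<le> g k x \<and> g k x \<le> 1"
    and CA: "\<And>M Z x k. bounded_test M (R + 2) Z \<Longrightarrow> k \<in> {1..n0} \<Longrightarrow>
      \<bar>gen_A n0 a b \<nu> \<epsilon>0 q (\<lambda>(x, k). Z k x) (x, k)\<bar> \<le> CA * M"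
    and consistent: "\<And>Z x k. bounded_test M\<^sub>Z (R + 2) Z \<Longrightarrow> k \<in> {1..n0} \<Longrightarrow>
      \<bar>gen_A n0 a b \<nu> \<epsilon>0 q (\<lambda>(x, k). Z k x) (x, k) - G Z x x k\<bar> \<le> \<kappa>"
    and k: "k \<in> {1..n0}"
    and P: "mp_solution (UNIV \<times> {1..n0}) (test_A n0) (gen_A n0 a b \<nu> \<epsilon>0 q) (x, k) P"
    and P': "mp_solution (UNIV \<times> {1..n0}) (test_A n0) (gen_A n0 a b \<nu> \<epsilon>0 q) (z, k) P'"
    and dom: "\<And>p p'. norm (p - x) < \<epsilon> \<Longrightarrow> norm (p' - z) < \<epsilon> \<Longrightarrow>
      iterate g N k p + iterate (\<lambda>k x. 1 - g k x) N k p' - 1 \<le> M"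
  shows "(\<integral>\<omega>. (case \<omega> (real N * h) of (x, k) \<Rightarrow> g k x) \<partial>P) - (\<integral>\<omega>. (case \<omega> (real N * h) of (x, k) \<Rightarrow> g k x) \<partial>P')
    \<le> M + 2 * (L * \<epsilon> + real N * (h * (\<kappa> + CA * (h * rate * M\<^sub>Z))))"
proof -
  have g'_lip: "lipschitz_valued L (\<lambda>k x. 1 - g k x)"
    unfolding lipschitz_valued_def
  proof (intro ballI allI)
    fix k x z assume "k \<in> {1..n0}"
    from lipschitz_valuedD[OF g_lip this, of x z] show "1 - g k x \<le> 1 - g k z + L * norm (x - z)" by linarith
  qed
  interpret s: scheme_data n0 \<epsilon>0 H C\<nu> Qb a \<sigma> b \<nu> q \<rho> \<tau> r h \<epsilon> R \<eta> M\<eta> g L CA \<kappa>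
    by unfold_locales (fact g_lip, fact L, fact g_unit, fact CA, fact consistent)
  interpret s': scheme_data n0 \<epsilon>0 H C\<nu> Qb a \<sigma> b \<nu> q \<rho> \<tau> r h \<epsilon> R \<eta> M\<eta> "\<lambda>k x. 1 - g k x" L CA \<kappa>
    by unfold_locales (fact g'_lip, fact L, use g_unit in simp, fact CA, fact consistent)
  have av: "1 - s.Z N k x = average (iterate g N) k x" "1 - s'.Z N k z = average (iterate (\<lambda>k x. 1 - g k x) N) k z"
  proof -
    have *: "average (\<lambda>k x. 1 - \<zeta> k x) k x = 1 - average \<zeta> k x" if "unit_valued \<zeta>" for \<zeta> x
    proof -
      have "average (\<lambda>k x. 1 - \<zeta> k x) k x = (\<integral>w. \<eta> w - \<eta> w * \<zeta> k (x - w) \<partial>lborel)"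
        unfolding average_def by (intro Bochner_Integration.integral_cong) (auto simp: algebra_simps)
      also have "\<dots> = 1 - average \<zeta> k x"
        using average_integrable[OF that k, of x] eta_integrable eta_integral by (simp add: average_def)
      finally show ?thesis .
    qed
    show "1 - s.Z N k x = average (iterate g N) k x" unfolding s.Z_average[OF k] *[OF s.U_unit] by simp
    show "1 - s'.Z N k z = average (iterate (\<lambda>k x. 1 - g k x) N) k z" unfolding s'.Z_average[OF k] *[OF s'.U_unit] by simp
  qed
  have "average (iterate (\<lambda>k x. 1 - g k x) N) k z \<le> M + 1 - average (iterate g N) k x"
  proof (rule average_le[OF s'.U_unit k])
    fix w' :: "real^'d" assume w': "norm w' < \<epsilon>"
    have "average (iterate g N) k x \<le> M + 1 - iterate (\<lambda>k x. 1 - g k x) N k (z - w')"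
    proof (rule average_le[OF s.U_unit k])
      fix w :: "real^'d" assume "norm w < \<epsilon>"
      then show "iterate g N k (x - w) \<le> M + 1 - iterate (\<lambda>k x. 1 - g k x) N k (z - w')"
        using dom[of "x - w" "z - w'"] w' by simp
    qed
    then show "iterate (\<lambda>k x. 1 - g k x) N k (z - w') \<le> M + 1 - average (iterate g N) k x" by linarith
  qed
  moreover have "(\<integral>\<omega>. (case \<omega> (real N * h) of (x, k) \<Rightarrow> 1 - g k x) \<partial>P') = 1 - (\<integral>\<omega>. (case \<omega> (real N * h) of (x, k) \<Rightarrow> g k x) \<partial>P')"
  proof -
    have pr: "prob_space P'" using P' by (simp add: mp_solution_def)
    have i: "integrable P' (\<lambda>\<omega>. case \<omega> (real N * h) of (x, k) \<Rightarrow> g k x)"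
    proof (rule integrable_marginal[OF P', where M=1])
      show "0 \<le> real N * h" using h by simp
      show "\<And>k. k \<in> {1..n0} \<Longrightarrow> g k \<in> borel_measurable borel" by (rule lipschitz_valued_measurable[OF g_lip])
      show "\<And>k x. k \<in> {1..n0} \<Longrightarrow> \<bar>g k x\<bar> \<le> 1" using g_unit by auto
    qed
    have "(\<integral>\<omega>. (case \<omega> (real N * h) of (x, k) \<Rightarrow> 1 - g k x) \<partial>P') = (\<integral>\<omega>. 1 - (case \<omega> (real N * h) of (x, k) \<Rightarrow> g k x) \<partial>P')"
      by (intro Bochner_Integration.integral_cong refl) (simp split: prod.splits)
    also have "\<dots> = 1 - (\<integral>\<omega>. (case \<omega> (real N * h) of (x, k) \<Rightarrow> g k x) \<partial>P')"
      using i prob_space.prob_space[OF pr] prob_space.finite_measure[OF pr]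
      by (subst Bochner_Integration.integral_diff) (auto simp: finite_measure.integrable_const)
    finally show ?thesis .
  qed
  moreover have "s'.err = s.err" by (simp add: s.err_def s'.err_def)
  ultimately show ?thesis
    using s.upper_bound[OF P k, of N] s'.upper_bound[OF P' k, of N] av
    unfolding s.err_def s'.err_def distrib_left[of 2] by linarith
qed

context switching begin

text \<open>Each parameter depends only on earlier ones: \<open>s0\<close> from Osgood's condition,
  \<open>K\<close> from the tails, \<open>R\<close> from the Lyapunov bound,
  \<open>\<epsilon>\<close> and the mollifier, then \<open>r\<close>, \<open>\<tau>\<close> and the
  number of steps. The closeness \<open>s\<close> is fixed by \<open>s0\<close> and so does not
  depend on the discretisation.\<close>

lemma marginals_close:
  fixes g :: "nat \<Rightarrow> real^'d \<Rightarrow> real"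
  assumes osgood: "\<forall>c>0. (\<integral>\<^sup>+r. indicator {0<..c} r * ennreal (1 / \<rho> r) \<partial>lborel) = \<infinity>"
    and T: "0 < T" and \<kappa>: "0 < \<kappa>" and X: "0 \<le> X"
    and g_lip: "\<forall>k\<in>{1..n0}. \<forall>x z. g k x \<le> g k z + L * norm (x - z)" and L: "0 \<le> L"
    and g_unit: "\<And>k x. k \<in> {1..n0} \<Longrightarrow> 0 \<le> g k x \<and> g k x \<le> 1"
  obtains s where "0 < s" "\<And>x z k P P'. norm x \<le> X \<Longrightarrow> norm z \<le> X \<Longrightarrow> norm (x - z) < s \<Longrightarrow> k \<in> {1..n0} \<Longrightarrow>
    mp_solution (UNIV \<times> {1..n0}) (test_A n0) (gen_A n0 a b \<nu> \<epsilon>0 q) (x, k) P \<Longrightarrow>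
    mp_solution (UNIV \<times> {1..n0}) (test_A n0) (gen_A n0 a b \<nu> \<epsilon>0 q) (z, k) P' \<Longrightarrow>
    (\<integral>\<omega>. (case \<omega> T of (x, k) \<Rightarrow> g k x) \<partial>P) - (\<integral>\<omega>. (case \<omega> T of (x, k) \<Rightarrow> g k x) \<partial>P') \<le> \<kappa>"
proof -
  define C where "C = 6 * H + real n0 * H / \<rho> 1"
  define A0 where "A0 = max 1 L"
  \<comment> \<open>Errors per unit time act over the time \<open>T\<close>; each such term thus
    contributes \<open>\<kappa> / 64\<close> in the end.\<close>
  define \<kappa>' where "\<kappa>' = \<kappa> / 64 / T"
  have \<kappa>': "0 < \<kappa>'" "T * \<kappa>' = \<kappa> / 64" using \<kappa> T by (simp_all add: \<kappa>'_def)
  have A0: "1 \<le> A0" "L \<le> A0" by (auto simp: A0_def)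
  have C0: "0 \<le> C" using H_pos rho_nonneg[of 1] by (simp add: C_def)
  have "0 < \<kappa> / (8 * A0)" using \<kappa> A0 by simp
  then obtain s0 where s0: "0 < s0" and es: "\<And>h N. 0 \<le> h \<Longrightarrow> real N * h \<le> C * T \<Longrightarrow> euler_seq h s0 N \<le> \<kappa> / (8 * A0)"
    using euler_seq_osgood[OF osgood, of "\<kappa> / (8 * A0)" "C * T"] C0 T by (metis less_imp_le mult_nonneg_nonneg)
  define Amax where "Amax = A0 * exp (C * (\<rho> s0 / s0) * T)"
  have Amax: "0 \<le> Amax" using A0 by (simp add: Amax_def)
  obtain Cg where Cg: "Cg \<ge> 0" "\<And>k y. k \<in> {1..n0} \<Longrightarrow> 2 * (y \<bullet> b y k) + (norm (\<sigma> y k))\<^sup>2 \<le> Cg * (1 + (norm y)\<^sup>2)"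
    using coercive_growth by blast
  obtain K where K: "0 < K" "\<And>k. k \<in> {1..n0} \<Longrightarrow> (\<integral>u. indicator {u. K < norm u} u \<partial>\<nu> 0 k) \<le> \<kappa>'" "2 * H * \<rho> 1 / K \<le> \<kappa>'"
    using nu_tail_small[OF \<kappa>'(1)] by blast
  define E where "E = 3 * Cg + 2 + max 1 (\<epsilon>0\<^sup>2) * C\<nu> + ln (3 + 4 * K\<^sup>2) * (C\<nu> / min 1 (\<epsilon>0\<^sup>2))"
  \<comment> \<open>\<open>R = exp m\<close> ensures \<open>ln (1 + R^2) \<ge> m\<close>. The two
    entries make the bounded part of the Lyapunov drift at most \<open>\<kappa>'\<close> and the
    Lyapunov function at most \<open>\<kappa> / 16\<close> on the ball of radius
    \<open>X + 1\<close>.\<close>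
  define m where "m = max 1 (max (E / \<kappa>') (ln (1 + (X + 1)\<^sup>2) / (\<kappa> / 16)))"
  define R where "R = exp m"
  have R: "0 < R" by (simp add: R_def)
  have lnR: "m \<le> ln (1 + R\<^sup>2)"
  proof -
    have "1 \<le> R" unfolding R_def by (simp add: m_def)
    then have "R * 1 \<le> R * R" using R by (intro mult_left_mono) auto
    then have "R \<le> 1 + R\<^sup>2" by (simp add: power2_eq_square)
    then have "ln R \<le> ln (1 + R\<^sup>2)" using R by (subst ln_le_cancel_iff) (auto intro: add_pos_nonneg)
    then show ?thesis by (simp add: R_def)
  qed
  have lnR0: "0 < ln (1 + R\<^sup>2)" using lnR by (simp add: m_def)
  have ER: "E / ln (1 + R\<^sup>2) \<le> \<kappa>'"
  proof -
    have "E / \<kappa>' \<le> ln (1 + R\<^sup>2)" using lnR by (simp add: m_def)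
    then show ?thesis using \<kappa>' lnR0 by (simp add: field_simps)
  qed
  have XR: "ln (1 + (X + 1)\<^sup>2) / ln (1 + R\<^sup>2) \<le> \<kappa> / 16"
  proof -
    have "ln (1 + (X + 1)\<^sup>2) / (\<kappa> / 16) \<le> ln (1 + R\<^sup>2)" using lnR by (simp add: m_def)
    then show ?thesis using \<kappa> lnR0 by (simp add: field_simps)
  qed
  obtain B where B: "B \<ge> 0" "\<And>k x. k \<in> {1..n0} \<Longrightarrow> norm x \<le> R + 3 \<Longrightarrow> norm (b x k) \<le> B \<and> norm (\<sigma> x k) \<le> B"
    using coeffs_locally_bounded[of "R + 3"] by blast
  \<comment> \<open>A quarter of \<open>s0\<close> for the smoothing and a quarter for the distance
    of the starting points leave room for two mollification radii.\<close>
  define \<delta> where "\<delta> = s0 / 4"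
  have \<delta>: "0 < \<delta>" using s0 by (simp add: \<delta>_def)
  have "\<forall>\<^sub>F \<epsilon> in at_right (0::real). 0 < \<epsilon> \<and> 4 * \<epsilon> \<le> \<delta> \<and> 2 * \<epsilon> \<le> 1 \<and> (4 * B) * \<epsilon> \<le> 1 \<and>
      (Amax * 8 * B / \<delta>) * \<epsilon> \<le> \<kappa>' \<and> (4 * (real n0 * H)) * \<epsilon> \<le> \<kappa>' \<and> L * \<epsilon> \<le> \<kappa> / 64"
    using \<delta> \<kappa> \<kappa>' by (intro eventually_conj eventually_linear_le eventually_at_right_less) auto
  then obtain \<epsilon> where \<epsilon>: "0 < \<epsilon>" "4 * \<epsilon> \<le> \<delta>" "2 * \<epsilon> \<le> 1" "(4 * B) * \<epsilon> \<le> 1"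
      "(Amax * 8 * B / \<delta>) * \<epsilon> \<le> \<kappa>'" "(4 * (real n0 * H)) * \<epsilon> \<le> \<kappa>'" "L * \<epsilon> \<le> \<kappa> / 64"
    using eventually_happens'[OF trivial_limit_at_right_real] by blast
  obtain \<eta> :: "real^'d \<Rightarrow> real" where \<eta>: "smooth_bounded \<eta>" "\<And>x. \<eta> x \<ge> 0"
    "\<And>x. \<epsilon> \<le> norm x \<Longrightarrow> \<eta> x = 0" "(\<integral>x. \<eta> x \<partial>lborel) = 1" "integrable lborel \<eta>"
    using exists_mollifier[OF \<epsilon>(1)] by metis
  obtain M\<eta> where M\<eta>: "M\<eta> \<ge> 0" "\<And>x. \<bar>\<eta> x\<bar> \<le> M\<eta>" "\<And>i x. \<bar>iter_partial [i] \<eta> x\<bar> \<le> M\<eta>"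
    "\<And>i j x. \<bar>iter_partial [i,j] \<eta> x\<bar> \<le> M\<eta>" "\<And>i j l x. \<bar>iter_partial [i,j,l] \<eta> x\<bar> \<le> M\<eta>"
    using smooth_bounded_bounds3[OF \<eta>(1)] by metis
  define MZ where "MZ = M\<eta> * measure lborel (cball 0 (R + 1) :: (real^'d) set)"
  have MZ: "0 \<le> MZ" using M\<eta>(1) by (simp add: MZ_def)
  obtain CA where CA: "0 \<le> CA" "\<And>M Z x k. bounded_test M (R + 2) Z \<Longrightarrow> k \<in> {1..n0} \<Longrightarrow> \<bar>gen Z x k\<bar> \<le> CA * M"
    using gen_bounded[of "R + 2"] by blast
  obtain r1 where r1: "0 < r1" "\<And>r. 0 < r \<Longrightarrow> r \<le> r1 \<Longrightarrow> \<exists>\<tau>1>0. \<forall>\<tau>. 0 < \<tau> \<and> \<tau> \<le> \<tau>1 \<longrightarrow>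
    (\<forall>Z x k. bounded_test MZ (R + 2) Z \<and> k \<in> {1..n0} \<longrightarrow> \<bar>gen Z x k - approx_gen \<tau> r (R + 2 + 1) Z x x k\<bar> \<le> \<kappa>')"
    using approx_gen_consistent[OF \<kappa>'(1) MZ, of "R + 2"] by blast
  define r where "r = min r1 \<epsilon>0"
  have rr: "0 < r" "r \<le> \<epsilon>0" "r \<le> r1" using r1(1) eps0 by (auto simp: r_def)
  obtain \<tau>1 where \<tau>1: "0 < \<tau>1" "\<And>\<tau> Z x k. 0 < \<tau> \<Longrightarrow> \<tau> \<le> \<tau>1 \<Longrightarrow> bounded_test MZ (R + 2) Z \<Longrightarrow> k \<in> {1..n0} \<Longrightarrow>
      \<bar>gen Z x k - approx_gen \<tau> r (R + 3) Z x x k\<bar> \<le> \<kappa>'"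
    using r1(2)[OF rr(1,3)] by (auto simp: add.assoc)
  define B\<beta> where "B\<beta> = B + \<epsilon>0 / min 1 (r\<^sup>2) * C\<nu>"
  have B\<beta>: "norm (drift r (R+3) y k) \<le> B\<beta>" if "k \<in> {1..n0}" "norm y \<le> R + 3" for k y
    using norm_triangle_ineq4[of "b y k" "compensator r y k"] B(2)[OF that] compensator_integrable(2)[OF that(1) rr(1), of y] that
    by (simp add: B\<beta>_def drift_def)
  have "\<forall>\<^sub>F \<tau> in at_right (0::real). 0 < \<tau> \<and> 1 * \<tau> \<le> \<tau>1 \<and> B\<beta>\<^sup>2 * \<tau> \<le> 1 \<and> (Amax * 2 * B\<beta>\<^sup>2 / \<delta>) * \<tau> \<le> \<kappa>'"
    using \<tau>1(1) \<kappa>' by (intro eventually_conj eventually_linear_le eventually_at_right_less) auto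
  then obtain \<tau> where \<tau>: "0 < \<tau>" "1 * \<tau> \<le> \<tau>1" "B\<beta>\<^sup>2 * \<tau> \<le> 1" "(Amax * 2 * B\<beta>\<^sup>2 / \<delta>) * \<tau> \<le> \<kappa>'"
    using eventually_happens'[OF trivial_limit_at_right_real] by blast
  define \<Lambda> where "\<Lambda> = (1 + real CARD('d)) / \<tau> + 2 * (C\<nu> / min 1 (r\<^sup>2)) + 2 * (real n0 * \<bar>Qb\<bar>)"
  \<comment> \<open>The time step comes last: small enough for the step condition and for the error
    \<open>CA * (h * \<Lambda> * MZ)\<close>, with \<open>N * h = T\<close> exactly.\<close>
  obtain N0 where N0: "max 1 (max (T * \<Lambda>) (CA * (T * \<Lambda> * MZ) / \<kappa>')) \<le> real N0" using real_arch_simple by blast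
  define N where "N = N0"
  define h where "h = T / real N"
  have N: "0 < real N" "T * \<Lambda> \<le> real N" "CA * (T * \<Lambda> * MZ) / \<kappa>' \<le> real N" using N0 by (auto simp: N_def)
  have hT: "0 < h" "real N * h = T" using T N by (auto simp: h_def)
  have h\<Lambda>: "h * \<Lambda> \<le> 1" using N by (simp add: h_def divide_le_eq)
  have hCA: "CA * (h * \<Lambda> * MZ) \<le> \<kappa>'"
  proof -
    have "CA * (T * \<Lambda> * MZ) \<le> \<kappa>' * real N" using N(3) \<kappa>' by (simp add: divide_le_eq mult.commute)
    then have "CA * (T * \<Lambda> * MZ) / real N \<le> \<kappa>'" using N(1) by (simp add: divide_le_eq)
    then show ?thesis by (simp add: h_def mult_ac)
  qed
  interpret mollified_scheme n0 \<epsilon>0 H C\<nu> Qb a \<sigma> b \<nu> q \<rho> \<tau> r h \<epsilon> R \<eta> M\<eta>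
    using \<tau>(1) rr(1) hT(1) \<epsilon>(1,3) h\<Lambda> \<eta> M\<eta> by unfold_locales (auto simp: \<Lambda>_def)
  have rate: "rate = \<Lambda>" by (simp add: rate_def \<Lambda>_def)
  have MZ_eq: "M\<^sub>Z = MZ" by (simp add: M\<^sub>Z_def MZ_def)
  have lip: "lipschitz_valued L g" using g_lip by (simp add: lipschitz_valued_def)
  have lyap: "G (\<lambda>_. lyap) y x k \<le> 3 * \<kappa>'" if k: "k \<in> {1..n0}" and x: "norm x \<le> R" and xy: "norm (x - y) \<le> 2 * \<epsilon>" for k x y
  proof -
    have y: "norm y \<le> R + 3" using norm_triangle_ineq2[of y x] xy \<epsilon>(3) x by (simp add: norm_minus_commute)
    have "G (\<lambda>_. lyap) y x k \<le> E / ln (1 + R\<^sup>2) + \<kappa>' + 2 * H * \<rho> 1 / K"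
      unfolding E_def using \<epsilon>(4) \<tau>(3)
      by (intro G_lyap_le[OF k R x xy \<epsilon>(3) rr(2) Cg(1) Cg(2)[OF k] _ _ B\<beta>[OF k y] _ K(1) K(2)[OF k], of B])
        (use B(2)[OF k y] in \<open>auto simp: mult_ac\<close>)
    then show ?thesis using ER K(3) by linarith
  qed
  show ?thesis
  proof (rule that[of "s0 / 4"])
    show "0 < s0 / 4" using s0 by simp
    fix x z k P P'
    assume x: "norm x \<le> X" "norm z \<le> X" and xz: "norm (x - z) < s0 / 4" and k: "k \<in> {1..n0}"
      and P: "mp_solution (UNIV \<times> {1..n0}) (test_A n0) (gen_A n0 a b \<nu> \<epsilon>0 q) (x, k) P"
        "mp_solution (UNIV \<times> {1..n0}) (test_A n0) (gen_A n0 a b \<nu> \<epsilon>0 q) (z, k) P'"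
    have lyap_X: "lyap p \<le> \<kappa> / 16" if "norm p \<le> X + 1" for p
    proof -
      have "ln (1 + (norm p)\<^sup>2) \<le> ln (1 + (X + 1)\<^sup>2)"
        using that by (subst ln_le_cancel_iff) (auto intro: add_pos_nonneg power_mono)
      then have "ln (1 + (norm p)\<^sup>2) / ln (1 + R\<^sup>2) \<le> ln (1 + (X + 1)\<^sup>2) / ln (1 + R\<^sup>2)"
        using lnR0 by (intro divide_right_mono) auto
      then show ?thesis using lyap_props(5)[OF R, of p] XR by linarith
    qed
    have dom: "iterate g N k p + iterate (\<lambda>k x. 1 - g k x) N k p' - 1 \<le> \<kappa> / 8 + 9 * (\<kappa> / 64) + \<kappa> / 8"
      if p: "norm (p - x) < \<epsilon>" "norm (p' - z) < \<epsilon>" for p p'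
    proof -
      have sn: "soft_norm \<delta> (p - p') \<le> s0"
      proof -
        have "norm (p - p') = norm ((p - x) + (x - z) - (p' - z))" by simp
        then have "norm (p - p') \<le> norm (p - x) + norm (x - z) + norm (p' - z)"
          using norm_triangle_ineq4[of "(p - x) + (x - z)" "p' - z"] norm_triangle_ineq[of "p - x" "x - z"] by linarith
        then have "norm (p - p') \<le> 2 * \<epsilon> + s0 / 4" using p xz by linarith
        then show ?thesis using soft_norm_le[of \<delta> "p - p'"] \<delta> \<epsilon>(2) unfolding \<delta>_def by linarith
      qed
      have "iterate g N k p + iterate (\<lambda>k x. 1 - g k x) N k p' - 1
        \<le> A0 * euler_seq (h * C) s0 N + real N * (h * (9 * \<kappa>')) + lyap p + lyap p'"
      proof (rule comparison[OF lip L g_unit A0 \<delta> s0 R C_def _ \<epsilon>(2,3) B(1) _ B\<beta> lyap _ _ k sn])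
        have "h * C * (\<rho> s0 / s0) * real N = C * (\<rho> s0 / s0) * (real N * h)" by (simp only: mult_ac)
        then have "h * C * (\<rho> s0 / s0) * real N = C * (\<rho> s0 / s0) * T" by (simp only: hT(2))
        then show "A0 * exp (h * C * (\<rho> s0 / s0) * real N) \<le> Amax" unfolding Amax_def by (simp only: order.refl)
        show "\<And>k y. k \<in> {1..n0} \<Longrightarrow> norm y \<le> R + 3 \<Longrightarrow> norm (b y k) \<le> B" using B(2) by blast
        have "Amax * ((8 * \<epsilon> * B + 2 * \<tau> * B\<beta>\<^sup>2) / \<delta>) = (Amax * 8 * B / \<delta>) * \<epsilon> + (Amax * 2 * B\<beta>\<^sup>2 / \<delta>) * \<tau>"
          using \<delta> by (simp add: field_simps)
        \<comment> \<open>Of the nine units \<open>\<kappa>'\<close>, two come from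
          \<open>\<epsilon>\<close> and \<open>\<tau>\<close> in the coupling, six from the Lyapunov
          drift at the two points and one from switching.\<close>
        then show "Amax * ((8 * \<epsilon> * B + 2 * \<tau> * B\<beta>\<^sup>2) / \<delta>) + 2 * (3 * \<kappa>') + 4 * (real n0 * H) * \<epsilon> \<le> 9 * \<kappa>'"
          using \<epsilon>(5,6) \<tau>(4) by linarith
        show "0 \<le> 9 * \<kappa>'" using \<kappa>' by simp
      qed
      moreover have "A0 * euler_seq (h * C) s0 N \<le> \<kappa> / 8"
      proof -
        have "real N * (h * C) = C * (real N * h)" by (simp add: mult_ac)
        then have "euler_seq (h * C) s0 N \<le> \<kappa> / (8 * A0)" using hT C0 by (intro es) auto
        then have "A0 * euler_seq (h * C) s0 N \<le> A0 * (\<kappa> / (8 * A0))" using A0 by (intro mult_left_mono) auto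
        then show ?thesis using A0 by simp
      qed
      moreover have "real N * (h * (9 * \<kappa>')) = 9 * (\<kappa> / 64)"
      proof -
        have "real N * (h * (9 * \<kappa>')) = 9 * ((real N * h) * \<kappa>')" by (simp add: mult_ac)
        then show ?thesis unfolding hT(2) using \<kappa>'(2) by simp
      qed
      moreover have "norm p \<le> X + 1" "norm p' \<le> X + 1"
        using norm_triangle_ineq2[of p x] norm_triangle_ineq2[of p' z] p x \<epsilon>(3) by linarith+
      then have "lyap p \<le> \<kappa> / 16" "lyap p' \<le> \<kappa> / 16" by - (erule lyap_X)+
      ultimately show ?thesis by linarith
    qed
    have "(\<integral>\<omega>. (case \<omega> (real N * h) of (x, k) \<Rightarrow> g k x) \<partial>P) - (\<integral>\<omega>. (case \<omega> (real N * h) of (x, k) \<Rightarrow> g k x) \<partial>P')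
      \<le> \<kappa> / 8 + 9 * (\<kappa> / 64) + \<kappa> / 8 + 2 * (L * \<epsilon> + real N * (h * (\<kappa>' + CA * (h * rate * M\<^sub>Z))))"
    proof (rule expectation_diff_le[OF lip L g_unit CA(2) _ k P dom])
      fix Z x k assume "bounded_test M\<^sub>Z (R + 2) Z" "k \<in> {1..n0}"
      then show "\<bar>gen Z x k - G Z x x k\<bar> \<le> \<kappa>'" using \<tau>1(2)[of \<tau> Z k x] \<tau> unfolding MZ_eq by simp
    qed
    moreover have "real N * (h * (\<kappa>' + CA * (h * rate * M\<^sub>Z))) \<le> \<kappa> / 32"
    proof -
      have "(real N * h) * (\<kappa>' + CA * (h * rate * M\<^sub>Z)) \<le> (real N * h) * (\<kappa>' + \<kappa>')"
        unfolding rate MZ_eq hT(2) using hCA T by (intro mult_left_mono add_left_mono) auto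
      also have "\<dots> = 2 * (T * \<kappa>')" unfolding hT(2) by (simp add: algebra_simps)
      also have "\<dots> = \<kappa> / 32" unfolding \<kappa>'(2) by simp
      finally show ?thesis by (simp add: mult.assoc)
    qed
    ultimately show "(\<integral>\<omega>. (case \<omega> T of (x, k) \<Rightarrow> g k x) \<partial>P) - (\<integral>\<omega>. (case \<omega> T of (x, k) \<Rightarrow> g k x) \<partial>P') \<le> \<kappa>"
      using \<epsilon>(7) \<kappa> unfolding hT(2) distrib_left[of 2] by linarith
  qed
qed

end

section \<open>Infimal convolutions\<close>

definition inf_conv :: "real \<Rightarrow> ('a::real_normed_vector \<Rightarrow> real) \<Rightarrow> 'a \<Rightarrow> real" where
  "inf_conv m f x = (INF y. f y + m * norm (x - y))"

context
  fixes f :: "'a::real_normed_vector \<Rightarrow> real" and m :: real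
  assumes f: "\<And>x. 0 \<le> f x" and m: "0 \<le> m"
begin

lemma inf_conv_le: "inf_conv m f x \<le> f y + m * norm (x - y)"
  unfolding inf_conv_def
  by (intro cINF_lower bdd_belowI2[of _ 0]) (auto intro!: add_nonneg_nonneg mult_nonneg_nonneg f m)

lemma inf_conv_ge: "(\<And>y. c \<le> f y + m * norm (x - y)) \<Longrightarrow> c \<le> inf_conv m f x"
  unfolding inf_conv_def by (intro cINF_greatest) auto

lemma inf_conv_bounds: "0 \<le> inf_conv m f x" "inf_conv m f x \<le> f x"
  using inf_conv_le[of x x] by (auto intro!: inf_conv_ge add_nonneg_nonneg mult_nonneg_nonneg f m)

lemma inf_conv_lipschitz: "inf_conv m f x \<le> inf_conv m f z + m * norm (x - z)"
proof -
  have "inf_conv m f x - m * norm (x - z) \<le> inf_conv m f z"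
  proof (rule inf_conv_ge)
    fix y
    have "m * norm (x - y) \<le> m * (norm (x - z) + norm (z - y))"
      using norm_triangle_ineq[of "x - z" "z - y"] m by (intro mult_left_mono) auto
    then show "inf_conv m f x - m * norm (x - z) \<le> f y + m * norm (z - y)"
      using inf_conv_le[of x y] by (simp add: distrib_left)
  qed
  then show ?thesis by simp
qed

end

text \<open>Points within the continuity radius \<open>d\<close> lower the value by at most
  \<open>e / 2\<close>; points farther away cost at least \<open>n * d \<ge> 1\<close>, which
  exceeds the range of \<open>f\<close>.\<close>

lemma inf_conv_tendsto:
  fixes f :: "'a::real_normed_vector \<Rightarrow> real"
  assumes f: "\<And>x. 0 \<le> f x" "\<And>x. f x \<le> 1" and cont: "continuous_on UNIV f"
  shows "(\<lambda>n. inf_conv (real n) f x) \<longlonglongrightarrow> f x"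
proof (rule LIMSEQ_I)
  fix e :: real assume e: "0 < e"
  have "isCont f x" using cont by (simp add: continuous_on_eq_continuous_at)
  then obtain d where d: "0 < d" "\<And>y. norm (y - x) < d \<Longrightarrow> \<bar>f y - f x\<bar> < e / 2"
    using e unfolding continuous_at_eps_delta dist_norm by (metis half_gt_zero real_norm_def)
  obtain N where N: "1 / d \<le> real N" using real_arch_simple by blast
  show "\<exists>no. \<forall>n\<ge>no. norm (inf_conv (real n) f x - f x) < e"
  proof (intro exI[of _ N] allI impI)
    fix n assume n: "N \<le> n"
    have nd: "1 \<le> real n * d"
    proof -
      have "1 / d \<le> real n" using N n by linarith
      then show ?thesis using d(1) by (simp add: divide_le_eq)
    qed
    have "f x - e / 2 \<le> inf_conv (real n) f x"
    proof (rule inf_conv_ge[OF f(1)])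
      fix y
      show "f x - e / 2 \<le> f y + real n * norm (x - y)"
      proof (cases "norm (y - x) < d")
        case True
        have "f x - f y < e / 2" using d(2)[OF True] by linarith
        moreover have "0 \<le> real n * norm (x - y)" by simp
        ultimately show ?thesis by linarith
      next
        case False
        then have "real n * d \<le> real n * norm (x - y)" by (intro mult_left_mono) (auto simp: norm_minus_commute)
        then show ?thesis using nd f(1)[of y] f(2)[of x] e by linarith
      qed
    qed simp
    moreover have "inf_conv (real n) f x \<le> f x" by (rule inf_conv_bounds[OF f(1)]) simp
    ultimately show "norm (inf_conv (real n) f x - f x) < e" using e by simp
  qed
qed

text \<open>Lower semicontinuity: the infimal convolutions are Lipschitz and approximate
  \<open>F\<close> from below. The index is fixed by convergence under the single measure from
  \<open>x\<close>; at the nearby \<open>z\<close> only the inequality is needed, so the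
  approximation need not be uniform over starting points.\<close>

lemma (in switching) expectation_lsc:
  fixes F :: "nat \<Rightarrow> real^'d \<Rightarrow> real" and P :: "real^'d \<Rightarrow> nat \<Rightarrow> (real \<Rightarrow> (real^'d) \<times> nat) measure"
  assumes osgood: "\<forall>c>0. (\<integral>\<^sup>+r. indicator {0<..c} r * ennreal (1 / \<rho> r) \<partial>lborel) = \<infinity>"
    and P: "\<And>x k. k \<in> {1..n0} \<Longrightarrow> mp_solution (UNIV \<times> {1..n0}) (test_A n0) (gen_A n0 a b \<nu> \<epsilon>0 q) (x, k) (P x k)"
    and F: "\<And>k. k \<in> {1..n0} \<Longrightarrow> continuous_on UNIV (F k)" "\<And>k x. k \<in> {1..n0} \<Longrightarrow> 0 \<le> F k x \<and> F k x \<le> 1"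
    and t: "0 < t" and e: "0 < e" and k: "k \<in> {1..n0}"
  obtains s where "0 < s" "\<And>z. norm (z - x) < s \<Longrightarrow>
    (\<integral>\<omega>. (case \<omega> t of (x, k) \<Rightarrow> F k x) \<partial>P x k) - (\<integral>\<omega>. (case \<omega> t of (x, k) \<Rightarrow> F k x) \<partial>P z k) \<le> e"
proof -
  let ?E = "\<lambda>F z. \<integral>\<omega>. (case \<omega> t of (x, k) \<Rightarrow> F k x) \<partial>P z k"
  define Fm where "Fm = (\<lambda>n l. inf_conv (real n) (F l))"
  have Fm: "0 \<le> Fm n l x" "Fm n l x \<le> F l x" "Fm n l x \<le> 1" "Fm n l x \<le> Fm n l z + real n * norm (x - z)" if "l \<in> {1..n0}" for n l x z
    using inf_conv_bounds[of "F l" "real n" x] inf_conv_lipschitz[of "F l" "real n" x z] F(2)[OF that] order.trans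
    unfolding Fm_def by auto
  have Fm_meas: "Fm n l \<in> borel_measurable borel" if "l \<in> {1..n0}" for n l
  proof (intro borel_measurable_continuous_onI continuous_at_imp_continuous_on ballI)
    fix x
    have "\<bar>Fm n l z - Fm n l x\<bar> \<le> real n * norm (z - x)" for z
      using Fm(4)[OF that, of n z x] Fm(4)[OF that, of n x z] by (simp add: norm_minus_commute abs_le_iff)
    moreover have "((\<lambda>z. real n * norm (z - x)) \<longlongrightarrow> real n * norm (x - x)) (at x)"
      by (intro tendsto_mult tendsto_const tendsto_norm tendsto_diff tendsto_ident_at)
    ultimately have "((\<lambda>z. Fm n l z - Fm n l x) \<longlongrightarrow> 0) (at x)"
      by (intro Lim_null_comparison[of "\<lambda>z. Fm n l z - Fm n l x" "\<lambda>z. real n * norm (z - x)"] always_eventually) auto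
    then show "isCont (Fm n l) x" unfolding isCont_def by (simp add: LIM_zero_iff)
  qed
  have i: "integrable (P z k) (\<lambda>\<omega>. case \<omega> t of (x, k) \<Rightarrow> F k x)" "integrable (P z k) (\<lambda>\<omega>. case \<omega> t of (x, k) \<Rightarrow> Fm n k x)" for z n
    by (rule integrable_marginal[OF P[OF k], where M=1];
        use t F Fm Fm_meas in \<open>auto intro!: borel_measurable_continuous_onI simp: abs_le_iff\<close>)+
  have inE: "\<omega> t \<in> UNIV \<times> {1..n0}" if "\<omega> \<in> space (P z k)" for \<omega> z
  proof -
    have "sets (P z k) = sets (path_space (UNIV \<times> {1..n0}))" using P[OF k, of z] by (simp add: mp_solution_def)
    from sets_eq_imp_space_eq[OF this] that show ?thesis by (auto simp: cadlag_paths_def)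
  qed
  have "(\<lambda>n. ?E (Fm n) x) \<longlonglongrightarrow> ?E F x"
  proof (rule integral_dominated_convergence[where w="\<lambda>_. 1"])
    have "prob_space (P x k)" using P[OF k] by (simp add: mp_solution_def)
    then show "integrable (P x k) (\<lambda>_. 1::real)" using finite_measure.integrable_const prob_space.finite_measure by blast
    show "AE \<omega> in P x k. (\<lambda>n. case \<omega> t of (x, k) \<Rightarrow> Fm n k x) \<longlonglongrightarrow> (case \<omega> t of (x, k) \<Rightarrow> F k x)"
    proof (rule AE_I2)
      fix \<omega> assume "\<omega> \<in> space (P x k)"
      from inE[OF this] obtain y l where yl: "\<omega> t = (y, l)" "l \<in> {1..n0}" by auto
      have "(\<lambda>n. inf_conv (real n) (F l) y) \<longlonglongrightarrow> F l y"
        by (rule inf_conv_tendsto) (use F yl(2) in auto)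
      then show "(\<lambda>n. case \<omega> t of (x, k) \<Rightarrow> Fm n k x) \<longlonglongrightarrow> (case \<omega> t of (x, k) \<Rightarrow> F k x)" using yl by (simp add: Fm_def)
    qed
    show "AE \<omega> in P x k. norm (case \<omega> t of (x, k) \<Rightarrow> Fm n k x) \<le> 1" for n
    proof (rule AE_I2)
      fix \<omega> assume "\<omega> \<in> space (P x k)"
      from inE[OF this] obtain y l where yl: "\<omega> t = (y, l)" "l \<in> {1..n0}" by auto
      then show "norm (case \<omega> t of (x, k) \<Rightarrow> Fm n k x) \<le> 1" using Fm(1,3)[OF yl(2), of n y] by simp
    qed
  qed (use i borel_measurable_integrable in blast)+
  then have "\<forall>\<^sub>F n in sequentially. ?E F x - e / 2 < ?E (Fm n) x"
    by (rule order_tendstoD(1)) (use e in simp)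
  then obtain n where n: "?E F x - e / 2 < ?E (Fm n) x" using eventually_happens'[OF sequentially_bot] by blast
  have "\<forall>l\<in>{1..n0}. \<forall>x z. Fm n l x \<le> Fm n l z + real n * norm (x - z)" using Fm(4) by blast
  moreover have "\<And>l x. l \<in> {1..n0} \<Longrightarrow> 0 \<le> Fm n l x \<and> Fm n l x \<le> 1" using Fm(1,3) by blast
  moreover have "0 < e / 2" "0 \<le> norm x + 1" "0 \<le> real n" using e by auto
  ultimately obtain s where s: "0 < s" "\<And>y z. norm y \<le> norm x + 1 \<Longrightarrow> norm z \<le> norm x + 1 \<Longrightarrow> norm (y - z) < s \<Longrightarrow>
      ?E (Fm n) y - ?E (Fm n) z \<le> e / 2"
    using marginals_close[OF osgood t, of "e / 2" "norm x + 1" "Fm n" "real n"] P[OF k] k by (metis (no_types, lifting))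
  show ?thesis
  proof (rule that[of "min s 1"])
    fix z assume z: "norm (z - x) < min s 1"
    then have "norm z \<le> norm x + 1" using norm_triangle_ineq2[of z x] by linarith
    then have "?E (Fm n) x - ?E (Fm n) z \<le> e / 2" using z by (intro s(2)) (auto simp: norm_minus_commute)
    moreover have "?E (Fm n) z \<le> ?E F z"
    proof (rule integral_mono[OF i(2) i(1)])
      fix \<omega> assume "\<omega> \<in> space (P z k)"
      from inE[OF this] show "(case \<omega> t of (x, k) \<Rightarrow> Fm n k x) \<le> (case \<omega> t of (x, k) \<Rightarrow> F k x)" using Fm(2) by auto
    qed
    ultimately show "?E F x - ?E F z \<le> e" using n by linarith
  qed (use s in simp)
qed

text \<open>After an affine change \<open>f\<close> takes values in the unit interval; lower
  semicontinuity for \<open>F\<close> and for \<open>1 - F\<close> together give continuity in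
  \<open>x\<close>. The regimes are discrete, so nothing has to be compared across them.\<close>

lemma (in switching) feller:
  fixes f :: "(real^'d) \<times> nat \<Rightarrow> real" and P :: "real^'d \<Rightarrow> nat \<Rightarrow> (real \<Rightarrow> (real^'d) \<times> nat) measure"
  assumes osgood: "\<forall>c>0. (\<integral>\<^sup>+r. indicator {0<..c} r * ennreal (1 / \<rho> r) \<partial>lborel) = \<infinity>"
    and P: "\<And>x k. k \<in> {1..n0} \<Longrightarrow> mp_solution (UNIV \<times> {1..n0}) (test_A n0) (gen_A n0 a b \<nu> \<epsilon>0 q) (x, k) (P x k)"
    and f: "continuous_on (UNIV \<times> {1..n0}) f" "bounded (f ` (UNIV \<times> {1..n0}))" and t: "0 < t"
  shows "continuous_on (UNIV \<times> {1..n0}) (\<lambda>(x, k). \<integral>\<omega>. f (\<omega> t) \<partial>(P x k))"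
proof -
  obtain M where M: "0 < M" "\<And>x k. k \<in> {1..n0} \<Longrightarrow> \<bar>f (x, k)\<bar> \<le> M"
    using f(2) unfolding bounded_pos by auto
  define F where "F = (\<lambda>k x. (f (x, k) + M) / (2 * M))"
  have cont: "continuous_on UNIV (F k)" if "k \<in> {1..n0}" for k
  proof -
    have "continuous_on UNIV (\<lambda>x. f (x, k))"
      by (rule continuous_on_compose2[OF f(1)]) (use that in \<open>auto intro!: continuous_intros\<close>)
    then show ?thesis unfolding F_def using M(1) by (intro continuous_intros) auto
  qed
  have unit: "0 \<le> F k x \<and> F k x \<le> 1" if "k \<in> {1..n0}" for k x
    using M(2)[OF that, of x] M(1) by (auto simp: F_def abs_le_iff divide_le_eq)
  define E where "E = (\<lambda>x k. \<integral>\<omega>. (case \<omega> t of (x, k) \<Rightarrow> F k x) \<partial>P x k)"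
  have i: "integrable (P x k) (\<lambda>\<omega>. case \<omega> t of (x, k) \<Rightarrow> F k x)" if "k \<in> {1..n0}" for x k
    by (rule integrable_marginal[OF P[OF that], where M=1])
      (use t unit cont in \<open>auto intro!: borel_measurable_continuous_onI simp: abs_le_iff\<close>)
  have pr: "prob_space (P x k)" if "k \<in> {1..n0}" for x k using P[OF that] by (simp add: mp_solution_def)
  have E': "(\<integral>\<omega>. (case \<omega> t of (x, k) \<Rightarrow> 1 - F k x) \<partial>P x k) = 1 - E x k" if k: "k \<in> {1..n0}" for x k
  proof -
    have "(\<integral>\<omega>. (case \<omega> t of (x, k) \<Rightarrow> 1 - F k x) \<partial>P x k) = (\<integral>\<omega>. 1 - (case \<omega> t of (x, k) \<Rightarrow> F k x) \<partial>P x k)"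
      by (intro Bochner_Integration.integral_cong refl) (simp split: prod.splits)
    also have "\<dots> = 1 - E x k"
      unfolding E_def using i[OF k] prob_space.prob_space[OF pr[OF k]] prob_space.finite_measure[OF pr[OF k]]
      by (subst Bochner_Integration.integral_diff) (auto simp: finite_measure.integrable_const)
    finally show ?thesis .
  qed
  have Ef: "(\<integral>\<omega>. f (\<omega> t) \<partial>P x k) = 2 * M * E x k - M" if k: "k \<in> {1..n0}" for x k
  proof -
    have "(\<integral>\<omega>. f (\<omega> t) \<partial>P x k) = (\<integral>\<omega>. 2 * M * (case \<omega> t of (x, k) \<Rightarrow> F k x) - M \<partial>P x k)"
      using M(1) by (intro Bochner_Integration.integral_cong refl) (auto simp: F_def split: prod.splits)
    also have "\<dots> = 2 * M * E x k - M"
      unfolding E_def using i[OF k] prob_space.prob_space[OF pr[OF k]] prob_space.finite_measure[OF pr[OF k]]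
      by (subst Bochner_Integration.integral_diff) (auto simp: finite_measure.integrable_const)
    finally show ?thesis .
  qed
  have near: "\<exists>s>0. \<forall>z. norm (z - x) < s \<longrightarrow> \<bar>E x k - E z k\<bar> \<le> e" if k: "k \<in> {1..n0}" and e: "0 < e" for x k e
  proof -
    obtain s1 where s1: "0 < s1" "\<And>z. norm (z - x) < s1 \<Longrightarrow> E x k - E z k \<le> e"
      unfolding E_def by (rule expectation_lsc[where F=F and P=P and x=x, OF osgood P cont unit t e k]) blast+
    have c': "continuous_on UNIV (\<lambda>x. 1 - F k x)" if "k \<in> {1..n0}" for k using cont[OF that] by (intro continuous_intros)
    have u': "0 \<le> 1 - F k x \<and> 1 - F k x \<le> 1" if "k \<in> {1..n0}" for k x using unit[OF that, of x] by auto
    obtain s2 where s2: "0 < s2" "\<And>z. norm (z - x) < s2 \<Longrightarrow>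
      (\<integral>\<omega>. (case \<omega> t of (x, k) \<Rightarrow> 1 - F k x) \<partial>P x k) - (\<integral>\<omega>. (case \<omega> t of (x, k) \<Rightarrow> 1 - F k x) \<partial>P z k) \<le> e"
      by (rule expectation_lsc[where F="\<lambda>k x. 1 - F k x" and P=P and x=x, OF osgood P c' u' t e k]) blast+
    show ?thesis
      using s1 s2 unfolding E'[OF k] by (intro exI[of _ "min s1 s2"]) (auto simp: abs_le_iff)
  qed
  show ?thesis
    unfolding continuous_on_def
  proof (intro ballI tendstoI)
    fix p :: "(real^'d) \<times> nat" and e :: real
    assume p: "p \<in> UNIV \<times> {1..n0}" and e: "0 < e"
    obtain x k where xk: "p = (x, k)" "k \<in> {1..n0}" using p by auto
    have "0 < e / (4 * M)" using e M(1) by simp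
    from near[OF xk(2) this, of x] obtain s where s: "0 < s" "\<And>z. norm (z - x) < s \<Longrightarrow> \<bar>E x k - E z k\<bar> \<le> e / (4 * M)" by blast
    have "dist (\<integral>\<omega>. f (\<omega> t) \<partial>P z k) (\<integral>\<omega>. f (\<omega> t) \<partial>P x k) < e" if "z \<in> ball x s" for z
    proof -
      have "\<bar>E x k - E z k\<bar> \<le> e / (4 * M)" using that by (intro s(2)) (simp add: dist_norm norm_minus_commute)
      then have "2 * M * \<bar>E z k - E x k\<bar> \<le> 2 * M * (e / (4 * M))" using M(1) by (intro mult_left_mono) (auto simp: abs_minus_commute)
      also have "\<dots> = e / 2" using M(1) by simp
      finally have "\<bar>2 * M * (E z k - E x k)\<bar> < e" using M(1) e by (simp add: abs_mult)
      then show ?thesis unfolding Ef[OF xk(2)] by (simp add: dist_real_def right_diff_distrib)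
    qed
    moreover have "open (ball x s \<times> {k})" by (intro open_Times open_ball Topological_Spaces.open_discrete)
    ultimately show "\<forall>\<^sub>F q in at p within UNIV \<times> {1..n0}. dist (case q of (x, k) \<Rightarrow> \<integral>\<omega>. f (\<omega> t) \<partial>P x k)
        (case p of (x, k) \<Rightarrow> \<integral>\<omega>. f (\<omega> t) \<partial>P x k) < e"
      unfolding eventually_at_topological xk
      using s(1) by (intro exI[of _ "ball x s \<times> {k}"]) auto
  qed
qed

theorem theorem4p4:
  fixes n0 :: nat and \<epsilon>0 H :: real
    and a :: "real^'d::finite \<Rightarrow> nat \<Rightarrow> real^'d^'d"
    and b :: "real^'d \<Rightarrow> nat \<Rightarrow> real^'d"
    and \<nu> :: "real^'d \<Rightarrow> nat \<Rightarrow> (real^'d) measure"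
    and q :: "real^'d \<Rightarrow> nat \<Rightarrow> nat \<Rightarrow> real"
    and \<rho> :: "real \<Rightarrow> real"
    and P :: "real^'d \<Rightarrow> nat \<Rightarrow> (real \<Rightarrow> (real^'d) \<times> nat) measure"
  assumes n0: "n0 \<ge> 1" and eps0: "\<epsilon>0 > 0"
    and a_sym: "\<forall>x. \<forall>k\<in>{1..n0}. transpose (a x k) = a x k"
    and a_psd: "\<forall>x. \<forall>k\<in>{1..n0}. \<forall>v. 0 \<le> v \<bullet> (a x k *v v)"
    and a_meas: "\<forall>k\<in>{1..n0}. (\<lambda>x. a x k) \<in> borel_measurable borel"
    and b_meas: "\<forall>k\<in>{1..n0}. (\<lambda>x. b x k) \<in> borel_measurable borel"
    and \<nu>_sets: "\<forall>x. \<forall>k\<in>{1..n0}. sets (\<nu> x k) = sets borel"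
    and \<nu>_zero: "\<forall>x. \<forall>k\<in>{1..n0}. emeasure (\<nu> x k) {0} = 0"
    and \<nu>_sfin: "\<forall>x. \<forall>k\<in>{1..n0}. sigma_finite_measure (\<nu> x k)"
    and \<nu>_small: "\<forall>x. \<forall>k\<in>{1..n0}.
        (\<integral>\<^sup>+u. ennreal ((norm u)\<^sup>2) * indicator (ball 0 \<epsilon>0) u \<partial>(\<nu> x k)) < \<infinity>"
    and \<nu>_large: "\<forall>x. \<forall>k\<in>{1..n0}. emeasure (\<nu> x k) (UNIV - ball 0 \<epsilon>0) < \<infinity>"
    and \<nu>_meas: "\<forall>k\<in>{1..n0}. \<forall>A\<in>sets borel. (\<lambda>x. emeasure (\<nu> x k) A) \<in> borel_measurable borel"
    and q_meas: "\<forall>k\<in>{1..n0}. \<forall>l\<in>{1..n0}. (\<lambda>x. q x k l) \<in> borel_measurable borel"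
    and q_nonneg: "\<forall>x. \<forall>k\<in>{1..n0}. \<forall>l\<in>{1..n0}. k \<noteq> l \<longrightarrow> q x k l \<ge> 0"
    and q_rows: "\<forall>x. \<forall>k\<in>{1..n0}. (\<Sum>l\<in>{1..n0}. q x k l) = 0"
    and A_i: "\<forall>k\<in>{1..n0}. \<forall>x. \<exists>!Q. mp_solution UNIV C_c_inf (gen_L a b \<nu> \<epsilon>0 k) x Q"
    and A_ii: "\<forall>k\<in>{1..n0}. \<exists>c. \<forall>x. c \<le> q x k k"
    and A_iii: "\<exists>C. \<forall>x. \<forall>k\<in>{1..n0}.
        (\<integral>\<^sup>+y. ennreal (min 1 ((norm y)\<^sup>2)) \<partial>(\<nu> x k)) \<le> ennreal C"
    and H_pos: "H > 0"
    and \<rho>_mono: "mono_on {0..} \<rho>" and \<rho>_concave: "concave_on {0..} \<rho>"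
    and \<rho>_nonneg: "\<forall>r\<ge>0. \<rho> r \<ge> 0" and \<rho>_pos: "\<forall>r>0. \<rho> r > 0"
    and \<rho>_osgood: "\<forall>c>0. (\<integral>\<^sup>+r. indicator {0<..c} r * ennreal (1 / \<rho> r) \<partial>lborel) = \<infinity>"
    and F1_diff: "\<exists>\<sigma> :: real^'d \<Rightarrow> nat \<Rightarrow> real^'d^'d.
        (\<forall>x. \<forall>k\<in>{1..n0}. \<sigma> x k ** transpose (\<sigma> x k) = a x k) \<and>
        (\<forall>k\<in>{1..n0}. \<forall>x z. (norm (\<sigma> x k - \<sigma> z k))\<^sup>2 + 2 * ((x - z) \<bullet> (b x k - b z k))
            \<le> H * norm (x - z) * \<rho> (norm (x - z)))"
    and F1_jump: "\<forall>k\<in>{1..n0}. \<forall>x z.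
        tv_nn_integral (\<lambda>u. ennreal (norm u)) (\<nu> x k) (\<nu> z k) \<le> ennreal (H * \<rho> (norm (x - z)))"
    and F2: "\<forall>k\<in>{1..n0}. \<forall>l\<in>{1..n0}. k \<noteq> l \<longrightarrow>
        (\<forall>x z. \<bar>q x k l - q z k l\<bar> \<le> H * norm (x - z))"
    and P_sol: "\<forall>x. \<forall>k\<in>{1..n0}.
        mp_solution (UNIV \<times> {1..n0}) (test_A n0) (gen_A n0 a b \<nu> \<epsilon>0 q) (x, k) (P x k)"
  shows "\<forall>t>0. \<forall>f :: (real^'d) \<times> nat \<Rightarrow> real.
           continuous_on (UNIV \<times> {1..n0}) f \<longrightarrow> bounded (f ` (UNIV \<times> {1..n0})) \<longrightarrow>
           continuous_on (UNIV \<times> {1..n0}) (\<lambda>(x, k). \<integral>\<omega>. f (\<omega> t) \<partial>(P x k))"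
proof (intro allI impI)
  fix t :: real and f :: "(real^'d) \<times> nat \<Rightarrow> real"
  assume t: "0 < t" and f: "continuous_on (UNIV \<times> {1..n0}) f" "bounded (f ` (UNIV \<times> {1..n0}))"
  obtain \<sigma> :: "real^'d \<Rightarrow> nat \<Rightarrow> real^'d^'d"
    where \<sigma>: "\<forall>x. \<forall>k\<in>{1..n0}. \<sigma> x k ** transpose (\<sigma> x k) = a x k"
      "\<forall>k\<in>{1..n0}. \<forall>x z. (norm (\<sigma> x k - \<sigma> z k))\<^sup>2 + 2 * ((x - z) \<bullet> (b x k - b z k))
        \<le> H * norm (x - z) * \<rho> (norm (x - z))"
    using F1_diff by blast
  obtain C where "\<forall>x. \<forall>k\<in>{1..n0}. (\<integral>\<^sup>+y. ennreal (min 1 ((norm y)\<^sup>2)) \<partial>(\<nu> x k)) \<le> ennreal C"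
    using A_iii by blast
  then have C: "(\<integral>\<^sup>+y. ennreal (min 1 ((norm y)\<^sup>2)) \<partial>(\<nu> x k)) \<le> ennreal (max 0 C)" if "k \<in> {1..n0}" for x k
    using that order.trans[OF _ ennreal_leI[of C "max 0 C"]] by simp
  obtain c where c: "\<forall>k\<in>{1..n0}. \<forall>x. c k \<le> q x k k" using bchoice[OF A_ii] by blast
  \<comment> \<open>Rows sum to zero and off-diagonal entries are nonnegative, so a lower bound for
    the diagonal bounds every entry of its row; the sum over the regimes makes the bound
    uniform.\<close>
  define Qb where "Qb = (\<Sum>k\<in>{1..n0}. \<bar>c k\<bar>)"
  have Qb: "\<bar>q x k l\<bar> \<le> Qb" if k: "k \<in> {1..n0}" and l: "l \<in> {1..n0}" for x k l
  proof -
    have rows: "q x k k + (\<Sum>m\<in>{1..n0} - {k}. q x k m) = 0"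
      using q_rows k sum.remove[OF finite_atLeastAtMost k, of "q x k"] by auto
    have pos: "\<And>m. m \<in> {1..n0} - {k} \<Longrightarrow> 0 \<le> q x k m" using q_nonneg k by auto
    have "\<bar>q x k l\<bar> \<le> - q x k k"
    proof (cases "l = k")
      case True
      have "0 \<le> (\<Sum>m\<in>{1..n0} - {k}. q x k m)" by (rule sum_nonneg) (rule pos)
      then show ?thesis using rows True by simp
    next
      case False
      then have l': "l \<in> {1..n0} - {k}" using l by blast
      have "q x k l \<le> (\<Sum>m\<in>{1..n0} - {k}. q x k m)"
        using pos l' by (intro member_le_sum) auto
      then show ?thesis using rows pos[OF l'] by linarith
    qed
    also have "\<dots> \<le> \<bar>c k\<bar>" using bspec[OF c k, THEN spec, of x] by linarith
    also have "\<dots> \<le> Qb" unfolding Qb_def using k by (intro member_le_sum) auto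
    finally show ?thesis .
  qed
  interpret switching n0 \<epsilon>0 H "max 0 C" Qb a \<sigma> b \<nu> q \<rho>
    by (rule switching.intro) (use q_nonneg F2 in
      \<open>simp_all only: eps0 H_pos \<rho>_mono \<rho>_concave a_meas b_meas \<nu>_sets \<nu>_sfin \<nu>_meas q_meas Qb C
        \<rho>_nonneg \<rho>_pos \<sigma> F1_jump max.cobounded1 not_False_eq_True simp_thms\<close>)
  show "continuous_on (UNIV \<times> {1..n0}) (\<lambda>(x, k). \<integral>\<omega>. f (\<omega> t) \<partial>(P x k))"
    by (rule feller[OF \<rho>_osgood _ f t]) (use P_sol in blast)
qed

end
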